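(* Let $\mu$ be a probability measure satisfying Assumption (A) of the context, let $t>1$, let $E_t\in\mathcal{R}_t$ be an exterior point of $\mathcal{V}_t$ and let $\mathcal{U}_t$ be a small neighborhood of $E_t$. Put $w_t:=\omega_t(E_t)$ and $$C_1(t):=-(t-1)\int_{\mathbb{R}}\frac{1}{(u-w_t)^3}\,\widehat{\mu}(\mathrm{d}u).$$ There exists a positive constant $S_1$ depending on $t$, determined by $$S_1\frac{t}{\sqrt{(t-1)^3}}=\frac{1}{\pi}\,\frac{\int_{\mathbb{R}}\frac{1}{(u-w_t)^2}\,\mu(\mathrm{d}u)}{\sqrt{(t-1)\big|\int_{\mathbb{R}}\frac{1}{(u-w_t)^3}\,\widehat{\mu}(\mathrm{d}u)\big|}},$$ such that for $x\in\mathcal{U}_t$ we either have $$\rho_t(x)=S_1\,\frac{t}{\sqrt{(t-1)^{3}}}\sqrt{x-E_t}+\mathcal{O}(x-E_t),\qquad x\geq E_t,$$ or we have $$\rho_t(x)=S_1\,\frac{t}{\sqrt{(t-1)^{3}}}\sqrt{E_t-x}+\mathcal{O}(E_t-x),\qquad x\leq E_t;$$ the first alternative occurs if $C_1(t)<0$ and the second if $C_1(t)>0$. If $E_t$ is not the leftmost or rightmost endpoint of $\mathrm{supp}(\mu^{\boxplus t})$, then there exist $t^*>t$ and an interior point $E_*$ of $\mathcal{V}_{t^*}$ such that $E_t$ converges to $E_*$ as $t$ approaches $t^*$ (here, as $t$ varies below $t^*$, $E_t$ denotes the continuous family of exterior points of $\mathcal{V}_t$ through the given point). Assume that $E_*\in\mathcal{R}_{t^*}$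 and set $\omega_*:=\omega_{t^*}(E_* )$. Then the following holds. (1) If $|x-E_t|^2=o\big((t^*-t)^3\big)$, then there exists a positive constant $S_2$, independent of $t>1$ and determined by $$S_2\,\frac{t^*}{\sqrt[4]{(t^*-1)^3}}=\frac{\sqrt[4]{t^*-1}}{\pi}\,\frac{\int_{\mathbb{R}}\frac{1}{(u-\omega_* )^2}\,\mu(\mathrm{d}u)}{\sqrt[4]{\int_{\mathbb{R}}\frac{1}{(u-\omega_* )^4}\,\widehat{\mu}(\mathrm{d}u)}},$$ such that for all $x\in\mathcal{U}_t$ we either have $$\rho_t(x)=S_2\,\frac{t^*}{\sqrt[4]{3(t-1)(t^*-1)^3}}\,\frac{\sqrt{x-E_t}}{\sqrt[4]{t^*-t}}+\mathcal{O}\Big(\frac{x-E_t}{\sqrt{t^*-t}}\Big)+\mathcal{O}\Big(\sqrt{x-E_t}\,\sqrt[4]{t^*-t}\Big)$$ when $x\geq E_t$ and $\rho_t(x)=0$ when $x<E_t$, or we have $$\rho_t(x)=S_2\,\frac{t^*}{\sqrt[4]{3(t-1)(t^*-1)^3}}\,\frac{\sqrt{E_t-x}}{\sqrt[4]{t^*-t}}+\mathcal{O}\Big(\frac{E_t-x}{\sqrt{t^*-t}}\Big)+\mathcal{O}\Big(\sqrt{E_t-x}\,\sqrt[4]{t^*-t}\Big)$$ when $x\leq E_t$ and $\rho_t(x)=0$ when $x>E_t$. Again the first alternative occurs if $C_1(t)<0$ and the second if $C_1(t)>0$ as $t<t^*$ converges to $t^*$. (2) If $t<t^*$ converges to $t^*$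 in such a way that $(t^*-t)^3=o\big(|x-E_t|^2\big)$, then there exists a positive constant $S_3$, independent of $t>1$ and given by $$S_3\,\frac{t^*}{\sqrt[3]{(t^*-1)^4}}=\frac{\sqrt{3}}{2\pi}\,\frac{\int_{\mathbb{R}}\frac{1}{(u-\omega_* )^2}\,\mu(\mathrm{d}u)}{\sqrt[3]{(t^*-1)\int_{\mathbb{R}}\frac{1}{(u-\omega_* )^4}\,\widehat{\mu}(\mathrm{d}u)}},$$ such that for all $x\in\mathcal{U}_t$, $$\rho_t(x)=S_3\,\frac{t^*}{\sqrt[3]{(t^*-1)^4}}\sqrt[3]{|x-E_t|}+\mathcal{O}\Big(|x-E_t|^{\frac23}\Big)+\mathcal{O}\Big(\sqrt{t^*-t}\Big).$$
   Context: Assumption (A). Let $n_{\mathrm{ac}}\geq 1$, $n_{\mathrm{pp}}\geq 0$ be integers. $\mu$ is a centered, compactly supported probability measure on $\mathbb{R}$ whose singular part consists of $n_{\mathrm{pp}}$ atoms and whose absolutely continuous part $\mu_{\mathrm{ac}}$ is supported on $n_{\mathrm{ac}}$ disjoint intervals $[E_j^-,E_j^+]$. The density $\rho$ of $\mu_{\mathrm{ac}}$ satisfies: for every $j=1,\dots,n_{\mathrm{ac}}$ there are exponents $-1<\beta_j^-,\beta_j^+<1$ and a constant $C_j\geq1$ with $C_j^{-1}<\frac{\rho(x)}{(x-E_j^-)^{\beta_j^-}(E_j^+-x)^{\beta_j^+}}<C_j$ for a.e. $x\in[E_j^-,E_j^+]$. Transforms. For a finite measure $\nu$ on $\mathbb{R}$,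 $m_\nu(z)=\int_{\mathbb{R}}\frac{1}{u-z}\,\nu(\mathrm{d}u)$ for $z\in\mathbb{C}^+=\{\mathrm{Im}\,z>0\}$, and $F_\mu=-1/m_\mu$. There is a finite measure $\widehat{\mu}$ on $\mathbb{R}$ with $F_\mu(\omega)-\omega=\int_{\mathbb{R}}\frac{1}{u-\omega}\,\widehat{\mu}(\mathrm{d}u)$ for $\omega\in\mathbb{C}^+$. Free additive convolution semigroup. For $t\geq1$ there is an analytic $\omega_t:\mathbb{C}^+\to\mathbb{C}^+$ with $\mathrm{Im}\,\omega_t(z)\geq\mathrm{Im}\,z$, $\omega_t(\mathrm{i}\eta)/(\mathrm{i}\eta)\to1$ as $\eta\to\infty$, and $t\omega_t(z)-z=(t-1)F_\mu(\omega_t(z))$; the function $F_\mu(\omega_t(z))$ is the negative reciprocal Cauchy–Stieltjes transform of the probability measure $\mu^{\boxplus t}$. For $t>1$, $\omega_t$ extends continuously to $\mathbb{C}^+\cup\mathbb{R}$ with values in $\mathbb{C}^+\cup\mathbb{R}$; the extension is also denoted $\omega_t$. $\mu^{\boxplus t}_{\mathrm{ac}}$ is the absolutely continuous part of $\mu^{\boxplus t}$ and $\rho_t$ its density, in the version given by $\frac1\pi$ times the non-tangential limit of $\mathrm{Im}\,m_{\mu^{\boxplus t}}$. Sets. $\mathcal{V}_t:=\partial\{x\in\mathbb{R}:0<\rho_t(x)<\infty\}$. A point $E_t\in\mathcal{V}_t$ is an exterior point of $\mathcal{V}_t$ if for some $\varepsilon_0>0$, $E_t-\varepsilon\notin\mathrm{supp}(\mu^{\boxplus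 t}_{\mathrm{ac}})$ or $E_t+\varepsilon\notin\mathrm{supp}(\mu^{\boxplus t}_{\mathrm{ac}})$ for all $0<\varepsilon<\varepsilon_0$; it is an interior point of $\mathcal{V}_t$ if for some $\varepsilon_0>0$, $E_t-\varepsilon\in\mathrm{supp}(\mu^{\boxplus t}_{\mathrm{ac}})$ and $E_t+\varepsilon\in\mathrm{supp}(\mu^{\boxplus t}_{\mathrm{ac}})$ for all $0<\varepsilon<\varepsilon_0$. $\mathcal{S}_t$ is the set of real points $E_t$ such that $E_0:=E_t/t$ is an atom of $\mu$ with $\mu(\{E_0\})\geq1-\frac1t$, and $\mathcal{R}_t:=\mathbb{R}\setminus\mathcal{S}_t$. Convention. For fixed $t$ the $\mathcal{O}$-terms are as $x\to E_t$ (constants may depend on $t$). In (1) and (2), $t\uparrow t^*$ and $x$ is close to $E_t$, jointly, so that the displayed ratio ($|x-E_t|^2/(t^*-t)^3$, respectively $(t^*-t)^3/|x-E_t|^2$) tends to $0$, and the $\mathcal{O}$-constants are uniform in that regime.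
   Formalization: "Not the leftmost or rightmost endpoint" refers to the support of the absolutely continuous part; in (1) the displayed error holds on a neighborhood of E_t, and over the whole regime with the extra term O(|x-E_t|^{3/2}/(t*-t)^{7/4}). *)

theory Defs
  imports "HOL-Probability.Probability"
begin

section \<open>Measures on the real line\<close>

definition msupp :: "real measure \<Rightarrow> real set" where
  "msupp \<nu> = {x. \<forall>U. open U \<and> x \<in> U \<longrightarrow> 0 < emeasure \<nu> U}"

definition lebesgue_decomposition :: "real measure \<Rightarrow> real measure \<Rightarrow> real measure \<Rightarrow> bool" where
  "lebesgue_decomposition \<nu> \<nu>ac \<nu>s \<longleftrightarrow>
     sets \<nu>ac = sets borel \<and> sets \<nu>s = sets borel \<and>
     absolutely_continuous lborel \<nu>ac \<and>
     (\<exists>N \<in> null_sets lborel. emeasure \<nu>s (- N) = 0) \<and>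
     (\<forall>A \<in> sets borel. emeasure \<nu> A = emeasure \<nu>ac A + emeasure \<nu>s A)"

lemma ex1_lebesgue_decomposition:
  assumes "finite_borel_measure \<nu>"
  shows "\<exists>!\<nu>ac. \<exists>\<nu>s. lebesgue_decomposition \<nu> \<nu>ac \<nu>s"
proof -
  interpret finite_borel_measure \<nu> by fact
  have [measurable_cong, simp]: "sets \<nu> = sets borel" by (rule M_is_borel)
  have [simp]: "space \<nu> = UNIV" using sets_eq_imp_space_eq[OF M_is_borel] by simp
  have null_borel: "N \<in> sets borel" if "N \<in> null_sets lborel" for N
    using null_setsD2[OF that] by simp
  define c where "c = (SUP N \<in> null_sets lborel. measure \<nu> N)"
  have bdd: "bdd_above (measure \<nu> ` null_sets lborel)"
    by (auto intro!: bdd_aboveI2[where M = "measure \<nu> (space \<nu>)"] bounded_measure)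
  have ne: "null_sets (lborel :: real measure) \<noteq> {}" by auto
  have "\<exists>N \<in> null_sets lborel. c - 1 / Suc k < measure \<nu> N" for k
    using less_cSUP_iff[OF ne bdd, of "c - 1 / Suc k"] unfolding c_def by auto
  then obtain F where F: "\<And>k. F k \<in> null_sets lborel" "\<And>k. c - 1 / Suc k < measure \<nu> (F k)"
    by metis
  define N where "N = (\<Union>k. F k)"
  have N: "N \<in> null_sets lborel" unfolding N_def using F(1) by auto
  then have Nb [measurable]: "N \<in> sets borel" by (rule null_borel)
  have "c - 1 / Suc k < measure \<nu> N" for k
    using F(2)[of k] finite_measure_mono[of "F k" N] Nb unfolding N_def by force
  then have cN: "c \<le> measure \<nu> N"
  proof -
    have "(\<lambda>k. c - 1 / Suc k) \<longlonglongrightarrow> c - 0"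
      by (intro tendsto_diff tendsto_const) (rule LIMSEQ_Suc[OF lim_1_over_n])
    with \<open>\<And>k. c - 1 / Suc k < measure \<nu> N\<close> show ?thesis
      by (intro LIMSEQ_le_const2[where X = "\<lambda>k. c - 1 / Suc k"]) (auto intro: less_imp_le)
  qed
  define a where "a = density \<nu> (indicator (- N))"
  define s where "s = density \<nu> (indicator N)"
  have ea: "emeasure a A = emeasure \<nu> (A - N)" if "A \<in> sets borel" for A
    using that unfolding a_def
    by (subst emeasure_density) (auto simp: Diff_eq Int_commute indicator_inter_arith[symmetric]
        intro!: nn_integral_cong nn_integral_indicator[THEN trans[rotated]] simp flip: nn_integral_indicator)
  have es: "emeasure s A = emeasure \<nu> (A \<inter> N)" if "A \<in> sets borel" for A
    using that unfolding s_def
    by (subst emeasure_density) (auto simp: Int_commute indicator_inter_arith[symmetric]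
        intro!: nn_integral_cong simp flip: nn_integral_indicator)
  have ac: "emeasure \<nu> (A - N) = 0" if A: "A \<in> null_sets lborel" for A
  proof -
    have Ab: "A \<in> sets borel" using A by (rule null_borel)
    have "measure \<nu> (N \<union> A) \<le> c"
      unfolding c_def by (rule cSUP_upper[OF _ bdd]) (use N A in auto)
    moreover have "measure \<nu> (N \<union> A) = measure \<nu> N + measure \<nu> (A - N)"
      using Ab Nb by (subst finite_measure_Union[symmetric]) (auto intro: arg_cong[where f = "measure \<nu>"])
    ultimately have "measure \<nu> (A - N) = 0"
      using cN measure_nonneg[of \<nu> "A - N"] by linarith
    then show ?thesis by (simp add: emeasure_eq_measure)
  qed
  have dec: "lebesgue_decomposition \<nu> a s"
    unfolding lebesgue_decomposition_def
  proof (intro conjI ballI)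
    show "absolutely_continuous lborel a"
      unfolding absolutely_continuous_def
      using ac ea null_borel by (auto simp: null_sets_def a_def)
    show "\<exists>N \<in> null_sets lborel. emeasure s (- N) = 0"
      using N es[of "- N"] Nb by (intro bexI[of _ N]) auto
    show "emeasure \<nu> A = emeasure a A + emeasure s A" if "A \<in> sets borel" for A
    proof -
      have "(A - N) \<inter> (A \<inter> N) = {}" by auto
      then show ?thesis
        using that Nb ea es plus_emeasure[of "A - N" \<nu> "A \<inter> N"] by (simp add: Un_Diff_Int)
    qed
  qed (auto simp: a_def s_def)
  have eq: "emeasure x A = emeasure \<nu> (A - M)"
    if x: "lebesgue_decomposition \<nu> x y" and M: "M \<in> null_sets lborel" "emeasure y (- M) = 0"
      and A: "A \<in> sets borel" for x y M A
  proof -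
    note x' = x[unfolded lebesgue_decomposition_def]
    have Mb: "M \<in> sets borel" using M by (auto intro: null_borel)
    have "emeasure y (A - M) = 0"
      using M emeasure_mono[of "A - M" "- M" y] x' Mb by auto
    moreover have "emeasure x (A \<inter> M) = 0"
    proof -
      have "M \<in> null_sets x" using x' M unfolding absolutely_continuous_def by auto
      then show ?thesis using emeasure_mono[of "A \<inter> M" M x] x' Mb by (auto simp: null_sets_def)
    qed
    moreover have "emeasure x A = emeasure x (A - M) + emeasure x (A \<inter> M)"
      using A Mb x' by (subst plus_emeasure) (auto intro: arg_cong[where f = "emeasure x"])
    ultimately show ?thesis using x' A Mb by auto
  qed
  have uniq: "x = x'" if d: "lebesgue_decomposition \<nu> x y" "lebesgue_decomposition \<nu> x' y'" for x y x' y'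
  proof -
    obtain M where M: "M \<in> null_sets lborel" "emeasure y (- M) = 0"
      using d(1) unfolding lebesgue_decomposition_def by auto
    obtain M' where M': "M' \<in> null_sets lborel" "emeasure y' (- M') = 0"
      using d(2) unfolding lebesgue_decomposition_def by auto
    have U: "M \<union> M' \<in> null_sets lborel" using M M' by auto
    have b: "M \<in> sets borel" "M' \<in> sets borel" using M M' by (auto intro: null_borel)
    have "emeasure y (- (M \<union> M')) = 0"
      using M emeasure_mono[of "- (M \<union> M')" "- M" y] d(1) b
      unfolding lebesgue_decomposition_def by auto
    moreover have "emeasure y' (- (M \<union> M')) = 0"
      using M' emeasure_mono[of "- (M \<union> M')" "- M'" y'] d(2) b
      unfolding lebesgue_decomposition_def by auto
    ultimately show ?thesis
      using eq[OF d(1) U] eq[OF d(2) U] d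
      by (intro measure_eqI) (auto simp: lebesgue_decomposition_def)
  qed
  show ?thesis using dec uniq by blast
qed

definition ac_part :: "real measure \<Rightarrow> real measure" where
  "ac_part \<nu> = (THE \<nu>ac. \<exists>\<nu>s. lebesgue_decomposition \<nu> \<nu>ac \<nu>s)"

definition assumption_A :: "nat \<Rightarrow> nat \<Rightarrow> real measure \<Rightarrow> bool" where
  "assumption_A nac npp \<mu> \<longleftrightarrow>
     1 \<le> nac \<and> real_distribution \<mu> \<and>
     (\<exists>K. compact K \<and> emeasure \<mu> (- K) = 0) \<and>
     (\<integral>u. u \<partial>\<mu>) = 0 \<and>
     (\<exists>\<mu>ac \<mu>s. lebesgue_decomposition \<mu> \<mu>ac \<mu>s \<and>
        (\<exists>P. finite P \<and> card P = npp \<and> (\<forall>a \<in> P. 0 < emeasure \<mu>s {a}) \<and> emeasure \<mu>s (- P) = 0) \<and>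
        (\<exists>(Em :: nat \<Rightarrow> real) (Ep :: nat \<Rightarrow> real) (\<rho> :: real \<Rightarrow> real).
           (\<forall>j \<in> {1..nac}. Em j < Ep j) \<and>
           disjoint_family_on (\<lambda>j. {Em j..Ep j}) {1..nac} \<and>
           \<rho> \<in> borel_measurable borel \<and> (\<forall>x. 0 \<le> \<rho> x) \<and>
           \<mu>ac = density lborel (\<lambda>x. ennreal (\<rho> x)) \<and>
           (AE x in lborel. x \<notin> (\<Union>j \<in> {1..nac}. {Em j..Ep j}) \<longrightarrow> \<rho> x = 0) \<and>
           (\<forall>j \<in> {1..nac}. \<exists>\<beta>m \<beta>p C :: real.
              -1 < \<beta>m \<and> \<beta>m < 1 \<and> -1 < \<beta>p \<and> \<beta>p < 1 \<and> 1 \<le> C \<and>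
              (AE x in lborel. x \<in> {Em j..Ep j} \<longrightarrow>
                 inverse C < \<rho> x / ((x - Em j) powr \<beta>m * (Ep j - x) powr \<beta>p) \<and>
                 \<rho> x / ((x - Em j) powr \<beta>m * (Ep j - x) powr \<beta>p) < C))))"


section \<open>Transforms and the free additive convolution semigroup\<close>

definition stieltjes :: "real measure \<Rightarrow> complex \<Rightarrow> complex" where
  "stieltjes \<nu> z = (\<integral>u. 1 / (complex_of_real u - z) \<partial>\<nu>)"

definition neg_recip_stieltjes :: "real measure \<Rightarrow> complex \<Rightarrow> complex" where
  "neg_recip_stieltjes \<nu> z = - 1 / stieltjes \<nu> z"

definition nevanlinna_measure :: "real measure \<Rightarrow> real measure \<Rightarrow> bool" where
  "nevanlinna_measure \<mu> \<mu>h \<longleftrightarrow> finite_borel_measure \<mu>h \<and>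
     (\<forall>w. 0 < Im w \<longrightarrow> neg_recip_stieltjes \<mu> w - w = stieltjes \<mu>h w)"

text \<open>For \<open>t > 1\<close> the values of \<open>\<omega> t\<close> on the real line are those of the continuous extension;
  on the open half-plane \<open>\<omega>\<close> is determined uniquely by these conditions.\<close>

definition subordination :: "real measure \<Rightarrow> (real \<Rightarrow> complex \<Rightarrow> complex) \<Rightarrow> bool" where
  "subordination \<mu> \<omega> \<longleftrightarrow>
     (\<forall>t \<ge> 1. \<omega> t analytic_on {z. 0 < Im z} \<and>
        (\<forall>z. 0 < Im z \<longrightarrow> Im z \<le> Im (\<omega> t z) \<and>
           of_real t * \<omega> t z - z = of_real (t - 1) * neg_recip_stieltjes \<mu> (\<omega> t z)) \<and>
        ((\<lambda>\<eta>. \<omega> t (\<i> * of_real \<eta>) / (\<i> * of_real \<eta>)) \<longlongrightarrow> 1) at_top) \<and>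
     (\<forall>t > 1. continuous_on {z. 0 \<le> Im z} (\<omega> t) \<and> (\<forall>z. 0 \<le> Im z \<longrightarrow> 0 \<le> Im (\<omega> t z)))"

text \<open>\<open>\<nu> t\<close> is \<open>\<mu>\<^sup>\<boxplus>\<^sup>t\<close>.\<close>

definition free_conv_semigroup ::
  "real measure \<Rightarrow> (real \<Rightarrow> complex \<Rightarrow> complex) \<Rightarrow> (real \<Rightarrow> real measure) \<Rightarrow> bool" where
  "free_conv_semigroup \<mu> \<omega> \<nu> \<longleftrightarrow>
     (\<forall>t \<ge> 1. real_distribution (\<nu> t) \<and>
        (\<forall>z. 0 < Im z \<longrightarrow> neg_recip_stieltjes (\<nu> t) z = neg_recip_stieltjes \<mu> (\<omega> t z)))"


section \<open>The density and its edges\<close>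

text \<open>Convergence along \<open>nontangential x\<close> is convergence within every cone at \<open>x\<close>.\<close>

definition nontangential :: "real \<Rightarrow> complex filter" where
  "nontangential x =
     (SUP a \<in> {0<..}. at (complex_of_real x) within {z. 0 < Im z \<and> \<bar>Re z - x\<bar> < a * Im z})"

text \<open>The limit is taken in the extended reals: it is infinite at an atom, for instance.\<close>

definition ac_density :: "real measure \<Rightarrow> real \<Rightarrow> ereal" where
  "ac_density \<nu> x = Lim (nontangential x) (\<lambda>z. ereal (Im (stieltjes \<nu> z) / pi))"

definition edge_set :: "real measure \<Rightarrow> real set" where
  "edge_set \<nu> = frontier {x. 0 < ac_density \<nu> x \<and> ac_density \<nu> x < \<infinity>}"

definition exterior_point :: "real measure \<Rightarrow> real \<Rightarrow> bool" where
  "exterior_point \<nu> E \<longleftrightarrow> E \<in> edge_set \<nu> \<and>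
     (\<exists>\<epsilon>0 > 0. \<forall>\<epsilon>. 0 < \<epsilon> \<and> \<epsilon> < \<epsilon>0 \<longrightarrow>
        E - \<epsilon> \<notin> msupp (ac_part \<nu>) \<or> E + \<epsilon> \<notin> msupp (ac_part \<nu>))"

definition interior_point :: "real measure \<Rightarrow> real \<Rightarrow> bool" where
  "interior_point \<nu> E \<longleftrightarrow> E \<in> edge_set \<nu> \<and>
     (\<exists>\<epsilon>0 > 0. \<forall>\<epsilon>. 0 < \<epsilon> \<and> \<epsilon> < \<epsilon>0 \<longrightarrow>
        E - \<epsilon> \<in> msupp (ac_part \<nu>) \<and> E + \<epsilon> \<in> msupp (ac_part \<nu>))"

definition singular_points :: "real measure \<Rightarrow> real \<Rightarrow> real set" where
  "singular_points \<mu> t = {E. 0 < measure \<mu> {E / t} \<and> 1 - 1 / t \<le> measure \<mu> {E / t}}"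

definition regular_points :: "real measure \<Rightarrow> real \<Rightarrow> real set" where
  "regular_points \<mu> t = - singular_points \<mu> t"

text \<open>\<open>edge_family \<nu> t E\<^sub>t t' E' E\<close>: as the time runs from \<open>t\<close> up to \<open>t'\<close>, the exterior point
  \<open>E\<^sub>t\<close> moves continuously through exterior points \<open>E s\<close> and converges to the interior point \<open>E'\<close>.\<close>

definition edge_family ::
  "(real \<Rightarrow> real measure) \<Rightarrow> real \<Rightarrow> real \<Rightarrow> real \<Rightarrow> real \<Rightarrow> (real \<Rightarrow> real) \<Rightarrow> bool" where
  "edge_family \<nu> t Et t' E' E \<longleftrightarrow>
     t < t' \<and> continuous_on {t..<t'} E \<and> E t = Et \<and>
     (\<forall>s \<in> {t..<t'}. exterior_point (\<nu> s) (E s)) \<and>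
     interior_point (\<nu> t') E' \<and> (E \<longlongrightarrow> E') (at_left t')"

text \<open>The integral of \<open>(u - w)\<close> to the power \<open>-k\<close> at \<open>w = \<omega>\<^sub>t(E)\<close>, for real \<open>\<omega>\<^sub>t(E)\<close>.\<close>

definition inv_moment ::
  "nat \<Rightarrow> real measure \<Rightarrow> (real \<Rightarrow> complex \<Rightarrow> complex) \<Rightarrow> real \<Rightarrow> real \<Rightarrow> real" where
  "inv_moment k \<nu> \<omega> t E = (\<integral>u. 1 / (u - Re (\<omega> t (of_real E))) ^ k \<partial>\<nu>)"

definition C1 :: "real measure \<Rightarrow> (real \<Rightarrow> complex \<Rightarrow> complex) \<Rightarrow> real \<Rightarrow> real \<Rightarrow> real" where
  "C1 \<mu>h \<omega> t E = - (t - 1) * inv_moment 3 \<mu>h \<omega> t E"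

text \<open>The estimates below are stated in \<open>ereal\<close>, so they include finiteness of the
  density; \<open>err\<close> bounds the error as a function of the distance to the edge.\<close>

definition right_edge :: "real measure \<Rightarrow> real \<Rightarrow> real \<Rightarrow> (real \<Rightarrow> real) \<Rightarrow> real set \<Rightarrow> bool" where
  "right_edge \<nu> E A err X \<longleftrightarrow>
     (\<forall>x \<in> X. E \<le> x \<longrightarrow> \<bar>ac_density \<nu> x - ereal (A * sqrt (x - E))\<bar> \<le> ereal (err (x - E)))"

definition left_edge :: "real measure \<Rightarrow> real \<Rightarrow> real \<Rightarrow> (real \<Rightarrow> real) \<Rightarrow> real set \<Rightarrow> bool" where
  "left_edge \<nu> E A err X \<longleftrightarrow>
     (\<forall>x \<in> X. x \<le> E \<longrightarrow> \<bar>ac_density \<nu> x - ereal (A * sqrt (E - x))\<bar> \<le> ereal (err (E - x)))"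

end

theory Submission
  imports Defs
begin

text \<open>The subordination function inverts \<open>H\<^sub>t(w) = w - (t - 1) \<integral> 1 / (u - w) \<mu>h(du)\<close> on the set where
  \<open>(t - 1) \<integral> 1 / |u - w|\<^sup>2 \<mu>h(du) \<le> 1\<close>, and the density is positive where its boundary values are not
  real. Since the exponents of \<open>\<mu>\<close> are less than 1, \<open>\<integral> 1 / |u - w|\<^sup>2 \<mu>(du)\<close> is infinite on the bands, so at
  a regular edge \<open>w = \<omega>\<^sub>t(E)\<close> is real and at positive distance from the supports of \<open>\<mu>\<close> and \<open>\<mu>h\<close>. There
  \<open>H\<^sub>t\<close> has a critical point, and with \<open>j\<^sub>k = \<integral> (u - w) \<close> to the power \<open>-k\<close> against \<open>\<mu>h\<close> the increment
  \<open>d = \<omega>\<^sub>t(x) - w\<close> solves \<open>(x - E) / (t - 1) + j\<^sub>3 d\<^sup>2 + j\<^sub>4 d\<^sup>3 = O(d\<^sup>4)\<close>. An edge is exterior iff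
  \<open>j\<^sub>3 \<noteq> 0\<close>, which gives the square root. When two edges merge at \<open>t*\<close>, the point \<open>w\<close> is at signed distance
  \<open>e\<close> from its limit with \<open>3 j\<^sub>4 e\<^sup>2\<close> asymptotic to \<open>(t* - t) / ((t - 1) (t* - 1))\<close>, and \<open>j\<^sub>3\<close> is
  asymptotic to \<open>3 j\<^sub>4 e\<close>; the two regimes are those where the quadratic or the cubic term dominates.\<close>

section \<open>Boundary behaviour of Stieltjes transforms\<close>

text \<open>Assumption (A) speaks of \<open>\<mu>\<close>, but the equation for
  \<open>\<omega>\<close> speaks of \<open>M\<close>. Taking imaginary parts in F(w) = w + m_M(w)
  gives \<open>sqint \<mu> w = (1 + sqint M w) * |stieltjes \<mu> w|^2\<close>; this identity
  carries bounds from one measure to the other and is behind every statement on regular points. The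
  local equation has several small roots. The branch taken by \<open>\<omega>\<close> is singled out
  by \<open>0 \<le> Im d\<close> and by \<open>sqint M \<le> 1 / (s - 1)\<close>, which is an
  equality when \<open>0 < Im d\<close>. For real \<open>d\<close> the expanded inequality is a sign
  condition on the derivative of the cubic, and it fails at the spurious real root. The two merging
  regimes need estimates uniform in the time, whereas \<open>\<omega> s\<close> is only assumed
  continuous in \<open>z\<close> for each fixed \<open>s\<close>. Joint continuity is obtained from
  compactness and from uniqueness of the admissible solution of \<open>H s w = z\<close>; after
  that, all expansions around the moving edge share one gap radius and hence one constant.\<close>

definition sqpot :: "real measure \<Rightarrow> complex \<Rightarrow> ennreal" where
  "sqpot M w = (\<integral>\<^sup>+u. inverse (ennreal ((cmod (of_real u - w))\<^sup>2)) \<partial>M)"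

text \<open>Agrees with \<open>sqpot\<close> only where that is finite: the Bochner integral of a
  non-integrable function is 0, and \<open>1 / 0 = 0\<close> hides an atom at \<open>w\<close>,
  whereas the inverse of 0 in \<open>ennreal\<close> is infinite and detects it.\<close>

definition sqint :: "real measure \<Rightarrow> complex \<Rightarrow> real" where
  "sqint M w = (\<integral>u. 1 / (cmod (of_real u - w))\<^sup>2 \<partial>M)"

lemma Im_inverse_diff: "Im (1 / (of_real u - w)) = Im w / (cmod (of_real u - w))\<^sup>2"
  by (simp add: Im_divide cmod_power2)

lemma norm_mult_le_squares: "cmod (a * b) \<le> ((cmod a)\<^sup>2 + (cmod b)\<^sup>2) / 2"
  using sum_squares_bound[of "cmod a" "cmod b"] by (simp add: norm_mult)

lemma inverse_ennreal_antimono: "0 \<le> a \<Longrightarrow> a < b \<Longrightarrow> inverse (ennreal b) \<le> inverse (ennreal a)"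
  by (cases "a = 0") (auto simp: inverse_ennreal intro!: ennreal_leI)

lemma le_one_plus_square: "x \<le> 1 + x\<^sup>2" for x :: real
proof -
  have "0 \<le> (x - 1 / 2)\<^sup>2" by simp
  then show ?thesis by (simp add: power2_eq_square algebra_simps)
qed

context finite_borel_measure
begin

declare M_is_borel [measurable_cong]

lemma space_UNIV [simp]: "space M = UNIV"
  using sets_eq_imp_space_eq[OF M_is_borel] by simp

lemma sqpot_eq_sqint:
  assumes "sqpot M w < \<infinity>"
  shows "AE u in M. of_real u \<noteq> w" "integrable M (\<lambda>u. 1 / (cmod (of_real u - w))\<^sup>2)"
    "sqpot M w = ennreal (sqint M w)"
proof -
  have "AE u in M. inverse (ennreal ((cmod (of_real u - w))\<^sup>2)) \<noteq> \<infinity>"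
    using assms unfolding sqpot_def by (intro nn_integral_noteq_infinite) auto
  then show AE: "AE u in M. of_real u \<noteq> w" by eventually_elim auto
  have eq: "sqpot M w = (\<integral>\<^sup>+u. ennreal (1 / (cmod (of_real u - w))\<^sup>2) \<partial>M)"
    unfolding sqpot_def using AE
    by (intro nn_integral_cong_AE, eventually_elim) (simp add: inverse_ennreal inverse_eq_divide)
  show int: "integrable M (\<lambda>u. 1 / (cmod (of_real u - w))\<^sup>2)"
    using assms unfolding eq by (intro integrableI_nonneg) auto
  show "sqpot M w = ennreal (sqint M w)"
    unfolding eq sqint_def by (intro nn_integral_eq_integral int) auto
qed

lemma sqpot_eqI:
  assumes "AE u in M. of_real u \<noteq> w" "integrable M (\<lambda>u. 1 / (cmod (of_real u - w))\<^sup>2)"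
  shows "sqpot M w = ennreal (sqint M w)"
proof -
  have eq: "sqpot M w = (\<integral>\<^sup>+u. ennreal (1 / (cmod (of_real u - w))\<^sup>2) \<partial>M)"
    unfolding sqpot_def using assms(1)
    by (intro nn_integral_cong_AE, eventually_elim) (simp add: inverse_ennreal inverse_eq_divide)
  show ?thesis
    unfolding eq sqint_def by (intro nn_integral_eq_integral assms) auto
qed

lemma sqint_nonneg [simp]: "0 \<le> sqint M w"
  unfolding sqint_def by simp

lemma sqpot_le_iff:
  "sqpot M w < \<infinity> \<Longrightarrow> 0 \<le> c \<Longrightarrow> sqpot M w \<le> ennreal c \<longleftrightarrow> sqint M w \<le> c"
  by (simp add: sqpot_eq_sqint(3))

lemma sqpot_leD:
  assumes "sqpot M w \<le> ennreal c"
  shows "sqpot M w < \<infinity>" "0 \<le> c \<Longrightarrow> sqint M w \<le> c"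
proof -
  show "sqpot M w < \<infinity>" using le_less_trans[OF assms] by (simp add: ennreal_less_top)
  then show "sqint M w \<le> c" if "0 \<le> c" using sqpot_le_iff that assms by auto
qed

lemma sqpot_finite_away:
  assumes "0 < r" "AE u in M. r \<le> cmod (of_real u - w)"
  shows "sqpot M w < \<infinity>" "sqint M w \<le> measure M (space M) / r\<^sup>2"
proof -
  have b: "AE u in M. 1 / (cmod (of_real u - w))\<^sup>2 \<le> 1 / r\<^sup>2"
    using assms(2) by eventually_elim (use assms(1) in \<open>auto intro!: divide_left_mono power_mono mult_pos_pos\<close>)
  have int: "integrable M (\<lambda>u. 1 / (cmod (of_real u - w))\<^sup>2)"
    using b by (intro integrable_const_bound[where B = "1 / r\<^sup>2"]) auto
  have "AE u in M. of_real u \<noteq> w" using assms(2) by eventually_elim (use assms(1) in auto)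
  from sqpot_eqI[OF this int] show "sqpot M w < \<infinity>" by simp
  have "sqint M w \<le> (\<integral>u. 1 / r\<^sup>2 \<partial>M)"
    unfolding sqint_def using b int by (intro integral_mono_AE) auto
  then show "sqint M w \<le> measure M (space M) / r\<^sup>2" by simp
qed

lemma sqpot_finite_upper: "0 < Im w \<Longrightarrow> sqpot M w < \<infinity>"
  by (rule sqpot_finite_away(1)[of "Im w"])
     (use abs_Im_le_cmod in \<open>auto intro!: always_eventually simp: cmod_def real_le_rsqrt\<close>)

lemma stieltjes_integrable:
  assumes "sqpot M w < \<infinity>"
  shows "integrable M (\<lambda>u. 1 / (of_real u - w))"
proof (rule Bochner_Integration.integrable_bound)
  show "integrable M (\<lambda>u. 1 + 1 / (cmod (of_real u - w))\<^sup>2)"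
    using sqpot_eq_sqint(2)[OF assms] by simp
  show "AE u in M. norm (1 / (of_real u - w)) \<le> norm (1 + 1 / (cmod (of_real u - w))\<^sup>2)"
  proof (rule always_eventually, intro allI)
    fix u
    show "norm (1 / (of_real u - w)) \<le> norm (1 + 1 / (cmod (of_real u - w))\<^sup>2)"
      using le_one_plus_square[of "1 / cmod (of_real u - w)"]
      by (simp add: norm_divide power_divide)
  qed
qed measurable

lemma stieltjes_bound:
  assumes "sqpot M w < \<infinity>"
  shows "cmod (stieltjes M w) \<le> measure M (space M) + sqint M w"
proof -
  have "cmod (stieltjes M w) \<le> (\<integral>u. 1 + 1 / (cmod (of_real u - w))\<^sup>2 \<partial>M)"
    unfolding stieltjes_def
  proof (intro order_trans[OF integral_norm_bound] integral_mono)
    show "integrable M (\<lambda>u. 1 + 1 / (cmod (of_real u - w))\<^sup>2)"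
      using sqpot_eq_sqint(2)[OF assms] by simp
    show "integrable M (\<lambda>u. norm (1 / (of_real u - w)))"
      using stieltjes_integrable[OF assms] by (rule integrable_norm)
    fix u
    show "norm (1 / (of_real u - w)) \<le> 1 + 1 / (cmod (of_real u - w))\<^sup>2"
      using le_one_plus_square[of "1 / cmod (of_real u - w)"]
      by (simp add: norm_divide power_divide)
  qed
  also have "\<dots> = measure M (space M) + sqint M w"
    unfolding sqint_def using sqpot_eq_sqint(2)[OF assms] by simp
  finally show ?thesis .
qed

lemma Im_stieltjes:
  assumes "sqpot M w < \<infinity>"
  shows "Im (stieltjes M w) = Im w * sqint M w"
proof -
  have "Im (stieltjes M w) = (\<integral>u. Im (1 / (of_real u - w)) \<partial>M)"
    unfolding stieltjes_def using stieltjes_integrable[OF assms] by simp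
  also have "\<dots> = (\<integral>u. Im w * (1 / (cmod (of_real u - w))\<^sup>2) \<partial>M)"
    by (simp add: Im_inverse_diff)
  also have "\<dots> = Im w * sqint M w"
    unfolding sqint_def by (rule integral_mult_right_zero)
  finally show ?thesis .
qed

text \<open>The exact difference quotient of the Stieltjes transform. It stands in for a derivative
  at real points where nothing more than finiteness of \<open>sqpot\<close> is known; the inequality
  between the arithmetic and geometric means bounds it by the average of the two
  \<open>sqint\<close>.\<close>

definition prodint :: "complex \<Rightarrow> complex \<Rightarrow> complex" where
  "prodint a b = (\<integral>u. 1 / (of_real u - a) * (1 / (of_real u - b)) \<partial>M)"

lemma prodint:
  assumes a: "sqpot M a < \<infinity>" and b: "sqpot M b < \<infinity>"
  shows "integrable M (\<lambda>u. 1 / (of_real u - a) * (1 / (of_real u - b)))"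
    "cmod (prodint a b) \<le> (sqint M a + sqint M b) / 2"
    "stieltjes M a - stieltjes M b = (a - b) * prodint a b"
proof -
  have bd: "cmod (1 / (of_real u - a) * (1 / (of_real u - b))) \<le>
      (1 / (cmod (of_real u - a))\<^sup>2 + 1 / (cmod (of_real u - b))\<^sup>2) / 2" for u
    using norm_mult_le_squares[of "1 / (of_real u - a)" "1 / (of_real u - b)"]
    by (simp add: norm_divide power_divide)
  have int: "integrable M (\<lambda>u. (1 / (cmod (of_real u - a))\<^sup>2 + 1 / (cmod (of_real u - b))\<^sup>2) / 2)"
    using sqpot_eq_sqint(2)[OF a] sqpot_eq_sqint(2)[OF b] by simp
  show p: "integrable M (\<lambda>u. 1 / (of_real u - a) * (1 / (of_real u - b)))"
    by (rule Bochner_Integration.integrable_bound[OF int])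
       (use bd in \<open>auto intro!: always_eventually intro: order_trans[OF _ abs_ge_self]\<close>)
  have "cmod (prodint a b) \<le> (\<integral>u. (1 / (cmod (of_real u - a))\<^sup>2 + 1 / (cmod (of_real u - b))\<^sup>2) / 2 \<partial>M)"
    unfolding prodint_def
    by (intro order_trans[OF integral_norm_bound] integral_mono integrable_norm p int bd)
  also have "\<dots> = (sqint M a + sqint M b) / 2"
    unfolding sqint_def using sqpot_eq_sqint(2)[OF a] sqpot_eq_sqint(2)[OF b] by simp
  finally show "cmod (prodint a b) \<le> (sqint M a + sqint M b) / 2" .
  have "stieltjes M a - stieltjes M b = (\<integral>u. 1 / (of_real u - a) - 1 / (of_real u - b) \<partial>M)"
    unfolding stieltjes_def using stieltjes_integrable[OF a] stieltjes_integrable[OF b] by simp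
  also have "\<dots> = (\<integral>u. (a - b) * (1 / (of_real u - a) * (1 / (of_real u - b))) \<partial>M)"
  proof (rule integral_cong_AE)
    show "AE u in M. 1 / (of_real u - a) - 1 / (of_real u - b) =
        (a - b) * (1 / (of_real u - a) * (1 / (of_real u - b)))"
      using sqpot_eq_sqint(1)[OF a] sqpot_eq_sqint(1)[OF b]
      by eventually_elim (simp add: field_simps)
  qed measurable
  also have "\<dots> = (a - b) * prodint a b"
    unfolding prodint_def by (rule integral_mult_right_zero)
  finally show "stieltjes M a - stieltjes M b = (a - b) * prodint a b" .
qed

text \<open>Fatou's lemma, the integrand being a continuous \<open>ennreal\<close>-valued function
  of \<open>w\<close> even at \<open>w = u\<close>. It lets bounds from the open half-plane survive
  at real limits, where continuity may fail.\<close>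

lemma sqpot_lsc:
  assumes w: "w \<longlonglongrightarrow> l" and b: "\<And>n. sqpot M (w n) \<le> ennreal (c n)" and c: "c \<longlonglongrightarrow> c0"
  shows "sqpot M l \<le> ennreal c0"
proof -
  have lim: "(\<lambda>n. inverse (ennreal ((cmod (of_real u - w n))\<^sup>2))) \<longlonglongrightarrow>
      inverse (ennreal ((cmod (of_real u - l))\<^sup>2))" for u
  proof -
    have "(\<lambda>n. ennreal ((cmod (of_real u - w n))\<^sup>2)) \<longlonglongrightarrow> ennreal ((cmod (of_real u - l))\<^sup>2)"
      by (intro tendsto_ennrealI tendsto_intros w)
    moreover have "isCont (inverse :: ennreal \<Rightarrow> ennreal) x" for x
      using continuous_on_inverse_ennreal[of UNIV "\<lambda>x. x"] by (auto simp: continuous_on_eq_continuous_at)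
    ultimately show ?thesis by (rule isCont_tendsto_compose[rotated])
  qed
  have "sqpot M l = (\<integral>\<^sup>+u. liminf (\<lambda>n. inverse (ennreal ((cmod (of_real u - w n))\<^sup>2))) \<partial>M)"
    unfolding sqpot_def by (intro nn_integral_cong) (metis lim lim_imp_Liminf trivial_limit_sequentially)
  also have "\<dots> \<le> liminf (\<lambda>n. sqpot M (w n))"
    unfolding sqpot_def by (rule nn_integral_liminf) measurable
  also have "\<dots> \<le> liminf (\<lambda>n. ennreal (c n))"
    by (rule Liminf_mono) (use b in auto)
  also have "\<dots> = ennreal c0"
    using c by (intro lim_imp_Liminf tendsto_ennrealI) auto
  finally show ?thesis .
qed

text \<open>Under a common bound on \<open>sqpot\<close> the transform is Lipschitz, by the bound on
  \<open>prodint\<close>; semicontinuity supplies the bound at the limit point.\<close>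

lemma stieltjes_tendsto:
  assumes w: "w \<longlonglongrightarrow> l" and b: "\<And>n. sqpot M (w n) \<le> ennreal (c n)" and c: "c \<longlonglongrightarrow> c0"
    and "\<And>n. 0 \<le> c n"
  shows "(\<lambda>n. stieltjes M (w n)) \<longlonglongrightarrow> stieltjes M l"
proof -
  have c0: "0 \<le> c0" using assms(4) c by (intro LIMSEQ_le_const) auto
  have fl: "sqpot M l < \<infinity>" "sqint M l \<le> c0"
    using sqpot_leD[OF sqpot_lsc[OF w b c]] c0 by auto
  have fw: "sqpot M (w n) < \<infinity>" "sqint M (w n) \<le> c n" for n
    using sqpot_leD[OF b] assms(4) by auto
  have "(\<lambda>n. stieltjes M (w n) - stieltjes M l) \<longlonglongrightarrow> 0"
  proof (rule Lim_null_comparison)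
    show "(\<lambda>n. cmod (w n - l) * ((c n + c0) / 2)) \<longlonglongrightarrow> 0"
      using tendsto_mult[OF tendsto_norm[OF LIM_zero[OF w]] tendsto_divide[OF tendsto_add[OF c tendsto_const[of c0]] tendsto_const[of 2]]]
      by simp
    show "\<forall>\<^sub>F n in sequentially. norm (stieltjes M (w n) - stieltjes M l) \<le> cmod (w n - l) * ((c n + c0) / 2)"
    proof (rule always_eventually, rule allI)
      fix n
      show "norm (stieltjes M (w n) - stieltjes M l) \<le> cmod (w n - l) * ((c n + c0) / 2)"
        unfolding prodint(3)[OF fw(1) fl(1)] norm_mult
        using prodint(2)[OF fw(1)[of n] fl(1)] fw(2)[of n] fl(2) by (intro mult_left_mono) auto
    qed
  qed
  then show ?thesis by (rule LIM_zero_cancel)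
qed

text \<open>Moving \<open>w\<close> upwards increases its distance to every real \<open>u\<close>.
  The strict form fails for the zero measure, hence the hypothesis on
  \<open>space M\<close>.\<close>

lemma sqpot_shift_up:
  assumes "0 \<le> Im w" "0 < \<eta>"
  shows "sqpot M (w + \<i> * of_real \<eta>) \<le> sqpot M w" "sqpot M w < \<infinity> \<Longrightarrow> emeasure M (space M) \<noteq> 0 \<Longrightarrow>
     sqint M (w + \<i> * of_real \<eta>) < sqint M w"
proof -
  have lt: "(cmod (of_real u - w))\<^sup>2 < (cmod (of_real u - (w + \<i> * of_real \<eta>)))\<^sup>2" for u
    using assms unfolding cmod_power2
    by (simp add: power2_eq_square algebra_simps add_pos_nonneg add_nonneg_pos)
  then show "sqpot M (w + \<i> * of_real \<eta>) \<le> sqpot M w"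
    unfolding sqpot_def by (intro nn_integral_mono) (auto intro!: inverse_ennreal_antimono)
  have pos: "0 < (cmod (of_real u - (w + \<i> * of_real \<eta>)))\<^sup>2" for u
    by (rule le_less_trans[OF zero_le_power2 lt])
  assume f: "sqpot M w < \<infinity>" and ne: "emeasure M (space M) \<noteq> 0"
  have f': "sqpot M (w + \<i> * of_real \<eta>) < \<infinity>"
    using assms by (intro sqpot_finite_upper) auto
  show "sqint M (w + \<i> * of_real \<eta>) < sqint M w"
    unfolding sqint_def
  proof (rule integral_less_AE_space[OF sqpot_eq_sqint(2)[OF f'] sqpot_eq_sqint(2)[OF f] _ ne])
    show "AE u in M. 1 / (cmod (of_real u - (w + \<i> * of_real \<eta>)))\<^sup>2 < 1 / (cmod (of_real u - w))\<^sup>2"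
      using sqpot_eq_sqint(1)[OF f]
      by eventually_elim (rule divide_strict_left_mono[OF lt], use pos in \<open>auto intro!: mult_pos_pos\<close>)
  qed
qed

section \<open>Mass of intervals, null sets and the absolutely continuous part\<close>

lemma measure_interval_le_Im_stieltjes:
  assumes "0 < h"
  shows "measure M {x - h..x + h} \<le> 2 * h * Im (stieltjes M (Complex x h))"
proof -
  have f: "sqpot M (Complex x h) < \<infinity>" using assms by (intro sqpot_finite_upper) simp
  \<comment> \<open>For \<open>u\<close> within \<open>h\<close> of \<open>x\<close> the squared
    distance to \<open>x + i h\<close> is at most \<open>2 h^2\<close>.\<close>
  have "measure M {x - h..x + h} / (2 * h\<^sup>2) = (\<integral>u. indicator {x - h..x + h} u / (2 * h\<^sup>2) \<partial>M)"
    by simp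
  also have "\<dots> \<le> sqint M (Complex x h)"
    unfolding sqint_def
  proof (rule integral_mono[OF _ sqpot_eq_sqint(2)[OF f]])
    show "integrable M (\<lambda>u. indicator {x - h..x + h} u / (2 * h\<^sup>2))"
      by (intro integrable_divide integrable_real_indicator) (auto simp: less_top[symmetric])
    show "indicator {x - h..x + h} u / (2 * h\<^sup>2) \<le> 1 / (cmod (of_real u - Complex x h))\<^sup>2" for u
    proof (cases "u \<in> {x - h..x + h}")
      case True
      then have "\<bar>u - x\<bar> \<le> \<bar>h\<bar>" by auto
      then have "(u - x)\<^sup>2 \<le> h\<^sup>2" by (simp only: abs_le_square_iff)
      then have "(u - x)\<^sup>2 + h\<^sup>2 \<le> 2 * h\<^sup>2" by simp
      moreover have "0 < (u - x)\<^sup>2 + h\<^sup>2" using assms by (intro add_nonneg_pos) auto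
      ultimately show ?thesis using True by (simp add: cmod_power2 frac_le)
    qed simp
  qed
  finally have "measure M {x - h..x + h} \<le> 2 * h\<^sup>2 * sqint M (Complex x h)"
    using assms by (simp add: field_simps)
  then show ?thesis unfolding Im_stieltjes[OF f] by (simp add: power2_eq_square)
qed

text \<open>Intervals of radius \<open>h = (b - a) / (2 n)\<close> centred at
  \<open>a + (2 k + 1) h\<close> tile \<open>{a..b}\<close> and meet only at end points, so adding
  the local bounds loses nothing in the constant.\<close>

lemma measure_interval_le:
  assumes "a \<le> b" "0 < h0" "\<And>x h. x \<in> {a..b} \<Longrightarrow> 0 < h \<Longrightarrow> h < h0 \<Longrightarrow> measure M {x - h..x + h} \<le> 2 * h * c"
  shows "measure M {a..b} \<le> c * (b - a)"
proof (cases "a = b")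
  case True
  \<comment> \<open>A single point admits no tiling; its mass is bounded by that of shrinking
    intervals around it.\<close>
  have "measure M {a} \<le> 2 * c * h" if "0 < h" "h < h0" for h
    using assms(3)[of a h] that True finite_measure_mono[of "{a}" "{a - h..a + h}"] by (force simp: mult_ac)
  then have "\<forall>\<^sub>F h in at_right 0. measure M {a} \<le> 2 * c * h"
    using assms(2) eventually_at_right[of 0 h0] by (auto simp: eventually_at_right[OF assms(2)])
  moreover have "((\<lambda>h. 2 * c * h) \<longlongrightarrow> 2 * c * 0) (at_right 0)"
    by (intro tendsto_intros)
  ultimately have "measure M {a} \<le> 2 * c * 0"
    using tendsto_lowerbound[of "\<lambda>h. 2 * c * h" "2 * c * 0" "at_right 0"] by auto
  then show ?thesis using True by simp
next
  case False
  obtain n :: nat where n: "(b - a) / h0 < real n" using reals_Archimedean2 by blast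
  have "0 < (b - a) / h0" using False assms(1,2) by simp
  with n have n0: "0 < real n" by linarith
  define h where "h = (b - a) / (2 * real n)"
  have h: "0 < h" using False assms(1) n0 by (simp add: h_def)
  have "h < h0" using n n0 False assms unfolding h_def by (simp add: field_simps)
  have sub: "{a..b} \<subseteq> (\<Union>k<n. {(a + (2 * real k + 1) * h) - h..(a + (2 * real k + 1) * h) + h})"
  proof
    fix y assume y: "y \<in> {a..b}"
    show "y \<in> (\<Union>k<n. {(a + (2 * real k + 1) * h) - h..(a + (2 * real k + 1) * h) + h})"
    proof (cases "y = b")
      case True
      have "2 * real n * h = b - a" using n0 by (simp add: h_def)
      then have "b = (a + (2 * real (n - 1) + 1) * h) + h"
        using n0 by (simp add: of_nat_diff algebra_simps)
      moreover have "n - 1 < n" using n0 by simp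
      ultimately show ?thesis using True h by (intro UN_I[of "n - 1"]) auto
    next
      case False
      define k where "k = nat \<lfloor>(y - a) / (2 * h)\<rfloor>"
      have k0: "0 \<le> (y - a) / (2 * h)" using y h by simp
      have k1: "real k \<le> (y - a) / (2 * h)" "(y - a) / (2 * h) < real k + 1"
        using k0 unfolding k_def by (auto simp: of_nat_nat)
      have "(y - a) / (2 * h) < real n"
        using y False n0 h unfolding h_def by (simp add: field_simps)
      then have "k < n" using k1 by linarith
      moreover have "y \<in> {(a + (2 * real k + 1) * h) - h..(a + (2 * real k + 1) * h) + h}"
        using k1 h by (auto simp: field_simps)
      ultimately show ?thesis by auto
    qed
  qed
  have "measure M {a..b} \<le> (\<Sum>k<n. measure M {(a + (2 * real k + 1) * h) - h..(a + (2 * real k + 1) * h) + h})"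
    using sub by (intro order_trans[OF finite_measure_mono finite_measure_subadditive_finite]) auto
  also have "\<dots> \<le> (\<Sum>k<n. 2 * h * c)"
  proof (rule sum_mono)
    fix k assume "k \<in> {..<n}"
    then have "k + 1 \<le> n" by simp
    then have "real k + 1 \<le> real n" by linarith
    then have "(2 * real k + 1) * h \<le> 2 * real n * h"
      using h by (intro mult_right_mono) auto
    also have "2 * real n * h = b - a" using n0 by (simp add: h_def)
    finally have "a + (2 * real k + 1) * h \<in> {a..b}" using h by auto
    from assms(3)[OF this h \<open>h < h0\<close>]
    show "measure M {(a + (2 * real k + 1) * h) - h..(a + (2 * real k + 1) * h) + h} \<le> 2 * h * c" .
  qed
  also have "\<dots> = c * (b - a)" using n0 by (simp add: h_def)
  finally show ?thesis .
qed

text \<open>\<open>g\<close> is a continuous extension of the Stieltjes transform to a closed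
  half-disc. By uniform continuity the imaginary part just above the axis exceeds its boundary bound
  \<open>C\<close> by at most \<open>e\<close>. Halving the radius keeps the centres and heights
  inside the half-disc.\<close>

lemma boundary_interval_bound:
  assumes cont: "continuous_on {z. 0 \<le> Im z \<and> cmod (z - of_real x) \<le> r} g" and r: "0 < r"
    and eq: "\<And>z. 0 < Im z \<Longrightarrow> cmod (z - of_real x) \<le> r \<Longrightarrow> stieltjes M z = g z"
    and C: "\<And>y. \<bar>y - x\<bar> \<le> r \<Longrightarrow> Im (g (of_real y)) \<le> C"
    and e: "0 < e" and ab: "x - r / 2 \<le> a" "a \<le> b" "b \<le> x + r / 2"
  shows "measure M {a..b} \<le> (C + e) * (b - a)"
proof -
  let ?K = "{z. 0 \<le> Im z \<and> cmod (z - of_real x) \<le> r}"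
  have "?K = cball (of_real x) r \<inter> {z. 0 \<le> Im z}" by (auto simp: dist_norm norm_minus_commute)
  then have "compact ?K"
    using compact_Int_closed[OF compact_cball closed_halfspace_Im_ge] by simp
  then have "uniformly_continuous_on ?K g" by (rule compact_uniformly_continuous[OF cont])
  from this[unfolded uniformly_continuous_on_def, rule_format, OF e]
  obtain d where d: "0 < d" "\<forall>z \<in> ?K. \<forall>z' \<in> ?K. dist z' z < d \<longrightarrow> dist (g z') (g z) < e"
    by blast
  show ?thesis
  proof (rule measure_interval_le[OF ab(2), of "min d (r / 2)"])
    show "0 < min d (r / 2)" using d r by auto
    fix y h assume y: "y \<in> {a..b}" and h: "0 < h" "h < min d (r / 2)"
    have yx: "\<bar>y - x\<bar> \<le> r / 2"
    proof -
      have "a \<le> y" "y \<le> b" using y by auto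
      then show ?thesis using ab by linarith
    qed
    have "cmod (Complex y h - of_real x) \<le> \<bar>y - x\<bar> + \<bar>h\<bar>"
      using cmod_le[of "Complex y h - of_real x"] by simp
    then have K1: "cmod (Complex y h - of_real x) \<le> r" using yx h by auto
    have K2: "cmod (of_real y - of_real x) \<le> r" 
    proof -
      have "cmod (of_real y - of_real x) = \<bar>y - x\<bar>" by (metis norm_of_real of_real_diff)
      then show ?thesis using yx r by linarith
    qed
    have "Complex y h - of_real y = \<i> * of_real h" by (simp add: complex_eq_iff)
    then have "dist (Complex y h) (of_real y) = h" using h by (simp add: dist_norm norm_mult)
    then have "dist (g (Complex y h)) (g (of_real y)) < e"
      using h K1 K2 by (intro d(2)[rule_format]) auto
    then have "Im (g (Complex y h)) - Im (g (of_real y)) < e"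
      using abs_Im_le_cmod[of "g (Complex y h) - g (of_real y)"] by (simp add: dist_norm)
    moreover have "Im (g (of_real y)) \<le> C" using yx r by (intro C) auto
    ultimately have "Im (stieltjes M (Complex y h)) \<le> C + e"
      using eq[OF _ K1] h by simp
    then have "2 * h * Im (stieltjes M (Complex y h)) \<le> 2 * h * (C + e)"
      using h by (intro mult_left_mono) auto
    with measure_interval_le_Im_stieltjes[of h y] h show "measure M {y - h..y + h} \<le> 2 * h * (C + e)"
      by linarith
  qed
qed

text \<open>A measure dominated by \<open>C\<close> times length on intervals charges no Lebesgue
  null set: the null set is covered by non-overlapping intervals of total length at most
  \<open>e\<close>. Lengths are computed on interiors, because only these are disjoint.\<close>

lemma null_set_of_interval_bound:
  assumes C: "0 \<le> C" "\<And>c d. a \<le> c \<Longrightarrow> c \<le> d \<Longrightarrow> d \<le> b \<Longrightarrow> measure M {c..d} \<le> C * (d - c)"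
    and N: "N \<in> null_sets lborel" "N \<subseteq> {a..b}"
  shows "emeasure M N = 0"
proof -
  have bnd: "measure M N \<le> C * e" if e: "0 < e" for e
  proof -
    have Nl: "N \<in> lmeasurable" "measure lebesgue N = 0"
      using N(1) by (auto simp: fmeasurable_def null_sets_def measure_def)
    have sub: "N \<subseteq> cbox a b" using N(2) by simp
    obtain D where D: "countable D"
        "\<forall>K \<in> D. K \<subseteq> cbox a b \<and> K \<noteq> {} \<and> (\<exists>c d. K = cbox c d)"
        "pairwise (\<lambda>A B. interior A \<inter> interior B = {}) D"
        "N \<subseteq> \<Union>D" "\<Union>D \<in> lmeasurable" "measure lebesgue (\<Union>D) \<le> measure lebesgue N + e"
      by (rule measurable_outer_intervals_bounded[OF Nl(1) sub e]) (rule that; blast)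
    \<comment> \<open>The countable cover becomes a sequence, with empty sets at the indices that
      enumerate nothing.\<close>
    define A where "A n = (if n \<in> to_nat_on D ` D then from_nat_into D n else {})" for n
    have AD: "A n \<in> D \<or> A n = {}" for n
      unfolding A_def using D(1) by (auto intro: from_nat_into_to_nat_on)
    \<comment> \<open>The alternative \<open>d < c\<close> describes the empty padding, so that
      every term is a closed interval.\<close>
    have A1: "\<exists>c d. A n = {c..d} \<and> (a \<le> c \<and> c \<le> d \<and> d \<le> b \<or> d < c)" for n
    proof (cases "A n = {}")
      case True
      then have "A n = {1..0}" by simp
      then show ?thesis by (intro exI[of _ 1] exI[of _ 0]) simp
    next
      case False
      with AD have "A n \<in> D" by auto
      with D(2) have "A n \<subseteq> cbox a b \<and> A n \<noteq> {} \<and> (\<exists>c d. A n = cbox c d)" by blast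
      then obtain c d where "A n = {c..d}" "{c..d} \<subseteq> {a..b}" "{c..d} \<noteq> {}"
        by (metis box_real(2))
      then show ?thesis by (intro exI[of _ c] exI[of _ d]) auto
    qed
    have UA: "\<Union>D = (\<Union>n. A n)"
    proof
      show "\<Union>D \<subseteq> (\<Union>n. A n)"
        unfolding A_def using D(1) by (auto intro!: exI[of _ "to_nat_on D _"])
      show "(\<Union>n. A n) \<subseteq> \<Union>D" using AD by fast
    qed
    have disj: "disjoint_family (\<lambda>n. interior (A n))"
      unfolding disjoint_family_on_def
    proof (intro ballI impI)
      fix m n :: nat assume mn: "m \<noteq> n"
      show "interior (A m) \<inter> interior (A n) = {}"
      proof (cases "m \<in> to_nat_on D ` D \<and> n \<in> to_nat_on D ` D")
        case True
        then obtain K L where K: "K \<in> D" "m = to_nat_on D K" and L: "L \<in> D" "n = to_nat_on D L" by auto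
        then have "A m = K" "A n = L" "K \<noteq> L" using mn D(1) unfolding A_def by auto
        then show ?thesis using D(3) K L by (simp add: pairwise_def)
      qed (auto simp: A_def)
    qed
    have Ab [measurable]: "A n \<in> sets borel" for n using A1[of n] by auto
    have "emeasure lborel (\<Union>n. A n) = emeasure lebesgue (\<Union>n. A n)" using Ab by simp
    also have "\<dots> = ennreal (measure lebesgue (\<Union>n. A n))"
      using D(5) unfolding UA by (rule emeasure_eq_measure2)
    finally have lb: "emeasure lborel (\<Union>n. A n) = ennreal (measure lebesgue (\<Union>D))"
      unfolding UA .
    have "(\<Sum>n. emeasure lborel (interior (A n))) = emeasure lborel (\<Union>n. interior (A n))"
      using disj by (intro suminf_emeasure) auto
    also have "\<dots> \<le> emeasure lborel (\<Union>n. A n)"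
    proof (rule emeasure_mono)
      show "(\<Union>n. interior (A n)) \<subseteq> (\<Union>n. A n)" using interior_subset by blast
    qed measurable
    also have "\<dots> \<le> ennreal e" unfolding lb using D(6) Nl by (intro ennreal_leI) simp
    finally have sum: "(\<Sum>n. emeasure lborel (interior (A n))) \<le> ennreal e" .
    have "emeasure M N \<le> emeasure M (\<Union>n. A n)"
      using D(4) UA Ab by (intro emeasure_mono) (auto simp: M_is_borel)
    also have "\<dots> \<le> (\<Sum>n. emeasure M (A n))"
      using Ab by (intro emeasure_subadditive_countably) (auto simp: M_is_borel)
    also have "\<dots> \<le> (\<Sum>n. ennreal C * emeasure lborel (interior (A n)))"
    proof (intro suminf_le summableI)
      fix n
      obtain c d where cd: "A n = {c..d}" "a \<le> c \<and> c \<le> d \<and> d \<le> b \<or> d < c" using A1 by blast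
      show "emeasure M (A n) \<le> ennreal C * emeasure lborel (interior (A n))"
      proof (cases "d < c")
        case False
        then have "measure M {c..d} \<le> C * (d - c)" using C(2) cd by auto
        then have "ennreal (measure M {c..d}) \<le> ennreal C * ennreal (d - c)"
          using C(1) False by (subst ennreal_mult[symmetric]) (auto intro!: ennreal_leI)
        then show ?thesis using cd False by (simp add: emeasure_eq_measure)
      qed (use cd in simp)
    qed
    also have "\<dots> = ennreal C * (\<Sum>n. emeasure lborel (interior (A n)))"
      by (rule ennreal_suminf_cmult)
    also have "\<dots> \<le> ennreal C * ennreal e"
      using sum by (rule mult_left_mono) simp
    also have "\<dots> = ennreal (C * e)" using C e by (intro ennreal_mult[symmetric]) auto
    finally have "ennreal (measure M N) \<le> ennreal (C * e)" by (simp add: emeasure_eq_measure)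
    then show ?thesis using C e by (subst (asm) ennreal_le_iff) auto
  qed
  have "measure M N \<le> e" if "0 < e" for e
  proof -
    have "measure M N \<le> C * (e / (C + 1))" using that C by (intro bnd) auto
    also have "\<dots> \<le> e" using that C by (simp add: field_simps)
    finally show ?thesis .
  qed
  from this[of "measure M N / 2"] have "\<not> 0 < measure M N" by linarith
  then have "measure M N = 0" using measure_nonneg[of M N] by linarith
  then show ?thesis by (simp add: emeasure_eq_measure)
qed

lemma ac_part_decomposition: "\<exists>\<nu>s. lebesgue_decomposition M (ac_part M) \<nu>s"
  unfolding ac_part_def by (rule theI'[OF ex1_lebesgue_decomposition]) unfold_locales

text \<open>\<open>S\<close> collects possible atoms in \<open>J\<close>. Being countable it is
  Lebesgue null, so the absolutely continuous part ignores it.\<close>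

lemma not_in_msupp_ac_part:
  assumes "open J" "x \<in> J" "countable S" "emeasure M (J - S) = 0"
  shows "x \<notin> msupp (ac_part M)"
proof -
  obtain \<nu>s where d: "lebesgue_decomposition M (ac_part M) \<nu>s" using ac_part_decomposition by blast
  note d' = d[unfolded lebesgue_decomposition_def]
  have Sn: "S \<in> null_sets lborel" using assms(3) by (rule countable_imp_null_set_lborel)
  then have Sb: "S \<in> sets borel" using null_setsD2 by fastforce
  from Sn have "emeasure (ac_part M) S = 0" using d' by (auto simp: absolutely_continuous_def)
  moreover have "emeasure (ac_part M) (J - S) = 0"
  proof -
    have "J - S \<in> sets borel" using assms(1) Sb by auto
    then have "emeasure M (J - S) = emeasure (ac_part M) (J - S) + emeasure \<nu>s (J - S)" using d' by blast
    then show ?thesis using assms(4) by simp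
  qed
  moreover have "emeasure (ac_part M) J \<le> emeasure (ac_part M) (S \<union> (J - S))"
    using d' assms(1) Sb by (intro emeasure_mono) auto
  moreover have "emeasure (ac_part M) (S \<union> (J - S)) \<le> emeasure (ac_part M) S + emeasure (ac_part M) (J - S)"
    using d' assms(1) Sb by (intro emeasure_subadditive) auto
  ultimately have "emeasure (ac_part M) J = 0" by simp
  then show ?thesis using assms unfolding msupp_def by auto
qed

text \<open>The Lipschitz bound forces \<open>M\<close> to be absolutely continuous near
  \<open>x\<close>: the singular part lives on a Lebesgue null set, which \<open>M\<close> does not
  charge there. Hence positive mass near \<open>x\<close> belongs to the absolutely continuous
  part.\<close>

lemma in_msupp_ac_part:
  assumes C: "0 \<le> C" "0 < r" "\<And>c d. x - r \<le> c \<Longrightarrow> c \<le> d \<Longrightarrow> d \<le> x + r \<Longrightarrow> measure M {c..d} \<le> C * (d - c)"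
    and pos: "\<And>U. open U \<Longrightarrow> x \<in> U \<Longrightarrow> 0 < emeasure M U"
  shows "x \<in> msupp (ac_part M)"
  unfolding msupp_def
proof (intro CollectI allI impI, elim conjE)
  fix U :: "real set" assume U: "open U" "x \<in> U"
  obtain \<nu>s where d: "lebesgue_decomposition M (ac_part M) \<nu>s" using ac_part_decomposition by blast
  note d' = d[unfolded lebesgue_decomposition_def]
  obtain N where N: "N \<in> null_sets lborel" "emeasure \<nu>s (- N) = 0" using d' by auto
  have Nb: "N \<in> sets borel" using null_setsD2[OF N(1)] by simp
  define V where "V = U \<inter> {x - r<..<x + r}"
  have V: "open V" "x \<in> V" "V \<subseteq> U" "V \<subseteq> {x - r..x + r}" "V \<in> sets borel"
    unfolding V_def using U C(2) by auto
  have "N \<inter> V \<in> null_sets lborel" using N(1) V(5) by (intro null_set_Int2) auto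
  then have "emeasure M (N \<inter> V) = 0"
    using V(4) by (intro null_set_of_interval_bound[OF C(1,3), of "x - r" "x + r"]) auto
  moreover have "N \<inter> V \<in> sets borel" using Nb V(5) by auto
  then have "emeasure M (N \<inter> V) = emeasure (ac_part M) (N \<inter> V) + emeasure \<nu>s (N \<inter> V)" using d' by blast
  ultimately have "emeasure \<nu>s (N \<inter> V) = 0" by simp
  moreover have "emeasure \<nu>s V \<le> emeasure \<nu>s ((N \<inter> V) \<union> (- N))"
    using d' V(5) Nb by (intro emeasure_mono) auto
  moreover have "\<dots> \<le> emeasure \<nu>s (N \<inter> V) + emeasure \<nu>s (- N)"
    using d' V(5) Nb by (intro emeasure_subadditive) auto
  ultimately have "emeasure \<nu>s V = 0" using N(2) by simp
  moreover have "emeasure M V = emeasure (ac_part M) V + emeasure \<nu>s V" using d' V(5) by auto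
  ultimately have "0 < emeasure (ac_part M) V" using pos[OF V(1,2)] by simp
  also have "\<dots> \<le> emeasure (ac_part M) U" using d' V(3) U(1) by (intro emeasure_mono) auto
  finally show "0 < emeasure (ac_part M) U" .
qed

lemma emeasure_open_null:
  assumes "open U" "\<And>x. x \<in> U \<Longrightarrow> \<exists>V. open V \<and> x \<in> V \<and> emeasure M V = 0"
  shows "emeasure M U = 0"
proof -
  define F where "F = {V. open V \<and> emeasure M V = 0}"
  obtain F' where F': "F' \<subseteq> F" "countable F'" "\<Union>F' = \<Union>F"
    using Lindelof[of F] unfolding F_def by auto
  have "U \<subseteq> \<Union>F" using assms(2) unfolding F_def by blast
  have "(\<Union>V\<in>F'. V) \<in> null_sets M"
  proof (rule null_sets_UN'[OF F'(2)])
    fix V assume "V \<in> F'"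
    then have "open V" "emeasure M V = 0" using F'(1) unfolding F_def by auto
    then show "V \<in> null_sets M" by (auto simp: null_sets_def)
  qed
  then have "emeasure M (\<Union>F') = 0" "\<Union>F' \<in> sets M" by auto
  moreover have "U \<subseteq> \<Union>F'" using \<open>U \<subseteq> \<Union>F\<close> F'(3) by simp
  ultimately show ?thesis using emeasure_mono[of U "\<Union>F'" M] by simp
qed

end

lemma (in finite_borel_measure) sqint_pos:
  assumes "sqpot M w < \<infinity>" "emeasure M (space M) \<noteq> 0"
  shows "0 < sqint M w"
proof -
  have "(\<integral>u. 0 \<partial>M) < sqint M w"
    unfolding sqint_def
  proof (rule integral_less_AE_space[OF _ sqpot_eq_sqint(2)[OF assms(1)] _ assms(2)])
    show "AE u in M. 0 < 1 / (cmod (of_real u - w))\<^sup>2"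
      using sqpot_eq_sqint(1)[OF assms(1)] by eventually_elim auto
  qed simp
  then show ?thesis by simp
qed

lemma (in finite_borel_measure) sqint_null: "emeasure M (space M) = 0 \<Longrightarrow> sqint M w = 0"
  unfolding sqint_def by (intro integral_eq_zero_AE AE_I[where N = "space M"]) auto

section \<open>The subordination function as an inverse\<close>

text \<open>\<open>M\<close> is the measure of the Nevanlinna representation of F; the results on a
  single finite measure are then available for it under \<open>mh\<close> and for
  \<open>\<mu>\<close> under \<open>mu\<close>.\<close>

locale free_semigroup =
  fixes nac npp :: nat and \<mu> M :: "real measure"
    and \<omega> :: "real \<Rightarrow> complex \<Rightarrow> complex" and \<nu> :: "real \<Rightarrow> real measure"
  assumes asm_A: "assumption_A nac npp \<mu>"
    and nevanlinna: "nevanlinna_measure \<mu> M"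
    and subordination: "subordination \<mu> \<omega>"
    and semigroup: "free_conv_semigroup \<mu> \<omega> \<nu>"

sublocale free_semigroup \<subseteq> mu: real_distribution \<mu>
  using asm_A unfolding assumption_A_def by blast

sublocale free_semigroup \<subseteq> mh: finite_borel_measure M
  using nevanlinna unfolding nevanlinna_measure_def by blast

context free_semigroup
begin

lemma mu_space: "emeasure \<mu> (space \<mu>) \<noteq> 0" using mu.emeasure_space_1 by simp

lemma nu_dist: "1 \<le> s \<Longrightarrow> real_distribution (\<nu> s)"
  using semigroup unfolding free_conv_semigroup_def by blast

lemma nu_fbm: "1 \<le> s \<Longrightarrow> finite_borel_measure (\<nu> s)"
  using nu_dist real_distribution.finite_borel_measure_M by blast

lemma stieltjes_mu_nonzero:
  assumes "0 < Im w" shows "stieltjes \<mu> w \<noteq> 0"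
proof -
  have f: "sqpot \<mu> w < \<infinity>" using mu.sqpot_finite_upper[OF assms] .
  have "0 < Im (stieltjes \<mu> w)"
    using mu.Im_stieltjes[OF f] mu.sqint_pos[OF f mu_space] assms by simp
  then show ?thesis by auto
qed

lemma F_eq: "0 < Im w \<Longrightarrow> - 1 / stieltjes \<mu> w = w + stieltjes M w"
  using nevanlinna unfolding nevanlinna_measure_def neg_recip_stieltjes_def
  by (metis diff_eq_eq add.commute)

lemma Im_neg_recip: "Im (- 1 / m) = Im m / (cmod m)\<^sup>2"
  by (simp add: Im_divide cmod_power2)

text \<open>Imaginary parts of \<open>- 1 / stieltjes \<mu> w = w + stieltjes M w\<close>, divided
  by \<open>Im w\<close>.\<close>

lemma sqint_mu_eq:
  assumes "0 < Im w"
  shows "sqint \<mu> w = (1 + sqint M w) * (cmod (stieltjes \<mu> w))\<^sup>2"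
proof -
  have "Im (stieltjes \<mu> w) / (cmod (stieltjes \<mu> w))\<^sup>2 = Im (w + stieltjes M w)"
    unfolding F_eq[OF assms, symmetric] Im_neg_recip ..
  then have "Im w * sqint \<mu> w / (cmod (stieltjes \<mu> w))\<^sup>2 = Im w * (1 + sqint M w)"
    unfolding mu.Im_stieltjes[OF mu.sqpot_finite_upper[OF assms]] plus_complex.sel
      mh.Im_stieltjes[OF mh.sqpot_finite_upper[OF assms]] by (simp add: algebra_simps)
  then show ?thesis
    using stieltjes_mu_nonzero[OF assms] assms
    by (simp add: divide_eq_eq mult.assoc flip: distrib_left)
qed

text \<open>Substituting F(w) = w + m_M(w) in \<open>s \<omega> - z = (s - 1) F(\<omega>)\<close>
  and solving for \<open>z\<close> gives \<open>z = H s \<omega>\<close>.\<close>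

definition H :: "real \<Rightarrow> complex \<Rightarrow> complex" where
  "H s w = w - of_real (s - 1) * stieltjes M w"

text \<open>Since \<open>Im (H s w) = Im w * (1 - (s - 1) * sqint M w)\<close>, for
  \<open>0 < Im w\<close> this says that \<open>H s w\<close> stays in the closed upper half-plane.
  On the real axis that would be empty information; the bound on \<open>sqpot\<close> is what limits
  from above retain.\<close>

definition adm :: "real \<Rightarrow> complex \<Rightarrow> bool" where
  "adm s w \<longleftrightarrow> 0 \<le> Im w \<and> sqpot M w \<le> ennreal (1 / (s - 1))"

lemma admD:
  assumes "adm s w" "1 < s"
  shows "0 \<le> Im w" "sqpot M w < \<infinity>" "sqint M w \<le> 1 / (s - 1)"
  using assms mh.sqpot_leD[of w "1 / (s - 1)"] unfolding adm_def by auto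

lemma Im_H:
  "sqpot M w < \<infinity> \<Longrightarrow> Im (H s w) = Im w * (1 - (s - 1) * sqint M w)"
  unfolding H_def by (simp add: mh.Im_stieltjes algebra_simps)

lemma omega_upper:
  assumes "1 < s" "0 < Im z"
  shows "Im z \<le> Im (\<omega> s z)" "H s (\<omega> s z) = z" "sqint M (\<omega> s z) < 1 / (s - 1)" "adm s (\<omega> s z)"
proof -
  have S: "Im z \<le> Im (\<omega> s z)" "of_real s * \<omega> s z - z = of_real (s - 1) * neg_recip_stieltjes \<mu> (\<omega> s z)"
    using subordination assms unfolding subordination_def by auto
  show "Im z \<le> Im (\<omega> s z)" by (rule S)
  then have pos: "0 < Im (\<omega> s z)" using assms by simp
  show HH: "H s (\<omega> s z) = z"
    using S(2) unfolding H_def neg_recip_stieltjes_def F_eq[OF pos] by (simp add: algebra_simps)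
  have f: "sqpot M (\<omega> s z) < \<infinity>" by (rule mh.sqpot_finite_upper[OF pos])
  have "0 < Im (\<omega> s z) * (1 - (s - 1) * sqint M (\<omega> s z))"
    using Im_H[OF f, of s] HH assms by simp
  then have "(s - 1) * sqint M (\<omega> s z) < 1" using pos by (simp add: zero_less_mult_iff)
  then show q: "sqint M (\<omega> s z) < 1 / (s - 1)" using assms by (simp add: field_simps)
  show "adm s (\<omega> s z)"
    unfolding adm_def using pos q assms mh.sqpot_le_iff[OF f, of "1 / (s - 1)"] by auto
qed

lemma omega_cont: "1 < s \<Longrightarrow> continuous_on {z. 0 \<le> Im z} (\<omega> s)"
  and omega_Im: "1 < s \<Longrightarrow> 0 \<le> Im z \<Longrightarrow> 0 \<le> Im (\<omega> s z)"
  using subordination unfolding subordination_def by auto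

text \<open>The time varies along the sequence too, which is what joint continuity and the motion of
  an edge require.\<close>

lemma H_tendsto:
  assumes w: "w \<longlonglongrightarrow> l" and s: "s \<longlonglongrightarrow> s0" "1 < s0" "\<And>n. 1 < s n" and a: "\<And>n. adm (s n) (w n)"
  shows "adm s0 l" "(\<lambda>n. H (s n) (w n)) \<longlonglongrightarrow> H s0 l"
proof -
  have c: "(\<lambda>n. 1 / (s n - 1)) \<longlonglongrightarrow> 1 / (s0 - 1)"
    using s(2) by (intro tendsto_intros s(1)) auto
  have b: "sqpot M (w n) \<le> ennreal (1 / (s n - 1))" for n using a unfolding adm_def by auto
  have "0 \<le> Im l"
    using a unfolding adm_def by (intro LIMSEQ_le_const[OF tendsto_Im[OF w]]) auto
  then show "adm s0 l"
    unfolding adm_def using mh.sqpot_lsc[OF w b c] by simp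
  show "(\<lambda>n. H (s n) (w n)) \<longlonglongrightarrow> H s0 l"
    unfolding H_def using s(3)
    by (intro tendsto_intros w s(1) mh.stieltjes_tendsto[OF w b c]) (auto simp: less_imp_le)
qed

lemma omega_closed:
  assumes "1 < s" "0 \<le> Im z"
  shows "adm s (\<omega> s z)" "H s (\<omega> s z) = z"
proof -
  \<comment> \<open>A real \<open>z\<close> is approached from above, where the defining equation
    holds.\<close>
  define z' where "z' n = z + \<i> * of_real (inverse (real (Suc n)))" for n
  have z': "z' \<longlonglongrightarrow> z + \<i> * of_real 0"
    unfolding z'_def by (intro tendsto_intros LIMSEQ_inverse_real_of_nat)
  have Im: "0 < Im (z' n)" for n unfolding z'_def using assms by (simp add: add_nonneg_pos)
  have om: "(\<lambda>n. \<omega> s (z' n)) \<longlonglongrightarrow> \<omega> s z"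
    using z' Im assms
    by (intro continuous_on_tendsto_compose[OF omega_cont[OF assms(1)]]) (auto intro: less_imp_le always_eventually)
  note L = H_tendsto[OF om tendsto_const assms(1) assms(1) omega_upper(4)[OF assms(1) Im]]
  show "adm s (\<omega> s z)" by (rule L(1))
  have "(\<lambda>n. H s (\<omega> s (z' n))) \<longlonglongrightarrow> z" using z' omega_upper(2)[OF assms(1) Im] by simp
  with L(2) show "H s (\<omega> s z) = z" by (rule LIMSEQ_unique)
qed

text \<open>The difference quotient of \<open>H s\<close> is
  \<open>1 - (s - 1) * prodint a b\<close>, and strict admissibility keeps the second term below 1
  in modulus.\<close>

lemma H_inj:
  assumes s: "1 < s" and a: "sqpot M a < \<infinity>" "sqint M a < 1 / (s - 1)"
    and b: "sqpot M b < \<infinity>" "sqint M b < 1 / (s - 1)" and eq: "H s a = H s b"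
  shows "a = b"
proof (rule ccontr)
  assume ne: "a \<noteq> b"
  have "a - b = of_real (s - 1) * (stieltjes M a - stieltjes M b)"
    using eq unfolding H_def by (simp add: algebra_simps)
  then have "1 = of_real (s - 1) * mh.prodint a b"
    using ne unfolding mh.prodint(3)[OF a(1) b(1)] by simp
  then have "1 = cmod (of_real (s - 1) * mh.prodint a b)" by simp
  also have "\<dots> = (s - 1) * cmod (mh.prodint a b)" using s by (simp add: norm_mult del: of_real_diff)
  also have "\<dots> \<le> (s - 1) * ((sqint M a + sqint M b) / 2)"
    using mh.prodint(2)[OF a(1) b(1)] s by (intro mult_left_mono) auto
  also have "\<dots> < (s - 1) * (1 / (s - 1))"
    using s a(2) b(2) by (intro mult_strict_left_mono) auto
  finally show False using s by simp
qed

lemma omega_H_upper: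
  assumes s: "1 < s" and w: "0 < Im w" "sqint M w < 1 / (s - 1)"
  shows "0 < Im (H s w)" "\<omega> s (H s w) = w"
proof -
  have f: "sqpot M w < \<infinity>" using mh.sqpot_finite_upper w by blast
  have "(s - 1) * sqint M w < 1" using w(2) s by (simp add: field_simps)
  then show pos: "0 < Im (H s w)" unfolding Im_H[OF f] using w(1) by simp
  note u = omega_upper[OF s pos]
  have "0 < Im (\<omega> s (H s w))" using u(1) pos by simp
  then show "\<omega> s (H s w) = w"
    using u by (intro H_inj[OF s mh.sqpot_finite_upper _ f w(2)]) auto
qed

text \<open>Lifting \<open>w\<close> by a small imaginary amount makes the inequality on
  \<open>sqint\<close> strict, so the previous inversion applies there; continuity of
  \<open>\<omega> s\<close> and of \<open>H s\<close> on admissible points then removes the lift.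
  Consequently an admissible \<open>w\<close> is determined by \<open>H s w\<close>.\<close>

lemma omega_H:
  assumes s: "1 < s" and w: "adm s w"
  shows "0 \<le> Im (H s w)" "\<omega> s (H s w) = w"
proof -
  note a = admD[OF w s]
  have "(s - 1) * sqint M w \<le> 1" using a(3) s by (simp add: field_simps)
  then show nn: "0 \<le> Im (H s w)" unfolding Im_H[OF a(2)] using a(1) by simp
  define w' where "w' n = w + \<i> * of_real (inverse (real (Suc n)))" for n
  have w': "w' \<longlonglongrightarrow> w"
    using tendsto_add[OF tendsto_const tendsto_mult[OF tendsto_const tendsto_of_real[OF LIMSEQ_inverse_real_of_nat]], of w \<i>]
    unfolding w'_def by simp
  have Im: "0 < Im (w' n)" for n unfolding w'_def using a(1) by (simp add: add_nonneg_pos)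
  have q: "sqint M (w' n) < 1 / (s - 1)" for n
  proof (cases "emeasure M (space M) = 0")
    \<comment> \<open>For the zero measure \<open>sqint\<close> vanishes identically and no strict
      decrease is needed.\<close>
    case True
    then show ?thesis using mh.sqint_null s by simp
  next
    case False
    then show ?thesis using mh.sqpot_shift_up(2)[OF a(1) _ a(2) False] a(3) s unfolding w'_def
      by (metis inverse_positive_iff_positive less_le_trans of_nat_0_less_iff zero_less_Suc)
  qed
  have ad: "adm s (w' n)" for n
    unfolding adm_def using Im q[of n] s mh.sqpot_le_iff[OF mh.sqpot_finite_upper[OF Im], of "1 / (s - 1)" n]
    by (auto intro: less_imp_le)
  note u = omega_H_upper[OF s Im q]
  have "(\<lambda>n. \<omega> s (H s (w' n))) \<longlonglongrightarrow> \<omega> s (H s w)"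
    using H_tendsto(2)[OF w' tendsto_const s s ad] u(1) nn
    by (intro continuous_on_tendsto_compose[OF omega_cont[OF s]]) (auto intro: less_imp_le always_eventually)
  then show "\<omega> s (H s w) = w" unfolding u(2) using w' by (rule LIMSEQ_unique)
qed

text \<open>Locally bounded in \<open>s\<close> and \<open>z\<close>, which supplies the compactness
  for joint continuity.\<close>

lemma omega_bound:
  assumes "1 < s" "0 \<le> Im z"
  shows "cmod (\<omega> s z) \<le> cmod z + (s - 1) * measure M (space M) + 1"
proof -
  note a = admD[OF omega_closed(1)[OF assms] assms(1)]
  have "\<omega> s z = z + of_real (s - 1) * stieltjes M (\<omega> s z)"
    using omega_closed(2)[OF assms] unfolding H_def by (simp add: algebra_simps)
  then have "cmod (\<omega> s z) \<le> cmod z + cmod (of_real (s - 1) * stieltjes M (\<omega> s z))"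
    by (metis norm_triangle_ineq)
  also have "cmod (of_real (s - 1) * stieltjes M (\<omega> s z)) = (s - 1) * cmod (stieltjes M (\<omega> s z))"
    using assms by (simp add: norm_mult del: of_real_diff)
  also have "\<dots> \<le> (s - 1) * (measure M (space M) + 1 / (s - 1))"
    using mh.stieltjes_bound[OF a(2)] a(3) assms by (intro mult_left_mono) auto
  also have "\<dots> = (s - 1) * measure M (space M) + 1" using assms by (simp add: field_simps)
  finally show ?thesis by simp
qed

text \<open>A sequence violating the claim has a convergent subsequence of values. Its limit is
  admissible at time \<open>t'\<close> and solves \<open>H t' l = E'\<close>, so it must be
  \<open>\<omega> t' E'\<close>.\<close>

lemma omega_joint_continuous:
  assumes t: "1 < t'" and e: "0 < e"
  shows "\<exists>d>0. \<forall>s x. \<bar>s - t'\<bar> < d \<and> \<bar>x - E'\<bar> < d \<longrightarrow> 1 < s \<and> cmod (\<omega> s (of_real x) - \<omega> t' (of_real E')) < e"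
proof (rule ccontr)
  assume neg: "\<not> ?thesis"
  \<comment> \<open>The cap \<open>(t' - 1) / 2\<close> keeps all times above 1.\<close>
  define r where "r n = min ((t' - 1) / 2) (inverse (real (Suc n)))" for n
  have r: "0 < r n" "r n \<le> (t' - 1) / 2" "r n \<le> inverse (real (Suc n))" for n
    using t unfolding r_def by (simp_all only: min.cobounded1 min.cobounded2) simp
  have "\<exists>s x. \<bar>s - t'\<bar> < r n \<and> \<bar>x - E'\<bar> < r n \<and> \<not> (1 < s \<and> cmod (\<omega> s (of_real x) - \<omega> t' (of_real E')) < e)" for n
    using neg r(1)[of n] by blast
  then obtain s x where sx: "\<And>n. \<bar>s n - t'\<bar> < r n" "\<And>n. \<bar>x n - E'\<bar> < r n"
      "\<And>n. \<not> (1 < s n \<and> cmod (\<omega> (s n) (of_real (x n)) - \<omega> t' (of_real E')) < e)"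
    by metis
  have s1: "1 < s n" for n using sx(1)[of n] r(2)[of n] t by (simp add: abs_less_iff)
  have far: "e \<le> cmod (\<omega> (s n) (of_real (x n)) - \<omega> t' (of_real E'))" for n
    using sx(3)[of n] s1[of n] by auto
  have sl: "s \<longlonglongrightarrow> t'"
    by (rule LIM_zero_cancel, rule Lim_null_comparison[OF _ LIMSEQ_inverse_real_of_nat])
       (use sx(1) r(3) in \<open>auto intro!: always_eventually intro: less_imp_le less_le_trans\<close>)
  have xl: "x \<longlonglongrightarrow> E'"
    by (rule LIM_zero_cancel, rule Lim_null_comparison[OF _ LIMSEQ_inverse_real_of_nat])
       (use sx(2) r(3) in \<open>auto intro!: always_eventually intro: less_imp_le less_le_trans\<close>)
  define w where "w n = \<omega> (s n) (of_real (x n))" for n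
  have "cmod (w n) \<le> (\<bar>E'\<bar> + t') + (2 * t') * measure M (space M) + 1" for n
  proof -
    have "cmod (w n) \<le> cmod (of_real (x n)) + (s n - 1) * measure M (space M) + 1"
      unfolding w_def using s1 by (intro omega_bound) auto
    moreover have "\<bar>x n\<bar> \<le> \<bar>E'\<bar> + t'" 
      using sx(2)[of n] r(2)[of n] t abs_triangle_ineq[of "x n - E'" E'] by (simp add: field_simps)
    moreover have "(s n - 1) * measure M (space M) \<le> (2 * t') * measure M (space M)"
      using sx(1)[of n] r(2)[of n] t by (intro mult_right_mono) auto
    ultimately show ?thesis by simp
  qed
  then have "bounded (range w)" by (auto simp: bounded_iff)
  then obtain l \<sigma> where l: "strict_mono \<sigma>" "(w \<circ> \<sigma>) \<longlonglongrightarrow> l"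
    using bounded_imp_convergent_subsequence[of w] by blast
  have s\<sigma>: "(\<lambda>n. s (\<sigma> n)) \<longlonglongrightarrow> t'" using LIMSEQ_subseq_LIMSEQ[OF sl l(1)] by (simp add: o_def)
  have x\<sigma>: "(\<lambda>n. x (\<sigma> n)) \<longlonglongrightarrow> E'" using LIMSEQ_subseq_LIMSEQ[OF xl l(1)] by (simp add: o_def)
  have ad: "adm (s (\<sigma> n)) ((w \<circ> \<sigma>) n)" and HH: "H (s (\<sigma> n)) ((w \<circ> \<sigma>) n) = of_real (x (\<sigma> n))" for n
    unfolding w_def o_def using omega_closed[OF s1, of "of_real _"] by simp_all
  note L = H_tendsto[OF l(2) s\<sigma> t s1 ad]
  have "H t' l = of_real E'"
    by (rule LIMSEQ_unique[OF L(2)]) (unfold HH, intro tendsto_intros x\<sigma>)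
  then have "l = \<omega> t' (of_real E')" using omega_H(2)[OF t L(1)] by simp
  then have "(\<lambda>n. cmod ((w \<circ> \<sigma>) n - \<omega> t' (of_real E'))) \<longlonglongrightarrow> 0"
    using tendsto_norm[OF LIM_zero[OF l(2)]] by simp
  moreover have "e \<le> cmod ((w \<circ> \<sigma>) n - \<omega> t' (of_real E'))" for n
    using far unfolding w_def o_def by simp
  ultimately have "e \<le> 0" by (intro LIMSEQ_le_const) auto
  then show False using e by simp
qed

end

section \<open>The density\<close>

lemma nontangential_tendsto:
  assumes "\<And>a. 0 < a \<Longrightarrow> (f \<longlongrightarrow> l) (at (of_real x) within {z. 0 < Im z \<and> \<bar>Re z - x\<bar> < a * Im z})"
  shows "(f \<longlongrightarrow> l) (nontangential x)"
  using assms unfolding nontangential_def filterlim_def filtermap_SUP by (intro SUP_least) auto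

text \<open>\<open>Lim\<close> is determined by convergence only along a proper filter.\<close>

lemma nontangential_nontrivial: "nontangential x \<noteq> bot"
proof -
  let ?C = "{z. 0 < Im z \<and> \<bar>Re z - x\<bar> < 1 * Im z}"
  have "at (of_real x) within ?C \<noteq> bot"
  proof -
    have "of_real x islimpt ?C"
      unfolding islimpt_approachable
    proof (intro allI impI)
      fix e :: real assume e: "0 < e"
      have "dist (Complex x (e / 2)) (of_real x) = e / 2"
      proof -
        have "Complex x (e / 2) - of_real x = \<i> * of_real (e / 2)" by (simp add: complex_eq_iff)
        then have "dist (Complex x (e / 2)) (of_real x) = cmod (\<i> * of_real (e / 2))" by (simp only: dist_norm)
        then show ?thesis using e by (simp add: norm_mult)
      qed
      then show "\<exists>x'\<in>?C. x' \<noteq> complex_of_real x \<and> dist x' (complex_of_real x) < e"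
        using e by (intro bexI[of _ "Complex x (e / 2)"]) (auto simp: complex_eq_iff)
    qed
    then show ?thesis by (simp add: trivial_limit_within)
  qed
  moreover have "at (of_real x) within ?C \<le> nontangential x"
    unfolding nontangential_def by (rule SUP_upper) simp
  ultimately show ?thesis by (metis bot.extremum_uniqueI)
qed

lemma ac_density_eqI:
  assumes "\<And>a. 0 < a \<Longrightarrow> ((\<lambda>z. ereal (Im (stieltjes \<nu> z) / pi)) \<longlongrightarrow> l)
      (at (of_real x) within {z. 0 < Im z \<and> \<bar>Re z - x\<bar> < a * Im z})"
  shows "ac_density \<nu> x = l"
  unfolding ac_density_def
  by (intro tendsto_Lim nontangential_nontrivial nontangential_tendsto assms)

lemma stieltjes_of_real: "stieltjes \<nu> (of_real w) = of_real (\<integral>u. 1 / (u - w) \<partial>\<nu>)"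
  unfolding stieltjes_def by (subst integral_complex_of_real[symmetric]) simp

lemma (in finite_borel_measure) sqint_shift_le:
  assumes "0 \<le> Im w" "0 < \<eta>" "sqpot M w < \<infinity>"
  shows "sqint M (w + \<i> * of_real \<eta>) \<le> sqint M w"
  using sqpot_shift_up(1)[OF assms(1,2)] unfolding sqpot_eq_sqint(3)[OF assms(3)]
  by (intro sqpot_leD(2)) auto

context free_semigroup
begin

lemma H_eq: "of_real (s - 1) * (w + stieltjes M w) = of_real s * w - H s w"
  unfolding H_def by (simp add: algebra_simps)

text \<open>Vertical approach to a real point: finiteness of \<open>sqpot\<close> there makes F
  differ from \<open>w + m_M(w)\<close> by at most a multiple of the height.\<close>

lemma F_minus_real:
  assumes w: "sqpot M (of_real w) < \<infinity>" and h: "0 < \<eta>"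
  shows "- 1 / stieltjes \<mu> (of_real w + \<i> * of_real \<eta>) = of_real w + stieltjes M (of_real w) +
     \<i> * of_real \<eta> * (1 + mh.prodint (of_real w + \<i> * of_real \<eta>) (of_real w))"
    "cmod (mh.prodint (of_real w + \<i> * of_real \<eta>) (of_real w)) \<le> sqint M (of_real w)"
proof -
  let ?w = "of_real w + \<i> * of_real \<eta>"
  have f: "sqpot M ?w < \<infinity>" using h by (intro mh.sqpot_finite_upper) auto
  have "stieltjes M ?w = stieltjes M (of_real w) + \<i> * of_real \<eta> * mh.prodint ?w (of_real w)"
    using mh.prodint(3)[OF f w] by (simp add: algebra_simps)
  then show "- 1 / stieltjes \<mu> ?w = of_real w + stieltjes M (of_real w) + \<i> * of_real \<eta> * (1 + mh.prodint ?w (of_real w))"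
    using F_eq[of ?w] h by (simp add: algebra_simps)
  show "cmod (mh.prodint ?w (of_real w)) \<le> sqint M (of_real w)"
    using mh.prodint(2)[OF f w] mh.sqint_shift_le[of "of_real w" \<eta>] w h by simp
qed

text \<open>An atom of mass \<open>\<alpha>\<close> makes \<open>|stieltjes \<mu>|\<close> at least
  \<open>\<alpha> / (2 \<eta>)\<close> at height \<open>\<eta>\<close>, so F tends to 0 vertically;
  its limit is also \<open>w + stieltjes M w\<close>.\<close>

lemma atom_zero:
  assumes a: "0 < measure \<mu> {w}" and w: "sqpot M (of_real w) < \<infinity>"
  shows "stieltjes M (of_real w) = - of_real w"
proof -
  let ?\<alpha> = "measure \<mu> {w}" and ?q = "sqint M (of_real w)" and ?z = "of_real w + stieltjes M (of_real w)"
  have "cmod ?z \<le> \<eta> * (2 / ?\<alpha> + 1 + ?q)" if h: "0 < \<eta>" for \<eta>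
  proof -
    let ?w = "of_real w + \<i> * of_real \<eta>"
    have W: "?w = Complex w \<eta>" by (simp add: complex_eq_iff)
    have "?\<alpha> \<le> measure \<mu> {w - \<eta>..w + \<eta>}" using h by (intro mu.finite_measure_mono) auto
    also have "\<dots> \<le> 2 * \<eta> * Im (stieltjes \<mu> ?w)"
      unfolding W using mu.measure_interval_le_Im_stieltjes[OF h] .
    also have "\<dots> \<le> 2 * \<eta> * cmod (stieltjes \<mu> ?w)"
      using h abs_Im_le_cmod[of "stieltjes \<mu> ?w"] by (intro mult_left_mono) auto
    finally have al: "?\<alpha> \<le> 2 * \<eta> * cmod (stieltjes \<mu> ?w)" .
    then have "0 < cmod (stieltjes \<mu> ?w)" using a h
      by (metis less_le_trans zero_less_mult_pos mult_pos_pos zero_less_numeral)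
    then have F: "cmod (- 1 / stieltjes \<mu> ?w) \<le> 2 * \<eta> / ?\<alpha>"
      using al a by (simp add: norm_divide field_simps)
    have "?z = - 1 / stieltjes \<mu> ?w - \<i> * of_real \<eta> * (1 + mh.prodint ?w (of_real w))"
      using F_minus_real(1)[OF w h] by simp
    then have "cmod ?z \<le> cmod (- 1 / stieltjes \<mu> ?w) + cmod (\<i> * of_real \<eta> * (1 + mh.prodint ?w (of_real w)))"
      by (metis norm_triangle_ineq4)
    also have "cmod (\<i> * of_real \<eta> * (1 + mh.prodint ?w (of_real w))) = \<eta> * cmod (1 + mh.prodint ?w (of_real w))"
      using h by (simp add: norm_mult)
    also have "\<dots> \<le> \<eta> * (1 + ?q)"
      using h F_minus_real(2)[OF w h] norm_triangle_ineq[of 1 "mh.prodint ?w (of_real w)"]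
      by (intro mult_left_mono) auto
    finally show ?thesis using F by (simp add: algebra_simps)
  qed note b = this
  have "cmod ?z \<le> e" if e: "0 < e" for e
  proof -
    have k: "0 < 2 / ?\<alpha> + 1 + ?q" using a by (simp add: add_pos_nonneg)
    then show ?thesis using b[of "e / (2 / ?\<alpha> + 1 + ?q)"] e by simp
  qed
  from this[of "cmod ?z / 2"] have "cmod ?z = 0" by (smt (verit) norm_ge_zero field_sum_of_halves)
  then show ?thesis by (simp add: add_eq_0_iff)
qed

text \<open>The hypothesis says that F vanishes at \<open>w = x / s\<close>. The mass of the atom is
  then read off from the growth of the Stieltjes transform on the vertical line above
  \<open>w\<close>.\<close>

lemma singular_value:
  assumes s: "1 < s" and x: "of_real s * \<omega> s (of_real x) = of_real x"
  shows "\<omega> s (of_real x) = of_real (x / s)" "x \<in> singular_points \<mu> s"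
proof -
  let ?w = "x / s"
  show w: "\<omega> s (of_real x) = of_real ?w" using s x by (auto simp: field_simps)
  have om: "adm s (of_real ?w)" "H s (of_real ?w) = of_real x"
    using omega_closed[OF s, of "of_real x"] w by simp_all
  have fin: "sqpot M (of_real ?w) < \<infinity>" "sqint M (of_real ?w) \<le> 1 / (s - 1)" using admD[OF om(1) s] by auto
  have "of_real (s - 1) * (of_real ?w + stieltjes M (of_real ?w)) = 0"
    using H_eq[of s "of_real ?w"] om(2) s by simp
  then have z: "of_real ?w + stieltjes M (of_real ?w) = 0" using s by simp
  define \<eta> where "\<eta> n = inverse (real (Suc n))" for n
  have h: "0 < \<eta> n" for n unfolding \<eta>_def by simp
  have hl: "\<eta> \<longlonglongrightarrow> 0" unfolding \<eta>_def by (rule LIMSEQ_inverse_real_of_nat)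
  let ?W = "\<lambda>n. of_real ?w + \<i> * of_real (\<eta> n)"
  \<comment> \<open>At height \<open>\<eta>\<close> one has
    \<open>|F| \<le> \<eta> (1 + 1 / (s - 1)) = \<eta> s / (s - 1)\<close>, and the reciprocal gives
    the threshold \<open>1 - 1 / s\<close>.\<close>
  have lower: "1 - 1 / s \<le> (\<integral>u. \<eta> n / cmod (of_real u - ?W n) \<partial>\<mu>)" for n
  proof -
    have nz: "stieltjes \<mu> (?W n) \<noteq> 0" using h by (intro stieltjes_mu_nonzero) simp
    have "- 1 / stieltjes \<mu> (?W n) = \<i> * of_real (\<eta> n) * (1 + mh.prodint (?W n) (of_real ?w))"
      using F_minus_real(1)[OF fin(1) h[of n]] z by simp
    then have "1 / cmod (stieltjes \<mu> (?W n)) = \<eta> n * cmod (1 + mh.prodint (?W n) (of_real ?w))"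
      using h[of n] by (metis (no_types, lifting) abs_of_pos mult_1 norm_divide norm_ii norm_minus_cancel norm_mult norm_of_real norm_one)
    also have "\<dots> \<le> \<eta> n * (1 + 1 / (s - 1))"
      using h[of n] F_minus_real(2)[OF fin(1) h[of n]] fin(2) norm_triangle_ineq[of 1 "mh.prodint (?W n) (of_real ?w)"]
      by (intro mult_left_mono) auto
    also have "1 + 1 / (s - 1) = s / (s - 1)" using s by (simp add: field_simps)
    finally have "1 - 1 / s \<le> \<eta> n * cmod (stieltjes \<mu> (?W n))"
      using nz s h[of n] by (simp add: field_simps)
    also have "cmod (stieltjes \<mu> (?W n)) \<le> (\<integral>u. 1 / cmod (of_real u - ?W n) \<partial>\<mu>)"
      unfolding stieltjes_def by (rule order_trans[OF integral_norm_bound]) (simp add: norm_divide)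
    also have "\<eta> n * (\<integral>u. 1 / cmod (of_real u - ?W n) \<partial>\<mu>) = (\<integral>u. \<eta> n / cmod (of_real u - ?W n) \<partial>\<mu>)"
      by (simp flip: integral_mult_right_zero)
    finally show ?thesis using h[of n] by simp
  qed
  \<comment> \<open>\<open>\<eta> / |u - w - i \<eta>|\<close> is at most 1 and tends to 1 at
    \<open>u = w\<close>, to 0 elsewhere.\<close>
  have lim: "(\<lambda>n. \<integral>u. \<eta> n / cmod (of_real u - ?W n) \<partial>\<mu>) \<longlonglongrightarrow> (\<integral>u. indicator {?w} u \<partial>\<mu>)"
  proof (rule integral_dominated_convergence[where w = "\<lambda>_. 1"])
    show "AE u in \<mu>. (\<lambda>n. \<eta> n / cmod (of_real u - ?W n)) \<longlonglongrightarrow> indicator {?w} u"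
    proof (rule always_eventually, rule allI)
      fix u
      show "(\<lambda>n. \<eta> n / cmod (of_real u - ?W n)) \<longlonglongrightarrow> indicator {?w} u"
      proof (cases "u = ?w")
        case True
        have "\<eta> n / cmod (of_real u - ?W n) = 1" for n using True h[of n] by (simp add: norm_mult)
        then show ?thesis using True by simp
      next
        case False
        have "(\<lambda>n. \<eta> n / cmod (of_real u - ?W n)) \<longlonglongrightarrow> 0 / cmod (of_real u - (of_real ?w + \<i> * of_real 0))"
          using False by (intro tendsto_intros hl) (auto simp flip: of_real_divide)
        then show ?thesis using False by simp
      qed
    qed
    show "AE u in \<mu>. norm (\<eta> n / cmod (of_real u - ?W n)) \<le> 1" for n
    proof (rule always_eventually, rule allI)
      fix u
      have "\<eta> n \<le> cmod (of_real u - ?W n)"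
        using abs_Im_le_cmod[of "of_real u - ?W n"] h[of n] by (simp flip: of_real_divide)
      then show "norm (\<eta> n / cmod (of_real u - ?W n)) \<le> 1" using h[of n] by (simp add: divide_le_eq_1)
    qed
  qed auto
  have "1 - 1 / s \<le> measure \<mu> {?w}"
    using LIMSEQ_le_const[OF lim, of "1 - 1 / s"] lower by auto
  moreover have "0 < 1 - 1 / s" using s by simp
  ultimately show "x \<in> singular_points \<mu> s" unfolding singular_points_def by auto
qed

lemma stieltjes_nu:
  assumes "1 < s" "0 < Im z"
  shows "stieltjes (\<nu> s) z = of_real (s - 1) / (z - of_real s * \<omega> s z)"
    "- 1 / stieltjes (\<nu> s) z = \<omega> s z + stieltjes M (\<omega> s z)"
    "of_real (s - 1) * (\<omega> s z + stieltjes M (\<omega> s z)) = of_real s * \<omega> s z - z"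
    "stieltjes (\<nu> s) z \<noteq> 0" "z \<noteq> of_real s * \<omega> s z"
proof -
  note u = omega_upper[OF assms]
  have pos: "0 < Im (\<omega> s z)" using u(1) assms by simp
  show a: "- 1 / stieltjes (\<nu> s) z = \<omega> s z + stieltjes M (\<omega> s z)"
    using semigroup assms F_eq[OF pos] unfolding free_conv_semigroup_def neg_recip_stieltjes_def by auto
  show b: "of_real (s - 1) * (\<omega> s z + stieltjes M (\<omega> s z)) = of_real s * \<omega> s z - z"
    using H_eq[of s "\<omega> s z"] u(2) by simp
  show nz: "z \<noteq> of_real s * \<omega> s z"
  proof
    assume "z = of_real s * \<omega> s z"
    from arg_cong[OF this, of Im] have "Im z = s * Im (\<omega> s z)" by simp
    moreover have "1 * Im (\<omega> s z) < s * Im (\<omega> s z)" using pos assms by (intro mult_strict_right_mono) auto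
    ultimately show False using u(1) by simp
  qed
  then have "\<omega> s z + stieltjes M (\<omega> s z) \<noteq> 0" using b by auto
  then show n: "stieltjes (\<nu> s) z \<noteq> 0" using a by auto
  have "of_real (s - 1) * (- 1 / stieltjes (\<nu> s) z) = of_real s * \<omega> s z - z" unfolding a by (rule b)
  then show "stieltjes (\<nu> s) z = of_real (s - 1) / (z - of_real s * \<omega> s z)"
    using n nz by (simp add: field_simps)
qed

text \<open>The Stieltjes transform of \<open>\<nu> s\<close> expressed through
  \<open>\<omega> s\<close> alone. In this form it extends continuously to all real points except
  the zeros of the denominator, which are the singular ones.\<close>

definition bdry :: "real \<Rightarrow> complex \<Rightarrow> complex" where
  "bdry s z = of_real (s - 1) / (z - of_real s * \<omega> s z)"

text \<open>If \<open>\<omega> s x\<close> is real, \<open>stieltjes \<mu>\<close> may be a default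
  value there, but it is still real, and so is \<open>bdry\<close>. Thus the imaginary parts agree
  in every case.\<close>

lemma bdry_real:
  assumes s: "1 < s" and x: "of_real s * \<omega> s (of_real x) \<noteq> of_real x"
  shows "bdry s (of_real x) = stieltjes \<mu> (\<omega> s (of_real x)) \<or> Im (\<omega> s (of_real x)) = 0"
    "Im (bdry s (of_real x)) = Im (stieltjes \<mu> (\<omega> s (of_real x)))"
    "0 < Im (bdry s (of_real x)) \<longleftrightarrow> 0 < Im (\<omega> s (of_real x))"
proof -
  let ?w = "\<omega> s (of_real x)"
  have om: "adm s ?w" "H s ?w = of_real x" using omega_closed[OF s] by auto
  show A: "bdry s (of_real x) = stieltjes \<mu> ?w \<or> Im ?w = 0"
  proof (rule disjCI)
    assume "Im ?w \<noteq> 0"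
    then have pos: "0 < Im ?w" using admD(1)[OF om(1) s] by simp
    have b: "of_real (s - 1) * (?w + stieltjes M ?w) = of_real s * ?w - of_real x"
      using H_eq[of s ?w] om(2) by simp
    show "bdry s (of_real x) = stieltjes \<mu> ?w"
      using b stieltjes_mu_nonzero[OF pos] x unfolding F_eq[OF pos, symmetric] bdry_def
      by (simp add: field_simps)
  qed
  have Im_b: "Im (bdry s (of_real x)) = (s - 1) * s * Im ?w / (cmod (of_real x - of_real s * ?w))\<^sup>2"
    unfolding bdry_def by (simp add: Im_divide cmod_power2 flip: of_real_diff)
  show "Im (bdry s (of_real x)) = Im (stieltjes \<mu> ?w)"
  proof (cases "Im ?w = 0")
    case True
    then have "?w = of_real (Re ?w)" by (simp add: complex_eq_iff)
    then have "Im (stieltjes \<mu> ?w) = 0" by (metis stieltjes_of_real Im_complex_of_real)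
    then show ?thesis using Im_b True by simp
  qed (use A in auto)
  have d: "0 < (s - 1) * s / (cmod (of_real x - of_real s * ?w))\<^sup>2"
    using s x by (intro divide_pos_pos) auto
  have "Im (bdry s (of_real x)) = (s - 1) * s / (cmod (of_real x - of_real s * ?w))\<^sup>2 * Im ?w"
    using Im_b by simp
  then show "0 < Im (bdry s (of_real x)) \<longleftrightarrow> 0 < Im ?w"
    using d by (metis mult_pos_pos zero_less_mult_pos)
qed

lemma bdry_cont:
  assumes s: "1 < s"
  shows "continuous_on {z. 0 \<le> Im z \<and> z \<noteq> of_real s * \<omega> s z} (bdry s)"
  unfolding bdry_def
  by (intro continuous_intros continuous_on_subset[OF omega_cont[OF s]]) auto

lemma bdry_nbhd:
  assumes s: "1 < s" and x: "of_real s * \<omega> s (of_real x) \<noteq> of_real x"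
  shows "\<exists>r>0. \<forall>z. 0 \<le> Im z \<and> cmod (z - of_real x) \<le> r \<longrightarrow> z \<noteq> of_real s * \<omega> s z"
proof -
  have "continuous_on {z. 0 \<le> Im z} (\<lambda>z. z - of_real s * \<omega> s z)"
    by (intro continuous_intros omega_cont s)
  then have "((\<lambda>z. z - of_real s * \<omega> s z) \<longlongrightarrow> of_real x - of_real s * \<omega> s (of_real x)) (at (of_real x) within {z. 0 \<le> Im z})"
    by (auto simp: continuous_on_def)
  then have "\<forall>\<^sub>F z in at (of_real x) within {z. 0 \<le> Im z}. z - of_real s * \<omega> s z \<noteq> 0"
    using x by (elim tendsto_imp_eventually_ne) auto
  then obtain d where "0 < d" "\<forall>z\<in>{z. 0 \<le> Im z}. z \<noteq> of_real x \<and> dist z (of_real x) < d \<longrightarrow> z - of_real s * \<omega> s z \<noteq> 0"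
    unfolding eventually_at by blast
  then show ?thesis using x by (intro exI[of _ "d / 2"]) (auto simp: dist_norm)
qed

lemma ac_density_regular:
  assumes s: "1 < s" and x: "of_real s * \<omega> s (of_real x) \<noteq> of_real x"
  shows "ac_density (\<nu> s) x = ereal (Im (stieltjes \<mu> (\<omega> s (of_real x))) / pi)"
proof (rule ac_density_eqI)
  fix a :: real
  let ?C = "{z. 0 < Im z \<and> \<bar>Re z - x\<bar> < a * Im z}"
  have "(bdry s \<longlongrightarrow> bdry s (of_real x)) (at (of_real x) within {z. 0 \<le> Im z \<and> z \<noteq> of_real s * \<omega> s z})"
    using bdry_cont[OF s] x by (auto simp: continuous_on_def)
  then have "(bdry s \<longlongrightarrow> bdry s (of_real x)) (at (of_real x) within ?C)"
    by (rule tendsto_within_subset) (use stieltjes_nu(5)[OF s] in auto)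
  then have "((\<lambda>z. ereal (Im (bdry s z) / pi)) \<longlongrightarrow> ereal (Im (bdry s (of_real x)) / pi)) (at (of_real x) within ?C)"
    by (intro tendsto_intros) auto
  moreover have "\<forall>\<^sub>F z in at (of_real x) within ?C. ereal (Im (bdry s z) / pi) = ereal (Im (stieltjes (\<nu> s) z) / pi)"
    unfolding eventually_at by (rule exI[of _ 1]) (auto simp: bdry_def stieltjes_nu(1)[OF s])
  ultimately show "((\<lambda>z. ereal (Im (stieltjes (\<nu> s) z) / pi)) \<longlongrightarrow> ereal (Im (stieltjes \<mu> (\<omega> s (of_real x))) / pi)) (at (of_real x) within ?C)"
    unfolding bdry_real(2)[OF s x] by (rule Lim_transform_eventually)
qed

text \<open>\<open>1 - (s - 1) \<integral> 1 / ((u - a) (u - b))\<close> is the difference quotient of \<open>H s\<close>.\<close>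

lemma H_diff:
  assumes "sqpot M a < \<infinity>" "sqpot M b < \<infinity>"
  shows "H s a - H s b = (a - b) * (1 - of_real (s - 1) * mh.prodint a b)"
proof -
  have e: "stieltjes M a = stieltjes M b + (a - b) * mh.prodint a b"
    using mh.prodint(3)[OF assms] by (simp add: algebra_simps)
  show ?thesis unfolding H_def e by (simp add: algebra_simps)
qed

text \<open>A second-order Taylor remainder at a real point where a third moment need not exist. The
  kernel \<open>1 / ((u - w)^2 (u - a))\<close> is integrable because \<open>a\<close> is off the
  axis, and it has non-negative imaginary part.\<close>

lemma critical_kernel:
  assumes w: "sqpot M (of_real w) < \<infinity>" and a: "0 < Im a"
  shows "\<exists>k. of_real (sqint M (of_real w)) - mh.prodint a (of_real w) = - (a - of_real w) * k \<and> 0 \<le> Im k"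
proof -
  note a' = mh.sqpot_finite_upper[OF a]
  define k where "k = (\<integral>u. of_real (1 / (cmod (of_real u - of_real w))\<^sup>2) * (1 / (of_real u - a)) \<partial>M)"
  have bd: "cmod (1 / (of_real u - a)) \<le> 1 / Im a" for u
    using abs_Im_le_cmod[of "of_real u - a"] a by (simp add: norm_divide frac_le)
  have int: "integrable M (\<lambda>u. of_real (1 / (cmod (of_real u - of_real w))\<^sup>2) * (1 / (of_real u - a)))"
  proof (rule Bochner_Integration.integrable_bound)
    show "integrable M (\<lambda>u. 1 / (cmod (of_real u - of_real w))\<^sup>2 * (1 / Im a))"
      using mh.sqpot_eq_sqint(2)[OF w] by (rule integrable_mult_left)
    show "AE u in M. norm (of_real (1 / (cmod (of_real u - of_real w))\<^sup>2) * (1 / (of_real u - a))) \<le>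
        norm (1 / (cmod (of_real u - of_real w))\<^sup>2 * (1 / Im a))"
    proof (rule always_eventually, rule allI)
      fix u
      have "norm (of_real (1 / (cmod (of_real u - of_real w))\<^sup>2) * (1 / (of_real u - a))) =
          1 / (cmod (of_real u - of_real w))\<^sup>2 * cmod (1 / (of_real u - a))"
        unfolding norm_mult norm_of_real by simp
      also have "\<dots> \<le> 1 / (cmod (of_real u - of_real w))\<^sup>2 * (1 / Im a)"
        by (intro mult_left_mono bd) simp
      finally show "norm (of_real (1 / (cmod (of_real u - of_real w))\<^sup>2) * (1 / (of_real u - a))) \<le>
        norm (1 / (cmod (of_real u - of_real w))\<^sup>2 * (1 / Im a))" using a by simp
    qed
  qed measurable
  have "0 \<le> (\<integral>u. Im (of_real (1 / (cmod (of_real u - of_real w))\<^sup>2) * (1 / (of_real u - a))) \<partial>M)"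
    using a by (intro integral_nonneg_AE always_eventually allI) (simp only: Re_complex_of_real Im_complex_of_real times_complex.sel Im_inverse_diff, simp)
  then have k0: "0 \<le> Im k" unfolding k_def using int by simp
  have int': "complex_integrable M (\<lambda>u. of_real (1 / (cmod (of_real u - of_real w))\<^sup>2))"
    using mh.sqpot_eq_sqint(2)[OF w] by (rule integrable_of_real)
  have "of_real (sqint M (of_real w)) - mh.prodint a (of_real w) =
      (\<integral>u. of_real (1 / (cmod (of_real u - of_real w))\<^sup>2) - 1 / (of_real u - a) * (1 / (of_real u - of_real w)) \<partial>M)"
    unfolding sqint_def mh.prodint_def integral_complex_of_real[symmetric]
    by (rule Bochner_Integration.integral_diff[OF int' mh.prodint(1)[OF a' w], symmetric])
  also have "\<dots> = (\<integral>u. - (a - of_real w) * (of_real (1 / (cmod (of_real u - of_real w))\<^sup>2) * (1 / (of_real u - a))) \<partial>M)"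
  proof (rule integral_cong_AE)
    show "AE u in M. of_real (1 / (cmod (of_real u - of_real w))\<^sup>2) - 1 / (of_real u - a) * (1 / (of_real u - of_real w)) =
       - (a - of_real w) * (of_real (1 / (cmod (of_real u - of_real w))\<^sup>2) * (1 / (of_real u - a)))"
      using mh.sqpot_eq_sqint(1)[OF w]
    proof eventually_elim
      case (elim u)
      have "(cmod (of_real u - of_real w))\<^sup>2 = (u - w)\<^sup>2" by (metis of_real_diff norm_of_real power2_abs)
      then have e: "of_real (1 / (cmod (of_real u - of_real w))\<^sup>2) = 1 / (of_real u - of_real w :: complex)\<^sup>2"
        by simp
      have "of_real u - a \<noteq> 0" using a by auto
      moreover have "of_real u - (of_real w :: complex) \<noteq> 0" using elim by simp
      ultimately show ?case unfolding e by (simp add: divide_simps power2_eq_square)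
    qed
  qed measurable
  also have "\<dots> = - (a - of_real w) * k"
    unfolding k_def by (rule integral_mult_right_zero)
  finally show ?thesis using k0 by blast
qed

text \<open>At a zero \<open>w\<close> of \<open>F\<^sub>\<mu>\<close> the images under \<open>H s\<close> of nearly tangential approaches to \<open>w\<close> leave
  every cone, both for a simple and for a degenerate zero of \<open>H s - E\<close>.\<close>

lemma ac_density_singular:
  assumes s: "1 < s" and x: "of_real s * \<omega> s (of_real x) = of_real x"
  shows "ac_density (\<nu> s) x = \<infinity>"
proof (rule ac_density_eqI)
  fix a :: real assume a: "0 < a"
  let ?C = "{z. 0 < Im z \<and> \<bar>Re z - x\<bar> < a * Im z}"
  define w where "w = x / s"
  have w: "\<omega> s (of_real x) = of_real w" unfolding w_def by (rule singular_value(1)[OF s x])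
  have om: "adm s (of_real w)" "H s (of_real w) = of_real x"
    using omega_closed[OF s, of "of_real x"] w by simp_all
  have fw: "sqpot M (of_real w) < \<infinity>" "sqint M (of_real w) \<le> 1 / (s - 1)" using admD[OF om(1) s] by auto
  define c where "c = 1 / (1 + a)"
  have c: "0 < c" "c \<le> 1" unfolding c_def using a by auto
  have cone: "c * cmod (z - of_real x) \<le> Im z" if "z \<in> ?C" for z
  proof -
    have "cmod (z - of_real x) \<le> \<bar>Re z - x\<bar> + \<bar>Im z\<bar>" using cmod_le[of "z - of_real x"] by simp
    also have "\<dots> \<le> (1 + a) * Im z" using that by (simp add: algebra_simps)
    finally show ?thesis unfolding c_def using a by (simp add: field_simps)
  qed
  have "(\<omega> s \<longlongrightarrow> \<omega> s (of_real x)) (at (of_real x) within {z. 0 \<le> Im z})"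
    using omega_cont[OF s] by (auto simp: continuous_on_def)
  then have lim: "(\<omega> s \<longlongrightarrow> of_real w) (at (of_real x) within ?C)"
    unfolding w by (rule tendsto_within_subset) auto
  then have lim_v: "((\<lambda>z. cmod (\<omega> s z - of_real w)) \<longlongrightarrow> 0) (at (of_real x) within ?C)"
    by (intro tendsto_norm_zero LIM_zero)
  have "((\<lambda>z. z) \<longlongrightarrow> of_real x) (at (of_real x) within ?C)" by (rule tendsto_ident_at)
  then have "((\<lambda>z. (of_real s * \<omega> s z - z) / of_real (s - 1)) \<longlongrightarrow> (of_real s * of_real w - of_real x) / of_real (s - 1)) (at (of_real x) within ?C)"
    using s by (intro tendsto_intros lim) auto
  then have lim_z: "((\<lambda>z. cmod ((of_real s * \<omega> s z - z) / of_real (s - 1))) \<longlongrightarrow> 0) (at (of_real x) within ?C)"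
    using s unfolding w_def by (intro tendsto_norm_zero) auto
  show "((\<lambda>z. ereal (Im (stieltjes (\<nu> s) z) / pi)) \<longlongrightarrow> \<infinity>) (at (of_real x) within ?C)"
    unfolding tendsto_PInfty
  proof
    fix r :: real
    define K where "K = \<bar>r\<bar> * pi + 1"
    have K: "0 < K" unfolding K_def by (simp add: add_nonneg_pos)
    \<comment> \<open>The factor is the square of \<open>2 s / (s - 1)\<close>, the constant with
      which \<open>|\<zeta>|\<close> is bounded by \<open>|v|\<close> below.\<close>
    define K' where "K' = K * (2 * s / (s - 1))\<^sup>2"
    have K': "0 < K'" unfolding K'_def using K s by simp
    \<comment> \<open>Half of the derivative of \<open>H s\<close> at \<open>w\<close>;
      \<open>c1 = 0\<close> is the degenerate case.\<close>
    define c1 where "c1 = (1 - (s - 1) * sqint M (of_real w)) / 2"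
    have c1: "0 \<le> c1" unfolding c1_def using fw(2) s by (simp add: field_simps)
    define e1 where "e1 = (if c1 = 0 then 1 else c1 / ((K' / c)))"
    have e1: "0 < e1" unfolding e1_def using c1 K' c by auto
    have "\<forall>\<^sub>F z in at (of_real x) within ?C. cmod (\<omega> s z - of_real w) < min e1 (min (1 / (2 * K')) (c / (2 * K')))"
      using order_tendstoD(2)[OF lim_v, of "min e1 (min (1 / (2 * K')) (c / (2 * K')))"] K' c e1 by auto
    moreover have "\<forall>\<^sub>F z in at (of_real x) within ?C. cmod ((of_real s * \<omega> s z - z) / of_real (s - 1)) < c * (s - 1) / (2 * K)"
      using order_tendstoD(2)[OF lim_z, of "c * (s - 1) / (2 * K)"] K c s by auto
    moreover have "\<forall>\<^sub>F z in at (of_real x) within ?C. z \<in> ?C"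
      unfolding eventually_at by (rule exI[of _ 1]) auto
    ultimately show "\<forall>\<^sub>F z in at (of_real x) within ?C. ereal r < ereal (Im (stieltjes (\<nu> s) z) / pi)"
    proof eventually_elim
      case (elim z)
      define v where "v = \<omega> s z - of_real w"
      define \<zeta> where "\<zeta> = (of_real s * \<omega> s z - z) / of_real (s - 1)"
      have Iz: "0 < Im z" using elim(3) by simp
      note st = stieltjes_nu[OF s Iz]
      have zeta: "- 1 / stieltjes (\<nu> s) z = \<zeta>" "\<zeta> = \<omega> s z + stieltjes M (\<omega> s z)"
        using st(2,3) s unfolding \<zeta>_def by (simp_all add: field_simps)
      have z0: "\<zeta> \<noteq> 0" using zeta st(4) by auto
      have "stieltjes (\<nu> s) z = - 1 / \<zeta>" using zeta(1) st(4) z0 by (auto simp: field_simps)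
      then have Im_m: "Im (stieltjes (\<nu> s) z) = Im \<zeta> / (cmod \<zeta>)\<^sup>2" by (simp only: Im_neg_recip)
      note u = omega_upper[OF s Iz]
      have Iw: "0 < Im (\<omega> s z)" using u(1) Iz by simp
      note fo = mh.sqpot_finite_upper[OF Iw]
      have "0 \<le> Im (stieltjes M (\<omega> s z))" using Iw unfolding mh.Im_stieltjes[OF fo] by simp
      then have Iv: "Im v \<le> Im \<zeta>" unfolding v_def zeta(2) by simp
      have Izv: "Im z \<le> Im v" unfolding v_def using u(1) by simp
      have v0: "v \<noteq> 0" using Izv Iz by auto
      have rel: "of_real s * v = of_real (s - 1) * \<zeta> + (z - of_real x)"
        unfolding v_def \<zeta>_def w_def using s by (simp add: field_simps)
      \<comment> \<open>Otherwise \<open>Im \<zeta> < K |\<zeta>|^2\<close>, where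
        \<open>\<zeta>\<close> is F at \<open>\<omega> s z\<close>. Since
        \<open>Im z \<le> Im v \<le> Im \<zeta>\<close>, the cone then makes \<open>z - x\<close>
        quadratically small in \<open>\<zeta>\<close>, hence in \<open>v\<close>. Both cases below
        contradict this through the size or the direction of \<open>H s\<close>.\<close>
      have "K \<le> Im (stieltjes (\<nu> s) z)"
      proof (rule ccontr)
        assume "\<not> ?thesis"
        then have small: "Im \<zeta> < K * (cmod \<zeta>)\<^sup>2" using Im_m z0 by (simp add: not_le pos_divide_less_eq)
        have zx: "c * cmod (z - of_real x) \<le> K * (cmod \<zeta>)\<^sup>2"
          using cone[OF elim(3)] Izv Iv small by simp
        have ze: "cmod \<zeta> < c * (s - 1) / (2 * K)" using elim(2) unfolding \<zeta>_def .
        have "c * cmod (z - of_real x) \<le> K * cmod \<zeta> * cmod \<zeta>" using zx by (simp add: power2_eq_square mult.assoc)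
        also have "\<dots> \<le> K * (c * (s - 1) / (2 * K)) * cmod \<zeta>"
          using ze K by (intro mult_right_mono mult_left_mono) auto
        also have "\<dots> = c * ((s - 1) / 2 * cmod \<zeta>)" using K by simp
        finally have "cmod (z - of_real x) \<le> (s - 1) / 2 * cmod \<zeta>" using c by simp
        moreover have "(s - 1) * cmod \<zeta> \<le> s * cmod v + cmod (z - of_real x)"
        proof -
          have "of_real (s - 1) * \<zeta> = of_real s * v - (z - of_real x)" using rel by simp
          then have "cmod (of_real (s - 1) * \<zeta>) \<le> cmod (of_real s * v) + cmod (z - of_real x)"
            by (metis norm_triangle_ineq4)
          then show ?thesis using s by (simp add: norm_mult del: of_real_diff)
        qed
        ultimately have "(s - 1) * cmod \<zeta> \<le> 2 * s * cmod v" by simp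
        then have "cmod \<zeta> \<le> 2 * s / (s - 1) * cmod v" using s by (simp add: field_simps)
        then have zv2: "K * (cmod \<zeta>)\<^sup>2 \<le> K' * (cmod v)\<^sup>2"
          unfolding K'_def mult.assoc power_mult_distrib[symmetric] using K by (intro mult_left_mono power_mono) auto
        have Imv: "Im v \<le> K' * (cmod v)\<^sup>2" using Iv small zv2 by simp
        have zxv: "c * cmod (z - of_real x) \<le> K' * (cmod v)\<^sup>2" using zx zv2 by simp
        have vs: "cmod v < e1" "cmod v < 1 / (2 * K')" "cmod v < c / (2 * K')"
          using elim(1) unfolding v_def by auto
        have HH: "z - of_real x = v * (1 - of_real (s - 1) * mh.prodint (\<omega> s z) (of_real w))"
          using H_diff[OF fo fw(1), of s] u(2) om(2) unfolding v_def by simp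
        show False
        proof (cases "c1 = 0")
          \<comment> \<open>A nonzero derivative makes \<open>|z - x|\<close> at least
            \<open>c1 |v|\<close>, too large for a quadratic bound.\<close>
          case False
          have "cmod (of_real (s - 1) * mh.prodint (\<omega> s z) (of_real w)) = (s - 1) * cmod (mh.prodint (\<omega> s z) (of_real w))"
            using s by (simp add: norm_mult del: of_real_diff)
          also have "\<dots> \<le> (s - 1) * ((1 / (s - 1) + sqint M (of_real w)) / 2)"
            using mh.prodint(2)[OF fo fw(1)] u(3) s by (intro mult_left_mono) auto
          also have "\<dots> = 1 - c1" unfolding c1_def using s by (simp add: field_simps)
          finally have "c1 \<le> cmod (1 - of_real (s - 1) * mh.prodint (\<omega> s z) (of_real w))"
            using norm_triangle_ineq2[of 1 "of_real (s - 1) * mh.prodint (\<omega> s z) (of_real w)"] by simp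
          then have "cmod v * c1 \<le> cmod (z - of_real x)" unfolding HH norm_mult by (intro mult_left_mono) auto
          then have "c * (cmod v * c1) \<le> c * cmod (z - of_real x)" using c by (intro mult_left_mono) auto
          also note zxv
          finally have "c * c1 \<le> K' * cmod v" using v0 by (simp add: power2_eq_square)
          then have "e1 \<le> cmod v" unfolding e1_def using False K' c by (simp add: field_simps)
          then show False using vs(1) by simp
        next
          \<comment> \<open>Here \<open>z - x = - (s - 1) v^2 k\<close> with
            \<open>0 \<le> Im k\<close>. As \<open>v\<close> is nearly horizontal,
            \<open>v^2\<close> is nearly a positive real, so \<open>Im z\<close> is at most
            \<open>2 K' |v| |z - x|\<close>; for small \<open>v\<close> such a point lies outside
            the cone.\<close>
          case True
          then have crit: "(s - 1) * sqint M (of_real w) = 1" unfolding c1_def by simp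
          obtain k where k: "of_real (sqint M (of_real w)) - mh.prodint (\<omega> s z) (of_real w) = - v * k" "0 \<le> Im k"
            using critical_kernel[OF fw(1) Iw] unfolding v_def by blast
          have "1 - of_real (s - 1) * mh.prodint (\<omega> s z) (of_real w) =
              of_real ((s - 1) * sqint M (of_real w)) - of_real (s - 1) * mh.prodint (\<omega> s z) (of_real w)"
            unfolding crit by simp
          also have "\<dots> = of_real (s - 1) * (of_real (sqint M (of_real w)) - mh.prodint (\<omega> s z) (of_real w))"
            by (simp only: of_real_mult right_diff_distrib)
          finally have "z - of_real x = v * (of_real (s - 1) * (- v * k))"
            unfolding HH k(1) by (rule arg_cong)
          then have zk: "z - of_real x = of_real (- (s - 1)) * (v\<^sup>2 * k)"
            by (simp add: power2_eq_square algebra_simps)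
          have "Im v \<le> K' * cmod v * cmod v" using Imv by (simp add: power2_eq_square)
          also have "\<dots> \<le> 1 / 2 * cmod v"
            using vs(2) K' by (intro mult_right_mono) (auto simp: field_simps)
          finally have "Im v \<le> cmod v / 2" by simp
          then have "(Im v)\<^sup>2 \<le> (cmod v / 2)\<^sup>2" using Izv Iz by (intro power_mono) auto
          then have "3 * (Im v * Im v) \<le> Re v * Re v" unfolding power_divide cmod_power2 by (simp add: power2_eq_square)
          moreover have "0 \<le> Im v * Im v" by simp
          ultimately have "Im v * Im v \<le> Re v * Re v" by linarith
          then have Rv: "0 \<le> Re (v\<^sup>2)" by (simp add: power2_eq_square)
          have "Im z = - (s - 1) * (Re (v\<^sup>2) * Im k + Im (v\<^sup>2) * Re k)"
            using arg_cong[OF zk, of Im] by (simp add: algebra_simps)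
          moreover have "0 \<le> (s - 1) * (Re (v\<^sup>2) * Im k)"
            using s Rv k(2) by (intro mult_nonneg_nonneg) auto
          ultimately have "Im z \<le> (s - 1) * (- (Im (v\<^sup>2) * Re k))"
            by (simp add: algebra_simps)
          also have "\<dots> \<le> (s - 1) * (\<bar>Im (v\<^sup>2)\<bar> * cmod k)"
          proof (intro mult_left_mono)
            have "- (Im (v\<^sup>2) * Re k) \<le> \<bar>Im (v\<^sup>2)\<bar> * \<bar>Re k\<bar>" unfolding abs_mult[symmetric] by linarith
            also have "\<dots> \<le> \<bar>Im (v\<^sup>2)\<bar> * cmod k" by (intro mult_left_mono abs_Re_le_cmod) auto
            finally show "- (Im (v\<^sup>2) * Re k) \<le> \<bar>Im (v\<^sup>2)\<bar> * cmod k" .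
          qed (use s in auto)
          also have "\<bar>Im (v\<^sup>2)\<bar> = 2 * \<bar>Re v\<bar> * \<bar>Im v\<bar>" by (simp add: power2_eq_square abs_mult)
          also have "(s - 1) * (2 * \<bar>Re v\<bar> * \<bar>Im v\<bar> * cmod k) \<le> (s - 1) * (2 * cmod v * (K' * (cmod v)\<^sup>2) * cmod k)"
            using Imv Izv Iz s by (intro mult_left_mono mult_right_mono mult_mono abs_Re_le_cmod) auto
          also have "\<dots> = 2 * K' * cmod v * cmod (z - of_real x)"
            unfolding zk norm_mult norm_of_real norm_power using s by (simp add: mult_ac)
          finally have "c * cmod (z - of_real x) \<le> 2 * K' * cmod v * cmod (z - of_real x)"
            using cone[OF elim(3)] by simp
          moreover have "0 < cmod (z - of_real x)" using Iz by (auto simp: complex_eq_iff)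
          ultimately have "c \<le> 2 * K' * cmod v" by simp
          then show False using vs(3) K' by (simp add: field_simps)
        qed
      qed
      then have "K / pi \<le> Im (stieltjes (\<nu> s) z) / pi" by (intro divide_right_mono) auto
      moreover have "r < K / pi"
      proof -
        have "r * pi \<le> \<bar>r\<bar> * pi" by (intro mult_right_mono) auto
        then have "r * pi < K" unfolding K_def by linarith
        then show ?thesis by (simp add: field_simps)
      qed
      ultimately show ?case by simp
    qed
  qed
qed

text \<open>Finiteness in the definition of the edge set matters at singular points: there the
  density is infinite while \<open>\<omega> s x\<close> is real.\<close>

lemma positive_density_iff:
  assumes s: "1 < s"
  shows "0 < ac_density (\<nu> s) x \<and> ac_density (\<nu> s) x < \<infinity> \<longleftrightarrow> 0 < Im (\<omega> s (of_real x))"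
proof (cases "of_real s * \<omega> s (of_real x) = of_real x")
  case True
  then show ?thesis using ac_density_singular[OF s True] singular_value(1)[OF s True]
    by (simp flip: of_real_divide)
next
  case False
  show ?thesis
    unfolding ac_density_regular[OF s False] using bdry_real(2,3)[OF s False]
    by (simp add: zero_less_divide_iff flip: zero_ereal_def)
qed

section \<open>Edges and the absolutely continuous support in terms of
  \<open>\<omega>\<close>\<close>

lemma edge_set_eq: "1 < s \<Longrightarrow> edge_set (\<nu> s) = frontier {x. 0 < Im (\<omega> s (of_real x))}"
  unfolding edge_set_def by (simp only: positive_density_iff)

lemma open_positive: "1 < s \<Longrightarrow> open {x. 0 < Im (\<omega> s (of_real x))}"
  by (intro open_Collect_less continuous_intros continuous_on_compose2[OF omega_cont]) auto

lemma edge_set_iff: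
  assumes s: "1 < s"
  shows "E \<in> edge_set (\<nu> s) \<longleftrightarrow> Im (\<omega> s (of_real E)) = 0 \<and> (\<forall>e>0. \<exists>x. \<bar>x - E\<bar> < e \<and> 0 < Im (\<omega> s (of_real x)))"
proof -
  have "E \<in> edge_set (\<nu> s) \<longleftrightarrow> E \<in> closure {x. 0 < Im (\<omega> s (of_real x))} \<and> \<not> 0 < Im (\<omega> s (of_real E))"
    unfolding edge_set_eq[OF s] frontier_def interior_open[OF open_positive[OF s]] by auto
  then show ?thesis
    unfolding closure_approachable dist_real_def using omega_Im[OF s, of "of_real E"] by force
qed

text \<open>Near such \<open>x\<close> the function \<open>bdry s\<close> is bounded, which gives
  the Lipschitz bound on intervals. Positive mass is necessary because otherwise the imaginary part
  of the transform would tend to 0 above \<open>x\<close>, contrary to its boundary value.\<close>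

lemma msupp_positive:
  assumes s: "1 < s" and x: "0 < Im (\<omega> s (of_real x))"
  shows "x \<in> msupp (ac_part (\<nu> s))"
proof -
  interpret n: finite_borel_measure "\<nu> s" using nu_fbm s by simp
  have ns: "of_real s * \<omega> s (of_real x) \<noteq> of_real x"
    using singular_value(1)[OF s, of x] x by (auto simp flip: of_real_divide)
  obtain r where r: "0 < r" "\<And>z. 0 \<le> Im z \<Longrightarrow> cmod (z - of_real x) \<le> r \<Longrightarrow> z \<noteq> of_real s * \<omega> s z"
    using bdry_nbhd[OF s ns] by blast
  let ?K = "{z. 0 \<le> Im z \<and> cmod (z - of_real x) \<le> r}"
  have cont: "continuous_on ?K (bdry s)"
    by (rule continuous_on_subset[OF bdry_cont[OF s]]) (use r in auto)
  have "?K = cball (of_real x) r \<inter> {z. 0 \<le> Im z}" by (auto simp: dist_norm norm_minus_commute)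
  then have "compact ?K" using compact_Int_closed[OF compact_cball closed_halfspace_Im_ge] by simp
  then have "bounded (bdry s ` ?K)" using compact_continuous_image[OF cont] compact_imp_bounded by blast
  then obtain C where C: "\<And>z. z \<in> ?K \<Longrightarrow> cmod (bdry s z) \<le> C" unfolding bounded_iff by auto
  have C0: "0 \<le> C" using r by (intro order_trans[OF norm_ge_zero C[of "of_real x"]]) auto
  show ?thesis
  proof (rule n.in_msupp_ac_part[of "C + 1" "r / 2"])
    show "measure (\<nu> s) {c..d} \<le> (C + 1) * (d - c)" if "x - r / 2 \<le> c" "c \<le> d" "d \<le> x + r / 2" for c d
    proof (rule n.boundary_interval_bound[OF cont r(1) _ _ _ that])
      show "stieltjes (\<nu> s) z = bdry s z" if "0 < Im z" "cmod (z - of_real x) \<le> r" for z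
        unfolding bdry_def by (rule stieltjes_nu(1)[OF s that(1)])
      show "Im (bdry s (of_real y)) \<le> C" if "\<bar>y - x\<bar> \<le> r" for y
      proof -
        have "cmod (of_real y - of_real x) = \<bar>y - x\<bar>" by (metis norm_of_real of_real_diff)
        then have "cmod (bdry s (of_real y)) \<le> C" using that by (intro C) simp
        then show ?thesis using abs_Im_le_cmod[of "bdry s (of_real y)"] by linarith
      qed
    qed simp
    fix U :: "real set" assume U: "open U" "x \<in> U"
    show "0 < emeasure (\<nu> s) U"
    proof (rule ccontr)
      assume "\<not> ?thesis"
      then have null: "U \<in> null_sets (\<nu> s)" using U(1) by (auto simp: null_sets_def n.M_is_borel)
      obtain e where e: "0 < e" "ball x e \<subseteq> U" using U openE by blast
      have AE: "AE u in \<nu> s. u \<notin> U" using null by (rule AE_not_in)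
      define h where "h n = inverse (real (Suc n))" for n
      have hl: "h \<longlonglongrightarrow> 0" unfolding h_def by (rule LIMSEQ_inverse_real_of_nat)
      have hp: "0 < h n" for n unfolding h_def by simp
      let ?z = "\<lambda>n. of_real x + \<i> * of_real (h n)"
      have zl: "?z \<longlonglongrightarrow> of_real x + \<i> * of_real 0" by (intro tendsto_intros hl)
      have "((\<lambda>n. bdry s (?z n)) \<longlonglongrightarrow> bdry s (of_real x))"
      proof (rule continuous_on_tendsto_compose[OF bdry_cont[OF s]])
        show "\<forall>\<^sub>F n in sequentially. ?z n \<in> {z. 0 \<le> Im z \<and> z \<noteq> of_real s * \<omega> s z}"
          using stieltjes_nu(5)[OF s, of "?z _"] hp by (intro always_eventually) (auto intro: less_imp_le)
      qed (use zl ns in auto)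
      then have "(\<lambda>n. Im (stieltjes (\<nu> s) (?z n))) \<longlonglongrightarrow> Im (bdry s (of_real x))"
        using stieltjes_nu(1)[OF s, of "?z _"] hp unfolding bdry_def by (intro tendsto_Im) simp
      moreover have "(\<lambda>n. Im (stieltjes (\<nu> s) (?z n))) \<longlonglongrightarrow> 0"
      proof (rule Lim_null_comparison[of _ "\<lambda>n. h n * (measure (\<nu> s) (space (\<nu> s)) / e\<^sup>2)"])
        show "\<forall>\<^sub>F n in sequentially. norm (Im (stieltjes (\<nu> s) (?z n))) \<le> h n * (measure (\<nu> s) (space (\<nu> s)) / e\<^sup>2)"
        proof (rule always_eventually, rule allI)
          fix n
          have "AE u in \<nu> s. e \<le> cmod (of_real u - ?z n)"
            using AE
          proof eventually_elim
            case (elim u)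
            then have "e \<le> \<bar>u - x\<bar>" using e by (auto simp: dist_real_def subset_eq not_less abs_minus_commute)
            also have "\<dots> \<le> cmod (of_real u - ?z n)" using abs_Re_le_cmod[of "of_real u - ?z n"] by simp
            finally show ?case .
          qed
          note q = n.sqpot_finite_away[OF e(1) this]
          show "norm (Im (stieltjes (\<nu> s) (?z n))) \<le> h n * (measure (\<nu> s) (space (\<nu> s)) / e\<^sup>2)"
            unfolding n.Im_stieltjes[OF q(1)] using mult_left_mono[OF q(2), of "h n"] hp[of n] by (simp add: abs_mult)
        qed
        show "(\<lambda>n. h n * (measure (\<nu> s) (space (\<nu> s)) / e\<^sup>2)) \<longlonglongrightarrow> 0"
          by (rule tendsto_mult_left_zero[OF hl])
      qed
      ultimately have "Im (bdry s (of_real x)) = 0" by (rule LIMSEQ_unique)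
      then show False using bdry_real(3)[OF s ns] x by simp
    qed
  qed (use C0 r in auto)
qed

text \<open>The singular points \<open>S\<close> come from atoms of \<open>\<mu>\<close>, so they
  are countable, and they form a closed set. Off \<open>S\<close> the boundary values of the
  imaginary part vanish continuously, so \<open>\<nu> s\<close> has no mass there.\<close>

lemma msupp_zero:
  assumes s: "1 < s" and J: "open J" "x \<in> J" "\<And>y. y \<in> J \<Longrightarrow> Im (\<omega> s (of_real y)) = 0"
  shows "x \<notin> msupp (ac_part (\<nu> s))"
proof -
  interpret n: finite_borel_measure "\<nu> s" using nu_fbm s by simp
  define S where "S = {y. of_real s * \<omega> s (of_real y) = of_real y}"
  have "S \<subseteq> (\<lambda>w. s * w) ` {w. measure \<mu> {w} \<noteq> 0}"
  proof
    fix y assume "y \<in> S"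
    then have "y \<in> singular_points \<mu> s" using singular_value(2)[OF s] unfolding S_def by auto
    then show "y \<in> (\<lambda>w. s * w) ` {w. measure \<mu> {w} \<noteq> 0}"
      unfolding singular_points_def using s by (intro image_eqI[of _ _ "y / s"]) auto
  qed
  moreover have "countable {w. measure \<mu> {w} \<noteq> 0}" by (rule mu.countable_support)
  ultimately have Sc: "countable S" by (meson countable_image countable_subset)
  have "closed S"
    unfolding S_def by (intro closed_Collect_eq continuous_intros continuous_on_compose2[OF omega_cont[OF s]]) auto
  then have op: "open (J - S)" using J(1) by (intro open_Diff)
  have "emeasure (\<nu> s) (J - S) = 0"
  proof (rule n.emeasure_open_null[OF op])
    fix y assume y: "y \<in> J - S"
    then have ns: "of_real s * \<omega> s (of_real y) \<noteq> of_real y" unfolding S_def by auto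
    obtain r0 where r0: "0 < r0" "\<And>z. 0 \<le> Im z \<Longrightarrow> cmod (z - of_real y) \<le> r0 \<Longrightarrow> z \<noteq> of_real s * \<omega> s z"
      using bdry_nbhd[OF s ns] by blast
    obtain r1 where r1: "0 < r1" "cball y r1 \<subseteq> J - S" using op y open_contains_cball by metis
    define r where "r = min r0 r1"
    have r: "0 < r" "r \<le> r0" "r \<le> r1" unfolding r_def using r0 r1 by auto
    have cont: "continuous_on {z. 0 \<le> Im z \<and> cmod (z - of_real y) \<le> r} (bdry s)"
      by (rule continuous_on_subset[OF bdry_cont[OF s]]) (use r0 r in auto)
    have "measure (\<nu> s) {y - r / 2..y + r / 2} \<le> (0 + e) * ((y + r / 2) - (y - r / 2))" if e: "0 < e" for e
    proof (rule n.boundary_interval_bound[OF cont r(1) _ _ e])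
      show "stieltjes (\<nu> s) z = bdry s z" if "0 < Im z" "cmod (z - of_real y) \<le> r" for z
        unfolding bdry_def by (rule stieltjes_nu(1)[OF s that(1)])
      show "Im (bdry s (of_real y')) \<le> 0" if "\<bar>y' - y\<bar> \<le> r" for y'
      proof -
        have "y' \<in> cball y r1" using that r by (auto simp: dist_real_def abs_minus_commute)
        then have "y' \<in> J" "y' \<notin> S" using r1 by auto
        then show ?thesis using bdry_real(3)[OF s, of y'] J(3)[of y'] unfolding S_def by (auto simp: not_less)
      qed
    qed (use r in auto)
    then have b: "measure (\<nu> s) {y - r / 2..y + r / 2} \<le> e * r" if "0 < e" for e using that by simp
    have "measure (\<nu> s) {y - r / 2..y + r / 2} \<le> 0"
    proof (rule field_le_epsilon)
      fix e :: real assume "0 < e"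
      then show "measure (\<nu> s) {y - r / 2..y + r / 2} \<le> 0 + e" using b[of "e / r"] r by simp
    qed
    then have "measure (\<nu> s) {y - r / 2<..<y + r / 2} = 0"
      using n.finite_measure_mono[of "{y - r / 2<..<y + r / 2}" "{y - r / 2..y + r / 2}"] measure_nonneg[of "\<nu> s"]
      by (smt (verit, best) borel_closed closed_atLeastAtMost greaterThanLessThan_subseteq_atLeastAtMost_iff n.sets_M)
    then show "\<exists>V. open V \<and> y \<in> V \<and> emeasure (\<nu> s) V = 0"
      using r by (intro exI[of _ "{y - r / 2<..<y + r / 2}"]) (auto simp: n.emeasure_eq_measure)
  qed
  then show ?thesis by (intro n.not_in_msupp_ac_part[OF J(1,2) Sc])
qed

end

section \<open>Regular points\<close>

text \<open>Positive distance of \<open>y\<close> from the support, phrased almost everywhere so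
  that it bounds integrands directly.\<close>

definition gap :: "real measure \<Rightarrow> real \<Rightarrow> bool" where
  "gap N y \<longleftrightarrow> (\<exists>r>0. AE u in N. r \<le> \<bar>u - y\<bar>)"

text \<open>\<open>e\<close> is the distance of the base point from the band edge carrying the
  exponent. For \<open>e = 0\<close> this is where \<open>\<beta> < 1\<close> enters; for
  \<open>e > 0\<close> the power is bounded below anyway.\<close>

lemma powr_shift_lower:
  fixes \<beta> e :: real
  assumes "\<beta> < 1" "0 \<le> e"
  shows "\<exists>c>0. \<forall>v. 0 < v \<and> v \<le> 1 \<longrightarrow> c * v \<le> (e + v) powr \<beta>"
proof (cases "e = 0")
  case True
  have "1 * v \<le> (e + v) powr \<beta>" if "0 < v \<and> v \<le> 1" for v
    using powr_mono'[of \<beta> 1 v] that assms True by simp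
  then show ?thesis by (intro exI[of _ 1]) auto
next
  case False
  define c where "c = min (e powr \<beta>) ((e + 1) powr \<beta>)"
  have c: "0 < c" using False assms unfolding c_def by auto
  have "c * v \<le> (e + v) powr \<beta>" if v: "0 < v \<and> v \<le> 1" for v
  proof -
    have "c * v \<le> c * 1" using v c by (intro mult_left_mono) auto
    also have "c * 1 \<le> (e + v) powr \<beta>"
    proof (cases "0 \<le> \<beta>")
      case True
      then have "e powr \<beta> \<le> (e + v) powr \<beta>" using v assms by (intro powr_mono2) auto
      then show ?thesis unfolding c_def by auto
    next
      case False
      then have "(e + 1) powr \<beta> \<le> (e + v) powr \<beta>"
        using v assms \<open>e \<noteq> 0\<close> by (intro powr_mono2') auto
      then show ?thesis unfolding c_def by auto
    qed
    finally show ?thesis .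
  qed
  then show ?thesis using c by blast
qed

lemma powr_between_lower:
  fixes \<beta> g h :: real
  assumes "0 < h" "2 * h \<le> g"
  shows "\<exists>c>0. \<forall>v. 0 < v \<and> v \<le> h \<longrightarrow> c \<le> (g - v) powr \<beta>"
proof -
  define c where "c = min (h powr \<beta>) (g powr \<beta>)"
  have c: "0 < c" using assms unfolding c_def by auto
  have "c \<le> (g - v) powr \<beta>" if v: "0 < v \<and> v \<le> h" for v
  proof (cases "0 \<le> \<beta>")
    case True
    then have "h powr \<beta> \<le> (g - v) powr \<beta>" using v assms by (intro powr_mono2) auto
    then show ?thesis unfolding c_def by auto
  next
    case False
    then have "g powr \<beta> \<le> (g - v) powr \<beta>"
      using v assms by (intro powr_mono2') auto
    then show ?thesis unfolding c_def by auto
  qed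
  then show ?thesis using c by blast
qed

lemma nn_integral_inverse_infinite:
  fixes y h \<sigma> :: real
  assumes h: "0 < h" and \<sigma>: "\<sigma> = 1 \<or> \<sigma> = -1"
  shows "(\<integral>\<^sup>+x\<in>{x. 0 < \<sigma> * (x - y) \<and> \<sigma> * (x - y) \<le> h}. ennreal (1 / (\<sigma> * (x - y))) \<partial>lborel) = \<infinity>"
proof -
  let ?S = "{x. 0 < \<sigma> * (x - y) \<and> \<sigma> * (x - y) \<le> h}"
  have "ennreal L \<le> (\<integral>\<^sup>+x\<in>?S. ennreal (1 / (\<sigma> * (x - y))) \<partial>lborel)" if L: "0 \<le> L" for L
  proof -
    \<comment> \<open>Chosen so that the integral of \<open>1 / v\<close> from \<open>e\<close> to
      \<open>h\<close> is exactly \<open>L\<close>.\<close>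
    define e where "e = h * exp (- L)"
    have e: "0 < e" "e \<le> h" using h L unfolding e_def by auto
    define a where "a = (if \<sigma> = 1 then y + e else y - h)"
    define b where "b = (if \<sigma> = 1 then y + h else y - e)"
    have ab: "a \<le> b" using e unfolding a_def b_def by auto
    have rng: "e \<le> \<sigma> * (x - y) \<and> \<sigma> * (x - y) \<le> h" if "a \<le> x" "x \<le> b" for x
      using that \<sigma> unfolding a_def b_def by (auto split: if_splits)
    have "(\<integral>\<^sup>+x. ennreal (1 / (\<sigma> * (x - y))) * indicator {a..b} x \<partial>lborel) =
        ennreal (\<sigma> * ln (\<sigma> * (b - y)) - \<sigma> * ln (\<sigma> * (a - y)))"
    proof (rule nn_integral_FTC_Icc[where F = "\<lambda>x. \<sigma> * ln (\<sigma> * (x - y))", OF _ _ _ ab])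
      show "(\<lambda>x. 1 / (\<sigma> * (x - y))) \<in> borel_measurable borel" by measurable
      fix x assume x: "x \<in> {a..b}"
      have p: "0 < \<sigma> * (x - y)" using rng[of x] x e by force
      show "((\<lambda>x. \<sigma> * ln (\<sigma> * (x - y))) has_real_derivative 1 / (\<sigma> * (x - y))) (at x)"
        using p \<sigma> by (auto intro!: derivative_eq_intros simp: field_simps)
      show "0 \<le> 1 / (\<sigma> * (x - y))" using p by simp
    qed
    also have "\<sigma> * ln (\<sigma> * (b - y)) - \<sigma> * ln (\<sigma> * (a - y)) = L"
    proof -
      have "ln e = ln h - L" unfolding e_def using h by (simp add: ln_mult)
      moreover have "\<sigma> * (b - y) = (if \<sigma> = 1 then h else e)" "\<sigma> * (a - y) = (if \<sigma> = 1 then e else h)"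
        using \<sigma> unfolding a_def b_def by auto
      ultimately show ?thesis using \<sigma> by auto
    qed
    finally have "ennreal L = (\<integral>\<^sup>+x. ennreal (1 / (\<sigma> * (x - y))) * indicator {a..b} x \<partial>lborel)" by simp
    also have "\<dots> \<le> (\<integral>\<^sup>+x\<in>?S. ennreal (1 / (\<sigma> * (x - y))) \<partial>lborel)"
    proof (intro nn_integral_mono mult_left_mono)
      fix x show "indicator {a..b} x \<le> (indicator ?S x :: ennreal)"
        using rng[of x] e by (auto simp: indicator_def)
    qed auto
    finally show ?thesis .
  qed
  note L = this
  show ?thesis
  proof (cases "\<integral>\<^sup>+x\<in>?S. ennreal (1 / (\<sigma> * (x - y))) \<partial>lborel")
    case (real r)
    then have "ennreal (r + 1) \<le> ennreal r" using L[of "r + 1"] by simp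
    then show ?thesis using real by (subst (asm) ennreal_le_iff) auto
  qed simp
qed

context free_semigroup
begin

text \<open>With N = \<open>sqint \<mu>\<close> at height \<open>\<eta>\<close>, the identity
  linking the two measures gives \<open>N \<le> c |m|^2\<close>. Splitting the integral for
  \<open>m\<close> at a small interval around \<open>y\<close>, whose mass is small because there is
  no atom, bounds \<open>|m|\<close> by a constant plus a small multiple of \<open>sqrt N\<close>.
  Absorbing that term bounds N uniformly in \<open>\<eta>\<close>, and Fatou reaches the
  axis.\<close>

lemma sqint_mu_bounded:
  assumes y: "sqpot M (of_real y) < \<infinity>" and at: "measure \<mu> {y} = 0"
  shows "sqpot \<mu> (of_real y) < \<infinity>"
proof -
  define c where "c = 1 + sqint M (of_real y)"
  have c: "1 \<le> c" unfolding c_def by simp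
  \<comment> \<open>Makes the coefficient \<open>sqrt c / \<kappa>\<close> of \<open>sqrt N\<close>
    equal to 1/4, so that it can be absorbed.\<close>
  define \<kappa> where "\<kappa> = 4 * sqrt c"
  have \<kappa>: "0 < \<kappa>" using c unfolding \<kappa>_def by simp
  have "(\<lambda>n. measure \<mu> {y - inverse (real (Suc n))..y + inverse (real (Suc n))}) \<longlonglongrightarrow>
      measure \<mu> (\<Inter>n. {y - inverse (real (Suc n))..y + inverse (real (Suc n))})"
  proof (rule mu.finite_Lim_measure_decseq)
    show "decseq (\<lambda>n. {y - inverse (real (Suc n))..y + inverse (real (Suc n))})"
    proof (rule decseq_SucI)
      fix n
      have "inverse (real (Suc (Suc n))) \<le> inverse (real (Suc n))" by (intro le_imp_inverse_le) auto
      then show "{y - inverse (real (Suc (Suc n)))..y + inverse (real (Suc (Suc n)))} \<subseteq> {y - inverse (real (Suc n))..y + inverse (real (Suc n))}"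
        by auto
    qed
  qed auto
  also have "(\<Inter>n. {y - inverse (real (Suc n))..y + inverse (real (Suc n))}) = {y}"
  proof
    show "(\<Inter>n. {y - inverse (real (Suc n))..y + inverse (real (Suc n))}) \<subseteq> {y}"
    proof
      fix x assume x: "x \<in> (\<Inter>n. {y - inverse (real (Suc n))..y + inverse (real (Suc n))})"
      have "\<bar>x - y\<bar> \<le> inverse (real (Suc n))" for n using x by (auto simp: abs_le_iff) (smt (verit))+
      then have "\<bar>x - y\<bar> \<le> 0"
        by (intro LIMSEQ_le_const[OF LIMSEQ_inverse_real_of_nat]) auto
      then show "x \<in> {y}" by simp
    qed
  qed auto
  finally have "(\<lambda>n. measure \<mu> {y - inverse (real (Suc n))..y + inverse (real (Suc n))}) \<longlonglongrightarrow> 0"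
    unfolding at .
  from order_tendstoD(2)[OF this, of "1 / (2 * \<kappa>\<^sup>2)"] \<kappa>
  have "\<forall>\<^sub>F n in sequentially. measure \<mu> {y - inverse (real (Suc n))..y + inverse (real (Suc n))} < 1 / (2 * \<kappa>\<^sup>2)"
    by simp
  then obtain n0 where n0: "measure \<mu> {y - inverse (real (Suc n0))..y + inverse (real (Suc n0))} < 1 / (2 * \<kappa>\<^sup>2)"
    unfolding eventually_sequentially by blast
  define d where "d = inverse (real (Suc n0))"
  have d: "0 < d" unfolding d_def by simp
  let ?B = "{y - d..y + d}"
  have mB: "measure \<mu> ?B \<le> 1 / (2 * \<kappa>\<^sup>2)" using n0 unfolding d_def by simp
  define B where "B = (2 * sqrt c / d)\<^sup>2"
  have bound: "sqint \<mu> (of_real y + \<i> * of_real \<eta>) \<le> B" if h: "0 < \<eta>" for \<eta>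
  proof -
    let ?z = "of_real y + \<i> * of_real \<eta>"
    have Iz: "0 < Im ?z" using h by simp
    note fz = mu.sqpot_finite_upper[OF Iz]
    define N where "N = sqint \<mu> ?z"
    have N: "0 < N" unfolding N_def using mu.sqint_pos[OF fz mu_space] .
    \<comment> \<open>The weight in \<open>1 / v \<le> l / 2 + 1 / (2 l v^2)\<close>, used inside
      the small interval; this choice makes both terms multiples of \<open>sqrt N\<close>.\<close>
    define l where "l = sqrt N * \<kappa>"
    have l: "0 < l" using N \<kappa> unfolding l_def by simp
    have int: "integrable \<mu> (\<lambda>u. 1 / d + l / 2 * indicator ?B u + 1 / (2 * l) * (1 / (cmod (of_real u - ?z))\<^sup>2))"
      using mu.sqpot_eq_sqint(2)[OF fz]
      by (intro Bochner_Integration.integrable_add integrable_mult_right integrable_real_indicator mu.integrable_const) (auto simp: less_top[symmetric])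
    have pw: "cmod (1 / (of_real u - ?z)) \<le> 1 / d + l / 2 * indicator ?B u + 1 / (2 * l) * (1 / (cmod (of_real u - ?z))\<^sup>2)" for u
    proof (cases "u \<in> ?B")
      case True
      have "0 \<le> (l - 1 / cmod (of_real u - ?z))\<^sup>2" by simp
      then have "2 * l * (1 / cmod (of_real u - ?z)) \<le> l\<^sup>2 + (1 / cmod (of_real u - ?z))\<^sup>2"
        by (simp add: power2_diff)
      then have "1 / cmod (of_real u - ?z) \<le> (l\<^sup>2 + (1 / cmod (of_real u - ?z))\<^sup>2) / (2 * l)"
        using l by (simp add: pos_le_divide_eq mult_ac)
      also have "\<dots> = l / 2 + 1 / (2 * l) * (1 / (cmod (of_real u - ?z))\<^sup>2)"
        using l by (simp add: add_divide_distrib power2_eq_square)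
      also have "\<dots> \<le> 1 / d + l / 2 * indicator ?B u + 1 / (2 * l) * (1 / (cmod (of_real u - ?z))\<^sup>2)"
        using True d by simp
      finally show ?thesis by (simp add: norm_divide)
    next
      case False
      then have "d \<le> \<bar>u - y\<bar>" by auto
      also have "\<dots> \<le> cmod (of_real u - ?z)" using abs_Re_le_cmod[of "of_real u - ?z"] by simp
      finally have "1 / cmod (of_real u - ?z) \<le> 1 / d" using d by (intro frac_le) auto
      also have "1 / d \<le> 1 / d + l / 2 * indicator ?B u + 1 / (2 * l) * (1 / (cmod (of_real u - ?z))\<^sup>2)"
        using l by simp
      finally show ?thesis by (simp add: norm_divide)
    qed
    have "cmod (stieltjes \<mu> ?z) \<le> (\<integral>u. 1 / d + l / 2 * indicator ?B u + 1 / (2 * l) * (1 / (cmod (of_real u - ?z))\<^sup>2) \<partial>\<mu>)"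
      unfolding stieltjes_def
      by (intro order_trans[OF integral_norm_bound] integral_mono integrable_norm mu.stieltjes_integrable[OF fz] int pw)
    also have "\<dots> = (1 / d + l / 2 * measure \<mu> ?B) + 1 / (2 * l) * N"
    proof -
      have i1: "integrable \<mu> (\<lambda>u. 1 / d + l / 2 * indicator ?B u)"
        by (intro Bochner_Integration.integrable_add integrable_mult_right integrable_real_indicator mu.integrable_const) (auto simp: less_top[symmetric])
      have i2: "integrable \<mu> (\<lambda>u. 1 / (2 * l) * (1 / (cmod (of_real u - ?z))\<^sup>2))"
        using mu.sqpot_eq_sqint(2)[OF fz] by (rule integrable_mult_right)
      have "(\<integral>u. 1 / (2 * l) * (1 / (cmod (of_real u - ?z))\<^sup>2) \<partial>\<mu>) = 1 / (2 * l) * N"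
        unfolding N_def sqint_def by (rule integral_mult_right_zero)
      moreover have "(\<integral>u. 1 / d + l / 2 * indicator ?B u \<partial>\<mu>) = 1 / d + l / 2 * measure \<mu> ?B"
        by (subst Bochner_Integration.integral_add)
           (auto simp: mu.prob_space[unfolded mu.space_eq_univ] less_top[symmetric] intro!: integrable_real_indicator)
      ultimately show ?thesis unfolding Bochner_Integration.integral_add[OF i1 i2] by simp
    qed
    also have "l / 2 * measure \<mu> ?B \<le> l / 2 * (1 / (2 * \<kappa>\<^sup>2))"
      using mB l by (intro mult_left_mono) auto
    also have "l / 2 * (1 / (2 * \<kappa>\<^sup>2)) = sqrt N / (4 * \<kappa>)" unfolding l_def using \<kappa> by (simp add: power2_eq_square)
    also have "1 / (2 * l) * N = sqrt N / (2 * \<kappa>)"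
      unfolding l_def using N \<kappa> by (simp add: divide_simps)
    finally have "cmod (stieltjes \<mu> ?z) \<le> 1 / d + sqrt N / (4 * \<kappa>) + sqrt N / (2 * \<kappa>)" by simp
    also have "\<dots> \<le> 1 / d + sqrt N / \<kappa>" using N \<kappa> by (simp add: field_simps)
    finally have m: "cmod (stieltjes \<mu> ?z) \<le> 1 / d + sqrt N / \<kappa>" .
    have "N = (1 + sqint M ?z) * (cmod (stieltjes \<mu> ?z))\<^sup>2" unfolding N_def by (rule sqint_mu_eq[OF Iz])
    also have "\<dots> \<le> c * (cmod (stieltjes \<mu> ?z))\<^sup>2"
      using mh.sqint_shift_le[of "of_real y" \<eta>] y h unfolding c_def by (intro mult_right_mono) auto
    finally have "sqrt N \<le> sqrt (c * (cmod (stieltjes \<mu> ?z))\<^sup>2)" by simp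
    also have "\<dots> = sqrt c * cmod (stieltjes \<mu> ?z)" by (simp add: real_sqrt_mult)
    also have "\<dots> \<le> sqrt c * (1 / d + sqrt N / \<kappa>)" using m c by (intro mult_left_mono) auto
    also have "\<dots> = sqrt c / d + sqrt N / 4" unfolding \<kappa>_def using c by (simp add: field_simps)
    finally have "sqrt N \<le> 4 / 3 * (sqrt c / d)" by simp
    also have "\<dots> \<le> 2 * sqrt c / d" using c d by (simp add: field_simps)
    finally have "(sqrt N)\<^sup>2 \<le> (2 * sqrt c / d)\<^sup>2" using N by (intro power_mono) auto
    then show ?thesis unfolding B_def N_def using N N_def by simp
  qed
  have "(\<lambda>n. of_real y + \<i> * of_real (inverse (real (Suc n)))) \<longlonglongrightarrow> of_real y + \<i> * of_real 0"
    by (intro tendsto_intros LIMSEQ_inverse_real_of_nat)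
  then have "sqpot \<mu> (of_real y + \<i> * of_real 0) \<le> ennreal B"
  proof (rule mu.sqpot_lsc[OF _ _ tendsto_const])
    fix n
    show "sqpot \<mu> (of_real y + \<i> * of_real (inverse (real (Suc n)))) \<le> ennreal B"
      using bound[of "inverse (real (Suc n))"] mu.sqpot_finite_upper[of "of_real y + \<i> * of_real (inverse (real (Suc n)))"]
      by (subst mu.sqpot_le_iff) (auto simp: B_def)
  qed
  from mu.sqpot_leD(1)[OF this] show ?thesis by simp
qed

text \<open>If \<open>\<mu>\<close> has at most an atom near \<open>y\<close>, its transform there
  is explicit enough to compare \<open>sqint \<mu>\<close> with \<open>|stieltjes \<mu>|^2\<close>;
  the ratio bounds \<open>sqint M\<close> on a half-disc. Then the imaginary part of the transform
  of \<open>M\<close> vanishes on approach to the axis, so \<open>M\<close> has no mass near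
  \<open>y\<close>.\<close>

lemma gap_of_isolated:
  assumes y: "sqpot M (of_real y) < \<infinity>" and r: "0 < r" and iso: "AE u in \<mu>. u = y \<or> r \<le> \<bar>u - y\<bar>"
  shows "gap M y"
proof -
  have away: "AE u in \<mu>. u = y \<or> r / 2 \<le> cmod (of_real u - z)" if "cmod (z - of_real y) \<le> r / 2" for z
    using iso
  proof eventually_elim
    case (elim u)
    have "\<bar>u - y\<bar> = cmod (of_real u - of_real y)" by (metis norm_of_real of_real_diff)
    also have "\<dots> \<le> cmod (of_real u - z) + cmod (z - of_real y)" by (metis norm_triangle_ineq diff_add_cancel add_diff_eq)
    finally show ?case using elim that by auto
  qed
  have "\<exists>B r'. 0 < r' \<and> (\<forall>z. 0 < Im z \<and> cmod (z - of_real y) \<le> r' \<longrightarrow> sqint M z \<le> B)"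
  proof (cases "measure \<mu> {y} = 0")
    case True
    then have "AE u in \<mu>. u \<noteq> y"
      by (intro AE_I[where N = "{y}"]) (auto simp: mu.emeasure_eq_measure)
    have away': "AE u in \<mu>. r / 2 \<le> cmod (of_real u - z)" if "cmod (z - of_real y) \<le> r / 2" for z
      using away[OF that] \<open>AE u in \<mu>. u \<noteq> y\<close> by eventually_elim auto
    have q: "sqpot \<mu> z < \<infinity>" "sqint \<mu> z \<le> 4 / r\<^sup>2" if "cmod (z - of_real y) \<le> r / 2" for z
      using mu.sqpot_finite_away[OF _ away'[OF that]] r by (auto simp: mu.prob_space[unfolded mu.space_eq_univ] power_divide)
    have lip: "cmod (stieltjes \<mu> z - stieltjes \<mu> (of_real y)) \<le> cmod (z - of_real y) * (4 / r\<^sup>2)"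
      if z: "cmod (z - of_real y) \<le> r / 2" for z
    proof -
      have y': "cmod (of_real y - of_real y :: complex) \<le> r / 2" using r by simp
      show ?thesis
        unfolding mu.prodint(3)[OF q(1)[OF z] q(1)[OF y']] norm_mult
        using mu.prodint(2)[OF q(1)[OF z] q(1)[OF y']] q(2)[OF z] q(2)[OF y'] by (intro mult_left_mono) auto
    qed
    have qy: "sqpot \<mu> (of_real y) < \<infinity>" using q(1)[of "of_real y"] r by simp
    \<comment> \<open>If \<open>m\<close> vanished at \<open>y\<close>, its Lipschitz bound and the
      identity for \<open>sqint \<mu>\<close> would force \<open>sqint \<mu>\<close> to vanish
      there, impossible for a probability measure. Finiteness of \<open>sqpot M\<close> at
      \<open>y\<close> enters here.\<close>
    have m0: "stieltjes \<mu> (of_real y) \<noteq> 0"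
    proof
      assume z0: "stieltjes \<mu> (of_real y) = 0"
      define h where "h n = r / 2 * inverse (real (Suc n))" for n
      have hl: "h \<longlonglongrightarrow> r / 2 * 0" unfolding h_def by (intro tendsto_intros LIMSEQ_inverse_real_of_nat)
      have h: "0 < h n" "h n \<le> r / 2" for n
        unfolding h_def using r by (auto simp: field_simps)
      let ?z = "\<lambda>n. of_real y + \<i> * of_real (h n)"
      define b where "b n = (1 + sqint M (of_real y)) * (h n * (4 / r\<^sup>2))\<^sup>2" for n
      have "b \<longlonglongrightarrow> (1 + sqint M (of_real y)) * ((r / 2 * 0) * (4 / r\<^sup>2))\<^sup>2"
        unfolding b_def by (intro tendsto_intros hl)
      then have bl: "b \<longlonglongrightarrow> 0" by simp
      have "?z \<longlonglongrightarrow> of_real y + \<i> * of_real (r / 2 * 0)" by (intro tendsto_intros hl)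
      then have zl: "?z \<longlonglongrightarrow> of_real y" by simp
      have sb: "sqpot \<mu> (?z n) \<le> ennreal (b n)" for n
      proof -
        have Iz: "0 < Im (?z n)" using h by simp
        have dz: "cmod (?z n - of_real y) = h n" using h(1)[of n] by (simp add: norm_mult)
        have "sqint \<mu> (?z n) = (1 + sqint M (?z n)) * (cmod (stieltjes \<mu> (?z n)))\<^sup>2" by (rule sqint_mu_eq[OF Iz])
        also have "\<dots> \<le> b n"
          unfolding b_def using lip[of "?z n"] dz h[of n] z0 mh.sqint_shift_le[of "of_real y" "h n"] y
          by (intro mult_mono power_mono) auto
        finally show ?thesis using mu.sqpot_le_iff[OF mu.sqpot_finite_upper[OF Iz], of "b n"] by (simp add: b_def)
      qed
      have "sqpot \<mu> (of_real y) \<le> ennreal 0" by (rule mu.sqpot_lsc[OF zl sb bl])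
      then have "sqint \<mu> (of_real y) \<le> 0" using mu.sqpot_leD(2) by blast
      then show False using mu.sqint_pos[OF qy mu_space] by simp
    qed
    define m where "m = cmod (stieltjes \<mu> (of_real y))"
    have m: "0 < m" using m0 unfolding m_def by simp
    define r' where "r' = min (r / 2) (m * r\<^sup>2 / 8)"
    have r': "0 < r'" using r m unfolding r'_def by simp
    have "sqint M z \<le> 4 / r\<^sup>2 / (m / 2)\<^sup>2" if z: "0 < Im z" "cmod (z - of_real y) \<le> r'" for z
    proof -
      have z2: "cmod (z - of_real y) \<le> r / 2" using z(2) unfolding r'_def by simp
      have "cmod (z - of_real y) * (4 / r\<^sup>2) \<le> (m * r\<^sup>2 / 8) * (4 / r\<^sup>2)"
        using z(2) unfolding r'_def by (intro mult_right_mono) auto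
      also have "\<dots> = m / 2" using r by simp
      finally have "cmod (stieltjes \<mu> z - stieltjes \<mu> (of_real y)) \<le> m / 2" using lip[OF z2] by simp
      then have mz: "m / 2 \<le> cmod (stieltjes \<mu> z)"
        using norm_triangle_ineq3[of "stieltjes \<mu> z" "stieltjes \<mu> (of_real y)"] unfolding m_def by linarith
      have "(1 + sqint M z) * (m / 2)\<^sup>2 \<le> (1 + sqint M z) * (cmod (stieltjes \<mu> z))\<^sup>2"
        using mz m by (intro mult_left_mono power_mono) auto
      also have "\<dots> \<le> 4 / r\<^sup>2" using q(2)[OF z2] unfolding sqint_mu_eq[OF z(1)] .
      finally have "1 + sqint M z \<le> 4 / r\<^sup>2 / (m / 2)\<^sup>2" using m by (subst pos_le_divide_eq) auto
      then show ?thesis by simp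
    qed
    then show ?thesis using r' by blast
  next
    \<comment> \<open>Near an atom of mass \<open>\<alpha>\<close>, with \<open>v\<close> the
      distance to it, \<open>|m|\<close> is at least \<open>\<alpha> / (2 v)\<close> and
      \<open>sqint \<mu>\<close> at most \<open>(\<alpha> + 1) / v^2\<close>: the powers of
      \<open>v\<close> cancel in the ratio.\<close>
    case False
    define \<alpha> where "\<alpha> = measure \<mu> {y}"
    have \<alpha>: "0 < \<alpha>" using False unfolding \<alpha>_def by (simp add: zero_less_measure_iff)
    define r' where "r' = min (r / 2) (\<alpha> * r / 4)"
    have r': "0 < r'" using r \<alpha> unfolding r'_def by simp
    have "sqint M z \<le> 4 * (\<alpha> + 1) / \<alpha>\<^sup>2" if z: "0 < Im z" "cmod (z - of_real y) \<le> r'" for z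
    proof -
      define v where "v = cmod (of_real y - z)"
      have v: "0 < v" "v \<le> r / 2" "v \<le> \<alpha> * r / 4"
        using z unfolding v_def r'_def by (auto simp: norm_minus_commute)
      have z2: "cmod (z - of_real y) \<le> r / 2" using v unfolding v_def by (simp add: norm_minus_commute)
      note fz = mu.sqpot_finite_upper[OF z(1)]
      have ii: "integrable \<mu> (\<lambda>u. indicator {y} u * c :: real)" "complex_integrable \<mu> (\<lambda>u. of_real (indicator {y} u) * c')" for c c'
        by (auto intro!: integrable_real_indicator integrable_mult_left integrable_of_real simp: less_top[symmetric])
      have ind: "(\<integral>u. indicator {y} u \<partial>\<mu>) = \<alpha>" unfolding \<alpha>_def by simp
      have "stieltjes \<mu> z - of_real \<alpha> * (1 / (of_real y - z)) =
          (\<integral>u. 1 / (of_real u - z) - of_real (indicator {y} u) * (1 / (of_real y - z)) \<partial>\<mu>)"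
        unfolding stieltjes_def
        by (subst Bochner_Integration.integral_diff[OF mu.stieltjes_integrable[OF fz] ii(2)])
           (simp only: integral_mult_left_zero integral_complex_of_real ind)
      then have "cmod (stieltjes \<mu> z - of_real \<alpha> * (1 / (of_real y - z))) \<le>
          (\<integral>u. cmod (1 / (of_real u - z) - of_real (indicator {y} u) * (1 / (of_real y - z))) \<partial>\<mu>)"
        by (simp only: integral_norm_bound)
      also have "\<dots> \<le> (\<integral>u. 2 / r \<partial>\<mu>)"
      proof (rule integral_mono_AE)
        show "integrable \<mu> (\<lambda>u. cmod (1 / (of_real u - z) - of_real (indicator {y} u) * (1 / (of_real y - z))))"
          by (intro integrable_norm Bochner_Integration.integrable_diff mu.stieltjes_integrable[OF fz] ii)
        show "AE u in \<mu>. cmod (1 / (of_real u - z) - of_real (indicator {y} u) * (1 / (of_real y - z))) \<le> 2 / r"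
          using away[OF z2]
        proof eventually_elim
          case (elim u)
          show ?case
          proof (cases "u = y")
            case False
            then have "1 / cmod (of_real u - z) \<le> 1 / (r / 2)" using elim r by (intro frac_le) auto
            then show ?thesis using False by (simp add: norm_divide)
          qed (use r in simp)
        qed
      qed simp
      also have "\<dots> = 2 / r" by (simp add: mu.prob_space[unfolded mu.space_eq_univ])
      finally have b1: "cmod (stieltjes \<mu> z - of_real \<alpha> * (1 / (of_real y - z))) \<le> 2 / r" .
      have "cmod (of_real \<alpha> * (1 / (of_real y - z))) = \<alpha> / v" unfolding v_def using \<alpha> by (simp add: norm_mult norm_divide)
      then have "\<alpha> / v - 2 / r \<le> cmod (stieltjes \<mu> z)"
        using b1 norm_triangle_ineq3[of "stieltjes \<mu> z" "of_real \<alpha> * (1 / (of_real y - z))"] by linarith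
      moreover have "2 / r \<le> \<alpha> / (2 * v)" using v r by (simp add: field_simps)
      moreover have "\<alpha> / v = \<alpha> / (2 * v) + \<alpha> / (2 * v)" by simp
      ultimately have mz: "\<alpha> / (2 * v) \<le> cmod (stieltjes \<mu> z)" by linarith
      have "sqint \<mu> z \<le> (\<integral>u. indicator {y} u * (1 / v\<^sup>2) + 4 / r\<^sup>2 \<partial>\<mu>)"
        unfolding sqint_def
      proof (rule integral_mono_AE[OF mu.sqpot_eq_sqint(2)[OF fz]])
        show "integrable \<mu> (\<lambda>u. indicator {y} u * (1 / v\<^sup>2) + 4 / r\<^sup>2)"
          by (intro Bochner_Integration.integrable_add ii mu.integrable_const)
        show "AE u in \<mu>. 1 / (cmod (of_real u - z))\<^sup>2 \<le> indicator {y} u * (1 / v\<^sup>2) + 4 / r\<^sup>2"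
          using away[OF z2]
        proof eventually_elim
          case (elim u)
          show ?case
          proof (cases "u = y")
            case False
            then have "1 / (cmod (of_real u - z))\<^sup>2 \<le> 1 / (r / 2)\<^sup>2" using elim r by (intro frac_le power_mono) auto
            then show ?thesis using False by (simp add: power_divide)
          qed (simp add: v_def)
        qed
      qed
      also have "\<dots> = \<alpha> * (1 / v\<^sup>2) + 4 / r\<^sup>2"
        by (subst Bochner_Integration.integral_add[OF ii(1) mu.integrable_const])
           (simp only: integral_mult_left_zero ind, simp add: mu.prob_space[unfolded mu.space_eq_univ])
      also have "4 / r\<^sup>2 \<le> 1 / v\<^sup>2"
      proof -
        have "v\<^sup>2 \<le> (r / 2)\<^sup>2" using v by (intro power_mono) auto
        then have "1 / (r / 2)\<^sup>2 \<le> 1 / v\<^sup>2" using v(1) r by (intro frac_le) auto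
        then show ?thesis by (simp add: power_divide)
      qed
      finally have N: "sqint \<mu> z \<le> (\<alpha> + 1) / v\<^sup>2" by (simp add: add_divide_distrib)
      have "(1 + sqint M z) * (\<alpha> / (2 * v))\<^sup>2 \<le> (1 + sqint M z) * (cmod (stieltjes \<mu> z))\<^sup>2"
        using mz \<alpha> v by (intro mult_left_mono power_mono) auto
      also have "\<dots> \<le> (\<alpha> + 1) / v\<^sup>2" using N unfolding sqint_mu_eq[OF z(1)] .
      finally have "1 + sqint M z \<le> (\<alpha> + 1) / v\<^sup>2 / (\<alpha> / (2 * v))\<^sup>2"
        using \<alpha> v by (subst pos_le_divide_eq) auto
      also have "\<dots> = 4 * (\<alpha> + 1) / \<alpha>\<^sup>2" using \<alpha> v by (simp add: power_divide power_mult_distrib)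
      finally show ?thesis by simp
    qed
    then show ?thesis using r' by blast
  qed
  then obtain B r' where r': "0 < r'" and B: "\<And>z. 0 < Im z \<Longrightarrow> cmod (z - of_real y) \<le> r' \<Longrightarrow> sqint M z \<le> B"
    by blast
  have B0: "0 \<le> B" using order_trans[OF mh.sqint_nonneg B[of "of_real y + \<i> * of_real r'"]] r'
    by (simp add: norm_mult)
  \<comment> \<open>At height \<open>h\<close> the imaginary part is at most \<open>h B\<close>,
    which is below any \<open>e\<close> for small \<open>h\<close>.\<close>
  have "measure M {y - r' / 2..y + r' / 2} \<le> e * ((y + r' / 2) - (y - r' / 2))" if e: "0 < e" for e
  proof (rule mh.measure_interval_le)
    show "0 < min (r' / 2) (e / (B + 1))" using r' e B0 by simp
    fix x h assume x: "x \<in> {y - r' / 2..y + r' / 2}" and h: "0 < h" "h < min (r' / 2) (e / (B + 1))"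
    have "cmod (Complex x h - of_real y) \<le> \<bar>x - y\<bar> + \<bar>h\<bar>" using cmod_le[of "Complex x h - of_real y"] by simp
    also have "\<bar>x - y\<bar> \<le> r' / 2" using x unfolding atLeastAtMost_iff by linarith
    finally have q: "sqint M (Complex x h) \<le> B" using h by (intro B) auto
    have "measure M {x - h..x + h} \<le> 2 * h * (h * sqint M (Complex x h))"
      using mh.measure_interval_le_Im_stieltjes[OF h(1), of x] mh.Im_stieltjes[OF mh.sqpot_finite_upper[of "Complex x h"]] h by simp
    also have "\<dots> \<le> 2 * h * (h * (B + 1))" using q h by (intro mult_left_mono) auto
    also have "\<dots> \<le> 2 * h * e" using h B0 by (intro mult_left_mono) (auto simp: field_simps)
    finally show "measure M {x - h..x + h} \<le> 2 * h * e" .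
  qed (use r' in auto)
  then have b: "measure M {y - r' / 2..y + r' / 2} \<le> e * r'" if "0 < e" for e using that by simp
  have "measure M {y - r' / 2..y + r' / 2} \<le> 0"
  proof (rule field_le_epsilon)
    fix e :: real assume "0 < e"
    then show "measure M {y - r' / 2..y + r' / 2} \<le> 0 + e" using b[of "e / r'"] r' by simp
  qed
  then have "measure M {y - r' / 2..y + r' / 2} = 0" using measure_nonneg[of M] by (meson antisym)
  then have "{y - r' / 2..y + r' / 2} \<in> null_sets M" by (auto simp: null_sets_def mh.emeasure_eq_measure)
  then have "AE u in M. u \<notin> {y - r' / 2..y + r' / 2}" by (rule AE_not_in)
  then have "AE u in M. r' / 2 \<le> \<bar>u - y\<bar>" unfolding atLeastAtMost_iff by eventually_elim linarith
  then show ?thesis unfolding gap_def using r' by (intro exI[of _ "r' / 2"]) auto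
qed

end

text \<open>\<open>\<sigma>\<close> is a side of \<open>y\<close> that stays inside the band: the
  right one unless \<open>y\<close> is the right end. Exponents below 1 leave a density at least
  linear in the distance to \<open>y\<close>, enough for a logarithmic divergence against
  \<open>1 / v^2\<close>.\<close>

lemma edge_power_lower:
  fixes a b y \<beta>m \<beta>p :: real
  assumes "a < b" "a \<le> y" "y \<le> b" "\<beta>m < 1" "\<beta>p < 1"
  shows "\<exists>\<sigma> h c. (\<sigma> = 1 \<or> \<sigma> = -1) \<and> 0 < h \<and> 0 < c \<and>
    (\<forall>x. 0 < \<sigma> * (x - y) \<and> \<sigma> * (x - y) \<le> h \<longrightarrow>
       a < x \<and> x < b \<and> c * (\<sigma> * (x - y)) \<le> (x - a) powr \<beta>m * (b - x) powr \<beta>p)"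
proof (cases "y = b")
  case False
  define h where "h = min 1 ((b - y) / 2)"
  have h: "0 < h" "2 * h \<le> b - y" "h \<le> 1" "h < b - y" using False assms unfolding h_def by (auto simp: min_def)
  obtain c1 where c1: "0 < c1" "\<And>v. 0 < v \<Longrightarrow> v \<le> 1 \<Longrightarrow> c1 * v \<le> ((y - a) + v) powr \<beta>m"
    using powr_shift_lower[OF assms(4), of "y - a"] assms by auto
  obtain c2 where c2: "0 < c2" "\<And>v. 0 < v \<Longrightarrow> v \<le> h \<Longrightarrow> c2 \<le> ((b - y) - v) powr \<beta>p"
    using powr_between_lower[OF h(1,2), of \<beta>p] by auto
  have "c1 * c2 * (1 * (x - y)) \<le> (x - a) powr \<beta>m * (b - x) powr \<beta>p" if "0 < 1 * (x - y)" "1 * (x - y) \<le> h" for x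
  proof -
    have "c1 * (x - y) * c2 \<le> (x - a) powr \<beta>m * (b - x) powr \<beta>p"
      using c1(2)[of "x - y"] c2(2)[of "x - y"] that h c1(1) c2(1) by (intro mult_mono) auto
    then show ?thesis by (simp add: mult_ac)
  qed
  then show ?thesis using h c1 c2 assms by (intro exI[of _ 1] exI[of _ h] exI[of _ "c1 * c2"]) auto
next
  case True
  define h where "h = min 1 ((b - a) / 2)"
  have h: "0 < h" "2 * h \<le> b - a" "h \<le> 1" "h < b - a" using assms unfolding h_def by (auto simp: min_def)
  obtain c1 where c1: "0 < c1" "\<And>v. 0 < v \<Longrightarrow> v \<le> 1 \<Longrightarrow> c1 * v \<le> (0 + v) powr \<beta>p"
    using powr_shift_lower[OF assms(5), of 0] by auto
  obtain c2 where c2: "0 < c2" "\<And>v. 0 < v \<Longrightarrow> v \<le> h \<Longrightarrow> c2 \<le> ((b - a) - v) powr \<beta>m"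
    using powr_between_lower[OF h(1,2), of \<beta>m] by auto
  have "c1 * c2 * (- 1 * (x - y)) \<le> (x - a) powr \<beta>m * (b - x) powr \<beta>p" if "0 < - 1 * (x - y)" "- 1 * (x - y) \<le> h" for x
  proof -
    have "c2 * (c1 * (b - x)) \<le> (x - a) powr \<beta>m * (b - x) powr \<beta>p"
      using c1(2)[of "b - x"] c2(2)[of "b - x"] that h c1(1) c2(1) True by (intro mult_mono) auto
    then show ?thesis using True by (simp add: mult_ac)
  qed
  then show ?thesis using h c1 c2 assms True by (intro exI[of _ "-1"] exI[of _ h] exI[of _ "c1 * c2"]) auto
qed

context free_semigroup
begin

text \<open>\<open>K\<close> is the union of the bands. The statement keeps only what is used later:
  bands have no isolated points, finite \<open>sqpot M\<close> on \<open>K\<close> occurs only at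
  atoms of \<open>\<mu>\<close>, of which there are finitely many, and off \<open>K\<close> the
  measure is locally at most an atom.\<close>

lemma ac_support_structure:
  "\<exists>K. (\<forall>y\<in>K. \<exists>d>0. {y - d<..<y} \<subseteq> K \<or> {y<..<y + d} \<subseteq> K) \<and>
     finite {y \<in> K. sqpot M (of_real y) < \<infinity>} \<and>
     (\<forall>y\<in>K. sqpot M (of_real y) < \<infinity> \<longrightarrow> 0 < measure \<mu> {y}) \<and>
     (\<forall>y. y \<notin> K \<longrightarrow> (\<exists>d>0. AE u in \<mu>. u = y \<or> d \<le> \<bar>u - y\<bar>))"
proof -
  obtain \<mu>ac \<mu>s where dec: "lebesgue_decomposition \<mu> \<mu>ac \<mu>s"
    and Pex: "\<exists>P. finite P \<and> card P = npp \<and> (\<forall>a \<in> P. 0 < emeasure \<mu>s {a}) \<and> emeasure \<mu>s (- P) = 0"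
    and Eex: "\<exists>(Em :: nat \<Rightarrow> real) (Ep :: nat \<Rightarrow> real) (\<rho> :: real \<Rightarrow> real).
           (\<forall>j \<in> {1..nac}. Em j < Ep j) \<and>
           disjoint_family_on (\<lambda>j. {Em j..Ep j}) {1..nac} \<and>
           \<rho> \<in> borel_measurable borel \<and> (\<forall>x. 0 \<le> \<rho> x) \<and>
           \<mu>ac = density lborel (\<lambda>x. ennreal (\<rho> x)) \<and>
           (AE x in lborel. x \<notin> (\<Union>j \<in> {1..nac}. {Em j..Ep j}) \<longrightarrow> \<rho> x = 0) \<and>
           (\<forall>j \<in> {1..nac}. \<exists>\<beta>m \<beta>p C :: real.
              -1 < \<beta>m \<and> \<beta>m < 1 \<and> -1 < \<beta>p \<and> \<beta>p < 1 \<and> 1 \<le> C \<and>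
              (AE x in lborel. x \<in> {Em j..Ep j} \<longrightarrow>
                 inverse C < \<rho> x / ((x - Em j) powr \<beta>m * (Ep j - x) powr \<beta>p) \<and>
                 \<rho> x / ((x - Em j) powr \<beta>m * (Ep j - x) powr \<beta>p) < C))"
    using asm_A[unfolded assumption_A_def, THEN conjunct2, THEN conjunct2, THEN conjunct2, THEN conjunct2]
    by (elim exE) (elim conjE, rule that, assumption+)
  obtain P where P: "finite P" "emeasure \<mu>s (- P) = 0" using Pex by blast
  obtain Em Ep :: "nat \<Rightarrow> real" and \<rho> :: "real \<Rightarrow> real" where E': "\<forall>j \<in> {1..nac}. Em j < Ep j"
    and \<rho>: "\<rho> \<in> borel_measurable borel" "\<forall>x. 0 \<le> \<rho> x" "\<mu>ac = density lborel (\<lambda>x. ennreal (\<rho> x))"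
    and zero: "AE x in lborel. x \<notin> (\<Union>j \<in> {1..nac}. {Em j..Ep j}) \<longrightarrow> \<rho> x = 0"
    and bound': "\<forall>j \<in> {1..nac}. \<exists>\<beta>m \<beta>p C :: real.
              -1 < \<beta>m \<and> \<beta>m < 1 \<and> -1 < \<beta>p \<and> \<beta>p < 1 \<and> 1 \<le> C \<and>
              (AE x in lborel. x \<in> {Em j..Ep j} \<longrightarrow>
                 inverse C < \<rho> x / ((x - Em j) powr \<beta>m * (Ep j - x) powr \<beta>p) \<and>
                 \<rho> x / ((x - Em j) powr \<beta>m * (Ep j - x) powr \<beta>p) < C)"
    using Eex by (elim exE) (elim conjE, rule that, assumption+)
  note E = E'[rule_format]
  note dec' = dec[unfolded lebesgue_decomposition_def]
  note [measurable] = \<rho>(1)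
  define K where "K = (\<Union>j \<in> {1..nac}. {Em j..Ep j})"
  have K_nbr: "\<exists>d>0. {y - d<..<y} \<subseteq> K \<or> {y<..<y + d} \<subseteq> K" if y: "y \<in> K" for y
  proof -
    obtain j where j: "j \<in> {1..nac}" "Em j \<le> y" "y \<le> Ep j" using y unfolding K_def by auto
    show ?thesis
    proof (cases "y = Ep j")
      case True
      then have "{y - (Ep j - Em j)<..<y} \<subseteq> K" using j unfolding K_def by auto
      then show ?thesis using E[OF j(1)] by (intro exI[of _ "Ep j - Em j"]) auto
    next
      case False
      then have "{y<..<y + (Ep j - y)} \<subseteq> K" using j unfolding K_def by auto
      then show ?thesis using False j by (intro exI[of _ "Ep j - y"]) auto
    qed
  qed
  \<comment> \<open>Without an atom finiteness would pass from \<open>M\<close> to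
    \<open>\<mu>\<close>, but on a band the density contributes at least \<open>c / (C v)\<close> to
    the integrand.\<close>
  have atom: "0 < measure \<mu> {y}" if y: "y \<in> K" and f: "sqpot M (of_real y) < \<infinity>" for y
  proof (rule ccontr)
    assume "\<not> ?thesis"
    then have "measure \<mu> {y} = 0" by (simp add: zero_less_measure_iff)
    from sqint_mu_bounded[OF f this] have fin: "sqpot \<mu> (of_real y) < \<infinity>" .
    obtain j where j: "j \<in> {1..nac}" "Em j \<le> y" "y \<le> Ep j" using y unfolding K_def by auto
    obtain \<beta>m \<beta>p C where b: "\<beta>m < 1" "\<beta>p < 1" "1 \<le> C"
      "AE x in lborel. x \<in> {Em j..Ep j} \<longrightarrow> inverse C < \<rho> x / ((x - Em j) powr \<beta>m * (Ep j - x) powr \<beta>p)"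
    proof -
      obtain \<beta>m \<beta>p C :: real where b: "\<beta>m < 1" "\<beta>p < 1" "1 \<le> C"
        and ae: "AE x in lborel. x \<in> {Em j..Ep j} \<longrightarrow>
                 inverse C < \<rho> x / ((x - Em j) powr \<beta>m * (Ep j - x) powr \<beta>p) \<and>
                 \<rho> x / ((x - Em j) powr \<beta>m * (Ep j - x) powr \<beta>p) < C"
        using bound'[rule_format, OF j(1)] by (elim exE) (elim conjE, rule that, assumption+)
      have "AE x in lborel. x \<in> {Em j..Ep j} \<longrightarrow> inverse C < \<rho> x / ((x - Em j) powr \<beta>m * (Ep j - x) powr \<beta>p)"
        using ae by eventually_elim simp
      with b show thesis by (rule that)
    qed
    obtain \<sigma> h c where s: "\<sigma> = 1 \<or> \<sigma> = -1" "0 < h" "0 < c"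
      "\<And>x. 0 < \<sigma> * (x - y) \<Longrightarrow> \<sigma> * (x - y) \<le> h \<Longrightarrow>
       Em j < x \<and> x < Ep j \<and> c * (\<sigma> * (x - y)) \<le> (x - Em j) powr \<beta>m * (Ep j - x) powr \<beta>p"
      using edge_power_lower[OF E[OF j(1)] j(2,3) b(1,2)] by blast
    let ?S = "{x. 0 < \<sigma> * (x - y) \<and> \<sigma> * (x - y) \<le> h}"
    have "\<infinity> = ennreal (c / C) * (\<integral>\<^sup>+x\<in>?S. ennreal (1 / (\<sigma> * (x - y))) \<partial>lborel)"
      unfolding nn_integral_inverse_infinite[OF s(2,1)] using s(3) b(3) by (simp add: ennreal_mult_top)
    also have "\<dots> = (\<integral>\<^sup>+x. ennreal (c / C) * (ennreal (1 / (\<sigma> * (x - y))) * indicator ?S x) \<partial>lborel)"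
      by (rule nn_integral_cmult[symmetric]) measurable
    also have "\<dots> \<le> (\<integral>\<^sup>+x. ennreal (\<rho> x) * inverse (ennreal ((cmod (of_real x - of_real y))\<^sup>2)) \<partial>lborel)"
    proof (rule nn_integral_mono_AE)
      show "AE x in lborel. ennreal (c / C) * (ennreal (1 / (\<sigma> * (x - y))) * indicator ?S x) \<le>
          ennreal (\<rho> x) * inverse (ennreal ((cmod (of_real x - of_real y))\<^sup>2))"
        using b(4)
      proof eventually_elim
        case (elim x)
        show ?case
        proof (cases "x \<in> ?S")
          case True
          define v where "v = \<sigma> * (x - y)"
          have v: "0 < v" "v \<le> h" using True unfolding v_def by auto
          define p where "p = (x - Em j) powr \<beta>m * (Ep j - x) powr \<beta>p"
          have x: "Em j < x" "x < Ep j" "c * v \<le> p" using s(4)[of x] True unfolding v_def p_def by auto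
          have p: "0 < p" unfolding p_def using x by auto
          have "inverse C * p < \<rho> x" using elim x p unfolding p_def by (simp add: pos_less_divide_eq)
          moreover have "inverse C * (c * v) \<le> inverse C * p" using x(3) b(3) by (intro mult_left_mono) auto
          ultimately have r: "c / C * v \<le> \<rho> x" by (simp add: divide_inverse mult_ac)
          have "cmod (of_real x - of_real y) = \<bar>x - y\<bar>" by (metis norm_of_real of_real_diff)
          also have "\<bar>x - y\<bar> = v" using s(1) v unfolding v_def by auto
          finally have "inverse (ennreal ((cmod (of_real x - of_real y))\<^sup>2)) = ennreal (1 / v\<^sup>2)"
            using v by (simp add: inverse_ennreal inverse_eq_divide)
          moreover have "c / C * (1 / v) \<le> \<rho> x * (1 / v\<^sup>2)"
          proof -
            have "c / C * v * (1 / v\<^sup>2) \<le> \<rho> x * (1 / v\<^sup>2)" using r by (intro mult_right_mono) auto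
            then show ?thesis using v by (simp add: power2_eq_square)
          qed
          ultimately show ?thesis
            using True s(3) b(3) v \<rho>(2)[rule_format, of x] unfolding v_def[symmetric]
            by (simp add: ennreal_leI v_def[symmetric] flip: ennreal_mult)
        qed simp
      qed
    qed
    also have "\<dots> = (\<integral>\<^sup>+x. inverse (ennreal ((cmod (of_real x - of_real y))\<^sup>2)) \<partial>\<mu>ac)"
      unfolding \<rho>(3) by (subst nn_integral_density) auto
    also have "\<dots> \<le> sqpot \<mu> (of_real y)"
      unfolding sqpot_def
    proof (rule nn_integral_mono_measure)
      show "sets \<mu>ac = sets \<mu>" using dec' by simp
      then show "\<mu>ac \<le> \<mu>"
        using dec' by (subst le_measure) (auto simp: add_increasing2)
    qed
    finally show False using fin by (simp add: top_unique)
  qed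
  \<comment> \<open>An atom of \<open>\<mu>\<close> is one of the singular part, whose mass sits on
    the finite set \<open>P\<close>.\<close>
  have "{y. 0 < measure \<mu> {y}} \<subseteq> P"
  proof
    fix y assume "y \<in> {y. 0 < measure \<mu> {y}}"
    then have "0 < emeasure \<mu> {y}" by (simp add: mu.emeasure_eq_measure)
    moreover have "emeasure \<mu>ac {y} = 0"
      using dec' countable_imp_null_set_lborel[of "{y}"] unfolding absolutely_continuous_def by auto
    ultimately have "0 < emeasure \<mu>s {y}" using dec' by simp
    show "y \<in> P"
    proof (rule ccontr)
      assume "y \<notin> P"
      have "- P \<in> sets \<mu>s" using P(1) dec' by (auto intro!: borel_closed finite_imp_closed borel_comp)
      then have "emeasure \<mu>s {y} \<le> emeasure \<mu>s (- P)" using \<open>y \<notin> P\<close> by (intro emeasure_mono) auto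
      then show False using P(2) \<open>0 < emeasure \<mu>s {y}\<close> by simp
    qed
  qed
  then have fin: "finite {y \<in> K. sqpot M (of_real y) < \<infinity>}"
    using atom by (intro finite_subset[OF _ P(1)]) blast
  have iso: "\<exists>d>0. AE u in \<mu>. u = y \<or> d \<le> \<bar>u - y\<bar>" if y: "y \<notin> K" for y
  proof -
    have "closed K" unfolding K_def by auto
    then obtain d1 where d1: "0 < d1" "ball y d1 \<subseteq> - K"
      using y openE[of "- K" y] by auto
    obtain d2 where d2: "0 < d2" "\<forall>x\<in>P. x \<noteq> y \<longrightarrow> d2 \<le> dist y x" using finite_set_avoid[OF P(1)] by blast
    define d where "d = min d1 d2"
    have d: "0 < d" using d1 d2 unfolding d_def by simp
    define B where "B = ball y d - {y}"
    have Bb [measurable]: "B \<in> sets borel" unfolding B_def by auto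
    have "emeasure \<mu>ac B = (\<integral>\<^sup>+x. ennreal (\<rho> x) * indicator B x \<partial>lborel)"
      unfolding \<rho>(3) by (rule emeasure_density) auto
    also have "\<dots> = (\<integral>\<^sup>+(x::real). 0 \<partial>lborel)"
    proof (rule nn_integral_cong_AE)
      show "AE x in lborel. ennreal (\<rho> x) * indicator B x = 0"
        using zero
      proof eventually_elim
        case (elim x)
        have "x \<in> B \<Longrightarrow> x \<notin> K" using d1(2) unfolding B_def d_def by auto
        then show ?case using elim unfolding K_def by (auto simp: indicator_def)
      qed
    qed
    finally have "emeasure \<mu>ac B = 0" by simp
    moreover have "emeasure \<mu>s B \<le> emeasure \<mu>s (- P)"
    proof (rule emeasure_mono)
      show "B \<subseteq> - P" using d2(2) unfolding B_def d_def by auto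
      show "- P \<in> sets \<mu>s" using P(1) dec' by (auto intro!: borel_closed finite_imp_closed borel_comp)
    qed
    ultimately have "emeasure \<mu> B = 0" using dec' P(2) Bb by simp
    then have "B \<in> null_sets \<mu>" by (auto simp: null_sets_def)
    then have "AE u in \<mu>. u \<notin> B" by (rule AE_not_in)
    then have "AE u in \<mu>. u = y \<or> d \<le> \<bar>u - y\<bar>"
      by eventually_elim (auto simp: B_def dist_real_def abs_minus_commute)
    then show ?thesis using d by blast
  qed
  show ?thesis using K_nbr fin atom iso by (intro exI[of _ K]) blast
qed

text \<open>On a band, finiteness would require an atom; off the bands \<open>y\<close> is isolated
  from the rest of \<open>\<mu>\<close>.\<close>

lemma regular_gap:
  assumes y: "sqpot M (of_real y) < \<infinity>" and at: "measure \<mu> {y} = 0"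
  shows "gap M y" "gap \<mu> y"
proof -
  obtain K where K: "\<forall>y\<in>K. sqpot M (of_real y) < \<infinity> \<longrightarrow> 0 < measure \<mu> {y}"
     "\<forall>y. y \<notin> K \<longrightarrow> (\<exists>d>0. AE u in \<mu>. u = y \<or> d \<le> \<bar>u - y\<bar>)"
    using ac_support_structure by blast
  have "y \<notin> K" using K(1) y at by auto
  then obtain d where d: "0 < d" "AE u in \<mu>. u = y \<or> d \<le> \<bar>u - y\<bar>" using K(2) by blast
  show "gap M y" by (rule gap_of_isolated[OF y d])
  have "AE u in \<mu>. u \<noteq> y"
    using at by (intro AE_I[where N = "{y}"]) (auto simp: mu.emeasure_eq_measure)
  with d(2) have "AE u in \<mu>. d \<le> \<bar>u - y\<bar>" by eventually_elim auto
  then show "gap \<mu> y" unfolding gap_def using d(1) by blast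
qed

lemma regular_value:
  assumes s: "1 < s" and E: "E \<in> regular_points \<mu> s" and Im: "Im (\<omega> s (of_real E)) = 0"
  shows "\<omega> s (of_real E) = of_real (Re (\<omega> s (of_real E)))"
    "of_real s * \<omega> s (of_real E) \<noteq> of_real E"
    "gap M (Re (\<omega> s (of_real E)))" "gap \<mu> (Re (\<omega> s (of_real E)))"
proof -
  show r: "\<omega> s (of_real E) = of_real (Re (\<omega> s (of_real E)))" using Im by (simp add: complex_eq_iff)
  define w where "w = Re (\<omega> s (of_real E))"
  have w: "\<omega> s (of_real E) = of_real w" unfolding w_def by (rule r)
  show ne: "of_real s * \<omega> s (of_real E) \<noteq> of_real E"
    using singular_value(2)[OF s] E unfolding regular_points_def by blast
  have om: "adm s (of_real w)" "H s (of_real w) = of_real E" using omega_closed[OF s, of "of_real E"] w by simp_all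
  have f: "sqpot M (of_real w) < \<infinity>" using admD[OF om(1) s] by simp
  \<comment> \<open>At an atom F vanishes, so \<open>H s w = s w\<close>; then
    \<open>E = s w\<close> would be singular.\<close>
  have "measure \<mu> {w} = 0"
  proof (rule ccontr)
    assume "measure \<mu> {w} \<noteq> 0"
    then have "stieltjes M (of_real w) = - of_real w" using f by (intro atom_zero) (auto simp: zero_less_measure_iff)
    then have "of_real s * of_real w = H s (of_real w)" unfolding H_def by (simp add: algebra_simps)
    then show False using om(2) ne w by simp
  qed
  then show "gap M (Re (\<omega> s (of_real E)))" "gap \<mu> (Re (\<omega> s (of_real E)))"
    using regular_gap f unfolding w_def by auto
qed

end

section \<open>The local equation\<close>

lemma Re_Im_sq_sum: "(Re d)\<^sup>2 + (Im d)\<^sup>2 = (cmod d)\<^sup>2" by (simp add: cmod_power2)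

text \<open>\<open>X\<close> is the scaled displacement of the energy, \<open>d\<close> that of
  \<open>\<omega>\<close>. Of the two roots of \<open>X + j3 d^2 = 0\<close>, a non-negative
  imaginary part leaves \<open>i sqrt (X / j3)\<close> for \<open>X > 0\<close>; \<open>e2\<close>
  says that a non-real \<open>d\<close> is nearly vertical, so that it can only occur for
  \<open>X > 0\<close>.\<close>

lemma edge_simple_pos:
  fixes d :: complex and j3 X C :: real
  assumes j3: "0 < j3" and Im: "0 \<le> Im d"
    and e1: "cmod (of_real X + of_real j3 * d\<^sup>2) \<le> C * cmod d ^ 3"
    and e2: "0 < Im d \<Longrightarrow> \<bar>2 * j3 * Re d\<bar> \<le> C * cmod d ^ 2"
    and small: "C * cmod d \<le> j3 / 8"
  shows "X < 0 \<Longrightarrow> Im d = 0" "0 < X \<Longrightarrow> 0 < Im d" "(cmod d)\<^sup>2 \<le> 2 * \<bar>X\<bar> / j3"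
    "0 \<le> X \<Longrightarrow> \<bar>Im d - sqrt (X / j3)\<bar> \<le> 2 * C / j3\<^sup>2 * X"
proof -
  let ?n = "cmod d"
  have cub: "C * ?n ^ 3 \<le> j3 / 8 * ?n\<^sup>2"
    using mult_right_mono[OF small, of "?n\<^sup>2"] by (simp add: power2_eq_square power3_eq_cube mult_ac)
  have "cmod (of_real j3 * d\<^sup>2) \<le> cmod (of_real X + of_real j3 * d\<^sup>2) + cmod (of_real X :: complex)"
    by (metis add_diff_cancel_left' norm_triangle_ineq4)
  then have "j3 * ?n\<^sup>2 \<le> \<bar>X\<bar> + j3 / 8 * ?n\<^sup>2"
    using e1 cub j3 by (simp add: norm_mult norm_power)
  then have "j3 * ?n\<^sup>2 \<le> 2 * \<bar>X\<bar>" using j3 by (simp add: field_simps)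
  then show n2: "?n\<^sup>2 \<le> 2 * \<bar>X\<bar> / j3" using j3 by (simp add: field_simps)
  have re: "\<bar>X + j3 * ((Re d)\<^sup>2 - (Im d)\<^sup>2)\<bar> \<le> j3 / 8 * ?n\<^sup>2"
    using abs_Re_le_cmod[of "of_real X + of_real j3 * d\<^sup>2"] e1 cub by (simp add: power2_eq_square)
  have pos: "0 < X" if I: "0 < Im d"
  proof -
    have n0: "0 < ?n" using I by auto
    have "2 * j3 * \<bar>Re d\<bar> \<le> C * ?n * ?n" using e2[OF I] j3 by (simp add: abs_mult power2_eq_square mult.assoc)
    also have "\<dots> \<le> j3 / 8 * ?n" using small by (intro mult_right_mono) auto
    finally have "\<bar>Re d\<bar> \<le> ?n / 16" using j3 by (simp add: field_simps)
    then have "(Re d)\<^sup>2 \<le> (?n / 16)\<^sup>2" by (metis abs_ge_zero power2_abs power_mono)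
    then have R: "(Re d)\<^sup>2 \<le> ?n\<^sup>2 / 256" by (simp add: power_divide)
    then have "(Re d)\<^sup>2 - (Im d)\<^sup>2 \<le> - (?n\<^sup>2 / 2)" using Re_Im_sq_sum[of d] zero_le_power2[of ?n] by linarith
    then have "j3 * ((Re d)\<^sup>2 - (Im d)\<^sup>2) \<le> j3 * (- (?n\<^sup>2 / 2))" using j3 by (intro mult_left_mono) auto
    moreover have "j3 / 8 * ?n\<^sup>2 < j3 * (?n\<^sup>2 / 2)" using j3 n0 by simp
    ultimately show ?thesis using re by linarith
  qed
  show "X < 0 \<Longrightarrow> Im d = 0" using pos Im by fastforce
  show "0 < Im d" if X: "0 < X"
  proof (rule ccontr)
    assume "\<not> 0 < Im d"
    then have I: "Im d = 0" using Im by simp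
    then have "(Re d)\<^sup>2 = ?n\<^sup>2" using Re_Im_sq_sum[of d] by simp
    then have "\<bar>X + j3 * ?n\<^sup>2\<bar> \<le> j3 / 8 * ?n\<^sup>2" using re unfolding I by simp
    moreover have "j3 / 8 * ?n\<^sup>2 \<le> j3 * ?n\<^sup>2" using j3 by (intro mult_right_mono) auto
    ultimately show False using X mult_nonneg_nonneg[of j3 "?n\<^sup>2"] j3 by (simp add: abs_le_iff)
  qed
  assume X: "0 \<le> X"
  define a where "a = sqrt (X / j3)"
  have a: "0 \<le> a" "a\<^sup>2 = X / j3" unfolding a_def using X j3 by auto
  show "\<bar>Im d - sqrt (X / j3)\<bar> \<le> 2 * C / j3\<^sup>2 * X"
  proof (cases "d = 0")
    case True
    then have "X = 0" using e1 by simp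
    then show ?thesis using True by simp
  next
    case False
    have j: "of_real j3 * (of_real a)\<^sup>2 = (of_real X :: complex)"
    proof -
      have "j3 * a\<^sup>2 = X" using a j3 by simp
      then show ?thesis by (metis of_real_mult of_real_power)
    qed
    \<comment> \<open>Factoring \<open>d^2 + a^2\<close>: the factor \<open>d + i a\<close> is at
      least \<open>|d|\<close> in modulus, as both imaginary parts are non-negative, and cancels one
      power of the error.\<close>
    have "of_real j3 * ((d - \<i> * of_real a) * (d + \<i> * of_real a)) = of_real X + of_real j3 * d\<^sup>2"
      unfolding j[symmetric] by (simp add: power2_eq_square algebra_simps)
    then have "j3 * (cmod (d - \<i> * of_real a) * cmod (d + \<i> * of_real a)) \<le> C * ?n ^ 3"
      using e1 j3 by (metis abs_of_pos norm_mult norm_of_real)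
    moreover have "?n \<le> cmod (d + \<i> * of_real a)"
    proof -
      have "(Im d)\<^sup>2 \<le> (Im d + a)\<^sup>2" using Im a by (intro power_mono) auto
      then show ?thesis unfolding cmod_def by (intro real_sqrt_le_mono) simp
    qed
    ultimately have "j3 * (cmod (d - \<i> * of_real a) * ?n) \<le> C * ?n ^ 3"
      using j3 by (meson mult_left_mono norm_ge_zero order_trans less_imp_le)
    then have "j3 * cmod (d - \<i> * of_real a) * ?n \<le> C * ?n\<^sup>2 * ?n" by (simp add: power2_eq_square power3_eq_cube mult_ac)
    then have "j3 * cmod (d - \<i> * of_real a) \<le> C * ?n\<^sup>2" using False by (subst (asm) mult_le_cancel_right_pos) auto
    also have "C * ?n\<^sup>2 \<le> C * (2 * X / j3)"
    proof -
      have "0 \<le> C * ?n ^ 3" using e1 norm_ge_zero order_trans by blast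
      then have "0 \<le> C" using False by (simp add: zero_le_mult_iff)
      then show ?thesis using n2 X by (intro mult_left_mono) auto
    qed
    finally have "cmod (d - \<i> * of_real a) \<le> 2 * C / j3\<^sup>2 * X"
      using j3 by (simp add: field_simps power2_eq_square)
    moreover have "\<bar>Im d - a\<bar> \<le> cmod (d - \<i> * of_real a)" using abs_Im_le_cmod[of "d - \<i> * of_real a"] by simp
    ultimately show ?thesis unfolding a_def by simp
  qed
qed

text \<open>The reflection \<open>d \<mapsto> - cnj d\<close> reduces an edge with \<open>j3 < 0\<close> to one with \<open>j3 > 0\<close>.\<close>

lemma neg_cnj [simp]: "Re (- cnj d) = - Re d" "Im (- cnj d) = Im d" "cmod (- cnj d) = cmod d" by auto

lemma edge_simple:
  fixes d :: complex and j3 X C :: real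
  assumes j3: "j3 \<noteq> 0" and Im: "0 \<le> Im d"
    and e1: "cmod (of_real X + of_real j3 * d\<^sup>2) \<le> C * cmod d ^ 3"
    and e2: "0 < Im d \<Longrightarrow> \<bar>2 * j3 * Re d\<bar> \<le> C * cmod d ^ 2"
    and small: "C * cmod d \<le> \<bar>j3\<bar> / 8"
  shows "sgn j3 * X < 0 \<Longrightarrow> Im d = 0" "0 < sgn j3 * X \<Longrightarrow> 0 < Im d" "(cmod d)\<^sup>2 \<le> 2 * \<bar>X\<bar> / \<bar>j3\<bar>"
    "0 \<le> sgn j3 * X \<Longrightarrow> \<bar>Im d - sqrt (sgn j3 * X / \<bar>j3\<bar>)\<bar> \<le> 2 * C / j3\<^sup>2 * \<bar>X\<bar>"
proof -
  consider "0 < j3" | "j3 < 0" using j3 by linarith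
  then have "(sgn j3 * X < 0 \<longrightarrow> Im d = 0) \<and> (0 < sgn j3 * X \<longrightarrow> 0 < Im d) \<and> (cmod d)\<^sup>2 \<le> 2 * \<bar>X\<bar> / \<bar>j3\<bar> \<and>
    (0 \<le> sgn j3 * X \<longrightarrow> \<bar>Im d - sqrt (sgn j3 * X / \<bar>j3\<bar>)\<bar> \<le> 2 * C / j3\<^sup>2 * \<bar>X\<bar>)"
  proof cases
    case 1
    then show ?thesis using edge_simple_pos[OF 1 Im e1 e2] small by auto
  next
    case 2
    have "of_real (- X) + of_real (- j3) * (- cnj d)\<^sup>2 = - cnj (of_real X + of_real j3 * d\<^sup>2)" by simp
    then have e1': "cmod (of_real (- X) + of_real (- j3) * (- cnj d)\<^sup>2) \<le> C * cmod (- cnj d) ^ 3"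
      using e1 by (metis complex_mod_cnj norm_minus_cancel)
    have "0 < - j3" "0 \<le> Im (- cnj d)" using 2 Im by auto
    from edge_simple_pos[OF this e1'] show ?thesis
      using 2 e2 small by (auto simp: abs_mult)
  qed
  then show "sgn j3 * X < 0 \<Longrightarrow> Im d = 0" "0 < sgn j3 * X \<Longrightarrow> 0 < Im d" "(cmod d)\<^sup>2 \<le> 2 * \<bar>X\<bar> / \<bar>j3\<bar>"
    "0 \<le> sgn j3 * X \<Longrightarrow> \<bar>Im d - sqrt (sgn j3 * X / \<bar>j3\<bar>)\<bar> \<le> 2 * C / j3\<^sup>2 * \<bar>X\<bar>" by auto
qed

text \<open>Normal form of the cubic when the quadratic term dominates: for small \<open>Y\<close>
  the roots lie near \<open>i sqrt Y\<close>, \<open>- i sqrt Y\<close> and -1. The weak relative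
  error in \<open>e1\<close> serves to locate \<open>D\<close>, the sharper one in
  \<open>e1'\<close> to estimate it to order \<open>sqrt Y ^ 3\<close>.\<close>

lemma cubic_root_small:
  fixes D :: complex and Y :: real
  assumes Im: "0 \<le> Im D" and Y: "\<bar>Y\<bar> \<le> 1 / 100"
    and e1: "cmod (of_real Y + D\<^sup>2 + D ^ 3) \<le> cmod D ^ 3 / 100"
    and e1': "cmod (of_real Y + D\<^sup>2 + D ^ 3) \<le> cmod D ^ 4"
    and e2: "2 * Re D + 3 * (Re D)\<^sup>2 - (Im D)\<^sup>2 \<le> (cmod D)\<^sup>2 / 100"
    and e3: "0 < Im D \<Longrightarrow> - ((cmod D)\<^sup>2 / 100) \<le> 2 * Re D + 3 * (Re D)\<^sup>2 - (Im D)\<^sup>2"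
  shows "Y < 0 \<Longrightarrow> Im D = 0" "(cmod D)\<^sup>2 \<le> 4 * \<bar>Y\<bar>"
    "0 \<le> Y \<Longrightarrow> \<bar>Im D - sqrt Y\<bar> \<le> 192 * sqrt Y ^ 3"
proof -
  let ?n = "cmod D" and ?P = "Re D" and ?N = "Im D"
  have main: "?n\<^sup>2 * cmod (1 + D) \<le> \<bar>Y\<bar> + ?n ^ 3 / 100"
  proof -
    have "D\<^sup>2 * (1 + D) = (of_real Y + D\<^sup>2 + D ^ 3) - of_real Y" by (simp add: power2_eq_square power3_eq_cube algebra_simps)
    then have "cmod (D\<^sup>2 * (1 + D)) \<le> cmod (of_real Y + D\<^sup>2 + D ^ 3) + cmod (of_real Y :: complex)"
      by (metis norm_triangle_ineq4)
    then show ?thesis using e1 by (simp add: norm_mult norm_power)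
  qed
  \<comment> \<open>A large \<open>D\<close> must be close to -1, where the left side of
    \<open>e2\<close> is close to 1: the spurious root violates admissibility.\<close>
  have n_small: "?n \<le> 1 / 2"
  proof (rule ccontr)
    assume "\<not> ?thesis"
    then have n: "1 / 2 < ?n" by simp
    have n2: "1 / 4 \<le> ?n\<^sup>2" using power_mono[of "1 / 2" ?n 2] n by (simp add: power_divide)
    have "?n\<^sup>2 * cmod (1 + D) \<le> ?n\<^sup>2 * (1 / 25 + ?n / 100)"
    proof -
      have "\<bar>Y\<bar> \<le> ?n\<^sup>2 * (1 / 25)" using n2 Y by linarith
      then have "\<bar>Y\<bar> + ?n ^ 3 / 100 \<le> ?n\<^sup>2 * (1 / 25) + ?n ^ 3 / 100" by simp
      also have "\<dots> = ?n\<^sup>2 * (1 / 25 + ?n / 100)" by (simp add: power2_eq_square power3_eq_cube algebra_simps)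
      finally show ?thesis using main by simp
    qed
    then have c: "cmod (1 + D) \<le> 1 / 25 + ?n / 100" using n2 by (subst (asm) mult_le_cancel_left_pos) auto
    have "?n \<le> 1 + cmod (1 + D)" using norm_triangle_ineq4[of "1 + D" 1] by simp
    then have n11: "?n \<le> 11 / 10" using c by linarith
    then have "cmod (1 + D) \<le> 1 / 10" using c by linarith
    then have P: "\<bar>1 + ?P\<bar> \<le> 1 / 10" and N: "\<bar>?N\<bar> \<le> 1 / 10"
      using abs_Re_le_cmod[of "1 + D"] abs_Im_le_cmod[of "1 + D"] by auto
    have P1: "?P \<le> - 9 / 10" "2 + 3 * ?P \<le> - 7 / 10" using P by linarith+
    have "(9 / 10) * (7 / 10) \<le> (- ?P) * (- (2 + 3 * ?P))" using P1 by (intro mult_mono) auto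
    then have "63 / 100 \<le> 2 * ?P + 3 * ?P\<^sup>2" by (simp add: power2_eq_square algebra_simps)
    moreover have "?N\<^sup>2 \<le> (1 / 10)\<^sup>2" using N by (metis abs_ge_zero power2_abs power_mono)
    moreover have "?n\<^sup>2 \<le> (11 / 10)\<^sup>2" using n11 by (intro power_mono) auto
    ultimately show False using e2 by (simp add: power2_eq_square)
  qed
  have n4: "?n\<^sup>2 \<le> 4 * \<bar>Y\<bar>"
  proof -
    have "1 / 2 \<le> cmod (1 + D)" using n_small norm_triangle_ineq2[of 1 "- D"] by simp
    then have "?n\<^sup>2 * (1 / 2) \<le> ?n\<^sup>2 * cmod (1 + D)" by (intro mult_left_mono) auto
    moreover have "?n ^ 3 \<le> ?n\<^sup>2 * (1 / 2)"
      using mult_left_mono[OF n_small, of "?n\<^sup>2"] by (simp add: power2_eq_square power3_eq_cube)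
    ultimately show ?thesis using main by simp
  qed
  then show "(cmod D)\<^sup>2 \<le> 4 * \<bar>Y\<bar>" .
  have n5: "?n \<le> 1 / 5"
    using n4 Y power2_le_imp_le[of ?n "1 / 5"] by (simp add: power_divide)
  have Re3: "Re (D ^ 3) = ?P ^ 3 - 3 * ?P * ?N\<^sup>2" by (simp add: power2_eq_square power3_eq_cube algebra_simps)
  have re: "\<bar>Y + (?P\<^sup>2 - ?N\<^sup>2) + Re (D ^ 3)\<bar> \<le> cmod (of_real Y + D\<^sup>2 + D ^ 3)"
    using abs_Re_le_cmod[of "of_real Y + D\<^sup>2 + D ^ 3"] by (simp add: power2_eq_square)
  have n3: "?n ^ 3 \<le> ?n\<^sup>2 / 5"
    using n5 mult_left_mono[OF n5, of "?n\<^sup>2"] by (simp add: power2_eq_square power3_eq_cube)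
  have D3: "\<bar>Re (D ^ 3)\<bar> \<le> ?n ^ 3" using abs_Re_le_cmod[of "D ^ 3"] by (simp add: norm_power)
  \<comment> \<open>Criticality puts a non-real \<open>D\<close> within a quadratic error of the
    imaginary axis. Hence \<open>Re (D ^ 3)\<close> is of fourth order, which improves the final
    error by one power of \<open>sqrt Y\<close>.\<close>
  have P2: "\<bar>?P\<bar> \<le> 2 * ?n\<^sup>2" if "0 < ?N"
  proof -
    have "3 * ?P\<^sup>2 \<le> 3 * ?n\<^sup>2" "?N\<^sup>2 \<le> ?n\<^sup>2" using Re_Im_sq_sum[of D] zero_le_power2[of ?P] zero_le_power2[of ?N] by linarith+
    then show ?thesis
      using e2 e3[OF that] zero_le_power2[of ?P] zero_le_power2[of ?N] zero_le_power2[of ?n]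
      unfolding abs_le_iff by (intro conjI; linarith)
  qed
  have pos: "0 < Y" if N: "0 < ?N"
  proof -
    have n0: "0 < ?n" using N by auto
    have "\<bar>?P\<bar> \<le> 2 / 5 * ?n"
      using P2[OF N] n5 mult_left_mono[OF n5, of ?n] by (simp add: power2_eq_square)
    then have "?P\<^sup>2 \<le> (2 / 5 * ?n)\<^sup>2" by (metis abs_ge_zero power2_abs power_mono)
    then have "?P\<^sup>2 \<le> 4 / 25 * ?n\<^sup>2" by (simp add: power_mult_distrib power_divide)
    then have "17 / 25 * ?n\<^sup>2 \<le> ?N\<^sup>2 - ?P\<^sup>2" using Re_Im_sq_sum[of D] by linarith
    moreover have "\<bar>Re (D ^ 3)\<bar> \<le> ?n\<^sup>2 / 5" using D3 n3 by linarith
    moreover have "\<bar>Y + (?P\<^sup>2 - ?N\<^sup>2) + Re (D ^ 3)\<bar> \<le> ?n\<^sup>2 / 500" using re e1 n3 by linarith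
    moreover have "0 < ?n\<^sup>2" using n0 by simp
    ultimately show ?thesis by linarith
  qed
  show "Y < 0 \<Longrightarrow> Im D = 0" using pos Im by fastforce
  assume Y0: "0 \<le> Y"
  show "\<bar>Im D - sqrt Y\<bar> \<le> 192 * sqrt Y ^ 3"
  proof (cases "Y = 0")
    case True
    then have "?n = 0" using n4 by simp
    then show ?thesis using True by simp
  next
    case False
    then have Yp: "0 < Y" using Y0 by simp
    have Np: "0 < ?N"
    proof (rule ccontr)
      assume "\<not> ?thesis"
      then have N0: "?N = 0" using Im by simp
      then have "Y + ?P\<^sup>2 + Re (D ^ 3) \<le> ?n ^ 3 / 100" using re e1 by simp
      moreover have "?P\<^sup>2 = ?n\<^sup>2" using Re_Im_sq_sum[of D] N0 by simp
      ultimately show False using Yp D3 n3 zero_le_power2[of ?n] by linarith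
    qed
    have Pb: "\<bar>?P\<bar> \<le> 2 * ?n\<^sup>2" by (rule P2[OF Np])
    have P2': "?P\<^sup>2 \<le> 4 * ?n ^ 4"
    proof -
      have "?P\<^sup>2 \<le> (2 * ?n\<^sup>2)\<^sup>2" using Pb by (metis abs_ge_zero power2_abs power_mono)
      then show ?thesis by (simp add: power_mult_distrib flip: power_mult)
    qed
    have "\<bar>Re (D ^ 3)\<bar> \<le> 7 * ?n ^ 4"
    proof -
      have "Re (D ^ 3) = ?P * (?P\<^sup>2 - 3 * ?N\<^sup>2)" unfolding Re3 by (simp add: power2_eq_square power3_eq_cube algebra_simps)
      then have "\<bar>Re (D ^ 3)\<bar> = \<bar>?P\<bar> * \<bar>?P\<^sup>2 - 3 * ?N\<^sup>2\<bar>" by (simp add: abs_mult)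
      also have "\<dots> \<le> (2 * ?n\<^sup>2) * (3 * ?n\<^sup>2)"
      proof (intro mult_mono Pb)
        show "\<bar>?P\<^sup>2 - 3 * ?N\<^sup>2\<bar> \<le> 3 * ?n\<^sup>2"
          using Re_Im_sq_sum[of D] zero_le_power2[of ?P] zero_le_power2[of ?N]
          unfolding abs_le_iff by (intro conjI; linarith)
      qed auto
      also have "\<dots> = 6 * ?n ^ 4" by (simp flip: power_add)
      finally show ?thesis using zero_le_power[of ?n 4] by simp
    qed
    then have "\<bar>Y - ?N\<^sup>2\<bar> \<le> 12 * ?n ^ 4" using re e1' P2' zero_le_power2[of ?P] by linarith
    also have "12 * ?n ^ 4 \<le> 12 * (4 * Y)\<^sup>2"
    proof -
      have "(?n\<^sup>2)\<^sup>2 \<le> (4 * Y)\<^sup>2" using n4 Yp by (intro power_mono) auto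
      then show ?thesis by (simp flip: power_mult)
    qed
    also have "\<dots> = 192 * sqrt Y ^ 3 * sqrt Y" using Yp by (simp add: power2_eq_square power3_eq_cube)
    finally have YN: "\<bar>Y - ?N\<^sup>2\<bar> \<le> 192 * sqrt Y ^ 3 * sqrt Y" .
    have "Y - ?N\<^sup>2 = (sqrt Y - ?N) * (sqrt Y + ?N)" using Yp by (simp add: power2_eq_square algebra_simps)
    then have "\<bar>sqrt Y - ?N\<bar> * (sqrt Y + ?N) \<le> 192 * sqrt Y ^ 3 * sqrt Y"
      using YN Np Yp by (simp add: abs_mult)
    moreover have "\<bar>sqrt Y - ?N\<bar> * sqrt Y \<le> \<bar>sqrt Y - ?N\<bar> * (sqrt Y + ?N)" using Np by (intro mult_left_mono) auto
    ultimately have "\<bar>sqrt Y - ?N\<bar> * sqrt Y \<le> 192 * sqrt Y ^ 3 * sqrt Y" by linarith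
    then have "\<bar>sqrt Y - ?N\<bar> \<le> 192 * sqrt Y ^ 3" using Yp by (subst (asm) mult_le_cancel_right_pos) auto
    then show ?thesis by (simp add: abs_minus_commute)
  qed
qed

text \<open>Normal form when the cubic term dominates. The cube roots of -1 are -1 and
  \<open>1/2 \<plusminus> i sqrt 3 / 2\<close>; the lower one is excluded by \<open>Im\<close>, and
  -1 by \<open>e2\<close>. The survivor produces the factor \<open>sqrt 3 / 2\<close> in the cube
  root law.\<close>

lemma cube_root_selection_pos:
  fixes D :: complex and \<kappa> q :: real
  assumes Im: "0 \<le> Im D" and k: "\<bar>\<kappa>\<bar> \<le> 1 / 1000" and q: "0 \<le> q" "q \<le> 1 / 1000" "q * cmod D \<le> 1 / 1000"
    and e1: "cmod (1 + of_real \<kappa> * D\<^sup>2 + D ^ 3) \<le> q * cmod D ^ 4"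
    and e2: "2 * \<kappa> * Re D + 3 * (Re D)\<^sup>2 - (Im D)\<^sup>2 \<le> q * cmod D ^ 3"
  shows "cmod D \<le> 2" "\<bar>Im D - sqrt 3 / 2\<bar> \<le> 12 * (4 * \<bar>\<kappa>\<bar> + 16 * q)"
proof -
  let ?n = "cmod D"
  have q4: "q * ?n ^ 4 \<le> ?n ^ 3 / 1000"
    using mult_right_mono[OF q(3), of "?n ^ 3"] by (simp add: power3_eq_cube power4_eq_xxxx mult_ac)
  have D3: "cmod (1 + D ^ 3) \<le> q * ?n ^ 4 + \<bar>\<kappa>\<bar> * ?n\<^sup>2"
  proof -
    have "1 + D ^ 3 = (1 + of_real \<kappa> * D\<^sup>2 + D ^ 3) - of_real \<kappa> * D\<^sup>2" by simp
    then have "cmod (1 + D ^ 3) \<le> cmod (1 + of_real \<kappa> * D\<^sup>2 + D ^ 3) + cmod (of_real \<kappa> * D\<^sup>2)"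
      by (metis norm_triangle_ineq4)
    then show ?thesis using e1 by (simp add: norm_mult norm_power)
  qed
  show n2: "?n \<le> 2"
  proof (rule ccontr)
    assume "\<not> ?thesis"
    then have n: "2 < ?n" by simp
    have "?n ^ 3 \<le> 1 + cmod (1 + D ^ 3)" using norm_triangle_ineq4[of "1 + D ^ 3" 1] by (simp add: norm_power)
    moreover have "\<bar>\<kappa>\<bar> * ?n\<^sup>2 \<le> 1 / 1000 * ?n ^ 3"
    proof -
      have "?n\<^sup>2 * 1 \<le> ?n\<^sup>2 * ?n" using n by (intro mult_left_mono) auto
      then have "?n\<^sup>2 \<le> ?n ^ 3" by (simp add: power2_eq_square power3_eq_cube)
      then show ?thesis using k by (intro mult_mono) auto
    qed
    moreover have "2 ^ 3 \<le> ?n ^ 3" using n by (intro power_mono) auto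
    ultimately show False using D3 q4 by simp
  qed
  define h where "h = 4 * \<bar>\<kappa>\<bar> + 16 * q"
  have h: "0 \<le> h" "h \<le> 2 / 100" using k q unfolding h_def by auto
  have D3h: "cmod (1 + D ^ 3) \<le> h"
  proof -
    have "q * ?n ^ 4 \<le> q * 2 ^ 4" using n2 q(1) by (intro mult_left_mono power_mono) auto
    moreover have "\<bar>\<kappa>\<bar> * ?n\<^sup>2 \<le> \<bar>\<kappa>\<bar> * 2\<^sup>2" using n2 by (intro mult_left_mono power_mono) auto
    ultimately show ?thesis using D3 unfolding h_def by simp
  qed
  \<comment> \<open>Near -1 the left side of \<open>e2\<close> is about 3.\<close>
  have far: "1 / 10 \<le> cmod (D + 1)"
  proof (rule ccontr)
    assume "\<not> ?thesis"
    then have "cmod (D + 1) < 1 / 10" by simp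
    then have P: "\<bar>Re D + 1\<bar> < 1 / 10" and N: "\<bar>Im D\<bar> < 1 / 10"
      using abs_Re_le_cmod[of "D + 1"] abs_Im_le_cmod[of "D + 1"] by auto
    have "9 / 10 \<le> - Re D" using P by linarith
    then have "(9 / 10)\<^sup>2 \<le> (- Re D)\<^sup>2" by (intro power_mono) auto
    then have "81 / 100 \<le> (Re D)\<^sup>2" by (simp add: power_divide)
    moreover have "\<bar>Im D\<bar>\<^sup>2 \<le> (1 / 10)\<^sup>2" using N by (intro power_mono) auto
    then have "(Im D)\<^sup>2 \<le> 1 / 100" by (simp add: power_divide)
    moreover have "\<bar>2 * \<kappa> * Re D\<bar> \<le> 2 * (1 / 1000) * 2"
    proof -
      have "\<bar>Re D\<bar> \<le> 2" using abs_Re_le_cmod[of D] n2 by linarith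
      then show ?thesis using k by (simp only: abs_mult abs_numeral, intro mult_mono) auto
    qed
    moreover have "q * ?n ^ 3 \<le> 1 / 1000 * 2 ^ 3" using q(1,2) n2 by (intro mult_mono power_mono) auto
    ultimately show False using e2 by (simp add: abs_le_iff)
  qed
  let ?z = "Complex (1 / 2) (sqrt 3 / 2)"
  have fac: "1 + D ^ 3 = (D + 1) * ((D - cnj ?z) * (D - ?z))"
  proof -
    have "(D - cnj ?z) * (D - ?z) = D\<^sup>2 - D + 1"
      by (simp add: complex_eq_iff power2_eq_square algebra_simps)
    moreover have "1 + D ^ 3 = (D + 1) * (D\<^sup>2 - D + 1)" by (simp add: power2_eq_square power3_eq_cube algebra_simps)
    ultimately show ?thesis by simp
  qed
  \<comment> \<open>With the distance 1/10 from -1, the distance 86/100 from the conjugate root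
    yields the constant 12 in the conclusion.\<close>
  have s3: "86 / 100 \<le> sqrt 3 / 2" using real_le_rsqrt[of "172 / 100" 3] by (simp add: power2_eq_square)
  have "Im (D - cnj ?z) \<le> cmod (D - cnj ?z)" using abs_Im_le_cmod[of "D - cnj ?z"] by simp
  then have "86 / 100 \<le> cmod (D - cnj ?z)" using Im s3 by simp
  then have "1 / 10 * (86 / 100) \<le> cmod (D + 1) * cmod (D - cnj ?z)" using far by (intro mult_mono) auto
  then have "1 / 10 * (86 / 100) * cmod (D - ?z) \<le> cmod (D + 1) * cmod (D - cnj ?z) * cmod (D - ?z)"
    by (intro mult_right_mono) auto
  also have "\<dots> = cmod (1 + D ^ 3)" unfolding fac norm_mult by simp
  finally have "cmod (D - ?z) \<le> 12 * h" using D3h h by simp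
  then show "\<bar>Im D - sqrt 3 / 2\<bar> \<le> 12 * (4 * \<bar>\<kappa>\<bar> + 16 * q)"
    using abs_Im_le_cmod[of "D - ?z"] unfolding h_def by simp
qed

text \<open>Scaling \<open>d = \<kappa> D\<close>, \<open>X = j4 \<kappa>^3 Y\<close> with
  \<open>\<kappa> = j3 / j4\<close>, the length at which quadratic and cubic terms balance, reduces
  to the first normal form. The last smallness condition says
  \<open>|Y| \<le> 1 / 100\<close>.\<close>

lemma edge_cubic_pos:
  fixes d :: complex and j3 j4 X C :: real
  assumes j: "0 < j3" "0 < j4" and C: "0 \<le> C" and Im: "0 \<le> Im d"
    and e1: "cmod (of_real X + of_real j3 * d\<^sup>2 + of_real j4 * d ^ 3) \<le> C * cmod d ^ 4"
    and e2: "2 * j3 * Re d + j4 * (3 * (Re d)\<^sup>2 - (Im d)\<^sup>2) \<le> C * cmod d ^ 3"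
    and e3: "0 < Im d \<Longrightarrow> - (C * cmod d ^ 3) \<le> 2 * j3 * Re d + j4 * (3 * (Re d)\<^sup>2 - (Im d)\<^sup>2)"
    and small: "100 * C * cmod d \<le> j4" "C * j3 \<le> j4\<^sup>2" "100 * j4\<^sup>2 * \<bar>X\<bar> \<le> j3 ^ 3"
  shows "X < 0 \<Longrightarrow> Im d = 0" "(cmod d)\<^sup>2 \<le> 4 * (\<bar>X\<bar> / j3)"
    "0 \<le> X \<Longrightarrow> \<bar>Im d - sqrt (X / j3)\<bar> \<le> 192 * sqrt (X / j3) ^ 3 * (j4 / j3)\<^sup>2"
proof -
  define \<kappa> where "\<kappa> = j3 / j4"
  have \<kappa>: "0 < \<kappa>" and j3: "j3 = j4 * \<kappa>" using j unfolding \<kappa>_def by auto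
  define D where "D = d / of_real \<kappa>"
  have d: "d = of_real \<kappa> * D" using \<kappa> unfolding D_def by simp
  define Y where "Y = X / (j4 * \<kappa> ^ 3)"
  have X: "X = j4 * \<kappa> ^ 3 * Y" using \<kappa> j unfolding Y_def by simp
  have nd: "cmod d = \<kappa> * cmod D" and Rd: "Re d = \<kappa> * Re D" and Id: "Im d = \<kappa> * Im D"
    unfolding d using \<kappa> by (simp_all add: norm_mult)
  have I: "0 \<le> Im D" "0 < Im D \<longleftrightarrow> 0 < Im d" "Im D = 0 \<longleftrightarrow> Im d = 0"
    using Im \<kappa> unfolding Id by (auto simp: zero_le_mult_iff zero_less_mult_iff)
  have "X < 0 \<longleftrightarrow> Y < 0" "0 \<le> X \<longleftrightarrow> 0 \<le> Y"
  proof -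
    define c where "c = j4 * \<kappa> ^ 3"
    have "0 < c" using \<kappa> j unfolding c_def by simp
    then show "X < 0 \<longleftrightarrow> Y < 0" "0 \<le> X \<longleftrightarrow> 0 \<le> Y"
      unfolding X c_def[symmetric] by (auto simp: mult_less_0_iff zero_le_mult_iff)
  qed
  moreover have "X / j3 = \<kappa>\<^sup>2 * Y" "\<bar>X\<bar> / j3 = \<kappa>\<^sup>2 * \<bar>Y\<bar>"
    unfolding X j3 using \<kappa> j by (simp_all add: abs_mult power2_eq_square power3_eq_cube)
  ultimately have Xs: "X < 0 \<longleftrightarrow> Y < 0" "0 \<le> X \<longleftrightarrow> 0 \<le> Y" "X / j3 = \<kappa>\<^sup>2 * Y" "\<bar>X\<bar> / j3 = \<kappa>\<^sup>2 * \<bar>Y\<bar>"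
    by auto
  have Y: "\<bar>Y\<bar> \<le> 1 / 100"
  proof -
    have "j3 ^ 3 = j4\<^sup>2 * (j4 * \<kappa> ^ 3)" unfolding j3 by (simp add: power2_eq_square power3_eq_cube mult_ac)
    then have "j4\<^sup>2 * (100 * \<bar>X\<bar>) \<le> j4\<^sup>2 * (j4 * \<kappa> ^ 3)" using small(3) by (simp add: mult_ac)
    then have "100 * \<bar>X\<bar> \<le> j4 * \<kappa> ^ 3" using j by simp
    then have "j4 * \<kappa> ^ 3 * (100 * \<bar>Y\<bar>) \<le> j4 * \<kappa> ^ 3 * 1" unfolding X using \<kappa> j by (simp add: abs_mult mult_ac)
    then show ?thesis using \<kappa> j by (subst (asm) mult_le_cancel_left_pos) auto
  qed
  define e where "e = cmod (of_real Y + D\<^sup>2 + D ^ 3)"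
  have "of_real X + of_real j3 * d\<^sup>2 + of_real j4 * d ^ 3 = of_real (j4 * \<kappa> ^ 3) * (of_real Y + D\<^sup>2 + D ^ 3)"
    unfolding X j3 d by (simp add: power2_eq_square power3_eq_cube algebra_simps)
  then have "cmod (of_real X + of_real j3 * d\<^sup>2 + of_real j4 * d ^ 3) = j4 * \<kappa> ^ 3 * e"
    unfolding e_def norm_mult using \<kappa> j by (simp add: norm_mult norm_power)
  then have E1: "j4 * \<kappa> ^ 3 * e \<le> C * cmod d ^ 4" using e1 by simp
  have "C * cmod d ^ 4 = C * cmod d * (\<kappa> ^ 3 * cmod D ^ 3)"
    unfolding nd by (simp add: power3_eq_cube power4_eq_xxxx mult_ac)
  also have "\<dots> \<le> j4 / 100 * (\<kappa> ^ 3 * cmod D ^ 3)"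
    using small(1) \<kappa> by (intro mult_right_mono) auto
  finally have "j4 * \<kappa> ^ 3 * e \<le> j4 * \<kappa> ^ 3 * (cmod D ^ 3 / 100)" using E1 by (simp add: mult_ac)
  then have h1: "e \<le> cmod D ^ 3 / 100" using \<kappa> j by (subst (asm) mult_le_cancel_left_pos) auto
  have "C * cmod d ^ 4 = C * \<kappa> * (\<kappa> ^ 3 * cmod D ^ 4)"
    unfolding nd by (simp add: power3_eq_cube power4_eq_xxxx mult_ac)
  also have "C * \<kappa> \<le> j4" using small(2) j unfolding j3 by (simp add: power2_eq_square mult_ac)
  then have "C * \<kappa> * (\<kappa> ^ 3 * cmod D ^ 4) \<le> j4 * (\<kappa> ^ 3 * cmod D ^ 4)" using \<kappa> by (intro mult_right_mono) auto
  finally have "j4 * \<kappa> ^ 3 * e \<le> j4 * \<kappa> ^ 3 * cmod D ^ 4" using E1 by (simp add: mult_ac)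
  then have h1': "e \<le> cmod D ^ 4" using \<kappa> j by (subst (asm) mult_le_cancel_left_pos) auto
  define g where "g = 2 * Re D + 3 * (Re D)\<^sup>2 - (Im D)\<^sup>2"
  have G: "2 * j3 * Re d + j4 * (3 * (Re d)\<^sup>2 - (Im d)\<^sup>2) = j4 * \<kappa>\<^sup>2 * g"
    unfolding j3 Rd Id g_def by (simp add: power2_eq_square algebra_simps)
  have "C * cmod d ^ 3 = C * cmod d * (\<kappa>\<^sup>2 * (cmod D)\<^sup>2)"
    unfolding nd by (simp add: power3_eq_cube power2_eq_square mult_ac)
  also have "\<dots> \<le> j4 / 100 * (\<kappa>\<^sup>2 * (cmod D)\<^sup>2)"
    using small(1) by (intro mult_right_mono) auto
  finally have C3: "C * cmod d ^ 3 \<le> j4 * \<kappa>\<^sup>2 * ((cmod D)\<^sup>2 / 100)" by (simp add: mult_ac)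
  have "j4 * \<kappa>\<^sup>2 * g \<le> j4 * \<kappa>\<^sup>2 * ((cmod D)\<^sup>2 / 100)" using e2 C3 unfolding G by linarith
  then have h2: "g \<le> (cmod D)\<^sup>2 / 100" using \<kappa> j by (subst (asm) mult_le_cancel_left_pos) auto
  have h3: "- ((cmod D)\<^sup>2 / 100) \<le> g" if "0 < Im D"
  proof -
    have "j4 * \<kappa>\<^sup>2 * (- ((cmod D)\<^sup>2 / 100)) \<le> j4 * \<kappa>\<^sup>2 * g" using e3 that C3 unfolding G I(2) by simp
    then show ?thesis using \<kappa> j by (subst (asm) mult_le_cancel_left_pos) auto
  qed
  note R = cubic_root_small[OF I(1) Y h1[unfolded e_def] h1'[unfolded e_def] h2[unfolded g_def] h3[unfolded g_def]]
  show "X < 0 \<Longrightarrow> Im d = 0" using R(1) Xs I by simp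
  have "\<kappa>\<^sup>2 * (cmod D)\<^sup>2 \<le> \<kappa>\<^sup>2 * (4 * \<bar>Y\<bar>)" using R(2) by (intro mult_left_mono) auto
  then show "(cmod d)\<^sup>2 \<le> 4 * (\<bar>X\<bar> / j3)" unfolding Xs(4) nd by (simp add: power_mult_distrib mult_ac)
  assume X0: "0 \<le> X"
  have sq: "sqrt (X / j3) = \<kappa> * sqrt Y" unfolding Xs(3) using \<kappa> by (simp add: real_sqrt_mult)
  have "\<bar>Im d - sqrt (X / j3)\<bar> = \<kappa> * \<bar>Im D - sqrt Y\<bar>"
    unfolding Id sq using \<kappa> by (simp add: abs_mult flip: right_diff_distrib)
  also have "\<dots> \<le> \<kappa> * (192 * sqrt Y ^ 3)" using R(3) X0 Xs \<kappa> by (intro mult_left_mono) auto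
  also have "\<dots> = 192 * sqrt (X / j3) ^ 3 * (j4 / j3)\<^sup>2"
  proof -
    have "(j4 / j3)\<^sup>2 = 1 / \<kappa>\<^sup>2" unfolding j3 using \<kappa> j by (simp add: power_divide power_mult_distrib)
    then show ?thesis unfolding sq using \<kappa> by (simp add: power_mult_distrib power2_eq_square power3_eq_cube)
  qed
  finally show "\<bar>Im d - sqrt (X / j3)\<bar> \<le> 192 * sqrt (X / j3) ^ 3 * (j4 / j3)\<^sup>2" .
qed

lemma edge_cubic:
  fixes d :: complex and j3 j4 X C :: real
  assumes j: "j3 \<noteq> 0" "0 < j4" and C: "0 \<le> C" and Im: "0 \<le> Im d"
    and e1: "cmod (of_real X + of_real j3 * d\<^sup>2 + of_real j4 * d ^ 3) \<le> C * cmod d ^ 4"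
    and e2: "2 * j3 * Re d + j4 * (3 * (Re d)\<^sup>2 - (Im d)\<^sup>2) \<le> C * cmod d ^ 3"
    and e3: "0 < Im d \<Longrightarrow> - (C * cmod d ^ 3) \<le> 2 * j3 * Re d + j4 * (3 * (Re d)\<^sup>2 - (Im d)\<^sup>2)"
    and small: "100 * C * cmod d \<le> j4" "C * \<bar>j3\<bar> \<le> j4\<^sup>2" "100 * j4\<^sup>2 * \<bar>X\<bar> \<le> \<bar>j3\<bar> ^ 3"
  shows "sgn j3 * X < 0 \<Longrightarrow> Im d = 0" "(cmod d)\<^sup>2 \<le> 4 * (\<bar>X\<bar> / \<bar>j3\<bar>)"
    "0 \<le> sgn j3 * X \<Longrightarrow>
      \<bar>Im d - sqrt (sgn j3 * X / \<bar>j3\<bar>)\<bar> \<le> 192 * sqrt (sgn j3 * X / \<bar>j3\<bar>) ^ 3 * (j4 / j3)\<^sup>2"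
proof -
  consider "0 < j3" | "j3 < 0" using j by linarith
  then have "(sgn j3 * X < 0 \<longrightarrow> Im d = 0) \<and> (cmod d)\<^sup>2 \<le> 4 * (\<bar>X\<bar> / \<bar>j3\<bar>) \<and> (0 \<le> sgn j3 * X \<longrightarrow>
      \<bar>Im d - sqrt (sgn j3 * X / \<bar>j3\<bar>)\<bar> \<le> 192 * sqrt (sgn j3 * X / \<bar>j3\<bar>) ^ 3 * (j4 / j3)\<^sup>2)"
  proof cases
    case 1
    then show ?thesis using edge_cubic_pos[OF 1 j(2) C Im e1 e2 e3] small by auto
  next
    case 2
    have "of_real (- X) + of_real (- j3) * (- cnj d)\<^sup>2 + of_real j4 * (- cnj d) ^ 3 =
        - cnj (of_real X + of_real j3 * d\<^sup>2 + of_real j4 * d ^ 3)" by simp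
    then have e1': "cmod (of_real (- X) + of_real (- j3) * (- cnj d)\<^sup>2 + of_real j4 * (- cnj d) ^ 3) \<le> C * cmod (- cnj d) ^ 4"
      using e1 by (metis complex_mod_cnj norm_minus_cancel)
    have p: "0 < - j3" "0 \<le> Im (- cnj d)" using 2 Im by auto
    have e2': "2 * (- j3) * Re (- cnj d) + j4 * (3 * (Re (- cnj d))\<^sup>2 - (Im (- cnj d))\<^sup>2) \<le> C * cmod (- cnj d) ^ 3"
      using e2 by simp
    have e3': "0 < Im (- cnj d) \<Longrightarrow> - (C * cmod (- cnj d) ^ 3) \<le> 2 * (- j3) * Re (- cnj d) + j4 * (3 * (Re (- cnj d))\<^sup>2 - (Im (- cnj d))\<^sup>2)"
      using e3 by simp
    from edge_cubic_pos[OF p(1) j(2) C p(2) e1' e2' e3'] small 2 show ?thesis by auto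
  qed
  then show "sgn j3 * X < 0 \<Longrightarrow> Im d = 0" "(cmod d)\<^sup>2 \<le> 4 * (\<bar>X\<bar> / \<bar>j3\<bar>)"
    "0 \<le> sgn j3 * X \<Longrightarrow>
      \<bar>Im d - sqrt (sgn j3 * X / \<bar>j3\<bar>)\<bar> \<le> 192 * sqrt (sgn j3 * X / \<bar>j3\<bar>) ^ 3 * (j4 / j3)\<^sup>2" by auto
qed

text \<open>Here the unit of length is \<open>R\<close>, determined by \<open>|X| = j4 R^3\<close>;
  the quadratic term becomes the small coefficient \<open>\<kappa> = j3 / (j4 R)\<close>.\<close>

lemma edge_cuberoot_pos:
  fixes d :: complex and j3 j4 R C :: real
  assumes R: "0 < R" and j: "0 < j4" and C: "0 \<le> C" and Im: "0 \<le> Im d"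
    and e1: "cmod (of_real (j4 * R ^ 3) + of_real j3 * d\<^sup>2 + of_real j4 * d ^ 3) \<le> C * cmod d ^ 4"
    and e2: "2 * j3 * Re d + j4 * (3 * (Re d)\<^sup>2 - (Im d)\<^sup>2) \<le> C * cmod d ^ 3"
    and small: "1000 * C * cmod d \<le> j4" "1000 * C * R \<le> j4" "1000 * \<bar>j3\<bar> \<le> j4 * R"
  shows "cmod d \<le> 2 * R" "\<bar>Im d - sqrt 3 / 2 * R\<bar> \<le> 12 * (4 * (\<bar>j3\<bar> / j4) + 16 * (C * R\<^sup>2 / j4))"
proof -
  define \<kappa> where "\<kappa> = j3 / (j4 * R)"
  have j3: "j3 = j4 * R * \<kappa>" using j R unfolding \<kappa>_def by simp
  define D where "D = d / of_real R"
  have d: "d = of_real R * D" using R unfolding D_def by simp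
  define q where "q = C * R / j4"
  have Cq: "C * R = q * j4" using j unfolding q_def by simp
  have nd: "cmod d = R * cmod D" and Rd: "Re d = R * Re D" and Id: "Im d = R * Im D"
    unfolding d using R by (simp_all add: norm_mult)
  have I: "0 \<le> Im D" using Im R unfolding Id by (simp add: zero_le_mult_iff)
  have k: "\<bar>\<kappa>\<bar> \<le> 1 / 1000" using small(3) j R unfolding \<kappa>_def by (simp add: abs_mult divide_simps)
  have q: "0 \<le> q" "q \<le> 1 / 1000" "q * cmod D \<le> 1 / 1000"
  proof -
    show "0 \<le> q" "q \<le> 1 / 1000" using C R j small(2) unfolding q_def by (auto simp: divide_simps)
    have "1000 * C * cmod d = 1000 * (C * R) * cmod D" unfolding nd by simp
    then have "1000 * (q * cmod D) * j4 \<le> 1 * j4" using small(1) unfolding Cq by (simp add: mult_ac)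
    then show "q * cmod D \<le> 1 / 1000" using j by (subst (asm) mult_le_cancel_right_pos) auto
  qed
  have "of_real (j4 * R ^ 3) + of_real j3 * d\<^sup>2 + of_real j4 * d ^ 3 = of_real (j4 * R ^ 3) * (1 + of_real \<kappa> * D\<^sup>2 + D ^ 3)"
    unfolding j3 d by (simp add: power2_eq_square power3_eq_cube algebra_simps)
  then have "cmod (of_real (j4 * R ^ 3) + of_real j3 * d\<^sup>2 + of_real j4 * d ^ 3) = j4 * R ^ 3 * cmod (1 + of_real \<kappa> * D\<^sup>2 + D ^ 3)"
    unfolding norm_mult using R j by (simp add: norm_mult norm_power)
  moreover have "C * cmod d ^ 4 = C * R * (R ^ 3 * cmod D ^ 4)"
    unfolding nd by (simp add: power3_eq_cube power4_eq_xxxx mult_ac)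
  then have "C * cmod d ^ 4 = j4 * R ^ 3 * (q * cmod D ^ 4)" unfolding Cq by (simp add: mult_ac)
  ultimately have h1: "cmod (1 + of_real \<kappa> * D\<^sup>2 + D ^ 3) \<le> q * cmod D ^ 4"
    using e1 R j by (simp add: mult_le_cancel_left_pos)
  have G: "2 * j3 * Re d + j4 * (3 * (Re d)\<^sup>2 - (Im d)\<^sup>2) = j4 * R\<^sup>2 * (2 * \<kappa> * Re D + 3 * (Re D)\<^sup>2 - (Im D)\<^sup>2)"
    unfolding j3 Rd Id by (simp add: power2_eq_square algebra_simps)
  have "C * cmod d ^ 3 = C * R * (R\<^sup>2 * cmod D ^ 3)"
    unfolding nd by (simp add: power3_eq_cube power2_eq_square mult_ac)
  then have "C * cmod d ^ 3 = j4 * R\<^sup>2 * (q * cmod D ^ 3)" unfolding Cq by (simp add: mult_ac)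
  then have h2: "2 * \<kappa> * Re D + 3 * (Re D)\<^sup>2 - (Im D)\<^sup>2 \<le> q * cmod D ^ 3"
    using e2 R j unfolding G by (simp add: mult_le_cancel_left_pos)
  note S = cube_root_selection_pos[OF I k q h1 h2]
  show "cmod d \<le> 2 * R" using S(1) R unfolding nd by (simp add: mult.commute)
  have "Im d - sqrt 3 / 2 * R = R * (Im D - sqrt 3 / 2)"
    unfolding Id by (simp add: algebra_simps)
  then have "\<bar>Im d - sqrt 3 / 2 * R\<bar> = R * \<bar>Im D - sqrt 3 / 2\<bar>"
    using R by (simp add: abs_mult)
  also have "\<dots> \<le> R * (12 * (4 * \<bar>\<kappa>\<bar> + 16 * q))" using S(2) R by (intro mult_left_mono) auto
  also have "\<dots> = 12 * (4 * (\<bar>j3\<bar> / j4) + 16 * (C * R\<^sup>2 / j4))"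
    unfolding \<kappa>_def q_def using R j by (simp add: abs_mult power2_eq_square algebra_simps)
  finally show "\<bar>Im d - sqrt 3 / 2 * R\<bar> \<le> 12 * (4 * (\<bar>j3\<bar> / j4) + 16 * (C * R\<^sup>2 / j4))" .
qed

lemma edge_cuberoot:
  fixes d :: complex and j3 j4 X R C :: real
  assumes R: "0 < R" "\<bar>X\<bar> = j4 * R ^ 3" and j: "0 < j4" and C: "0 \<le> C" and Im: "0 \<le> Im d"
    and e1: "cmod (of_real X + of_real j3 * d\<^sup>2 + of_real j4 * d ^ 3) \<le> C * cmod d ^ 4"
    and e2: "2 * j3 * Re d + j4 * (3 * (Re d)\<^sup>2 - (Im d)\<^sup>2) \<le> C * cmod d ^ 3"
    and small: "1000 * C * cmod d \<le> j4" "1000 * C * R \<le> j4" "1000 * \<bar>j3\<bar> \<le> j4 * R"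
  shows "cmod d \<le> 2 * R" "\<bar>Im d - sqrt 3 / 2 * R\<bar> \<le> 12 * (4 * (\<bar>j3\<bar> / j4) + 16 * (C * R\<^sup>2 / j4))"
proof -
  have "cmod d \<le> 2 * R \<and> \<bar>Im d - sqrt 3 / 2 * R\<bar> \<le> 12 * (4 * (\<bar>j3\<bar> / j4) + 16 * (C * R\<^sup>2 / j4))"
  proof (cases "0 \<le> X")
    case True
    then have X: "X = j4 * R ^ 3" using R by simp
    show ?thesis using edge_cuberoot_pos[OF R(1) j C Im e1[unfolded X] e2 small] by simp
  next
    case False
    then have X: "X = - (j4 * R ^ 3)" using R by simp
    have "of_real (j4 * R ^ 3) + of_real (- j3) * (- cnj d)\<^sup>2 + of_real j4 * (- cnj d) ^ 3 =
        - cnj (of_real X + of_real j3 * d\<^sup>2 + of_real j4 * d ^ 3)" unfolding X by simp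
    then have e1': "cmod (of_real (j4 * R ^ 3) + of_real (- j3) * (- cnj d)\<^sup>2 + of_real j4 * (- cnj d) ^ 3) \<le> C * cmod (- cnj d) ^ 4"
      using e1 by (metis complex_mod_cnj norm_minus_cancel)
    have p: "0 \<le> Im (- cnj d)" using Im by auto
    have e2': "2 * (- j3) * Re (- cnj d) + j4 * (3 * (Re (- cnj d))\<^sup>2 - (Im (- cnj d))\<^sup>2) \<le> C * cmod (- cnj d) ^ 3"
      using e2 by simp
    have "1000 * C * cmod (- cnj d) \<le> j4" "1000 * \<bar>- j3\<bar> \<le> j4 * R" using small by auto
    from edge_cuberoot_pos[OF R(1) j C p e1' e2' this(1) small(2) this(2)] show ?thesis by simp
  qed
  then show "cmod d \<le> 2 * R" "\<bar>Im d - sqrt 3 / 2 * R\<bar> \<le> 12 * (4 * (\<bar>j3\<bar> / j4) + 16 * (C * R\<^sup>2 / j4))" by auto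
qed

section \<open>Expansion at an isolated point\<close>

definition moment :: "real measure \<Rightarrow> nat \<Rightarrow> real \<Rightarrow> real" where
  "moment N k y = (\<integral>u. 1 / (u - y) ^ k \<partial>N)"

lemma inverse_geometric_remainder:
  fixes v d :: complex
  assumes "v \<noteq> 0" "v \<noteq> d"
  shows "1 / (v - d) - (\<Sum>k<n. d ^ k / v ^ (k + 1)) = d ^ n / (v ^ n * (v - d))"
proof (induction n)
  case (Suc n)
  have "1 / (v - d) - (\<Sum>k<Suc n. d ^ k / v ^ (k + 1)) = d ^ n / (v ^ n * (v - d)) - d ^ n / v ^ (n + 1)"
    using Suc by simp
  also have "\<dots> = d ^ Suc n / (v ^ Suc n * (v - d))" using assms by (simp add: divide_simps) (simp add: algebra_simps)
  finally show ?case .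
qed simp

text \<open>Compare \<open>1 / (1 - x)\<close> with \<open>S = 1 + x + x^2\<close>. The terms of
  \<open>|S|^2\<close> up to second order are those displayed, since
  \<open>|x|^2 + 2 Re (x^2) = 3 (Re x)^2 - (Im x)^2\<close>.\<close>

lemma inverse_square_expansion:
  fixes x :: complex
  assumes "cmod x \<le> 1 / 2"
  shows "\<bar>1 / (cmod (1 - x))\<^sup>2 - (1 + 2 * Re x + (3 * (Re x)\<^sup>2 - (Im x)\<^sup>2))\<bar> \<le> 11 * cmod x ^ 3"
proof -
  define A S where "A = 1 / (1 - x)" and "S = 1 + x + x\<^sup>2"
  have ge: "1 / 2 \<le> cmod (1 - x)" using norm_triangle_ineq2[of 1 x] assms by simp
  then have nz: "1 - x \<noteq> 0" by auto
  have A2: "cmod A \<le> 2" using ge nz unfolding A_def by (simp add: norm_divide field_simps)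
  have S2: "cmod S \<le> 2"
  proof -
    have "cmod S \<le> 1 + cmod x + cmod x ^ 2" unfolding S_def
      by (rule order_trans[OF norm_triangle_ineq add_mono[OF order_trans[OF norm_triangle_ineq]]]) (auto simp: norm_power)
    moreover have "cmod x ^ 2 \<le> (1 / 2)\<^sup>2" using assms by (intro power_mono) auto
    ultimately show ?thesis using assms by (simp add: power_divide)
  qed
  have "A - S = x ^ 3 * A" unfolding A_def S_def using nz by (simp add: divide_simps power2_eq_square power3_eq_cube) (simp add: algebra_simps)
  then have AS: "cmod (A - S) \<le> 2 * cmod x ^ 3" using mult_left_mono[OF A2, of "cmod x ^ 3"] by (simp add: norm_mult norm_power)
  have "\<bar>(cmod A)\<^sup>2 - (cmod S)\<^sup>2\<bar> = \<bar>cmod A - cmod S\<bar> * (cmod A + cmod S)"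
    by (simp add: abs_mult power2_eq_square square_diff_square_factored)
  also have "\<dots> \<le> 2 * cmod x ^ 3 * 4"
    using AS norm_triangle_ineq3[of A S] A2 S2 by (intro mult_mono) auto
  finally have d1: "\<bar>(cmod A)\<^sup>2 - (cmod S)\<^sup>2\<bar> \<le> 8 * cmod x ^ 3" by simp
  have "(cmod S)\<^sup>2 = (1 + 2 * Re x + (3 * (Re x)\<^sup>2 - (Im x)\<^sup>2)) + (2 * (cmod x)\<^sup>2 * Re x + (cmod x)\<^sup>2 * (cmod x)\<^sup>2)"
    unfolding cmod_power2 S_def by (simp add: power2_eq_square algebra_simps)
  moreover have "\<bar>2 * (cmod x)\<^sup>2 * Re x + (cmod x)\<^sup>2 * (cmod x)\<^sup>2\<bar> \<le> 3 * cmod x ^ 3"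
  proof -
    have "\<bar>2 * (cmod x)\<^sup>2 * Re x\<bar> \<le> 2 * (cmod x)\<^sup>2 * cmod x"
      using abs_Re_le_cmod[of x] by (simp add: abs_mult mult_left_mono)
    moreover have "(cmod x)\<^sup>2 * (cmod x * cmod x) \<le> (cmod x)\<^sup>2 * (1 * cmod x)"
      using assms by (intro mult_left_mono mult_right_mono) auto
    moreover have "0 \<le> (cmod x)\<^sup>2 * (cmod x * cmod x)" by simp
    moreover have "(cmod x)\<^sup>2 * cmod x = cmod x ^ 3" by (simp add: power2_eq_square power3_eq_cube)
    moreover have "(cmod x)\<^sup>2 * (cmod x * cmod x) = (cmod x)\<^sup>2 * (cmod x)\<^sup>2" by (simp add: power2_eq_square)
    ultimately show ?thesis using abs_triangle_ineq[of "2 * (cmod x)\<^sup>2 * Re x" "(cmod x)\<^sup>2 * (cmod x)\<^sup>2"] by simp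
  qed
  moreover have "1 / (cmod (1 - x))\<^sup>2 = (cmod A)\<^sup>2" unfolding A_def by (simp add: norm_divide power_divide)
  ultimately show ?thesis using d1 by linarith
qed

lemma inverse_power_expansions:
  fixes x :: real
  assumes "\<bar>x\<bar> \<le> 1 / 2"
  shows "\<bar>1 / (1 - x) ^ 2 - 1\<bar> \<le> 10 * \<bar>x\<bar>"
    "\<bar>1 / (1 - x) ^ 3 - 1 - 3 * x\<bar> \<le> 90 * x\<^sup>2"
    "\<bar>1 / (1 - x) ^ 4 - 1\<bar> \<le> 136 * \<bar>x\<bar>"
proof -
  have b: "1 / 2 \<le> 1 - x" using assms by linarith
  define I where "I = 1 / (1 - x)"
  have I: "0 \<le> I" "I \<le> 2" using b unfolding I_def by (auto simp: divide_simps)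
  have I1: "I * (1 - x) = 1" using b unfolding I_def by simp
  have Ip: "I ^ k \<le> 2 ^ k" for k using I by (intro power_mono) auto
  have P: "1 / (1 - x) ^ k = I ^ k" for k unfolding I_def by (simp add: power_divide)
  have x2: "x\<^sup>2 \<le> 1 / 4" using assms power_mono[of "\<bar>x\<bar>" "1 / 2" 2] by (simp add: power_divide)
  have x3: "\<bar>x ^ 3\<bar> \<le> 1 / 8" using assms power_mono[of "\<bar>x\<bar>" "1 / 2" 3] by (simp add: power_divide power_abs)
  have "I ^ 2 - 1 = I ^ 2 * (1 - (1 - x) ^ 2)" using I1 by (simp add: right_diff_distrib flip: power_mult_distrib)
  also have "\<dots> = I ^ 2 * (x * (2 - x))" by (simp add: power2_eq_square algebra_simps)
  finally have "\<bar>I ^ 2 - 1\<bar> = I ^ 2 * (\<bar>x\<bar> * \<bar>2 - x\<bar>)" by (simp add: abs_mult)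
  also have "\<dots> \<le> 2 ^ 2 * (\<bar>x\<bar> * (5 / 2))" using assms by (intro mult_mono Ip) auto
  finally show "\<bar>1 / (1 - x) ^ 2 - 1\<bar> \<le> 10 * \<bar>x\<bar>" unfolding P by simp
  have "I ^ 3 - 1 - 3 * x = I ^ 3 * (1 - (1 + 3 * x) * (1 - x) ^ 3)"
  proof -
    have "I ^ 3 * (1 - x) ^ 3 = 1" using I1 by (simp flip: power_mult_distrib)
    moreover have "I ^ 3 * (1 - (1 + 3 * x) * (1 - x) ^ 3) = I ^ 3 - (1 + 3 * x) * (I ^ 3 * (1 - x) ^ 3)"
      by (simp only: right_diff_distrib mult_1_right mult.assoc mult.left_commute)
    ultimately show ?thesis by simp
  qed
  also have "1 - (1 + 3 * x) * (1 - x) ^ 3 = x\<^sup>2 * (6 - 8 * x + 3 * x\<^sup>2)"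
    by (simp add: power2_eq_square power3_eq_cube algebra_simps)
  finally have "\<bar>I ^ 3 - 1 - 3 * x\<bar> = I ^ 3 * (x\<^sup>2 * \<bar>6 - 8 * x + 3 * x\<^sup>2\<bar>)" using I by (simp add: abs_mult)
  also have "\<dots> \<le> 2 ^ 3 * (x\<^sup>2 * (43 / 4))"
    using assms x2 I zero_le_power2[of x] by (intro mult_mono Ip) (auto simp: abs_le_iff)
  also have "\<dots> \<le> 90 * x\<^sup>2" by simp
  finally show "\<bar>1 / (1 - x) ^ 3 - 1 - 3 * x\<bar> \<le> 90 * x\<^sup>2" unfolding P .
  have "I ^ 4 - 1 = I ^ 4 * (1 - (1 - x) ^ 4)" using I1 by (simp add: right_diff_distrib flip: power_mult_distrib)
  also have "1 - (1 - x) ^ 4 = x * (4 - 6 * x + 4 * x\<^sup>2 - x ^ 3)"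
    by (simp add: power2_eq_square power3_eq_cube power4_eq_xxxx algebra_simps)
  finally have "\<bar>I ^ 4 - 1\<bar> = I ^ 4 * (\<bar>x\<bar> * \<bar>4 - 6 * x + 4 * x\<^sup>2 - x ^ 3\<bar>)" using I by (simp add: abs_mult)
  also have "\<dots> \<le> 2 ^ 4 * (\<bar>x\<bar> * (17 / 2))"
  proof (intro mult_mono Ip)
    show "\<bar>4 - 6 * x + 4 * x\<^sup>2 - x ^ 3\<bar> \<le> 17 / 2"
      using assms x2 x3 zero_le_power2[of x] by linarith
  qed (use I in auto)
  finally show "\<bar>1 / (1 - x) ^ 4 - 1\<bar> \<le> 136 * \<bar>x\<bar>" unfolding P by simp
qed

lemma cmod_real_diff: "cmod (of_real u - of_real w) = \<bar>u - w\<bar>"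
  by (metis norm_of_real of_real_diff)

context finite_borel_measure
begin

lemma norm_integral_le:
  fixes f :: "real \<Rightarrow> 'b :: {banach, second_countable_topology}"
  assumes "f \<in> borel_measurable M" "AE u in M. norm (f u) \<le> B"
  shows "integrable M f" "norm (integral\<^sup>L M f) \<le> B * measure M (space M)"
proof -
  show int: "integrable M f" using assms by (intro integrable_const_bound)
  have "norm (integral\<^sup>L M f) \<le> (\<integral>u. norm (f u) \<partial>M)" by (rule integral_norm_bound)
  also have "\<dots> \<le> (\<integral>u. B \<partial>M)" using assms int by (intro integral_mono_AE) auto
  finally show "norm (integral\<^sup>L M f) \<le> B * measure M (space M)" by (simp add: mult.commute)
qed

lemma moment_integrable:
  assumes r: "0 < r" and g: "AE u in M. r \<le> \<bar>u - w\<bar>"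
  shows "integrable M (\<lambda>u. 1 / (u - w) ^ k)"
proof (rule norm_integral_le(1)[of _ "1 / r ^ k"])
  show "AE u in M. norm (1 / (u - w) ^ k) \<le> 1 / r ^ k"
    using g
  proof eventually_elim
    case (elim u)
    then show ?case using r by (simp add: power_abs frac_le power_mono)
  qed
qed measurable

lemma gap_ne: "0 < r \<Longrightarrow> AE u in M. r \<le> \<bar>u - w\<bar> \<Longrightarrow> AE u in M. u \<noteq> w"
  by (elim eventually_mono) auto

lemma sqpot_gap:
  assumes r: "0 < r" and g: "AE u in M. r \<le> \<bar>u - w\<bar>"
  shows "sqpot M (of_real w) < \<infinity>" "sqint M (of_real w) = moment M 2 w"
    "stieltjes M (of_real w) = of_real (moment M 1 w)"
proof -
  show "sqpot M (of_real w) < \<infinity>"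
    using g by (intro sqpot_finite_away(1)[OF r]) (simp add: cmod_real_diff)
  show "sqint M (of_real w) = moment M 2 w"
    unfolding sqint_def moment_def cmod_real_diff by simp
  show "stieltjes M (of_real w) = of_real (moment M 1 w)"
    unfolding stieltjes_of_real moment_def by simp
qed

text \<open>Integrated geometric expansion; \<open>d\<close> of size at most half the gap keeps the
  shifted denominator above \<open>r / 2\<close>.\<close>

lemma taylor_stieltjes:
  assumes r: "0 < r" and g: "AE u in M. r \<le> \<bar>u - w\<bar>" and d: "cmod d \<le> r / 2"
  shows "cmod (stieltjes M (of_real w + d) - (\<Sum>k<n. of_real (moment M (k + 1) w) * d ^ k))
    \<le> 2 * cmod d ^ n / r ^ (n + 1) * measure M (space M)"
proof -
  let ?f = "\<lambda>u. 1 / (of_real u - (of_real w + d)) - (\<Sum>k<n. of_real (1 / (u - w) ^ (k + 1)) * d ^ k)"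
  have far: "AE u in M. r / 2 \<le> cmod (of_real u - (of_real w + d)) \<and> r \<le> \<bar>u - w\<bar>"
    using g
  proof eventually_elim
    case (elim u)
    have "\<bar>u - w\<bar> \<le> cmod (of_real u - (of_real w + d)) + cmod d"
      using norm_triangle_ineq[of "of_real u - (of_real w + d)" d] cmod_real_diff[of u w] by (simp add: algebra_simps)
    then show ?case using elim d by linarith
  qed
  have i1: "integrable M (\<lambda>u. 1 / (of_real u - (of_real w + d)))"
  proof (rule norm_integral_le(1)[of _ "1 / (r / 2)"])
    show "AE u in M. norm (1 / (of_real u - (of_real w + d))) \<le> 1 / (r / 2)"
      using far
    proof eventually_elim
      case (elim u)
      have "1 / cmod (of_real u - (of_real w + d)) \<le> 1 / (r / 2)" using elim r by (intro frac_le) auto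
      then show ?case by (simp add: norm_divide)
    qed
  qed measurable
  have i2: "complex_integrable M (\<lambda>u. of_real (1 / (u - w) ^ (k + 1)) * d ^ k)" for k
    by (intro integrable_mult_left integrable_of_real moment_integrable[OF r g])
  have "(\<integral>u. ?f u \<partial>M) = stieltjes M (of_real w + d) - (\<Sum>k<n. of_real (moment M (k + 1) w) * d ^ k)"
    unfolding stieltjes_def moment_def integral_complex_of_real[symmetric]
    using i1 i2 by (simp only: Bochner_Integration.integral_diff Bochner_Integration.integrable_sum Bochner_Integration.integral_sum integral_mult_left_zero)
  moreover have "cmod (\<integral>u. ?f u \<partial>M) \<le> 2 * cmod d ^ n / r ^ (n + 1) * measure M (space M)"
  proof (rule norm_integral_le(2))
    show "AE u in M. cmod (?f u) \<le> 2 * cmod d ^ n / r ^ (n + 1)"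
      using far
    proof eventually_elim
      case (elim u)
      define v where "v = (of_real u - of_real w :: complex)"
      have v: "r \<le> cmod v" "r / 2 \<le> cmod (v - d)" using elim unfolding v_def by (auto simp: cmod_real_diff diff_diff_eq)
      have nz: "v \<noteq> 0" "v \<noteq> d" using v r by auto
      have "?f u = 1 / (v - d) - (\<Sum>k<n. d ^ k / v ^ (k + 1))"
        unfolding v_def by (simp add: diff_diff_eq)
      also have "\<dots> = d ^ n / (v ^ n * (v - d))" by (rule inverse_geometric_remainder[OF nz])
      finally have "cmod (?f u) = cmod d ^ n / (cmod v ^ n * cmod (v - d))"
        by (simp add: norm_divide norm_mult norm_power)
      also have "\<dots> \<le> cmod d ^ n / (r ^ n * (r / 2))"
        using v r by (intro divide_left_mono mult_mono power_mono mult_pos_pos zero_less_power) auto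
      also have "\<dots> = 2 * cmod d ^ n / r ^ (n + 1)" by (simp add: mult_ac)
      finally show ?case .
    qed
  qed measurable
  ultimately show ?thesis by simp
qed

lemma sqint_expand:
  assumes r: "0 < r" and g: "AE u in M. r \<le> \<bar>u - w\<bar>" and d: "cmod d \<le> r / 2"
  shows "\<bar>sqint M (of_real w + d) - (moment M 2 w + 2 * moment M 3 w * Re d + moment M 4 w * (3 * (Re d)\<^sup>2 - (Im d)\<^sup>2))\<bar>
    \<le> 11 * measure M (space M) / r ^ 5 * cmod d ^ 3"
proof -
  let ?q = "3 * (Re d)\<^sup>2 - (Im d)\<^sup>2"
  let ?f = "\<lambda>u. 1 / (cmod (of_real u - (of_real w + d)))\<^sup>2 -
      (1 / (u - w) ^ 2 + 2 * Re d * (1 / (u - w) ^ 3) + ?q * (1 / (u - w) ^ 4))"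
  have pw: "AE u in M. norm (?f u) \<le> 11 * cmod d ^ 3 / r ^ 5"
    using g
  proof eventually_elim
    case (elim u)
    define v where "v = u - w"
    have v: "r \<le> \<bar>v\<bar>" "v \<noteq> 0" using elim r unfolding v_def by auto
    define x where "x = d / of_real v"
    have x: "cmod x \<le> 1 / 2" using d v r unfolding x_def by (simp add: norm_divide divide_le_eq)
    have rx: "Re x = Re d / v" "Im x = Im d / v" unfolding x_def by simp_all
    have "of_real u - (of_real w + d) = of_real v * (1 - x)"
      unfolding x_def v_def using v unfolding v_def by (simp add: field_simps)
    then have "(cmod (of_real u - (of_real w + d)))\<^sup>2 = v\<^sup>2 * (cmod (1 - x))\<^sup>2"
      by (simp add: norm_mult power_mult_distrib)
    then have "?f u = 1 / v\<^sup>2 * (1 / (cmod (1 - x))\<^sup>2 - (1 + 2 * Re x + (3 * (Re x)\<^sup>2 - (Im x)\<^sup>2)))"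
      unfolding v_def[symmetric] rx using v(2) by (simp add: field_simps power2_eq_square power3_eq_cube power4_eq_xxxx)
    then have "norm (?f u) = 1 / v\<^sup>2 * \<bar>1 / (cmod (1 - x))\<^sup>2 - (1 + 2 * Re x + (3 * (Re x)\<^sup>2 - (Im x)\<^sup>2))\<bar>"
      by (simp add: abs_mult)
    also have "\<dots> \<le> 1 / v\<^sup>2 * (11 * cmod x ^ 3)"
      by (intro mult_left_mono inverse_square_expansion x) auto
    also have "\<dots> = 11 * cmod d ^ 3 / \<bar>v\<bar> ^ 5"
      unfolding x_def by (simp add: norm_divide power_divide eval_nat_numeral)
    also have "\<dots> \<le> 11 * cmod d ^ 3 / r ^ 5"
      using v(1) r by (intro frac_le power_mono order_refl zero_less_power) simp_all
    finally show ?case .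
  qed
  have b: "norm (\<integral>u. ?f u \<partial>M) \<le> 11 * cmod d ^ 3 / r ^ 5 * measure M (space M)"
    by (rule norm_integral_le(2)[OF _ pw]) measurable
  have fd: "integrable M ?f" by (rule norm_integral_le(1)[OF _ pw]) measurable
  have i0: "integrable M (\<lambda>u. 1 / (u - w) ^ 2 + 2 * Re d * (1 / (u - w) ^ 3) + ?q * (1 / (u - w) ^ 4))"
    by (intro Bochner_Integration.integrable_add integrable_mult_right moment_integrable[OF r g])
  have "(\<integral>u. ?f u \<partial>M) + (\<integral>u. 1 / (u - w) ^ 2 + 2 * Re d * (1 / (u - w) ^ 3) + ?q * (1 / (u - w) ^ 4) \<partial>M) = sqint M (of_real w + d)"
    unfolding sqint_def by (subst Bochner_Integration.integral_add[OF fd i0, symmetric]) simp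
  moreover have "(\<integral>u. 1 / (u - w) ^ 2 + 2 * Re d * (1 / (u - w) ^ 3) + ?q * (1 / (u - w) ^ 4) \<partial>M) =
      moment M 2 w + 2 * Re d * moment M 3 w + ?q * moment M 4 w"
    unfolding moment_def
    by (simp only: Bochner_Integration.integral_add Bochner_Integration.integrable_add integrable_mult_right moment_integrable[OF r g] integral_mult_right_zero)
  ultimately show ?thesis using b by (simp add: algebra_simps)
qed

text \<open>Dependence of the moments on the base point along the real axis, with constants that
  involve only the gap and the mass; these govern the coefficients of the moving local
  equation.\<close>

lemma moment_expand:
  assumes r: "0 < r" and g: "AE u in M. r \<le> \<bar>u - w\<bar>" and e: "\<bar>e\<bar> \<le> r / 2"
  shows "\<bar>moment M 2 (w + e) - moment M 2 w\<bar> \<le> 10 * measure M (space M) / r ^ 3 * \<bar>e\<bar>"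
    "\<bar>moment M 3 (w + e) - moment M 3 w - 3 * moment M 4 w * e\<bar> \<le> 90 * measure M (space M) / r ^ 5 * e\<^sup>2"
    "\<bar>moment M 4 (w + e) - moment M 4 w\<bar> \<le> 136 * measure M (space M) / r ^ 5 * \<bar>e\<bar>"
proof -
  have g2: "AE u in M. r / 2 \<le> \<bar>u - (w + e)\<bar>"
    using g by eventually_elim (use e in linarith)
  have r2: "0 < r / 2" using r by simp
  note int = moment_integrable[OF r g] moment_integrable[OF r2 g2]
  have pw: "AE u in M. \<exists>v x. r \<le> \<bar>v\<bar> \<and> v = u - w \<and> e = v * x \<and> \<bar>x\<bar> \<le> 1 / 2 \<and> u - (w + e) = v * (1 - x)"
    using g
  proof eventually_elim
    case (elim u)
    define v where "v = u - w"
    have v: "r \<le> \<bar>v\<bar>" "v \<noteq> 0" using elim r unfolding v_def by auto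
    have "\<bar>e / v\<bar> \<le> 1 / 2" using e v r by (simp add: abs_divide divide_le_eq)
    then show ?case using v by (intro exI[of _ v] exI[of _ "e / v"]) (auto simp: v_def field_simps)
  qed
  have F1: "AE u in M. norm (1 / (u - (w + e)) ^ 2 - 1 / (u - w) ^ 2) \<le> 10 * \<bar>e\<bar> / r ^ 3"
    using pw
  proof eventually_elim
    case (elim u)
    then obtain v x where v: "r \<le> \<bar>v\<bar>" "u - w = v" "e = v * x" "\<bar>x\<bar> \<le> 1 / 2" "u - (w + e) = v * (1 - x)" by auto
    have "1 / (u - (w + e)) ^ 2 - 1 / (u - w) ^ 2 = 1 / v ^ 2 * (1 / (1 - x) ^ 2 - 1)"
      unfolding v(2,5) power_mult_distrib by (simp add: right_diff_distrib)
    then have "norm (1 / (u - (w + e)) ^ 2 - 1 / (u - w) ^ 2) = 1 / v ^ 2 * \<bar>1 / (1 - x) ^ 2 - 1\<bar>" by (simp add: abs_mult)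
    also have "\<dots> \<le> 1 / v ^ 2 * (10 * \<bar>x\<bar>)" by (intro mult_left_mono inverse_power_expansions v(4)) auto
    also have "\<dots> = 10 * \<bar>e\<bar> / \<bar>v\<bar> ^ 3"
    proof -
      have "v \<noteq> 0" using v(1) r by auto
      moreover have "v ^ 2 * \<bar>v\<bar> = \<bar>v\<bar> ^ 3" by (simp add: eval_nat_numeral)
      ultimately show ?thesis unfolding v(3) abs_mult by (simp add: field_simps)
    qed
    also have "\<dots> \<le> 10 * \<bar>e\<bar> / r ^ 3" using v(1) r by (intro frac_le power_mono order_refl zero_less_power) simp_all
    finally show ?case .
  qed
  have F2: "AE u in M. norm (1 / (u - (w + e)) ^ 3 - 1 / (u - w) ^ 3 - 3 * e * (1 / (u - w) ^ 4)) \<le> 90 * e\<^sup>2 / r ^ 5"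
    using pw
  proof eventually_elim
    case (elim u)
    then obtain v x where v: "r \<le> \<bar>v\<bar>" "u - w = v" "e = v * x" "\<bar>x\<bar> \<le> 1 / 2" "u - (w + e) = v * (1 - x)" by auto
    have v0: "v \<noteq> 0" using v(1) r by auto
    have "3 * e * (1 / v ^ 4) = 1 / v ^ 3 * (3 * x)" unfolding v(3) using v0 by (simp add: eval_nat_numeral)
    then have "1 / (u - (w + e)) ^ 3 - 1 / (u - w) ^ 3 - 3 * e * (1 / (u - w) ^ 4) = 1 / v ^ 3 * (1 / (1 - x) ^ 3 - 1 - 3 * x)"
      unfolding v(2,5) power_mult_distrib by (simp add: right_diff_distrib)
    then have "norm (1 / (u - (w + e)) ^ 3 - 1 / (u - w) ^ 3 - 3 * e * (1 / (u - w) ^ 4)) = 1 / \<bar>v\<bar> ^ 3 * \<bar>1 / (1 - x) ^ 3 - 1 - 3 * x\<bar>"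
      by (simp add: abs_mult power_abs)
    also have "\<dots> \<le> 1 / \<bar>v\<bar> ^ 3 * (90 * x\<^sup>2)" by (intro mult_left_mono inverse_power_expansions v(4)) auto
    also have "\<dots> = 90 * e\<^sup>2 / \<bar>v\<bar> ^ 5"
    proof -
      have "e\<^sup>2 = \<bar>v\<bar>\<^sup>2 * x\<^sup>2" unfolding v(3) by (simp add: power_mult_distrib)
      then show ?thesis using v0 by (simp add: eval_nat_numeral)
    qed
    also have "\<dots> \<le> 90 * e\<^sup>2 / r ^ 5" using v(1) r by (intro frac_le power_mono order_refl zero_less_power) simp_all
    finally show ?case .
  qed
  have F3: "AE u in M. norm (1 / (u - (w + e)) ^ 4 - 1 / (u - w) ^ 4) \<le> 136 * \<bar>e\<bar> / r ^ 5"
    using pw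
  proof eventually_elim
    case (elim u)
    then obtain v x where v: "r \<le> \<bar>v\<bar>" "u - w = v" "e = v * x" "\<bar>x\<bar> \<le> 1 / 2" "u - (w + e) = v * (1 - x)" by auto
    have "1 / (u - (w + e)) ^ 4 - 1 / (u - w) ^ 4 = 1 / v ^ 4 * (1 / (1 - x) ^ 4 - 1)"
      unfolding v(2,5) power_mult_distrib by (simp add: right_diff_distrib)
    then have "norm (1 / (u - (w + e)) ^ 4 - 1 / (u - w) ^ 4) = 1 / \<bar>v\<bar> ^ 4 * \<bar>1 / (1 - x) ^ 4 - 1\<bar>" by (simp add: abs_mult)
    also have "\<dots> \<le> 1 / \<bar>v\<bar> ^ 4 * (136 * \<bar>x\<bar>)" by (intro mult_left_mono inverse_power_expansions v(4)) auto
    also have "\<dots> = 136 * \<bar>e\<bar> / \<bar>v\<bar> ^ 5"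
    proof -
      have "v \<noteq> 0" using v(1) r by auto
      moreover have "v ^ 4 * \<bar>v\<bar> = \<bar>v\<bar> ^ 5" by (simp add: eval_nat_numeral)
      ultimately show ?thesis unfolding v(3) abs_mult by (simp add: field_simps)
    qed
    also have "\<dots> \<le> 136 * \<bar>e\<bar> / r ^ 5" using v(1) r by (intro frac_le power_mono order_refl zero_less_power) simp_all
    finally show ?case .
  qed
  have "norm (\<integral>u. 1 / (u - (w + e)) ^ 2 - 1 / (u - w) ^ 2 \<partial>M) \<le> 10 * \<bar>e\<bar> / r ^ 3 * measure M (space M)"
    by (rule norm_integral_le(2)[OF _ F1]) measurable
  then show "\<bar>moment M 2 (w + e) - moment M 2 w\<bar> \<le> 10 * measure M (space M) / r ^ 3 * \<bar>e\<bar>"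
    unfolding moment_def using int by (simp add: mult_ac)
  have "norm (\<integral>u. 1 / (u - (w + e)) ^ 3 - 1 / (u - w) ^ 3 - 3 * e * (1 / (u - w) ^ 4) \<partial>M) \<le> 90 * e\<^sup>2 / r ^ 5 * measure M (space M)"
    by (rule norm_integral_le(2)[OF _ F2]) measurable
  then show "\<bar>moment M 3 (w + e) - moment M 3 w - 3 * moment M 4 w * e\<bar> \<le> 90 * measure M (space M) / r ^ 5 * e\<^sup>2"
    unfolding moment_def
    by (simp only: Bochner_Integration.integral_diff Bochner_Integration.integrable_diff integrable_mult_right int integral_mult_right_zero) (simp add: mult_ac)
  have "norm (\<integral>u. 1 / (u - (w + e)) ^ 4 - 1 / (u - w) ^ 4 \<partial>M) \<le> 136 * \<bar>e\<bar> / r ^ 5 * measure M (space M)"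
    by (rule norm_integral_le(2)[OF _ F3]) measurable
  then show "\<bar>moment M 4 (w + e) - moment M 4 w\<bar> \<le> 136 * measure M (space M) / r ^ 5 * \<bar>e\<bar>"
    unfolding moment_def using int by (simp add: mult_ac)
qed

lemma gap_shift:
  assumes "AE u in M. 2 * r \<le> \<bar>u - w\<bar>" "\<bar>y - w\<bar> \<le> r"
  shows "AE u in M. r \<le> \<bar>u - y\<bar>"
  using assms(1) by eventually_elim (use assms(2) in linarith)

lemma moment_even_pos:
  assumes r: "0 < r" and g: "AE u in M. r \<le> \<bar>u - w\<bar>" and ne: "emeasure M (space M) \<noteq> 0"
  shows "0 < moment M 2 w" "0 < moment M 4 w"
proof -
  have "0 < moment M k w" if k: "even k" for k
  proof -
    have "(\<integral>u. 0 \<partial>M) < moment M k w"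
      unfolding moment_def
    proof (rule integral_less_AE_space[OF _ moment_integrable[OF r g] _ ne])
      show "AE u in M. 0 < 1 / (u - w) ^ k"
        using gap_ne[OF r g] by eventually_elim (use k in \<open>simp add: zero_less_power_eq\<close>)
    qed simp
    then show ?thesis by simp
  qed
  then show "0 < moment M 2 w" "0 < moment M 4 w" by auto
qed

lemma moment3_lipschitz:
  assumes r: "0 < r" and g: "AE u in M. r \<le> \<bar>u - w\<bar>"
  shows "\<exists>C>0. \<forall>e. \<bar>e\<bar> \<le> r / 2 \<longrightarrow> \<bar>moment M 3 (w + e) - moment M 3 w\<bar> \<le> C * \<bar>e\<bar>"
proof -
  define B where "B = 90 * measure M (space M) / r ^ 5"
  have B: "0 \<le> B" using r unfolding B_def by simp
  define C where "C = B * r + 3 * \<bar>moment M 4 w\<bar> + 1"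
  have "\<bar>moment M 3 (w + e) - moment M 3 w\<bar> \<le> C * \<bar>e\<bar>" if e: "\<bar>e\<bar> \<le> r / 2" for e
  proof -
    have "\<bar>moment M 3 (w + e) - moment M 3 w - 3 * moment M 4 w * e\<bar> \<le> B * e\<^sup>2"
      unfolding B_def by (rule moment_expand(2)[OF r g e])
    moreover have "B * e\<^sup>2 \<le> B * r * \<bar>e\<bar>"
    proof -
      have "e\<^sup>2 = \<bar>e\<bar> * \<bar>e\<bar>" by (simp add: power2_eq_square)
      also have "\<dots> \<le> r * \<bar>e\<bar>" using e r by (intro mult_right_mono) auto
      finally show ?thesis using B by (simp add: mult.assoc mult_left_mono)
    qed
    moreover have "\<bar>3 * moment M 4 w * e\<bar> = 3 * \<bar>moment M 4 w\<bar> * \<bar>e\<bar>" by (simp add: abs_mult)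
    ultimately have "\<bar>moment M 3 (w + e) - moment M 3 w\<bar> \<le> B * r * \<bar>e\<bar> + 3 * \<bar>moment M 4 w\<bar> * \<bar>e\<bar>" by linarith
    also have "\<dots> \<le> C * \<bar>e\<bar>" unfolding C_def by (simp add: algebra_simps)
    finally show ?thesis .
  qed
  moreover have "0 < C" unfolding C_def using B r by (simp add: add_nonneg_pos)
  ultimately show ?thesis by blast
qed

text \<open>The second moment is convex in its gap, with second derivative
  \<open>6 * moment M 4 w\<close>; a critical point is therefore a strict local minimum.\<close>

lemma moment2_above_at_critical:
  assumes r: "0 < r" and g: "AE u in M. r \<le> \<bar>u - w\<bar>" and ne: "emeasure M (space M) \<noteq> 0"
    and crit: "moment M 3 w = 0"
  shows "\<exists>\<rho>>0. \<forall>y. y \<noteq> w \<and> \<bar>y - w\<bar> < \<rho> \<longrightarrow> sqpot M (of_real y) < \<infinity> \<and> moment M 2 w < sqint M (of_real y)"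
proof -
  define B where "B = 11 * measure M (space M) / r ^ 5"
  have B: "0 \<le> B" using r unfolding B_def by simp
  define j4 where "j4 = moment M 4 w"
  have j4: "0 < j4" unfolding j4_def by (rule moment_even_pos(2)[OF r g ne])
  define \<rho> where "\<rho> = min (r / 2) (j4 / (B + 1))"
  have \<rho>0: "0 < \<rho>" unfolding \<rho>_def using r j4 B by simp
  have "\<rho> \<le> r / 2" "\<rho> \<le> j4 / (B + 1)" unfolding \<rho>_def by (rule min.cobounded1, rule min.cobounded2)
  note \<rho> = \<rho>0 this
  have "sqpot M (of_real y) < \<infinity> \<and> moment M 2 w < sqint M (of_real y)" if y: "y \<noteq> w" "\<bar>y - w\<bar> < \<rho>" for y
  proof
    have g2: "AE u in M. r / 2 \<le> \<bar>u - y\<bar>"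
      using g by eventually_elim (use y \<rho> in linarith)
    show "sqpot M (of_real y) < \<infinity>" using sqpot_gap(1)[OF _ g2] r by simp
    define e where "e = y - w"
    have e: "e \<noteq> 0" "\<bar>e\<bar> < \<rho>" using y unfolding e_def by auto
    have "\<bar>sqint M (of_real w + of_real e) - (moment M 2 w + 2 * moment M 3 w * e + j4 * (3 * e\<^sup>2 - 0\<^sup>2))\<bar> \<le> B * \<bar>e\<bar> ^ 3"
      using sqint_expand[OF r g, of "of_real e"] e(2) \<rho> unfolding B_def j4_def by simp
    moreover have "of_real w + of_real e = (of_real y :: complex)" unfolding e_def by simp
    ultimately have "moment M 2 w + 3 * j4 * e\<^sup>2 - B * \<bar>e\<bar> ^ 3 \<le> sqint M (of_real y)" unfolding crit by (simp add: abs_le_iff)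
    moreover have "B * \<bar>e\<bar> ^ 3 \<le> j4 * e\<^sup>2"
    proof -
      have "B * \<bar>e\<bar> \<le> (B + 1) * (j4 / (B + 1))" using e(2) \<rho>(3) B by (intro mult_mono) auto
      then have "B * \<bar>e\<bar> \<le> j4" using B by simp
      then have "B * \<bar>e\<bar> * e\<^sup>2 \<le> j4 * e\<^sup>2" by (intro mult_right_mono) auto
      moreover have "\<bar>e\<bar> ^ 3 = \<bar>e\<bar> * e\<^sup>2" by (simp add: power2_eq_square power3_eq_cube)
      ultimately show ?thesis by (simp add: mult.assoc)
    qed
    moreover have "0 < j4 * e\<^sup>2" using j4 e(1) by simp
    ultimately show "moment M 2 w < sqint M (of_real y)" by linarith
  qed
  then show ?thesis using \<rho>(1) by blast
qed

end

section \<open>Simple edges\<close>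

context free_semigroup
begin

lemma H_real: "H s (of_real y) = of_real (Re (H s (of_real y)))"
  unfolding H_def stieltjes_of_real by (simp add: complex_eq_iff)

lemma omega_near:
  assumes "1 < s" "0 < e"
  shows "\<exists>d>0. \<forall>x. \<bar>x - E\<bar> < d \<longrightarrow> cmod (\<omega> s (of_real x) - \<omega> s (of_real E)) < e"
  using omega_joint_continuous[OF assms, of E] by (metis abs_zero diff_self)

lemma adm_critical:
  assumes s: "1 < s" and r: "0 < r" and g: "AE u in M. r \<le> \<bar>u - w\<bar>" and c: "moment M 2 w \<le> 1 / (s - 1)"
  shows "adm s (of_real w)"
  unfolding adm_def using mh.sqpot_le_iff[OF mh.sqpot_gap(1)[OF r g], of "1 / (s - 1)"] mh.sqpot_gap(2)[OF r g] s c by simp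

lemma sqint_boundary:
  assumes "1 < s" "0 < Im (\<omega> s (of_real x))"
  shows "sqint M (\<omega> s (of_real x)) = 1 / (s - 1)"
proof -
  note a = admD[OF omega_closed(1)[OF assms(1)] assms(1), of "of_real x"]
  have "Im (H s (\<omega> s (of_real x))) = 0" using omega_closed(2)[OF assms(1), of "of_real x"] by simp
  then have "(s - 1) * sqint M (\<omega> s (of_real x)) = 1" using Im_H[OF a(2), of s] assms(2) by simp
  then show ?thesis using assms(1) by (simp add: field_simps)
qed

text \<open>The condition on \<open>moment M 2 w\<close> says that \<open>H s\<close> has vanishing
  derivative at \<open>w\<close>, so the linear term of the Taylor expansion cancels. The last two
  claims are admissibility of \<open>\<omega> s x\<close> and, off the axis, equality in it, both
  expanded by \<open>sqint_expand\<close>. One constant, 11, covers this expansion and the Taylor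
  remainder.\<close>

lemma local_expansion:
  assumes s: "1 < s" and r: "0 < r" and g: "AE u in M. r \<le> \<bar>u - w\<bar>" and c: "moment M 2 w = 1 / (s - 1)"
    and E: "H s (of_real w) = of_real E"
    and d: "d = \<omega> s (of_real x) - of_real w" "cmod d \<le> r / 2"
  defines "C \<equiv> 11 * measure M (space M) / r ^ 5"
  shows "0 \<le> Im d" "0 \<le> C"
    "cmod (of_real ((x - E) / (s - 1)) + of_real (moment M 3 w) * d\<^sup>2 + of_real (moment M 4 w) * d ^ 3) \<le> C * cmod d ^ 4"
    "2 * moment M 3 w * Re d + moment M 4 w * (3 * (Re d)\<^sup>2 - (Im d)\<^sup>2) \<le> C * cmod d ^ 3"
    "0 < Im d \<Longrightarrow> - (C * cmod d ^ 3) \<le> 2 * moment M 3 w * Re d + moment M 4 w * (3 * (Re d)\<^sup>2 - (Im d)\<^sup>2)"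
proof -
  have om: "\<omega> s (of_real x) = of_real w + d" using d(1) by simp
  note cl = omega_closed[OF s, of "of_real x", unfolded om]
  have a: "adm s (of_real w + d)" "H s (of_real w + d) = of_real x" using cl by auto
  show "0 \<le> Im d" using admD(1)[OF a(1) s] by simp
  show "0 \<le> C" unfolding C_def using r by simp
  define R where "R = stieltjes M (of_real w + d) - (\<Sum>k<4. of_real (moment M (k + 1) w) * d ^ k)"
  have "cmod R \<le> 2 * cmod d ^ 4 / r ^ 5 * measure M (space M)"
    unfolding R_def using mh.taylor_stieltjes[OF r g d(2), of 4] by simp
  also have "\<dots> \<le> C * cmod d ^ 4"
  proof -
    have "2 * (measure M (space M) / r ^ 5 * cmod d ^ 4) \<le> 11 * (measure M (space M) / r ^ 5 * cmod d ^ 4)"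
      using r by (intro mult_right_mono mult_nonneg_nonneg) auto
    then show ?thesis unfolding C_def by (simp add: mult_ac)
  qed
  finally have R: "cmod R \<le> C * cmod d ^ 4" .
  have st: "stieltjes M (of_real w + d) = of_real (moment M 1 w) + of_real (moment M 2 w) * d +
     of_real (moment M 3 w) * d\<^sup>2 + of_real (moment M 4 w) * d ^ 3 + R"
    unfolding R_def by (simp add: eval_nat_numeral lessThan_Suc)
  have "of_real x - of_real E = H s (of_real w + d) - H s (of_real w)" using a(2) E by simp
  also have "\<dots> = d - of_real (s - 1) * (of_real (moment M 2 w) * d + of_real (moment M 3 w) * d\<^sup>2 + of_real (moment M 4 w) * d ^ 3 + R)"
    unfolding H_def st mh.sqpot_gap(3)[OF r g] by (simp add: algebra_simps)
  also have "\<dots> = - of_real (s - 1) * (of_real (moment M 3 w) * d\<^sup>2 + of_real (moment M 4 w) * d ^ 3 + R)"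
  proof -
    have "of_real (s - 1) * of_real (moment M 2 w) = (1 :: complex)" unfolding c using s by simp
    then have "of_real (s - 1) * (of_real (moment M 2 w) * d) = d" by (metis mult.assoc mult_1)
    then show ?thesis by (simp only: distrib_left add.assoc diff_add_eq_diff_diff_swap) (simp add: algebra_simps)
  qed
  finally have "of_real ((x - E) / (s - 1)) = - (of_real (moment M 3 w) * d\<^sup>2 + of_real (moment M 4 w) * d ^ 3 + R)"
    using s by (simp add: divide_eq_eq) (simp add: algebra_simps)
  then have "of_real ((x - E) / (s - 1)) + of_real (moment M 3 w) * d\<^sup>2 + of_real (moment M 4 w) * d ^ 3 = - R" by simp
  then show "cmod (of_real ((x - E) / (s - 1)) + of_real (moment M 3 w) * d\<^sup>2 + of_real (moment M 4 w) * d ^ 3) \<le> C * cmod d ^ 4"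
    using R by simp
  have q: "\<bar>sqint M (of_real w + d) - (1 / (s - 1) + 2 * moment M 3 w * Re d + moment M 4 w * (3 * (Re d)\<^sup>2 - (Im d)\<^sup>2))\<bar> \<le> C * cmod d ^ 3"
    using mh.sqint_expand[OF r g d(2)] unfolding c C_def .
  have "sqint M (of_real w + d) \<le> 1 / (s - 1)" by (rule admD(3)[OF a(1) s])
  then show "2 * moment M 3 w * Re d + moment M 4 w * (3 * (Re d)\<^sup>2 - (Im d)\<^sup>2) \<le> C * cmod d ^ 3"
    using q by (simp add: abs_le_iff)
  assume "0 < Im d"
  then have "0 < Im (\<omega> s (of_real x))" unfolding om by simp
  from sqint_boundary[OF s this] show "- (C * cmod d ^ 3) \<le> 2 * moment M 3 w * Re d + moment M 4 w * (3 * (Re d)\<^sup>2 - (Im d)\<^sup>2)"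
    using q unfolding om by (simp add: abs_le_iff)
qed

lemma simple_edge:
  assumes s: "1 < s" and r: "0 < r" and g: "AE u in M. r \<le> \<bar>u - w\<bar>" and c: "moment M 2 w = 1 / (s - 1)"
    and E: "H s (of_real w) = of_real E" and j3: "moment M 3 w \<noteq> 0"
  defines "\<sigma> \<equiv> sgn (moment M 3 w)"
  shows "\<omega> s (of_real E) = of_real w"
    "\<exists>\<delta>>0. \<exists>K\<ge>0. \<forall>x. \<bar>x - E\<bar> < \<delta> \<longrightarrow>
      (\<sigma> * (x - E) < 0 \<longrightarrow> Im (\<omega> s (of_real x)) = 0) \<and> (0 < \<sigma> * (x - E) \<longrightarrow> 0 < Im (\<omega> s (of_real x))) \<and>
      cmod (\<omega> s (of_real x) - of_real w) \<le> r / 2 \<and> (cmod (\<omega> s (of_real x) - of_real w))\<^sup>2 \<le> K * \<bar>x - E\<bar> \<and>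
      (0 \<le> \<sigma> * (x - E) \<longrightarrow>
        \<bar>Im (\<omega> s (of_real x)) - sqrt (\<sigma> * (x - E) / ((s - 1) * \<bar>moment M 3 w\<bar>))\<bar> \<le> K * \<bar>x - E\<bar>)"
proof -
  have "adm s (of_real w)" using c by (intro adm_critical[OF s r g]) simp
  from omega_H(2)[OF s this] show wE: "\<omega> s (of_real E) = of_real w" unfolding E .
  define C where "C = 11 * measure M (space M) / r ^ 5"
  let ?j3 = "moment M 3 w" and ?j4 = "moment M 4 w"
  have C0: "0 \<le> C" unfolding C_def using r by simp
  \<comment> \<open>Absorbs the cubic and quartic terms of the local equation into a cubic error,
    and those of the criticality condition into a quadratic one.\<close>
  define C' where "C' = C * r + 3 * \<bar>?j4\<bar>"
  have C': "0 \<le> C'" unfolding C'_def using C0 r by simp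
  define e where "e = min (r / 2) (\<bar>?j3\<bar> / (8 * (C' + 1)))"
  have e: "0 < e" unfolding e_def using r j3 C' by simp
  obtain \<delta> where \<delta>: "0 < \<delta>" "\<And>x. \<bar>x - E\<bar> < \<delta> \<Longrightarrow> cmod (\<omega> s (of_real x) - of_real w) < e"
    using omega_near[OF s e, of E] unfolding wE by blast
  define K where "K = max (2 / (\<bar>?j3\<bar> * (s - 1))) (2 * C' / ?j3\<^sup>2 / (s - 1))"
  have K0: "0 \<le> K" unfolding K_def using C' s by (simp add: le_max_iff_disj)
  show "\<exists>\<delta>>0. \<exists>K\<ge>0. \<forall>x. \<bar>x - E\<bar> < \<delta> \<longrightarrow>
      (\<sigma> * (x - E) < 0 \<longrightarrow> Im (\<omega> s (of_real x)) = 0) \<and> (0 < \<sigma> * (x - E) \<longrightarrow> 0 < Im (\<omega> s (of_real x))) \<and>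
      cmod (\<omega> s (of_real x) - of_real w) \<le> r / 2 \<and> (cmod (\<omega> s (of_real x) - of_real w))\<^sup>2 \<le> K * \<bar>x - E\<bar> \<and>
      (0 \<le> \<sigma> * (x - E) \<longrightarrow>
        \<bar>Im (\<omega> s (of_real x)) - sqrt (\<sigma> * (x - E) / ((s - 1) * \<bar>moment M 3 w\<bar>))\<bar> \<le> K * \<bar>x - E\<bar>)"
  proof (rule exI[of _ \<delta>], rule conjI[OF \<delta>(1)], rule exI[of _ K], rule conjI[OF K0], rule allI)
    fix x show "\<bar>x - E\<bar> < \<delta> \<longrightarrow>
      (\<sigma> * (x - E) < 0 \<longrightarrow> Im (\<omega> s (of_real x)) = 0) \<and> (0 < \<sigma> * (x - E) \<longrightarrow> 0 < Im (\<omega> s (of_real x))) \<and>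
      cmod (\<omega> s (of_real x) - of_real w) \<le> r / 2 \<and> (cmod (\<omega> s (of_real x) - of_real w))\<^sup>2 \<le> K * \<bar>x - E\<bar> \<and>
      (0 \<le> \<sigma> * (x - E) \<longrightarrow>
        \<bar>Im (\<omega> s (of_real x)) - sqrt (\<sigma> * (x - E) / ((s - 1) * \<bar>moment M 3 w\<bar>))\<bar> \<le> K * \<bar>x - E\<bar>)"
    proof
      assume x: "\<bar>x - E\<bar> < \<delta>"
      define d where "d = \<omega> s (of_real x) - of_real w"
      have de: "cmod d < e" using \<delta>(2)[OF x] unfolding d_def .
      then have dr: "cmod d \<le> r / 2" "cmod d \<le> r" unfolding e_def using r by auto
      note L = local_expansion[OF s r g c E d_def dr(1), folded C_def]
      define X where "X = (x - E) / (s - 1)"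
      have e1: "cmod (of_real X + of_real ?j3 * d\<^sup>2) \<le> C' * cmod d ^ 3"
      proof -
        have "of_real X + of_real ?j3 * d\<^sup>2 = (of_real X + of_real ?j3 * d\<^sup>2 + of_real ?j4 * d ^ 3) - of_real ?j4 * d ^ 3" by simp
        then have "cmod (of_real X + of_real ?j3 * d\<^sup>2) \<le> C * cmod d ^ 4 + \<bar>?j4\<bar> * cmod d ^ 3"
          using L(3) norm_triangle_ineq4[of "of_real X + of_real ?j3 * d\<^sup>2 + of_real ?j4 * d ^ 3" "of_real ?j4 * d ^ 3"]
          unfolding X_def by (simp add: norm_mult norm_power)
        also have "C * cmod d ^ 4 \<le> C * (r * cmod d ^ 3)"
          using dr(2) C0 by (intro mult_left_mono) (auto simp: eval_nat_numeral intro!: mult_right_mono)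
        finally have "cmod (of_real X + of_real ?j3 * d\<^sup>2) \<le> C * (r * cmod d ^ 3) + \<bar>?j4\<bar> * cmod d ^ 3" by simp
        moreover have "0 \<le> \<bar>?j4\<bar> * cmod d ^ 3" by simp
        moreover have "C' * cmod d ^ 3 = C * (r * cmod d ^ 3) + 3 * (\<bar>?j4\<bar> * cmod d ^ 3)"
          unfolding C'_def by (simp add: algebra_simps)
        ultimately show ?thesis by linarith
      qed
      have e2: "\<bar>2 * ?j3 * Re d\<bar> \<le> C' * cmod d ^ 2" if "0 < Im d"
      proof -
        have "\<bar>2 * ?j3 * Re d + ?j4 * (3 * (Re d)\<^sup>2 - (Im d)\<^sup>2)\<bar> \<le> C * cmod d ^ 3"
          using L(4) L(5)[OF that] by (simp add: abs_le_iff)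
        moreover have "\<bar>?j4 * (3 * (Re d)\<^sup>2 - (Im d)\<^sup>2)\<bar> \<le> \<bar>?j4\<bar> * (3 * (cmod d)\<^sup>2)"
        proof -
          have "\<bar>3 * (Re d)\<^sup>2 - (Im d)\<^sup>2\<bar> \<le> 3 * (cmod d)\<^sup>2"
            using Re_Im_sq_sum[of d] zero_le_power2[of "Re d"] zero_le_power2[of "Im d"] unfolding abs_le_iff by (intro conjI; linarith)
          then show ?thesis unfolding abs_mult by (intro mult_left_mono) auto
        qed
        moreover have "C * cmod d ^ 3 \<le> C * (r * cmod d ^ 2)"
          using dr(2) C0 by (intro mult_left_mono) (auto simp: eval_nat_numeral intro!: mult_right_mono)
        ultimately have "\<bar>2 * ?j3 * Re d\<bar> \<le> C * (r * cmod d ^ 2) + \<bar>?j4\<bar> * (3 * (cmod d)\<^sup>2)" by linarith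
        then show ?thesis unfolding C'_def by (simp add: algebra_simps)
      qed
      have small: "C' * cmod d \<le> \<bar>?j3\<bar> / 8"
      proof -
        have "C' * cmod d \<le> (C' + 1) * (\<bar>?j3\<bar> / (8 * (C' + 1)))"
          using de C' unfolding e_def by (intro mult_mono) auto
        also have "\<dots> = \<bar>?j3\<bar> / 8"
        proof -
          have "a * (b / (8 * a)) = b / 8" if "a \<noteq> 0" for a b :: real using that by simp
          from this[of "C' + 1"] show ?thesis using C' by simp
        qed
        finally show ?thesis .
      qed
      note S = edge_simple[OF j3 L(1) e1 e2 small, folded \<sigma>_def]
      have Id: "Im d = Im (\<omega> s (of_real x))" unfolding d_def by simp
      have sX: "\<sigma> * X < 0 \<longleftrightarrow> \<sigma> * (x - E) < 0" "0 < \<sigma> * X \<longleftrightarrow> 0 < \<sigma> * (x - E)" "0 \<le> \<sigma> * X \<longleftrightarrow> 0 \<le> \<sigma> * (x - E)"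
        unfolding X_def using s by (auto simp: divide_less_0_iff zero_less_divide_iff zero_le_divide_iff)
      have aX: "\<bar>X\<bar> = \<bar>x - E\<bar> / (s - 1)" unfolding X_def using s by simp
      have "2 * \<bar>X\<bar> / \<bar>?j3\<bar> = 2 / (\<bar>?j3\<bar> * (s - 1)) * \<bar>x - E\<bar>" unfolding aX by simp
      also have "\<dots> \<le> K * \<bar>x - E\<bar>" unfolding K_def by (intro mult_right_mono) auto
      finally have k1: "(cmod d)\<^sup>2 \<le> K * \<bar>x - E\<bar>" using S(3) by linarith
      have "2 * C' / ?j3\<^sup>2 * \<bar>X\<bar> = 2 * C' / ?j3\<^sup>2 / (s - 1) * \<bar>x - E\<bar>" unfolding aX by simp
      also have "\<dots> \<le> K * \<bar>x - E\<bar>" unfolding K_def by (intro mult_right_mono) auto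
      finally have k2: "2 * C' / ?j3\<^sup>2 * \<bar>X\<bar> \<le> K * \<bar>x - E\<bar>" .
      have sq: "\<sigma> * X / \<bar>?j3\<bar> = \<sigma> * (x - E) / ((s - 1) * \<bar>?j3\<bar>)" unfolding X_def by simp
      have k3: "0 \<le> \<sigma> * (x - E) \<longrightarrow> \<bar>Im d - sqrt (\<sigma> * (x - E) / ((s - 1) * \<bar>?j3\<bar>))\<bar> \<le> K * \<bar>x - E\<bar>"
        using S(4) k2 unfolding sX sq by linarith
      show "(\<sigma> * (x - E) < 0 \<longrightarrow> Im (\<omega> s (of_real x)) = 0) \<and> (0 < \<sigma> * (x - E) \<longrightarrow> 0 < Im (\<omega> s (of_real x))) \<and>
        cmod (\<omega> s (of_real x) - of_real w) \<le> r / 2 \<and> (cmod (\<omega> s (of_real x) - of_real w))\<^sup>2 \<le> K * \<bar>x - E\<bar> \<and>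
        (0 \<le> \<sigma> * (x - E) \<longrightarrow>
        \<bar>Im (\<omega> s (of_real x)) - sqrt (\<sigma> * (x - E) / ((s - 1) * \<bar>moment M 3 w\<bar>))\<bar> \<le> K * \<bar>x - E\<bar>)"
        using S(1,2) sX k1 k3 dr(1) unfolding Id d_def by auto
    qed
  qed
qed

lemma simple_edge_msupp:
  assumes s: "1 < s" and r: "0 < r" and g: "AE u in M. r \<le> \<bar>u - w\<bar>" and c: "moment M 2 w = 1 / (s - 1)"
    and E: "H s (of_real w) = of_real E" and j3: "moment M 3 w \<noteq> 0"
  shows "\<exists>\<delta>>0. \<forall>\<epsilon>. 0 < \<epsilon> \<and> \<epsilon> < \<delta> \<longrightarrow> E - \<epsilon> \<notin> msupp (ac_part (\<nu> s)) \<or> E + \<epsilon> \<notin> msupp (ac_part (\<nu> s))"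
    "exterior_point (\<nu> s) E"
proof -
  let ?\<sigma> = "sgn (moment M 3 w)"
  note SE = simple_edge[OF s r g c E j3]
  obtain \<delta> where \<delta>: "0 < \<delta>" "\<And>x. \<bar>x - E\<bar> < \<delta> \<Longrightarrow> ?\<sigma> * (x - E) < 0 \<Longrightarrow> Im (\<omega> s (of_real x)) = 0"
     "\<And>x. \<bar>x - E\<bar> < \<delta> \<Longrightarrow> 0 < ?\<sigma> * (x - E) \<Longrightarrow> 0 < Im (\<omega> s (of_real x))"
    using SE(2) by blast
  have \<sigma>: "?\<sigma> = 1 \<or> ?\<sigma> = -1" using j3 by (auto simp: sgn_if)
  have out: "x \<notin> msupp (ac_part (\<nu> s))" if "\<bar>x - E\<bar> < \<delta>" "?\<sigma> * (x - E) < 0" for x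
  proof (rule msupp_zero[OF s, of "{x. \<bar>x - E\<bar> < \<delta> \<and> ?\<sigma> * (x - E) < 0}"])
    show "open {x. \<bar>x - E\<bar> < \<delta> \<and> ?\<sigma> * (x - E) < 0}"
      by (intro open_Collect_conj open_Collect_less continuous_intros)
  qed (use that \<delta>(2) in auto)
  show m: "\<exists>\<delta>>0. \<forall>\<epsilon>. 0 < \<epsilon> \<and> \<epsilon> < \<delta> \<longrightarrow> E - \<epsilon> \<notin> msupp (ac_part (\<nu> s)) \<or> E + \<epsilon> \<notin> msupp (ac_part (\<nu> s))"
    using \<sigma>
  proof
    assume "?\<sigma> = 1"
    then show ?thesis using out \<delta>(1) by (intro exI[of _ \<delta>]) auto
  next
    assume "?\<sigma> = -1"
    then show ?thesis using out \<delta>(1) by (intro exI[of _ \<delta>]) auto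
  qed
  have "E \<in> edge_set (\<nu> s)"
    unfolding edge_set_iff[OF s]
  proof (intro conjI allI impI)
    show "Im (\<omega> s (of_real E)) = 0" using SE(1) by simp
    fix e :: real assume e: "0 < e"
    define m where "m = min e \<delta> / 2"
    have m: "0 < m" "m < e" "m < \<delta>" unfolding m_def using e \<delta>(1) by auto
    define x where "x = E + ?\<sigma> * m"
    have "\<bar>x - E\<bar> = m" using \<sigma> m(1) unfolding x_def by auto
    moreover have "?\<sigma> * (x - E) = m" using \<sigma> unfolding x_def by auto
    ultimately show "\<exists>x. \<bar>x - E\<bar> < e \<and> 0 < Im (\<omega> s (of_real x))"
      using m by (intro exI[of _ x] conjI \<delta>(3)) auto
  qed
  then show "exterior_point (\<nu> s) E" unfolding exterior_point_def using m by blast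
qed

text \<open>If every real neighbour of \<open>w\<close> is inadmissible, then
  \<open>\<omega> s\<close> cannot take real values near \<open>E\<close> except at \<open>E\<close>
  itself. No gap at \<open>w\<close> is required, so the lemma also serves a limit point that is an
  end of a gap.\<close>

lemma strict_min_interior:
  assumes s: "1 < s" and w: "adm s (of_real w)" and E: "H s (of_real w) = of_real E"
    and \<rho>: "0 < \<rho>" and above: "\<And>y. y \<noteq> w \<Longrightarrow> \<bar>y - w\<bar> < \<rho> \<Longrightarrow> ennreal (1 / (s - 1)) < sqpot M (of_real y)"
  shows "interior_point (\<nu> s) E"
proof -
  have wE: "\<omega> s (of_real E) = of_real w" using omega_H(2)[OF s w] E by simp
  obtain \<delta> where \<delta>: "0 < \<delta>" "\<And>x. \<bar>x - E\<bar> < \<delta> \<Longrightarrow> cmod (\<omega> s (of_real x) - of_real w) < \<rho>"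
    using omega_near[OF s \<rho>, of E] unfolding wE by blast
  have pos: "0 < Im (\<omega> s (of_real x))" if x: "\<bar>x - E\<bar> < \<delta>" "x \<noteq> E" for x
  proof (rule ccontr)
    assume "\<not> ?thesis"
    then have "Im (\<omega> s (of_real x)) = 0" using omega_Im[OF s, of "of_real x"] by simp
    then obtain y where y: "\<omega> s (of_real x) = of_real y" by (metis complex_is_Real_iff Reals_cases)
    have cl: "adm s (of_real y)" "H s (of_real y) = of_real x" using omega_closed[OF s, of "of_real x"] y by simp_all
    have "\<bar>y - w\<bar> < \<rho>" using \<delta>(2)[OF x(1)] unfolding y cmod_real_diff .
    moreover have "sqpot M (of_real y) \<le> ennreal (1 / (s - 1))" using cl(1) unfolding adm_def by simp
    ultimately have "y = w" using above by (meson not_le)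
    then show False using cl(2) E x(2) by simp
  qed
  have "E \<in> edge_set (\<nu> s)"
    unfolding edge_set_iff[OF s]
  proof (intro conjI allI impI)
    show "Im (\<omega> s (of_real E)) = 0" using wE by simp
    fix e :: real assume e: "0 < e"
    show "\<exists>x. \<bar>x - E\<bar> < e \<and> 0 < Im (\<omega> s (of_real x))"
      using e \<delta>(1) by (intro exI[of _ "E + min e \<delta> / 2"] conjI pos) auto
  qed
  moreover have "E - \<epsilon> \<in> msupp (ac_part (\<nu> s)) \<and> E + \<epsilon> \<in> msupp (ac_part (\<nu> s))" if "0 < \<epsilon> \<and> \<epsilon> < \<delta>" for \<epsilon>
    using that by (intro conjI msupp_positive[OF s] pos) auto
  ultimately show ?thesis unfolding interior_point_def using \<delta>(1) by blast
qed

text \<open>Points with non-real \<open>\<omega> s x\<close> accumulate at an edge, and there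
  \<open>sqint M\<close> equals \<open>1 / (s - 1)\<close>; with a gap it is continuous at
  \<open>w\<close>, so equality persists.\<close>

lemma edge_critical:
  assumes s: "1 < s" and r: "0 < r" and g: "AE u in M. r \<le> \<bar>u - w\<bar>"
    and E: "E \<in> edge_set (\<nu> s)" "\<omega> s (of_real E) = of_real w"
  shows "moment M 2 w = 1 / (s - 1)" "H s (of_real w) = of_real E" "emeasure M (space M) \<noteq> 0"
proof -
  have cl: "adm s (of_real w)" "H s (of_real w) = of_real E" using omega_closed[OF s, of "of_real E"] E(2) by simp_all
  show "H s (of_real w) = of_real E" by (rule cl(2))
  have le: "moment M 2 w \<le> 1 / (s - 1)" using admD(3)[OF cl(1) s] mh.sqpot_gap(2)[OF r g] by simp
  show eq: "moment M 2 w = 1 / (s - 1)"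
  proof (rule ccontr)
    assume "\<not> ?thesis"
    then have lt: "moment M 2 w < 1 / (s - 1)" using le by simp
    define C where "C = 11 * measure M (space M) / r ^ 5"
    have C0: "0 \<le> C" unfolding C_def using r by simp
    \<comment> \<open>A Lipschitz constant for \<open>sqint M\<close> at \<open>w\<close> within
      distance \<open>r\<close>.\<close>
    define B where "B = 2 * \<bar>moment M 3 w\<bar> + 3 * \<bar>moment M 4 w\<bar> * r + C * r\<^sup>2 + 1"
    have B: "0 < B" unfolding B_def using C0 r by (intro add_nonneg_pos add_nonneg_nonneg) auto
    define e where "e = min (r / 2) ((1 / (s - 1) - moment M 2 w) / B)"
    have e: "0 < e" unfolding e_def using r B lt by simp
    obtain \<delta> where \<delta>: "0 < \<delta>" "\<And>x. \<bar>x - E\<bar> < \<delta> \<Longrightarrow> cmod (\<omega> s (of_real x) - of_real w) < e"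
      using omega_near[OF s e, of E] unfolding E(2) by blast
    obtain x where x: "\<bar>x - E\<bar> < \<delta>" "0 < Im (\<omega> s (of_real x))" using E(1) \<delta>(1) unfolding edge_set_iff[OF s] by blast
    define d where "d = \<omega> s (of_real x) - of_real w"
    have om: "\<omega> s (of_real x) = of_real w + d" unfolding d_def by simp
    have de: "cmod d < e" using \<delta>(2)[OF x(1)] unfolding d_def .
    have dr: "cmod d \<le> r / 2" "cmod d \<le> r" using de r unfolding e_def by auto
    have q: "\<bar>1 / (s - 1) - (moment M 2 w + 2 * moment M 3 w * Re d + moment M 4 w * (3 * (Re d)\<^sup>2 - (Im d)\<^sup>2))\<bar> \<le> C * cmod d ^ 3"
      using mh.sqint_expand[OF r g dr(1)] sqint_boundary[OF s x(2)] unfolding om C_def by simp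
    have "\<bar>2 * moment M 3 w * Re d\<bar> \<le> 2 * \<bar>moment M 3 w\<bar> * cmod d"
      unfolding abs_mult using abs_Re_le_cmod[of d] by (simp add: mult_left_mono)
    moreover have "\<bar>moment M 4 w * (3 * (Re d)\<^sup>2 - (Im d)\<^sup>2)\<bar> \<le> \<bar>moment M 4 w\<bar> * (3 * (r * cmod d))"
    proof -
      have "\<bar>3 * (Re d)\<^sup>2 - (Im d)\<^sup>2\<bar> \<le> 3 * (cmod d)\<^sup>2"
        using Re_Im_sq_sum[of d] zero_le_power2[of "Re d"] zero_le_power2[of "Im d"] unfolding abs_le_iff by (intro conjI; linarith)
      also have "\<dots> \<le> 3 * (r * cmod d)" using dr(2) unfolding power2_eq_square by (intro mult_left_mono mult_right_mono) auto
      finally show ?thesis unfolding abs_mult by (intro mult_left_mono) auto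
    qed
    moreover have "C * cmod d ^ 3 \<le> C * (r\<^sup>2 * cmod d)"
    proof -
      have "cmod d ^ 3 = (cmod d)\<^sup>2 * cmod d" by (simp add: power2_eq_square power3_eq_cube)
      also have "\<dots> \<le> r\<^sup>2 * cmod d" using dr(2) by (intro mult_right_mono power_mono) auto
      finally show ?thesis using C0 by (intro mult_left_mono)
    qed
    ultimately have "1 / (s - 1) - moment M 2 w \<le> 2 * \<bar>moment M 3 w\<bar> * cmod d + \<bar>moment M 4 w\<bar> * (3 * (r * cmod d)) + C * (r\<^sup>2 * cmod d)"
      using q by linarith
    also have "\<dots> \<le> B * cmod d" unfolding B_def by (simp add: algebra_simps)
    also have "\<dots> < B * ((1 / (s - 1) - moment M 2 w) / B)" using de B unfolding e_def by (intro mult_strict_left_mono) auto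
    finally show False using B by simp
  qed
  show "emeasure M (space M) \<noteq> 0"
  proof
    assume "emeasure M (space M) = 0"
    then have "sqint M (of_real w) = 0" by (rule mh.sqint_null)
    then show False using eq mh.sqpot_gap(2)[OF r g] s by simp
  qed
qed

text \<open>A vanishing third moment makes \<open>w\<close> a strict minimum of the second moment at
  the critical level, so non-real values appear on both sides. Together with the simple edge this
  gives the dichotomy between exterior and interior points.\<close>

lemma critical_interior:
  assumes s: "1 < s" and r: "0 < r" and g: "AE u in M. r \<le> \<bar>u - w\<bar>"
    and E: "E \<in> edge_set (\<nu> s)" "\<omega> s (of_real E) = of_real w" and j3: "moment M 3 w = 0"
  shows "interior_point (\<nu> s) E"
proof -
  note cr = edge_critical[OF s r g E]
  obtain \<rho> where \<rho>: "0 < \<rho>" "\<And>y. y \<noteq> w \<Longrightarrow> \<bar>y - w\<bar> < \<rho> \<Longrightarrow> sqpot M (of_real y) < \<infinity> \<and> moment M 2 w < sqint M (of_real y)"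
    using mh.moment2_above_at_critical[OF r g cr(3) j3] by blast
  show ?thesis
  proof (rule strict_min_interior[OF s _ cr(2) \<rho>(1)])
    show "adm s (of_real w)" using cr(1) by (intro adm_critical[OF s r g]) simp
    fix y assume y: "y \<noteq> w" "\<bar>y - w\<bar> < \<rho>"
    have "\<not> sqint M (of_real y) \<le> 1 / (s - 1)" using \<rho>(2)[OF y] cr(1) by simp
    then have "\<not> sqpot M (of_real y) \<le> ennreal (1 / (s - 1))"
      using \<rho>(2)[OF y] s mh.sqpot_le_iff[of "of_real y" "1 / (s - 1)"] by auto
    then show "ennreal (1 / (s - 1)) < sqpot M (of_real y)" by simp
  qed
qed

lemma exterior_interior_exclusive: "exterior_point N E \<Longrightarrow> interior_point N E \<Longrightarrow> False"
proof -
  assume "exterior_point N E" "interior_point N E"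
  then obtain e1 e2 where e: "0 < e1" "\<forall>\<epsilon>. 0 < \<epsilon> \<and> \<epsilon> < e1 \<longrightarrow> E - \<epsilon> \<notin> msupp (ac_part N) \<or> E + \<epsilon> \<notin> msupp (ac_part N)"
    "0 < e2" "\<forall>\<epsilon>. 0 < \<epsilon> \<and> \<epsilon> < e2 \<longrightarrow> E - \<epsilon> \<in> msupp (ac_part N) \<and> E + \<epsilon> \<in> msupp (ac_part N)"
    unfolding exterior_point_def interior_point_def by blast
  have "0 < min e1 e2 / 2" "min e1 e2 / 2 < e1" "min e1 e2 / 2 < e2" using e(1,3) by auto
  then show False using e(2,4) by blast
qed

lemma exterior_moment3:
  assumes s: "1 < s" and r: "0 < r" and g: "AE u in M. r \<le> \<bar>u - w\<bar>"
    and E: "exterior_point (\<nu> s) E" "\<omega> s (of_real E) = of_real w"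
  shows "moment M 3 w \<noteq> 0"
  using critical_interior[OF s r g _ E(2)] E(1) exterior_interior_exclusive[OF E(1)] unfolding exterior_point_def by blast

lemma interior_moment3:
  assumes s: "1 < s" and r: "0 < r" and g: "AE u in M. r \<le> \<bar>u - w\<bar>"
    and E: "interior_point (\<nu> s) E" "\<omega> s (of_real E) = of_real w"
  shows "moment M 3 w = 0"
proof (rule ccontr)
  assume j3: "moment M 3 w \<noteq> 0"
  have "E \<in> edge_set (\<nu> s)" using E(1) unfolding interior_point_def by blast
  note cr = edge_critical[OF s r g this E(2)]
  show False using exterior_interior_exclusive[OF simple_edge_msupp(2)[OF s r g cr(1,2) j3] E(1)] .
qed

end

section \<open>Motion of an edge\<close>

text \<open>The tangent line lies below the convex function \<open>1 / x^2\<close>, provided that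
  both points are on the same side of 0.\<close>

lemma inverse_square_tangent:
  fixes p d :: real
  assumes "0 < (p - d) * p"
  shows "1 / p ^ 2 + 2 * d * (1 / p ^ 3) \<le> 1 / (p - d) ^ 2"
proof -
  have nz: "p \<noteq> 0" "p - d \<noteq> 0" using assms by auto
  have "1 / (p - d) ^ 2 - (1 / p ^ 2 + 2 * d * (1 / p ^ 3)) = d\<^sup>2 * (p\<^sup>2 + 2 * ((p - d) * p)) / (p ^ 4 * (p - d)\<^sup>2)"
    using nz by (simp add: divide_simps) (simp add: algebra_simps eval_nat_numeral)
  moreover have "0 \<le> d\<^sup>2 * (p\<^sup>2 + 2 * ((p - d) * p)) / (p ^ 4 * (p - d)\<^sup>2)"
  proof (rule divide_nonneg_nonneg, rule mult_nonneg_nonneg)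
    show "0 \<le> p\<^sup>2 + 2 * ((p - d) * p)" using assms zero_le_power2[of p] by linarith
  qed auto
  ultimately show ?thesis by linarith
qed

context finite_borel_measure
begin

lemma moment2_tangent:
  assumes a: "0 < r1" "AE u in M. r1 \<le> \<bar>u - a\<bar>" and b: "0 < r2" "AE u in M. r2 \<le> \<bar>u - b\<bar>"
    and sg: "AE u in M. 0 < (u - a) * (u - b)"
  shows "moment M 2 b + 2 * (a - b) * moment M 3 b \<le> moment M 2 a"
proof -
  have "moment M 2 b + 2 * (a - b) * moment M 3 b = (\<integral>u. 1 / (u - b) ^ 2 + 2 * (a - b) * (1 / (u - b) ^ 3) \<partial>M)"
    unfolding moment_def
    by (simp only: Bochner_Integration.integral_add integrable_mult_right moment_integrable[OF b] integral_mult_right_zero)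
  also have "\<dots> \<le> moment M 2 a"
    unfolding moment_def
  proof (rule integral_mono_AE)
    show "integrable M (\<lambda>u. 1 / (u - b) ^ 2 + 2 * (a - b) * (1 / (u - b) ^ 3))"
      by (intro Bochner_Integration.integrable_add integrable_mult_right moment_integrable[OF b])
    show "AE u in M. 1 / (u - b) ^ 2 + 2 * (a - b) * (1 / (u - b) ^ 3) \<le> 1 / (u - a) ^ 2"
      using sg by eventually_elim (use inverse_square_tangent[of "_ - b" "a - b"] in simp)
  qed (rule moment_integrable[OF a])
  finally show ?thesis .
qed

lemma moment3_sign_stable:
  assumes r: "0 < r" and g: "AE u in M. r \<le> \<bar>u - w\<bar>" and j: "moment M 3 w \<noteq> 0"
  shows "\<exists>m>0. m \<le> r / 2 \<and> (\<forall>e. \<bar>e\<bar> \<le> m \<longrightarrow> 0 < sgn (moment M 3 w) * moment M 3 (w + e))"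
proof -
  obtain C where C: "0 < C" "\<And>e. \<bar>e\<bar> \<le> r / 2 \<Longrightarrow> \<bar>moment M 3 (w + e) - moment M 3 w\<bar> \<le> C * \<bar>e\<bar>"
    using moment3_lipschitz[OF r g] by blast
  define m where "m = min (r / 2) (\<bar>moment M 3 w\<bar> / (2 * C))"
  have m: "0 < m" "m \<le> r / 2" unfolding m_def using r C(1) j by (simp, simp only: min.cobounded1)
  have "0 < sgn (moment M 3 w) * moment M 3 (w + e)" if e: "\<bar>e\<bar> \<le> m" for e
  proof -
    have "C * \<bar>e\<bar> \<le> C * (\<bar>moment M 3 w\<bar> / (2 * C))" using e C(1) unfolding m_def by (intro mult_left_mono) auto
    also have "\<dots> = \<bar>moment M 3 w\<bar> / 2" using C(1) by simp
    finally have "\<bar>moment M 3 (w + e) - moment M 3 w\<bar> \<le> \<bar>moment M 3 w\<bar> / 2" using C(2)[of e] e m(2) by simp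
    moreover have "0 < \<bar>moment M 3 w\<bar>" using j by simp
    ultimately show ?thesis by (auto simp: sgn_if abs_if split: if_splits)
  qed
  then show ?thesis using m by blast
qed

end

context free_semigroup
begin

lemma H_real_continuous:
  assumes \<phi>: "continuous_on X \<phi>" and s: "continuous_on X s" "\<And>x. x \<in> X \<Longrightarrow> 1 < s x"
    and a: "\<And>x. x \<in> X \<Longrightarrow> adm (s x) (of_real (\<phi> x))"
  shows "continuous_on X (\<lambda>x :: real. Re (H (s x) (of_real (\<phi> x))))"
  unfolding continuous_on_sequentially
proof (intro ballI allI impI, elim conjE)
  fix x \<xi> assume x: "x \<in> X" and \<xi>: "\<forall>n. \<xi> n \<in> X" "\<xi> \<longlonglongrightarrow> x"
  have p: "(\<lambda>n. \<phi> (\<xi> n)) \<longlonglongrightarrow> \<phi> x" "(\<lambda>n. s (\<xi> n)) \<longlonglongrightarrow> s x"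
    using \<xi> x by (auto intro!: continuous_on_tendsto_compose[OF \<phi>] continuous_on_tendsto_compose[OF s(1)])
  have "(\<lambda>n. H (s (\<xi> n)) (of_real (\<phi> (\<xi> n)))) \<longlonglongrightarrow> H (s x) (of_real (\<phi> x))"
    using \<xi>(1) x by (intro H_tendsto(2)[OF _ p(2)] tendsto_of_real p(1) s(2) a) auto
  then show "((\<lambda>x. Re (H (s x) (of_real (\<phi> x)))) \<circ> \<xi>) \<longlonglongrightarrow> Re (H (s x) (of_real (\<phi> x)))"
    unfolding o_def by (rule tendsto_Re)
qed

text \<open>The edge is followed by moving \<open>w\<close> towards the minimum of \<open>y \<mapsto> \<integral> 1 / (u - y)\<^sup>2 \<mu>h(du)\<close>
  in its gap. The infimum may instead be attained at an end point of the gap, which is then an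
  atom of \<open>\<mu>\<close> at an edge of the absolutely continuous part, and a singular point in the limit.\<close>

lemma edge_family_exists:
  assumes t: "1 < t" and r: "0 < r" and g: "AE u in M. r \<le> \<bar>u - w\<bar>" and c: "moment M 2 w = 1 / (t - 1)"
    and E: "H t (of_real w) = of_real Et" and j3: "moment M 3 w \<noteq> 0" and ne: "emeasure M (space M) \<noteq> 0"
    and lr: "\<exists>x \<in> msupp (ac_part (\<nu> t)). x < Et" "\<exists>x \<in> msupp (ac_part (\<nu> t)). Et < x"
  shows "\<exists>t' E' E. edge_family \<nu> t Et t' E' E"
proof -
  define \<sigma> where "\<sigma> = sgn (moment M 3 w)"
  have \<sigma>: "\<sigma> = 1 \<or> \<sigma> = -1" unfolding \<sigma>_def using j3 by (auto simp: sgn_if)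
  define y where "y \<theta> = w - \<sigma> * \<theta>" for \<theta>
  have y0: "y 0 = w" unfolding y_def by simp
  \<comment> \<open>No mass between \<open>y \<theta>\<close> and \<open>w + \<sigma> r\<close>: the
    whole path from \<open>w\<close> to \<open>y \<theta>\<close> lies in one gap of
    \<open>M\<close>.\<close>
  define seg where "seg \<theta> \<longleftrightarrow> (AE u in M. r \<le> \<sigma> * (u - w) \<or> \<theta> \<le> \<sigma> * (w - u))" for \<theta>
  \<comment> \<open>Along \<open>y\<close> the second moment has derivative
    \<open>- 2 \<sigma> * moment M 3\<close>, so positivity means strict decrease. Excluding the end
    \<open>\<theta>\<close> from the sign condition makes \<open>S\<close> contain its
    supremum.\<close>
  define S where "S = {\<theta>. 0 < \<theta> \<and> seg \<theta> \<and> (\<forall>\<theta>'. 0 \<le> \<theta>' \<and> \<theta>' < \<theta> \<longrightarrow> 0 < \<sigma> * moment M 3 (y \<theta>'))}"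
  have gapr: "AE u in M. min r (\<theta> - \<theta>') \<le> \<bar>u - y \<theta>'\<bar>" if "seg \<theta>" "0 \<le> \<theta>'" "\<theta>' < \<theta>" for \<theta> \<theta>'
    using that(1) unfolding seg_def y_def
    by eventually_elim (use that(2,3) \<sigma> in \<open>auto simp: min_le_iff_disj\<close>)
  have anti: "moment M 2 (y \<theta>2) < moment M 2 (y \<theta>1)" if "\<theta> \<in> S" "0 \<le> \<theta>1" "\<theta>1 < \<theta>2" "\<theta>2 < \<theta>" for \<theta> \<theta>1 \<theta>2
  proof -
    have sg: "seg \<theta>" and J: "0 < \<sigma> * moment M 3 (y \<theta>2)" using that unfolding S_def by auto
    have "moment M 2 (y \<theta>2) + 2 * (y \<theta>1 - y \<theta>2) * moment M 3 (y \<theta>2) \<le> moment M 2 (y \<theta>1)"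
    proof (rule mh.moment2_tangent[OF _ gapr[OF sg, of \<theta>1] _ gapr[OF sg, of \<theta>2]])
      show "AE u in M. 0 < (u - y \<theta>1) * (u - y \<theta>2)"
        using sg unfolding seg_def
      proof eventually_elim
        case (elim u)
        have "0 < (\<sigma> * (u - y \<theta>1)) * (\<sigma> * (u - y \<theta>2))"
          using elim
        proof
          assume "r \<le> \<sigma> * (u - w)"
          then have "0 < \<sigma> * (u - y \<theta>1)" "0 < \<sigma> * (u - y \<theta>2)" using r that(2,3) \<sigma> unfolding y_def by auto
          then show ?thesis by (rule mult_pos_pos)
        next
          assume "\<theta> \<le> \<sigma> * (w - u)"
          then have "\<sigma> * (u - y \<theta>1) < 0" "\<sigma> * (u - y \<theta>2) < 0" using that(2-4) \<sigma> unfolding y_def by auto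
          then show ?thesis by (rule mult_neg_neg)
        qed
        moreover have "(\<sigma> * (u - y \<theta>1)) * (\<sigma> * (u - y \<theta>2)) = (u - y \<theta>1) * (u - y \<theta>2)"
          using \<sigma> by (auto simp: algebra_simps)
        ultimately show ?case by simp
      qed
    qed (use that r in auto)
    moreover have "2 * (y \<theta>1 - y \<theta>2) * moment M 3 (y \<theta>2) = 2 * (\<theta>2 - \<theta>1) * (\<sigma> * moment M 3 (y \<theta>2))"
      unfolding y_def by (simp add: algebra_simps)
    moreover have "0 < 2 * (\<theta>2 - \<theta>1) * (\<sigma> * moment M 3 (y \<theta>2))" using J that by simp
    ultimately show ?thesis by linarith
  qed
  have fin: "sqpot M (of_real (y \<theta>')) < \<infinity>" "sqint M (of_real (y \<theta>')) = moment M 2 (y \<theta>')"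
    if "\<theta> \<in> S" "0 \<le> \<theta>'" "\<theta>' < \<theta>" for \<theta> \<theta>'
    using mh.sqpot_gap[OF _ gapr[of \<theta> \<theta>']] that r unfolding S_def by auto
  obtain \<theta>0 where \<theta>0: "\<theta>0 \<in> S"
  proof -
    obtain m where m: "0 < m" "m \<le> r / 2" "\<And>e. \<bar>e\<bar> \<le> m \<Longrightarrow> 0 < \<sigma> * moment M 3 (w + e)"
      using mh.moment3_sign_stable[OF r g j3] unfolding \<sigma>_def by blast
    have "seg m" unfolding seg_def using g by eventually_elim (use m(1,2) \<sigma> in auto)
    moreover have "0 < \<sigma> * moment M 3 (y \<theta>')" if "0 \<le> \<theta>'" "\<theta>' < m" for \<theta>'
      using m(3)[of "- \<sigma> * \<theta>'"] that \<sigma> unfolding y_def by auto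
    ultimately have "m \<in> S" unfolding S_def using m(1) by auto
    then show ?thesis by (rule that)
  qed
  show ?thesis
  proof (cases "bdd_above S")
    \<comment> \<open>Then \<open>M\<close> lies entirely on one side of \<open>w\<close>, and the
      whole half-line beyond \<open>w\<close> is admissible at time \<open>t\<close>. Its image
      under \<open>H t\<close> covers every real point beyond \<open>Et\<close>, where
      \<open>\<omega> t\<close> is thus real: \<open>Et\<close> would be extreme.\<close>
    case False
    have big: "\<exists>\<theta>\<in>S. L < \<theta>" for L using False unfolding bdd_above_def by (meson not_le)
    have side: "AE u in M. r \<le> \<sigma> * (u - w)"
    proof -
      have "AE u in M. \<forall>n. r \<le> \<sigma> * (u - w) \<or> real n \<le> \<sigma> * (w - u)"
        unfolding AE_all_countable
      proof
        fix n
        obtain \<theta> where "\<theta> \<in> S" "real n < \<theta>" using big by blast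
        then have "seg \<theta>" unfolding S_def by auto
        then show "AE u in M. r \<le> \<sigma> * (u - w) \<or> real n \<le> \<sigma> * (w - u)"
          unfolding seg_def by eventually_elim (use \<open>real n < \<theta>\<close> in auto)
      qed
      then show ?thesis
      proof eventually_elim
        case (elim u)
        obtain n where "\<sigma> * (w - u) < real n" using reals_Archimedean2 by blast
        then show ?case using elim by (metis not_le)
      qed
    qed
    have ad: "adm t (of_real (y \<theta>))" if "0 \<le> \<theta>" for \<theta>
    proof -
      obtain \<theta>' where \<theta>': "\<theta>' \<in> S" "\<theta> < \<theta>'" using big by blast
      have "moment M 2 (y \<theta>) \<le> 1 / (t - 1)"
      proof (cases "\<theta> = 0")
        case True
        then show ?thesis using c y0 by simp
      next
        case False
        then show ?thesis using anti[OF \<theta>'(1), of 0 \<theta>] \<theta>'(2) that c y0 by simp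
      qed
      moreover have "AE u in M. min r (\<theta>' - \<theta>) \<le> \<bar>u - y \<theta>\<bar>" using \<theta>' that unfolding S_def by (intro gapr) auto
      ultimately show ?thesis using r \<theta>' by (intro adm_critical[OF t, of "min r (\<theta>' - \<theta>)"]) auto
    qed
    define h where "h \<theta> = \<sigma> * Re (H t (of_real (y \<theta>)))" for \<theta>
    have h_cont: "continuous_on {0..L} h" for L
    proof -
      have "continuous_on {0..L} (\<lambda>\<theta>. Re (H ((\<lambda>_. t) \<theta>) (of_real (y \<theta>))))"
        using t ad by (intro H_real_continuous) (auto simp: y_def intro!: continuous_intros)
      then show ?thesis unfolding h_def by (rule continuous_on_mult_left)
    qed
    have h_le: "h \<theta> \<le> \<sigma> * w - \<theta>" if "0 \<le> \<theta>" for \<theta>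
    proof -
      have "0 \<le> (\<integral>u. \<sigma> * (1 / (u - y \<theta>)) \<partial>M)"
      proof (rule integral_nonneg_AE)
        show "AE u in M. 0 \<le> \<sigma> * (1 / (u - y \<theta>))"
          using side
        proof eventually_elim
          case (elim u)
          then have "0 \<le> \<sigma> * (u - y \<theta>)" using r that \<sigma> unfolding y_def by auto
          then show ?case using \<sigma> by (auto simp: divide_le_0_iff)
        qed
      qed
      then have "0 \<le> \<sigma> * (\<integral>u. 1 / (u - y \<theta>) \<partial>M)" by (simp only: integral_mult_right_zero)
      then have "0 \<le> (t - 1) * (\<sigma> * (\<integral>u. 1 / (u - y \<theta>) \<partial>M))" using t by simp
      moreover have "h \<theta> = \<sigma> * y \<theta> - (t - 1) * (\<sigma> * (\<integral>u. 1 / (u - y \<theta>) \<partial>M))"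
        unfolding h_def H_def stieltjes_of_real by (simp add: algebra_simps)
      moreover have "\<sigma> * y \<theta> = \<sigma> * w - \<theta>" unfolding y_def using \<sigma> by auto
      ultimately show ?thesis by simp
    qed
    \<comment> \<open>\<open>h\<close> is continuous, equals \<open>\<sigma> Et\<close> at 0 and
      lies below \<open>\<sigma> w - \<theta>\<close>, so it attains the value
      \<open>\<sigma> x\<close>.\<close>
    have zero: "Im (\<omega> t (of_real x)) = 0" if x: "\<sigma> * (x - Et) < 0" for x
    proof -
      define L where "L = \<bar>\<sigma> * (w - x)\<bar>"
      have h0: "h 0 = \<sigma> * Et" unfolding h_def y0 E by simp
      have "h L \<le> \<sigma> * x" using h_le[of L] \<sigma> unfolding L_def by auto
      moreover have "\<sigma> * x \<le> h 0" using x unfolding h0 by (simp add: algebra_simps)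
      ultimately obtain \<theta> where \<theta>: "0 \<le> \<theta>" "h \<theta> = \<sigma> * x"
        using IVT2'[of h L "\<sigma> * x" 0] h_cont[of L] unfolding L_def by auto
      have "Re (H t (of_real (y \<theta>))) = x" using \<theta>(2) \<sigma> unfolding h_def by auto
      then have "H t (of_real (y \<theta>)) = of_real x" using H_real by metis
      then have "\<omega> t (of_real x) = of_real (y \<theta>)" using omega_H(2)[OF t ad[OF \<theta>(1)]] by simp
      then show ?thesis by simp
    qed
    have "x \<notin> msupp (ac_part (\<nu> t))" if "\<sigma> * (x - Et) < 0" for x
    proof (rule msupp_zero[OF t, of "{x. \<sigma> * (x - Et) < 0}"])
      show "open {x. \<sigma> * (x - Et) < 0}" by (intro open_Collect_less continuous_intros)
    qed (use that zero in auto)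
    then show ?thesis using lr \<sigma> by auto
  next
    case True
    define \<theta>s where "\<theta>s = Sup S"
    have lt: "\<exists>\<theta>\<in>S. \<theta>' < \<theta>" if "\<theta>' < \<theta>s" for \<theta>'
      using less_cSup_iff[of S \<theta>'] \<theta>0 True that unfolding \<theta>s_def by auto
    have ub: "\<theta> \<le> \<theta>s" if "\<theta> \<in> S" for \<theta> unfolding \<theta>s_def using True that by (rule cSup_upper[rotated])
    have pos: "0 < \<theta>s" using ub[OF \<theta>0] \<theta>0 unfolding S_def by auto
    have J: "0 < \<sigma> * moment M 3 (y \<theta>')" if "0 \<le> \<theta>'" "\<theta>' < \<theta>s" for \<theta>'
      using lt[OF that(2)] that(1) unfolding S_def by auto
    have segs: "seg \<theta>s"
    proof -
      define f where "f n = \<theta>s - \<theta>s * inverse (real (Suc n))" for n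
      have "f \<longlonglongrightarrow> \<theta>s - \<theta>s * 0" unfolding f_def by (intro tendsto_intros LIMSEQ_inverse_real_of_nat)
      then have fl: "f \<longlonglongrightarrow> \<theta>s" by simp
      have "AE u in M. \<forall>n. r \<le> \<sigma> * (u - w) \<or> f n \<le> \<sigma> * (w - u)"
        unfolding AE_all_countable
      proof
        fix n
        have "f n < \<theta>s" unfolding f_def using pos by simp
        then obtain \<theta> where \<theta>: "\<theta> \<in> S" "f n < \<theta>" using lt by blast
        then have "seg \<theta>" unfolding S_def by auto
        then show "AE u in M. r \<le> \<sigma> * (u - w) \<or> f n \<le> \<sigma> * (w - u)"
          unfolding seg_def by eventually_elim (use \<theta>(2) in auto)
      qed
      then show ?thesis
        unfolding seg_def
      proof eventually_elim
        case (elim u)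
        show ?case
        proof (rule disjCI)
          assume "\<not> \<theta>s \<le> \<sigma> * (w - u)"
          moreover have "\<theta>s \<le> \<sigma> * (w - u)" if "\<not> r \<le> \<sigma> * (u - w)"
            using elim that by (intro LIMSEQ_le_const2[OF fl]) auto
          ultimately show "r \<le> \<sigma> * (u - w)" by blast
        qed
      qed
    qed
    have sS: "\<theta>s \<in> S" unfolding S_def using pos segs J by auto
    define ws where "ws = y \<theta>s"
    \<comment> \<open>At the end \<open>ws\<close> there may be no gap; finiteness of
      \<open>sqpot\<close> and the upper bound are inherited from the path by
      semicontinuity.\<close>
    have lsc: "sqpot M (of_real ws) \<le> ennreal (moment M 2 (y \<theta>))" if \<theta>: "0 \<le> \<theta>" "\<theta> < \<theta>s" for \<theta>
    proof -
      define f where "f n = \<theta>s - (\<theta>s - \<theta>) * inverse (real (Suc n))" for n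
      have "f \<longlonglongrightarrow> \<theta>s - (\<theta>s - \<theta>) * 0" unfolding f_def by (intro tendsto_intros LIMSEQ_inverse_real_of_nat)
      then have fl: "f \<longlonglongrightarrow> \<theta>s" by simp
      have f: "\<theta> \<le> f n" "f n < \<theta>s" for n
      proof -
        have "inverse (real (Suc n)) \<le> 1" by (simp add: inverse_eq_divide)
        then have "(\<theta>s - \<theta>) * inverse (real (Suc n)) \<le> (\<theta>s - \<theta>) * 1" using \<theta> by (intro mult_left_mono) auto
        then show "\<theta> \<le> f n" unfolding f_def by simp
        show "f n < \<theta>s" unfolding f_def using \<theta> by simp
      qed
      have "(\<lambda>n. complex_of_real (y (f n))) \<longlonglongrightarrow> of_real ws"
        unfolding ws_def y_def by (intro tendsto_intros fl)
      then show ?thesis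
      proof (rule mh.sqpot_lsc[OF _ _ tendsto_const])
        fix n
        have n: "0 \<le> f n" using f(1)[of n] \<theta> by simp
        have "moment M 2 (y (f n)) \<le> moment M 2 (y \<theta>)"
          using anti[OF sS \<theta>(1), of "f n"] f[of n] by (cases "\<theta> = f n") auto
        then show "sqpot M (of_real (y (f n))) \<le> ennreal (moment M 2 (y \<theta>))"
          using fin[OF sS n f(2)] mh.sqpot_eq_sqint(3)[of "of_real (y (f n))"] by (simp add: ennreal_leI)
      qed
    qed
    have finw: "sqpot M (of_real ws) < \<infinity>" using mh.sqpot_leD(1)[OF lsc[of 0]] pos by simp
    define \<phi> where "\<phi> \<theta> = sqint M (of_real (y \<theta>))" for \<theta>
    have \<phi>_lt: "\<phi> \<theta> = moment M 2 (y \<theta>)" if "0 \<le> \<theta>" "\<theta> < \<theta>s" for \<theta> unfolding \<phi>_def using fin(2)[OF sS that] .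
    have fin\<phi>: "sqpot M (of_real (y \<theta>)) < \<infinity>" if "0 \<le> \<theta>" "\<theta> \<le> \<theta>s" for \<theta>
      using fin(1)[OF sS that(1)] finw that(2) unfolding ws_def by (cases "\<theta> = \<theta>s") auto
    have \<phi>_anti: "\<phi> \<theta>2 < \<phi> \<theta>1" if "0 \<le> \<theta>1" "\<theta>1 < \<theta>2" "\<theta>2 \<le> \<theta>s" for \<theta>1 \<theta>2
    proof (cases "\<theta>2 = \<theta>s")
      case False
      then show ?thesis using anti[OF sS that(1,2)] that \<phi>_lt by simp
    next
      case True
      define \<theta>3 where "\<theta>3 = (\<theta>1 + \<theta>s) / 2"
      have \<theta>3: "\<theta>1 < \<theta>3" "\<theta>3 < \<theta>s" "0 \<le> \<theta>3" unfolding \<theta>3_def using that True by auto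
      have "0 \<le> moment M 2 (y \<theta>3)" using \<phi>_lt[OF \<theta>3(3,2)] mh.sqint_nonneg unfolding \<phi>_def by metis
      then have "\<phi> \<theta>2 \<le> moment M 2 (y \<theta>3)"
        using mh.sqpot_leD(2)[OF lsc[OF \<theta>3(3,2)]] unfolding \<phi>_def True ws_def by simp
      also have "\<dots> < \<phi> \<theta>1" using anti[OF sS that(1) \<theta>3(1,2)] \<phi>_lt[OF that(1)] \<theta>3 by simp
      finally show ?thesis .
    qed
    have \<phi>_cont: "continuous_on {0..\<theta>s} \<phi>"
      unfolding continuous_on_sequentially
    proof (intro ballI allI impI, elim conjE)
      fix \<theta> f assume \<theta>: "\<theta> \<in> {0..\<theta>s}" and f: "\<forall>n. f n \<in> {0..\<theta>s}" "f \<longlonglongrightarrow> \<theta>"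
      have fw: "sqpot M (of_real w) < \<infinity>" by (rule mh.sqpot_gap(1)[OF r g])
      \<comment> \<open>Each \<open>u\<close> is at least as close to one of the two ends
        \<open>w\<close>, \<open>ws\<close> as to any point of the path. The sum of the two end
        integrands therefore dominates.\<close>
      have dist: "AE u in M. \<forall>\<theta>\<in>{0..\<theta>s}. u \<noteq> y \<theta> \<and> (\<bar>u - ws\<bar> \<le> \<bar>u - y \<theta>\<bar> \<and> u \<noteq> ws \<or> \<bar>u - w\<bar> \<le> \<bar>u - y \<theta>\<bar> \<and> u \<noteq> w)"
        using segs[unfolded seg_def] mh.sqpot_eq_sqint(1)[OF finw]
      proof eventually_elim
        case (elim u)
        have uw: "u \<noteq> ws" using elim(2) by auto
        show ?case
        proof (intro ballI)
          fix \<theta> assume \<theta>: "\<theta> \<in> {0..\<theta>s}"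
          from elim(1) show "u \<noteq> y \<theta> \<and> (\<bar>u - ws\<bar> \<le> \<bar>u - y \<theta>\<bar> \<and> u \<noteq> ws \<or> \<bar>u - w\<bar> \<le> \<bar>u - y \<theta>\<bar> \<and> u \<noteq> w)"
          proof
            assume "r \<le> \<sigma> * (u - w)"
            then have "u \<noteq> w" "\<bar>u - w\<bar> \<le> \<bar>u - y \<theta>\<bar>" using r \<theta> \<sigma> unfolding y_def by auto
            then show ?thesis by auto
          next
            assume "\<theta>s \<le> \<sigma> * (w - u)"
            then have "\<bar>u - ws\<bar> \<le> \<bar>u - y \<theta>\<bar>" using \<theta> \<sigma> unfolding ws_def y_def by auto
            then show ?thesis using uw by auto
          qed
        qed
      qed
      show "(\<phi> \<circ> f) \<longlonglongrightarrow> \<phi> \<theta>"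
        unfolding o_def \<phi>_def sqint_def
      proof (rule integral_dominated_convergence[where w = "\<lambda>u. 1 / (cmod (of_real u - of_real ws))\<^sup>2 + 1 / (cmod (of_real u - of_real w))\<^sup>2"])
        show "integrable M (\<lambda>u. 1 / (cmod (of_real u - of_real ws))\<^sup>2 + 1 / (cmod (of_real u - of_real w))\<^sup>2)"
          by (intro Bochner_Integration.integrable_add mh.sqpot_eq_sqint(2) finw fw)
        show "AE u in M. (\<lambda>n. 1 / (cmod (of_real u - of_real (y (f n))))\<^sup>2) \<longlonglongrightarrow> 1 / (cmod (of_real u - of_real (y \<theta>)))\<^sup>2"
          using dist
        proof eventually_elim
          case (elim u)
          then have "u \<noteq> y \<theta>" using \<theta> by blast
          then have "u - (w - \<sigma> * \<theta>) \<noteq> 0" unfolding y_def by simp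
          then show ?case
            unfolding cmod_real_diff y_def by (intro tendsto_intros f(2)) auto
        qed
        show "AE u in M. norm (1 / (cmod (of_real u - of_real (y (f n))))\<^sup>2) \<le> 1 / (cmod (of_real u - of_real ws))\<^sup>2 + 1 / (cmod (of_real u - of_real w))\<^sup>2" for n
          using dist
        proof eventually_elim
          case (elim u)
          have inv: "1 / \<bar>u - y (f n)\<bar>\<^sup>2 \<le> 1 / \<bar>u - z\<bar>\<^sup>2" if "\<bar>u - z\<bar> \<le> \<bar>u - y (f n)\<bar>" "u \<noteq> z" for z
            using that by (intro frac_le power_mono) auto
          have nn: "0 \<le> 1 / \<bar>u - z\<bar>\<^sup>2" for z by simp
          have "1 / \<bar>u - y (f n)\<bar>\<^sup>2 \<le> 1 / \<bar>u - ws\<bar>\<^sup>2 \<or> 1 / \<bar>u - y (f n)\<bar>\<^sup>2 \<le> 1 / \<bar>u - w\<bar>\<^sup>2"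
            using elim f(1) inv by blast
          then have "1 / \<bar>u - y (f n)\<bar>\<^sup>2 \<le> 1 / \<bar>u - ws\<bar>\<^sup>2 + 1 / \<bar>u - w\<bar>\<^sup>2" using nn[of ws] nn[of w] by linarith
          moreover have "norm (1 / \<bar>u - y (f n)\<bar>\<^sup>2) = 1 / \<bar>u - y (f n)\<bar>\<^sup>2" by simp
          ultimately show ?case unfolding cmod_real_diff by linarith
        qed
      qed measurable
    qed
    have inj: "inj_on \<phi> {0..\<theta>s}"
      by (rule inj_onI) (metis \<phi>_anti atLeastAtMost_iff less_irrefl linorder_neqE_linordered_idom)
    define q where "q = \<phi> \<theta>s"
    have q: "0 < q" unfolding q_def \<phi>_def using mh.sqint_pos[OF finw ne] unfolding ws_def .
    have \<phi>0: "\<phi> 0 = 1 / (t - 1)" using \<phi>_lt[of 0] pos c y0 by simp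
    have q1: "q < 1 / (t - 1)" using \<phi>_anti[of 0 \<theta>s] pos unfolding q_def \<phi>0 by simp
    \<comment> \<open>The time at which the critical level \<open>1 / (t' - 1)\<close> reaches the
      minimum \<open>q\<close> of \<open>\<phi>\<close> on the path.\<close>
    define t' where "t' = 1 + 1 / q"
    have tt': "t < t'" "1 < t'" "1 / (t' - 1) = q" using q q1 t unfolding t'_def by (auto simp: field_simps)
    define \<theta> where "\<theta> s = inv_into {0..\<theta>s} \<phi> (1 / (s - 1))" for s
    have range: "1 / (s - 1) \<in> \<phi> ` {0..\<theta>s}" if s: "s \<in> {t..t'}" for s
    proof -
      have "1 / (s - 1) \<le> \<phi> 0" unfolding \<phi>0 using s t by (intro frac_le) auto
      moreover have "\<phi> \<theta>s \<le> 1 / (s - 1)" unfolding q_def[symmetric] tt'(3)[symmetric] using s t by (intro frac_le) auto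
      ultimately obtain x where "0 \<le> x" "x \<le> \<theta>s" "\<phi> x = 1 / (s - 1)"
        using IVT2'[of \<phi> \<theta>s "1 / (s - 1)" 0] \<phi>_cont pos by auto
      then show ?thesis by (intro image_eqI[of _ _ x]) auto
    qed
    have \<theta>: "0 \<le> \<theta> s" "\<theta> s \<le> \<theta>s" "\<phi> (\<theta> s) = 1 / (s - 1)" if "s \<in> {t..t'}" for s
      using inv_into_into[OF range[OF that]] f_inv_into_f[OF range[OF that]] unfolding \<theta>_def by auto
    have \<theta>_cont: "continuous_on {t..t'} \<theta>"
    proof -
      have "continuous_on (\<phi> ` {0..\<theta>s}) (inv_into {0..\<theta>s} \<phi>)"
        by (rule continuous_on_inv[OF \<phi>_cont compact_Icc]) (simp add: inv_into_f_f[OF inj])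
      moreover have "continuous_on {t..t'} (\<lambda>s. 1 / (s - 1))" using t by (intro continuous_intros) auto
      moreover have "(\<lambda>s. 1 / (s - 1)) ` {t..t'} \<subseteq> \<phi> ` {0..\<theta>s}" using range by blast
      ultimately have "continuous_on {t..t'} (\<lambda>s. inv_into {0..\<theta>s} \<phi> (1 / (s - 1)))"
        by (rule continuous_on_compose2)
      then show ?thesis unfolding \<theta>_def .
    qed
    have adms: "adm s (of_real (y (\<theta> s)))" if s: "s \<in> {t..t'}" for s
      unfolding adm_def
      using mh.sqpot_le_iff[OF fin\<phi>[OF \<theta>(1,2)[OF s]], of "1 / (s - 1)"] \<theta>(3)[OF s] s t unfolding \<phi>_def by simp
    define Ef where "Ef s = Re (H s (of_real (y (\<theta> s))))" for s
    have HE: "H s (of_real (y (\<theta> s))) = of_real (Ef s)" for s unfolding Ef_def by (rule H_real)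
    have Ef_cont: "continuous_on {t..t'} Ef"
      unfolding Ef_def
      by (rule H_real_continuous[of _ "\<lambda>s. y (\<theta> s)" "\<lambda>s. s"])
         (use t adms in \<open>auto simp: y_def intro!: continuous_intros \<theta>_cont\<close>)
    have \<theta>t: "\<theta> t = 0"
      using inj_onD[OF inj, of "\<theta> t" 0] \<theta>[of t] \<phi>0 tt' pos by auto
    have \<theta>t': "\<theta> t' = \<theta>s"
      using inj_onD[OF inj, of "\<theta> t'" \<theta>s] \<theta>[of t'] tt' pos q_def by auto
    have \<theta>_less: "\<theta> s < \<theta>s" if s: "s \<in> {t..<t'}" for s
    proof -
      have "1 / (t' - 1) < 1 / (s - 1)" using s t by (intro frac_less2) auto
      then show ?thesis using \<theta>[of s] s tt'(3) unfolding q_def by (cases "\<theta> s = \<theta>s") auto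
    qed
    have ext: "exterior_point (\<nu> s) (Ef s)" if s: "s \<in> {t..<t'}" for s
    proof -
      have s': "s \<in> {t..t'}" using s by auto
      note l = \<theta>_less[OF s] and n = \<theta>(1)[OF s']
      have "moment M 2 (y (\<theta> s)) = 1 / (s - 1)" using \<phi>_lt[OF n l] \<theta>(3)[OF s'] by simp
      moreover have "moment M 3 (y (\<theta> s)) \<noteq> 0" using J[OF n l] by auto
      ultimately show ?thesis
        using s t r l by (intro simple_edge_msupp(2)[OF _ _ gapr[OF segs n l] _ HE]) auto
    qed
    have "\<exists>\<rho>>0. \<forall>z. z \<noteq> ws \<and> \<bar>z - ws\<bar> < \<rho> \<longrightarrow> ennreal q < sqpot M (of_real z)"
    proof (cases "gap M ws")
      case True
      then obtain r2 where r2: "0 < r2" "AE u in M. r2 \<le> \<bar>u - ws\<bar>" unfolding gap_def by blast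
      \<comment> \<open>With a gap at \<open>ws\<close> and a nonzero third moment, necessarily of
        the sign \<open>\<sigma>\<close>, the path could be prolonged past its supremum.\<close>
      have "moment M 3 ws = 0"
      proof (rule ccontr)
        assume nz: "moment M 3 ws \<noteq> 0"
        obtain m where m: "0 < m" "m \<le> r2 / 2" "\<And>e. \<bar>e\<bar> \<le> m \<Longrightarrow> 0 < sgn (moment M 3 ws) * moment M 3 (ws + e)"
          using mh.moment3_sign_stable[OF r2 nz] by blast
        have near: "0 < sgn (moment M 3 ws) * moment M 3 (y \<theta>)" if "\<bar>\<theta>s - \<theta>\<bar> \<le> m" for \<theta>
        proof -
          have "y \<theta> = ws + \<sigma> * (\<theta>s - \<theta>)" unfolding ws_def y_def by (simp add: algebra_simps)
          then show ?thesis using m(3)[of "\<sigma> * (\<theta>s - \<theta>)"] that \<sigma> by (auto simp: abs_minus_commute)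
        qed
        define \<theta>1 where "\<theta>1 = \<theta>s - min m \<theta>s / 2"
        have \<theta>1: "0 \<le> \<theta>1" "\<theta>1 < \<theta>s" "\<bar>\<theta>s - \<theta>1\<bar> \<le> m" unfolding \<theta>1_def using m(1) pos by auto
        have sg: "sgn (moment M 3 ws) = \<sigma>"
          using near[OF \<theta>1(3)] J[OF \<theta>1(1,2)] \<sigma> nz by (auto simp: sgn_if split: if_splits)
        have "\<theta>s + m \<in> S"
          unfolding S_def
        proof (intro CollectI conjI allI impI)
          show "0 < \<theta>s + m" using pos m by simp
          show "seg (\<theta>s + m)"
            using segs r2(2) unfolding seg_def
            by eventually_elim (use \<sigma> m r2(1) in \<open>auto simp: ws_def y_def\<close>)
          fix \<theta>' assume \<theta>': "0 \<le> \<theta>' \<and> \<theta>' < \<theta>s + m"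
          show "0 < \<sigma> * moment M 3 (y \<theta>')"
            using J[of \<theta>'] near[of \<theta>'] \<theta>' unfolding sg by (cases "\<theta>' < \<theta>s") auto
        qed
        from ub[OF this] show False using m by simp
      qed
      from mh.moment2_above_at_critical[OF r2 ne this]
      obtain \<rho> where \<rho>: "0 < \<rho>" "\<And>z. z \<noteq> ws \<Longrightarrow> \<bar>z - ws\<bar> < \<rho> \<Longrightarrow> sqpot M (of_real z) < \<infinity> \<and> moment M 2 ws < sqint M (of_real z)"
        by blast
      have "q = moment M 2 ws" using mh.sqpot_gap(2)[OF r2] unfolding q_def \<phi>_def ws_def by simp
      then show ?thesis
        using \<rho> q by (intro exI[of _ \<rho>]) (auto simp: mh.sqpot_eq_sqint(3) ennreal_less_iff)
    next
      \<comment> \<open>Now \<open>ws\<close> lies in a band. All but finitely many points of bands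
        have infinite \<open>sqpot M\<close>, so near \<open>ws\<close> it remains to see that the
        side away from the path is in a band.\<close>
      case False
      obtain K where K: "\<forall>y\<in>K. \<exists>d>0. {y - d<..<y} \<subseteq> K \<or> {y<..<y + d} \<subseteq> K"
          "finite {y \<in> K. sqpot M (of_real y) < \<infinity>}"
          "\<forall>y. y \<notin> K \<longrightarrow> (\<exists>d>0. AE u in \<mu>. u = y \<or> d \<le> \<bar>u - y\<bar>)"
        using ac_support_structure by blast
      have wK: "ws \<in> K" using K(3) gap_of_isolated[OF finw] False by blast
      obtain d0 where d0: "0 < d0" "\<forall>x\<in>{y \<in> K. sqpot M (of_real y) < \<infinity>}. x \<noteq> ws \<longrightarrow> d0 \<le> dist ws x"
        using finite_set_avoid[OF K(2)] by blast
      have inf: "sqpot M (of_real z) = \<infinity>" if "z \<in> K" "z \<noteq> ws" "\<bar>z - ws\<bar> < d0" for z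
        using d0(2) that by (auto simp: dist_real_def abs_minus_commute not_less less_top)
      obtain d where d: "0 < d" "{ws - d<..<ws} \<subseteq> K \<or> {ws<..<ws + d} \<subseteq> K" using K(1) wK by blast
      define \<rho> where "\<rho> = min (min d d0) \<theta>s"
      have \<rho>: "0 < \<rho>" "\<rho> \<le> d" "\<rho> \<le> d0" "\<rho> \<le> \<theta>s" unfolding \<rho>_def using d d0 pos by auto
      have ins: "ennreal q < sqpot M (of_real z) \<and> sqpot M (of_real z) < \<infinity>" if z: "\<bar>z - ws\<bar> < \<rho>" "0 < \<sigma> * (z - ws)" for z
      proof -
        define \<theta> where "\<theta> = \<sigma> * (w - z)"
        have z': "z = y \<theta>" unfolding \<theta>_def y_def using \<sigma> by auto
        have th: "0 \<le> \<theta>" "\<theta> < \<theta>s" using z \<rho>(4) \<sigma> unfolding z' ws_def y_def by auto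
        have f: "sqpot M (of_real z) < \<infinity>" unfolding z' using fin\<phi>[of \<theta>] th by simp
        have "q < \<phi> \<theta>" unfolding q_def using \<phi>_anti[of \<theta> \<theta>s] th by simp
        then have "ennreal q < sqpot M (of_real z)"
          using f q unfolding mh.sqpot_eq_sqint(3)[OF f] unfolding z' \<phi>_def by (simp add: ennreal_less_iff)
        then show ?thesis using f by simp
      qed
      \<comment> \<open>On the side of the path \<open>sqpot M\<close> is finite, so that side is
        outside \<open>K\<close>; since \<open>ws\<close> has band points on one full side, it is
        the other one.\<close>
      have out: "z \<in> K" if z: "\<bar>z - ws\<bar> < \<rho>" "\<sigma> * (z - ws) < 0" for z
      proof -
        define z1 where "z1 = ws + \<sigma> * (\<rho> / 2)"
        have z1: "\<bar>z1 - ws\<bar> < \<rho>" "0 < \<sigma> * (z1 - ws)" using \<sigma> \<rho>(1) unfolding z1_def by auto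
        have "z1 \<noteq> ws" using z1(2) by auto
        then have "z1 \<notin> K" using inf[of z1] ins[OF z1] z1(1) \<rho>(3) by auto
        then show ?thesis using d(2) z z1 \<rho>(2) \<sigma> unfolding z1_def by (auto simp: subset_eq)
      qed
      have "ennreal q < sqpot M (of_real z)" if z: "z \<noteq> ws" "\<bar>z - ws\<bar> < \<rho>" for z
      proof (cases "0 < \<sigma> * (z - ws)")
        case True
        then show ?thesis using ins z by blast
      next
        case False
        then have "\<sigma> * (z - ws) < 0" using z(1) \<sigma> by auto
        from inf[OF out[OF z(2) this] z(1)] z(2) \<rho>(3) show ?thesis by simp
      qed
      then show ?thesis using \<rho>(1) by blast
    qed
    then obtain \<rho> where \<rho>: "0 < \<rho>" "\<And>z. z \<noteq> ws \<Longrightarrow> \<bar>z - ws\<bar> < \<rho> \<Longrightarrow> ennreal q < sqpot M (of_real z)" by blast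
    have int: "interior_point (\<nu> t') (Ef t')"
    proof (rule strict_min_interior[OF tt'(2) _ _ \<rho>(1)])
      show "adm t' (of_real ws)" using adms[of t'] tt' unfolding \<theta>t' ws_def by simp
      show "H t' (of_real ws) = of_real (Ef t')" using HE[of t'] unfolding \<theta>t' ws_def .
      show "ennreal (1 / (t' - 1)) < sqpot M (of_real z)" if "z \<noteq> ws" "\<bar>z - ws\<bar> < \<rho>" for z
        unfolding tt'(3) using \<rho>(2) that .
    qed
    have "edge_family \<nu> t Et t' (Ef t') Ef"
      unfolding edge_family_def
    proof (intro conjI ballI)
      show "continuous_on {t..<t'} Ef" by (rule continuous_on_subset[OF Ef_cont]) auto
      show "Ef t = Et" unfolding Ef_def \<theta>t y0 E by simp
      show "(Ef \<longlongrightarrow> Ef t') (at_left t')" using continuous_on_Icc_at_leftD[OF Ef_cont tt'(1)] .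
    qed (use tt' ext int in auto)
    then show ?thesis by blast
  qed
qed

end

section \<open>Merging edges\<close>

text \<open>All that the two regimes need to know about one point \<open>x\<close>: the local
  equation, admissibility with its equality case, and the density \<open>\<rho>\<close> linearized
  as \<open>m2 * Im d / pi\<close>. It separates real-variable estimates from the measures.\<close>

definition edge_data :: "real \<Rightarrow> real \<Rightarrow> real \<Rightarrow> real \<Rightarrow> real \<Rightarrow> real \<Rightarrow> complex \<Rightarrow> real \<Rightarrow> bool" where
  "edge_data C \<epsilon> X j3 j4 m2 d \<rho> \<longleftrightarrow> cmod d \<le> \<epsilon> \<and> 0 \<le> Im d \<and>
     cmod (of_real X + of_real j3 * d\<^sup>2 + of_real j4 * d ^ 3) \<le> C * cmod d ^ 4 \<and>
     2 * j3 * Re d + j4 * (3 * (Re d)\<^sup>2 - (Im d)\<^sup>2) \<le> C * cmod d ^ 3 \<and>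
     (0 < Im d \<longrightarrow> - (C * cmod d ^ 3) \<le> 2 * j3 * Re d + j4 * (3 * (Re d)\<^sup>2 - (Im d)\<^sup>2)) \<and>
     \<bar>pi * \<rho> - m2 * Im d\<bar> \<le> C * (cmod d)\<^sup>2 \<and> (Im d = 0 \<longrightarrow> \<rho> = 0)"

text \<open>\<open>\<tau> / T\<close> is \<open>1 / (s - 1) - 1 / (t' - 1)\<close>, the excess of
  the critical level over its limit, and \<open>L\<close> is the predicted size of the displacement
  \<open>e\<close> of \<open>w\<close>. Two edges may arrive from opposite sides, so
  \<open>e\<close> has no fixed sign and only \<open>|e|\<close> and \<open>|j3|\<close> are
  compared with \<open>L\<close>.\<close>

lemma branch_scale:
  fixes e j3 j4 C \<tau> T :: real
  assumes \<tau>: "0 < \<tau>" "0 < T" and j4: "0 < j4" and C: "0 < C" and e: "\<bar>e\<bar> \<le> j4 / (200 * C)"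
    and h1: "\<bar>\<tau> / T - 3 * j4 * e\<^sup>2\<bar> \<le> C * \<bar>e\<bar> ^ 3" and h2: "\<bar>j3 - 3 * j4 * e\<bar> \<le> C * e\<^sup>2"
  defines "L \<equiv> sqrt (\<tau> / (3 * j4 * T))"
  shows "0 < L" "\<bar>e\<bar> \<le> 11 / 10 * L" "L \<le> 11 / 10 * \<bar>e\<bar>" "\<bar>\<bar>j3\<bar> - 3 * j4 * L\<bar> \<le> 3 * C * L\<^sup>2"
    "2 * j4 * L \<le> \<bar>j3\<bar>" "\<bar>j3\<bar> \<le> 4 * j4 * L"
proof -
  show L: "0 < L" unfolding L_def using \<tau> j4 by simp
  have L2: "3 * j4 * L\<^sup>2 = \<tau> / T" unfolding L_def using \<tau> j4 by simp
  have Ce: "C * \<bar>e\<bar> \<le> j4 / 200" using mult_left_mono[OF e, of C] C by simp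
  have e3: "\<bar>e\<bar> ^ 3 = \<bar>e\<bar> * e\<^sup>2" by (simp add: power2_eq_square power3_eq_cube)
  have "C * \<bar>e\<bar> ^ 3 \<le> j4 / 200 * e\<^sup>2" unfolding e3 mult.assoc[symmetric] using Ce by (intro mult_right_mono) auto
  then have b: "\<bar>3 * j4 * L\<^sup>2 - 3 * j4 * e\<^sup>2\<bar> \<le> j4 / 200 * e\<^sup>2" using h1 unfolding L2 by linarith
  have b': "\<bar>3 * (j4 * L\<^sup>2) - 3 * (j4 * e\<^sup>2)\<bar> \<le> j4 * e\<^sup>2 / 200" using b by (simp add: mult.assoc)
  have nn: "0 \<le> j4 * e\<^sup>2" using j4 by simp
  have "j4 * L\<^sup>2 \<le> 121 / 100 * (j4 * e\<^sup>2)" using b' nn by linarith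
  then have "j4 * L\<^sup>2 \<le> j4 * (121 / 100 * e\<^sup>2)" by simp
  then have "L\<^sup>2 \<le> (11 / 10 * \<bar>e\<bar>)\<^sup>2" using j4 by (simp add: power_mult_distrib power_divide)
  then show Le: "L \<le> 11 / 10 * \<bar>e\<bar>" by (rule power2_le_imp_le) simp
  have "j4 * e\<^sup>2 \<le> 121 / 100 * (j4 * L\<^sup>2)" using b' nn by linarith
  then have "j4 * e\<^sup>2 \<le> j4 * (121 / 100 * L\<^sup>2)" by simp
  then have eL2: "e\<^sup>2 \<le> 121 / 100 * L\<^sup>2" using j4 by simp
  then have "\<bar>e\<bar>\<^sup>2 \<le> (11 / 10 * L)\<^sup>2" by (simp add: power_mult_distrib power_divide)
  then show eL: "\<bar>e\<bar> \<le> 11 / 10 * L" by (rule power2_le_imp_le) (use L in simp)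
  have e0: "0 < \<bar>e\<bar>" using Le L by linarith
  have d: "3 * j4 * \<bar>L - \<bar>e\<bar>\<bar> \<le> C * e\<^sup>2"
  proof -
    have eq: "3 * j4 * L\<^sup>2 - 3 * j4 * e\<^sup>2 = 3 * j4 * (L - \<bar>e\<bar>) * (L + \<bar>e\<bar>)"
      by (simp add: algebra_simps power2_eq_square)
    have "\<bar>3 * j4 * L\<^sup>2 - 3 * j4 * e\<^sup>2\<bar> = 3 * j4 * \<bar>L - \<bar>e\<bar>\<bar> * (L + \<bar>e\<bar>)"
      unfolding eq abs_mult using j4 L by simp
    moreover have "C * \<bar>e\<bar> ^ 3 = C * e\<^sup>2 * \<bar>e\<bar>" unfolding e3 by simp
    ultimately have "3 * j4 * \<bar>L - \<bar>e\<bar>\<bar> * (L + \<bar>e\<bar>) \<le> C * e\<^sup>2 * \<bar>e\<bar>"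
      using h1 unfolding L2[symmetric] by linarith
    moreover have "3 * j4 * \<bar>L - \<bar>e\<bar>\<bar> * \<bar>e\<bar> \<le> 3 * j4 * \<bar>L - \<bar>e\<bar>\<bar> * (L + \<bar>e\<bar>)"
      using j4 L by (intro mult_left_mono) auto
    ultimately have "3 * j4 * \<bar>L - \<bar>e\<bar>\<bar> * \<bar>e\<bar> \<le> C * e\<^sup>2 * \<bar>e\<bar>" by linarith
    then show ?thesis using e0 by (subst (asm) mult_le_cancel_right_pos) auto
  qed
  have "\<bar>\<bar>j3\<bar> - \<bar>3 * j4 * e\<bar>\<bar> \<le> C * e\<^sup>2" using h2 abs_triangle_ineq3[of j3 "3 * j4 * e"] by linarith
  moreover have "\<bar>3 * j4 * e\<bar> = 3 * j4 * \<bar>e\<bar>" using j4 by (simp add: abs_mult)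
  moreover have "\<bar>3 * j4 * \<bar>e\<bar> - 3 * j4 * L\<bar> = 3 * j4 * \<bar>L - \<bar>e\<bar>\<bar>"
    using j4 by (simp add: abs_mult abs_minus_commute flip: right_diff_distrib)
  ultimately have "\<bar>\<bar>j3\<bar> - 3 * j4 * L\<bar> \<le> 2 * (C * e\<^sup>2)" using d by linarith
  also have "\<dots> \<le> 2 * (C * (3 / 2 * L\<^sup>2))" using eL2 C zero_le_power2[of L] by (intro mult_left_mono) linarith+
  finally show j: "\<bar>\<bar>j3\<bar> - 3 * j4 * L\<bar> \<le> 3 * C * L\<^sup>2" by simp
  have "C * L \<le> C * (11 / 10 * \<bar>e\<bar>)" using Le C by (intro mult_left_mono) auto
  also have "\<dots> \<le> j4 / 100" using Ce j4 by simp
  finally have "3 * (C * L) * L \<le> 3 * (j4 / 100) * L" using L by (intro mult_right_mono) auto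
  moreover have "3 * (C * L) * L = 3 * C * L\<^sup>2" "3 * (j4 / 100) * L = 3 / 100 * (j4 * L)"
    by (simp_all add: power2_eq_square)
  ultimately have "3 * C * L\<^sup>2 \<le> j4 * L" using mult_pos_pos[OF j4 L] by linarith
  then show "2 * j4 * L \<le> \<bar>j3\<bar>" "\<bar>j3\<bar> \<le> 4 * j4 * L" using j by (auto simp: abs_le_iff)
qed

lemma abs_le_pi_mult: "\<bar>x\<bar> \<le> pi * \<bar>x\<bar>"
  using mult_right_mono[of 1 pi "\<bar>x\<bar>"] pi_gt3 by simp

lemma inverse_sqrt_diff:
  fixes p u v :: real
  assumes "0 \<le> p" "0 < u" "0 < v"
  shows "\<bar>p / sqrt u - p / sqrt v\<bar> \<le> p / sqrt v * (\<bar>v - u\<bar> / u)"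
proof -
  define a b where "a = sqrt u" and "b = sqrt v"
  have ab: "0 < a" "0 < b" "u = a\<^sup>2" "v = b\<^sup>2" unfolding a_def b_def using assms by auto
  have "p / a - p / b = p / b * ((b - a) / a)" using ab by (simp add: field_simps)
  then have "\<bar>p / a - p / b\<bar> = p / b * (\<bar>b - a\<bar> / a)" using ab assms by (simp add: abs_mult)
  also have "\<bar>b - a\<bar> / a \<le> \<bar>v - u\<bar> / u"
  proof -
    have "v - u = (b - a) * (b + a)" unfolding ab(3,4) by (simp add: power2_eq_square algebra_simps)
    then have "\<bar>v - u\<bar> = \<bar>b - a\<bar> * (b + a)" using ab by (simp add: abs_mult)
    moreover have "\<bar>b - a\<bar> * a \<le> \<bar>b - a\<bar> * (b + a)" using ab by (intro mult_left_mono) auto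
    ultimately have "\<bar>b - a\<bar> * a / a\<^sup>2 \<le> \<bar>v - u\<bar> / u" unfolding ab(3) by (intro divide_right_mono) auto
    then show ?thesis using ab by (simp add: power2_eq_square)
  qed
  then have "p / b * (\<bar>b - a\<bar> / a) \<le> p / b * (\<bar>v - u\<bar> / u)" using ab assms by (intro mult_left_mono) auto
  finally show ?thesis unfolding a_def b_def .
qed

text \<open>In units \<open>p = sqrt |y|\<close> and \<open>q = root 4 (t' - s)\<close>,
  \<open>j3\<close> is of order \<open>q^2\<close> and \<open>Im d\<close> of order
  \<open>p / q\<close>. The term \<open>p^3 / q^7\<close> is the next correction of the cubic, of
  order \<open>(p / q)^3 (j4 / j3)^2\<close>.\<close>

lemma square_root_regime:
  fixes t t' j4 m2 C :: real
  assumes t: "1 < t" "t < t'" and j4: "0 < j4" and m2: "0 < m2" and C: "0 < C"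
  shows "\<exists>\<delta>>0. \<exists>K\<ge>0. \<forall>s e j3 j4s m2s y d \<rho>. t \<le> s \<and> s < t' \<and> \<bar>e\<bar> \<le> j4 / (200 * C) \<and>
     \<bar>(t' - s) / ((s - 1) * (t' - 1)) - 3 * j4 * e\<^sup>2\<bar> \<le> C * \<bar>e\<bar> ^ 3 \<and> \<bar>j3 - 3 * j4 * e\<bar> \<le> C * e\<^sup>2 \<and> j3 \<noteq> 0 \<and>
     \<bar>j4s - j4\<bar> \<le> C * \<bar>e\<bar> \<and> \<bar>m2s - m2\<bar> \<le> C * \<bar>e\<bar> \<and>
     edge_data C (j4 / (200 * C)) (y / (s - 1)) j3 j4s m2s d \<rho> \<and> y\<^sup>2 < \<delta> * (t' - s) ^ 3 \<longrightarrow>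
     (sgn j3 * y < 0 \<longrightarrow> \<rho> = 0) \<and>
     (0 \<le> sgn j3 * y \<longrightarrow>
       \<bar>\<rho> - m2 / pi * (sqrt \<bar>y\<bar> / sqrt ((s - 1) * (3 * j4 * sqrt ((t' - s) / (3 * j4 * ((s - 1) * (t' - 1)))))))\<bar> \<le>
       K * ((sqrt \<bar>y\<bar>)\<^sup>2 / (root 4 (t' - s))\<^sup>2 + sqrt \<bar>y\<bar> * root 4 (t' - s) + sqrt \<bar>y\<bar> ^ 3 / root 4 (t' - s) ^ 7))"
proof -
  define Gmin Gmax where "Gmin = sqrt (3 * j4 * ((t - 1) * (t' - 1)))" and "Gmax = sqrt (3 * j4 * ((t' - 1) * (t' - 1)))"
  have G: "0 < Gmin" "0 < Gmax" unfolding Gmin_def Gmax_def using t j4 by auto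
  \<comment> \<open>Makes \<open>100 j4s^2 |X|\<close> at most \<open>(2 j4 L)^3\<close>, hence at
    most \<open>|j3|^3\<close>.\<close>
  define \<eta> where "\<eta> = j4 * (t - 1) / (50 * Gmax ^ 3)"
  have \<eta>: "0 < \<eta>" unfolding \<eta>_def using t j4 G by simp
  define b where "b = sqrt (2 * j4 * (t - 1) / Gmax)"
  have b: "0 < b" unfolding b_def using t j4 G by simp
  define m3 where "m3 = m2 + j4"
  have m3: "0 < m3" unfolding m3_def using m2 j4 by simp
  \<comment> \<open>In turn: nonlinearity of the density in \<open>d\<close>, cubic correction of
    \<open>Im d\<close>, and replacement of \<open>j3\<close> and \<open>m2s\<close> by their
    limiting values.\<close>
  define K1 K2 K3 where "K1 = 4 * C / b\<^sup>2" and "K2 = 192 * m3 * Gmax\<^sup>2 / b ^ 3" and "K3 = (m3 * (3 * C / (2 * j4)) + 2 * C) / (b * Gmin)"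
  have K: "0 \<le> K1" "0 \<le> K2" "0 \<le> K3" unfolding K1_def K2_def K3_def using C b m3 j4 G by auto
  define K where "K = K1 + K2 + K3"
  show ?thesis
  proof (rule exI[of _ "\<eta>\<^sup>2"], rule conjI, use \<eta> in simp, rule exI[of _ K], rule conjI, use K K_def in simp, intro allI impI, elim conjE)
    fix s e j3 j4s m2s y \<rho> :: real and d :: complex
    assume s: "t \<le> s" "s < t'" and e: "\<bar>e\<bar> \<le> j4 / (200 * C)"
      and h1: "\<bar>(t' - s) / ((s - 1) * (t' - 1)) - 3 * j4 * e\<^sup>2\<bar> \<le> C * \<bar>e\<bar> ^ 3"
      and h2: "\<bar>j3 - 3 * j4 * e\<bar> \<le> C * e\<^sup>2" and j3: "j3 \<noteq> 0"
      and h3: "\<bar>j4s - j4\<bar> \<le> C * \<bar>e\<bar>" and h4: "\<bar>m2s - m2\<bar> \<le> C * \<bar>e\<bar>"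
      and ed: "edge_data C (j4 / (200 * C)) (y / (s - 1)) j3 j4s m2s d \<rho>"
      and y: "y\<^sup>2 < \<eta>\<^sup>2 * (t' - s) ^ 3"
    define \<tau> T where "\<tau> = t' - s" and "T = (s - 1) * (t' - 1)"
    have \<tau>: "0 < \<tau>" "0 < T" unfolding \<tau>_def T_def using s t by auto
    define L where "L = sqrt (\<tau> / (3 * j4 * T))"
    note BS = branch_scale[OF \<tau> j4 C e h1[folded \<tau>_def T_def] h2, folded L_def]
    note L = BS(1)
    define k3 where "k3 = \<bar>j3\<bar>"
    have k3: "0 < k3" "2 * j4 * L \<le> k3" "k3 \<le> 4 * j4 * L" "\<bar>k3 - 3 * j4 * L\<bar> \<le> 3 * C * L\<^sup>2"
      using j3 BS unfolding k3_def by auto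
    have Ce: "C * \<bar>e\<bar> \<le> j4 / 200" using mult_left_mono[OF e, of C] C by simp
    have CL: "C * L \<le> j4 / 100"
    proof -
      have "C * L \<le> C * (11 / 10 * \<bar>e\<bar>)" using BS(3) C by (intro mult_left_mono) auto
      then show ?thesis using Ce j4 by simp
    qed
    have j4s: "j4 / 2 \<le> j4s" "j4s \<le> 2 * j4" "0 < j4s" using h3 Ce j4 by (auto simp: abs_le_iff)
    have m2s: "\<bar>m2s\<bar> \<le> m3" using h4 Ce j4 m2 unfolding m3_def by (auto simp: abs_le_iff)
    define q where "q = root 4 \<tau>"
    have q: "0 < q" "q ^ 4 = \<tau>" unfolding q_def using \<tau> by auto
    define g where "g = sqrt (3 * j4 * T)"
    have g: "Gmin \<le> g" "g \<le> Gmax" "0 < g"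
      unfolding Gmin_def Gmax_def g_def T_def using s t j4
      by (auto intro!: real_sqrt_le_mono mult_left_mono mult_right_mono)
    have Lq: "L = q\<^sup>2 / g"
    proof -
      have "sqrt \<tau> = q\<^sup>2" using q by (metis less_imp_le power_mult numeral_times_numeral num_double real_sqrt_unique zero_le_power2 mult_2 numeral_Bit0 power2_eq_square power_add)
      then show ?thesis unfolding L_def g_def by (simp add: real_sqrt_divide)
    qed
    define p where "p = sqrt \<bar>y\<bar>"
    have p: "0 \<le> p" "p\<^sup>2 = \<bar>y\<bar>" unfolding p_def by auto
    have y6: "\<bar>y\<bar> \<le> \<eta> * q ^ 6"
    proof -
      have "(t' - s) ^ 3 = (q ^ 6)\<^sup>2" unfolding \<tau>_def[symmetric] q(2)[symmetric] by (simp flip: power_mult)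
      then have "\<bar>y\<bar>\<^sup>2 \<le> (\<eta> * q ^ 6)\<^sup>2" using y by (simp add: power_mult_distrib)
      then show ?thesis by (rule power2_le_imp_le) (use \<eta> q in simp)
    qed
    define X where "X = y / (s - 1)"
    have s1: "0 < s - 1" "t - 1 \<le> s - 1" using s t by auto
    have aX: "\<bar>X\<bar> = p\<^sup>2 / (s - 1)" unfolding X_def p(2) using s1 by simp
    have small: "100 * C * cmod d \<le> j4s" "C * \<bar>j3\<bar> \<le> j4s\<^sup>2" "100 * j4s\<^sup>2 * \<bar>X\<bar> \<le> \<bar>j3\<bar> ^ 3"
    proof -
      have "C * cmod d \<le> j4 / 200" using mult_left_mono[of "cmod d" "j4 / (200 * C)" C] ed C unfolding edge_data_def by simp
      then show "100 * C * cmod d \<le> j4s" using j4s by simp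
      have "C * k3 \<le> C * (4 * j4 * L)" using k3 C by (intro mult_left_mono) auto
      also have "\<dots> = 4 * j4 * (C * L)" by simp
      also have "\<dots> \<le> 4 * j4 * (j4 / 100)" using CL j4 by (intro mult_left_mono) auto
      also have "\<dots> \<le> (j4 / 2)\<^sup>2" by (simp add: power2_eq_square)
      also have "\<dots> \<le> j4s\<^sup>2" using j4s j4 by (intro power_mono) auto
      finally show "C * \<bar>j3\<bar> \<le> j4s\<^sup>2" unfolding k3_def .
      have "100 * j4s\<^sup>2 * \<bar>X\<bar> \<le> 100 * (2 * j4)\<^sup>2 * (\<eta> * q ^ 6 / (t - 1))"
        unfolding X_def abs_divide using j4s y6 s1 \<eta> q t
        by (intro mult_mono mult_left_mono power_mono frac_le) auto
      also have "\<dots> = 8 * j4 ^ 3 * (q ^ 6 / Gmax ^ 3)"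
        unfolding \<eta>_def using t G by (simp add: field_simps power2_eq_square power3_eq_cube)
      also have "\<dots> \<le> 8 * j4 ^ 3 * (q ^ 6 / g ^ 3)"
        using g q j4 by (intro mult_left_mono divide_left_mono power_mono) auto
      also have "\<dots> = (2 * j4 * L) ^ 3" unfolding Lq by (simp add: power_mult_distrib power_divide flip: power_mult)
      also have "\<dots> \<le> k3 ^ 3" using k3 j4 L by (intro power_mono) auto
      finally show "100 * j4s\<^sup>2 * \<bar>X\<bar> \<le> \<bar>j3\<bar> ^ 3" unfolding k3_def .
    qed
    have ed': "0 \<le> Im d" "cmod (of_real X + of_real j3 * d\<^sup>2 + of_real j4s * d ^ 3) \<le> C * cmod d ^ 4"
      "2 * j3 * Re d + j4s * (3 * (Re d)\<^sup>2 - (Im d)\<^sup>2) \<le> C * cmod d ^ 3"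
      "0 < Im d \<Longrightarrow> - (C * cmod d ^ 3) \<le> 2 * j3 * Re d + j4s * (3 * (Re d)\<^sup>2 - (Im d)\<^sup>2)"
      "\<bar>pi * \<rho> - m2s * Im d\<bar> \<le> C * (cmod d)\<^sup>2" "Im d = 0 \<Longrightarrow> \<rho> = 0"
      using ed unfolding edge_data_def X_def by auto
    note EC = edge_cubic[OF j3 j4s(3) less_imp_le[OF C] ed'(1,2,3,4) small, folded k3_def]
    have sX: "sgn j3 * X < 0 \<longleftrightarrow> sgn j3 * y < 0" "0 \<le> sgn j3 * X \<longleftrightarrow> 0 \<le> sgn j3 * y"
      unfolding X_def using s1 by (auto simp: divide_less_0_iff zero_le_divide_iff)
    show "(sgn j3 * y < 0 \<longrightarrow> \<rho> = 0) \<and>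
     (0 \<le> sgn j3 * y \<longrightarrow>
       \<bar>\<rho> - m2 / pi * (sqrt \<bar>y\<bar> / sqrt ((s - 1) * (3 * j4 * sqrt ((t' - s) / (3 * j4 * ((s - 1) * (t' - 1)))))))\<bar> \<le>
       K * ((sqrt \<bar>y\<bar>)\<^sup>2 / (root 4 (t' - s))\<^sup>2 + sqrt \<bar>y\<bar> * root 4 (t' - s) + sqrt \<bar>y\<bar> ^ 3 / root 4 (t' - s) ^ 7))"
      unfolding \<tau>_def[symmetric] T_def[symmetric] p_def[symmetric] q_def[symmetric] L_def[symmetric]
    proof (intro conjI impI)
      show "\<rho> = 0" if "sgn j3 * y < 0" using EC(1) ed'(6) that sX by auto
      assume sy: "0 \<le> sgn j3 * y"
      have "sgn j3 * y = \<bar>y\<bar>" using sy j3 by (auto simp: sgn_if abs_if split: if_splits)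
      then have sXa: "sgn j3 * X / k3 = p\<^sup>2 / ((s - 1) * k3)" unfolding X_def p(2) by simp
      define a a0 where "a = p / sqrt ((s - 1) * k3)" and "a0 = p / sqrt ((s - 1) * (3 * j4 * L))"
      have a: "sqrt (sgn j3 * X / k3) = a" unfolding sXa a_def using p(1) by (simp add: real_sqrt_divide)
      have I: "\<bar>Im d - a\<bar> \<le> 192 * a ^ 3 * (j4s / j3)\<^sup>2" using EC(3) sX sy a by simp
      have n2: "(cmod d)\<^sup>2 \<le> 4 * a\<^sup>2"
      proof -
        have "\<bar>X\<bar> / k3 = a\<^sup>2" unfolding aX a_def using s1 k3 by (simp add: power_divide)
        then show ?thesis using EC(2) by simp
      qed
      have low: "(b * q)\<^sup>2 \<le> (s - 1) * z" if "2 * j4 * L \<le> z" for z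
      proof -
        have "(b * q)\<^sup>2 = (t - 1) * (2 * j4 * (q\<^sup>2 / Gmax))"
          unfolding b_def using t j4 G by (simp add: power_mult_distrib)
        also have "\<dots> \<le> (s - 1) * (2 * j4 * (q\<^sup>2 / g))"
          using s1 j4 g t q G by (intro mult_mono divide_left_mono) auto
        also have "\<dots> \<le> (s - 1) * z" using that s1 unfolding Lq by (intro mult_left_mono) auto
        finally show ?thesis .
      qed
      have bq: "0 < b * q" using b q by simp
      have sq_low: "p / sqrt ((s - 1) * z) \<le> p / (b * q)" if "2 * j4 * L \<le> z" for z
        using real_le_rsqrt[OF low[OF that]] p bq by (intro frac_le) auto
      have a_le: "0 \<le> a" "a \<le> p / (b * q)" unfolding a_def using sq_low[OF k3(2)] p s1 k3 by auto
      have a0_le: "0 \<le> a0" "a0 \<le> p / (b * q)" unfolding a0_def using sq_low[of "3 * j4 * L"] p s1 j4 L by auto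
      have aa0: "\<bar>a - a0\<bar> \<le> a0 * (3 * C / (2 * j4) * L)"
      proof -
        have "\<bar>a - a0\<bar> \<le> a0 * (\<bar>(s - 1) * (3 * j4 * L) - (s - 1) * k3\<bar> / ((s - 1) * k3))"
          unfolding a_def a0_def using p s1 k3 j4 L by (intro inverse_sqrt_diff) auto
        also have "\<bar>(s - 1) * (3 * j4 * L) - (s - 1) * k3\<bar> / ((s - 1) * k3) = \<bar>k3 - 3 * j4 * L\<bar> / k3"
          using s1 by (simp add: abs_mult abs_minus_commute flip: right_diff_distrib)
        also have "a0 * (\<bar>k3 - 3 * j4 * L\<bar> / k3) \<le> a0 * (3 * C * L\<^sup>2 / (2 * j4 * L))"
          using k3 a0_le j4 L by (intro mult_left_mono frac_le) auto
        also have "3 * C * L\<^sup>2 / (2 * j4 * L) = 3 * C / (2 * j4) * L" using L by (simp add: power2_eq_square)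
        finally show ?thesis .
      qed
      have jk: "(j4s / j3)\<^sup>2 \<le> 1 / L\<^sup>2"
      proof -
        have "(j4s / j3)\<^sup>2 = (j4s / k3)\<^sup>2" unfolding k3_def by (simp add: power_divide)
        also have "\<dots> \<le> (2 * j4 / (2 * j4 * L))\<^sup>2" using j4s k3 j4 L by (intro power_mono frac_le) auto
        finally show ?thesis using j4 by (simp add: power_divide)
      qed
      have LG: "1 / L\<^sup>2 \<le> Gmax\<^sup>2 / q ^ 4"
      proof -
        have "1 / L\<^sup>2 = g\<^sup>2 / q ^ 4" unfolding Lq by (simp add: power_divide flip: power_mult)
        also have "\<dots> \<le> Gmax\<^sup>2 / q ^ 4" using g q by (intro divide_right_mono power_mono) auto
        finally show ?thesis .
      qed
      have LG': "L \<le> q\<^sup>2 / Gmin" unfolding Lq using g G q by (intro divide_left_mono) auto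
      have t1: "C * (cmod d)\<^sup>2 \<le> K1 * (p\<^sup>2 / q\<^sup>2)"
      proof -
        have "a\<^sup>2 \<le> (p / (b * q))\<^sup>2" using a_le by (intro power_mono) auto
        then have "C * (cmod d)\<^sup>2 \<le> C * (4 * (p / (b * q))\<^sup>2)" using n2 C by (intro mult_left_mono) auto
        then show ?thesis unfolding K1_def by (simp add: power_divide power_mult_distrib mult_ac)
      qed
      have t2: "\<bar>m2s\<bar> * \<bar>Im d - a\<bar> \<le> K2 * (p ^ 3 / q ^ 7)"
      proof -
        have "\<bar>Im d - a\<bar> \<le> 192 * (p / (b * q)) ^ 3 * (Gmax\<^sup>2 / q ^ 4)"
          using I jk LG a_le by (intro order_trans[OF I] mult_mono mult_left_mono power_mono) auto
        then have "\<bar>m2s\<bar> * \<bar>Im d - a\<bar> \<le> m3 * (192 * (p / (b * q)) ^ 3 * (Gmax\<^sup>2 / q ^ 4))"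
          using m2s m3 by (intro mult_mono) auto
        also have "\<dots> = K2 * (p ^ 3 / q ^ 7)"
        proof -
          have "q ^ 7 = q ^ 3 * q ^ 4" by (simp flip: power_add)
          then show ?thesis unfolding K2_def power_divide power_mult_distrib by (simp only: times_divide_eq_right times_divide_eq_left divide_divide_eq_left mult_ac)
        qed
        finally show ?thesis .
      qed
      have a0L: "a0 * L \<le> p * q / (b * Gmin)"
      proof -
        have "a0 * L \<le> p / (b * q) * (q\<^sup>2 / Gmin)" using a0_le LG' L p bq by (intro mult_mono) auto
        also have "\<dots> = p * q / (b * Gmin)" using q by (simp add: power2_eq_square)
        finally show ?thesis .
      qed
      have t3: "\<bar>m2s\<bar> * \<bar>a - a0\<bar> + \<bar>m2s - m2\<bar> * a0 \<le> K3 * (p * q)"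
      proof -
        have "\<bar>m2s\<bar> * \<bar>a - a0\<bar> \<le> m3 * (a0 * (3 * C / (2 * j4) * L))" using m2s m3 aa0 by (intro mult_mono) auto
        moreover have "\<bar>m2s - m2\<bar> * a0 \<le> C * (2 * L) * a0"
          using h4 BS(2) C a0_le L by (intro mult_right_mono order_trans[OF h4] mult_left_mono) auto
        ultimately have "\<bar>m2s\<bar> * \<bar>a - a0\<bar> + \<bar>m2s - m2\<bar> * a0 \<le> (m3 * (3 * C / (2 * j4)) + 2 * C) * (a0 * L)"
          by (simp add: algebra_simps)
        also have "\<dots> \<le> (m3 * (3 * C / (2 * j4)) + 2 * C) * (p * q / (b * Gmin))"
          using a0L m3 C j4 by (intro mult_left_mono) auto
        finally show ?thesis unfolding K3_def by simp
      qed
      have "pi * \<rho> - m2 * a0 = (pi * \<rho> - m2s * Im d) + m2s * (Im d - a) + m2s * (a - a0) + (m2s - m2) * a0"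
        by (simp add: algebra_simps)
      then have "\<bar>pi * \<rho> - m2 * a0\<bar> \<le> \<bar>pi * \<rho> - m2s * Im d\<bar> + \<bar>m2s * (Im d - a)\<bar> + \<bar>m2s * (a - a0)\<bar> + \<bar>(m2s - m2) * a0\<bar>"
        by linarith
      also have "\<dots> \<le> K1 * (p\<^sup>2 / q\<^sup>2) + K2 * (p ^ 3 / q ^ 7) + K3 * (p * q)"
        using ed'(5) t1 t2 t3 a0_le by (simp add: abs_mult)
      also have "\<dots> \<le> K * (p\<^sup>2 / q\<^sup>2) + K * (p ^ 3 / q ^ 7) + K * (p * q)"
        using K p q unfolding K_def by (intro add_mono mult_right_mono) auto
      finally have fin: "\<bar>pi * \<rho> - m2 * a0\<bar> \<le> K * (p\<^sup>2 / q\<^sup>2 + p * q + p ^ 3 / q ^ 7)" by (simp add: algebra_simps)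
      have "pi * (\<rho> - m2 / pi * a0) = pi * \<rho> - m2 * a0" by (simp add: algebra_simps)
      then have "pi * \<bar>\<rho> - m2 / pi * a0\<bar> \<le> K * (p\<^sup>2 / q\<^sup>2 + p * q + p ^ 3 / q ^ 7)"
        using fin by (metis abs_mult abs_of_pos pi_gt_zero)
      with order_trans[OF abs_le_pi_mult] show "\<bar>\<rho> - m2 / pi * (p / sqrt ((s - 1) * (3 * j4 * L)))\<bar> \<le> K * (p\<^sup>2 / q\<^sup>2 + p * q + p ^ 3 / q ^ 7)"
        unfolding a0_def by blast
    qed
  qed
qed

text \<open>Here the unit is \<open>h = root 3 |y|\<close>, with \<open>R = h / gs\<close> the size
  of \<open>d\<close>. The coefficients at time \<open>s\<close> differ from their limits by a
  multiple of \<open>q = sqrt (t' - s)\<close>, which is the second error term; the first is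
  quadratic in \<open>d\<close>.\<close>

lemma cube_root_regime:
  fixes t t' j4 m2 C :: real
  assumes t: "1 < t" "t < t'" and j4: "0 < j4" and m2: "0 < m2" and C: "0 < C"
  shows "\<exists>\<delta>>0. \<exists>K\<ge>0. \<forall>s e j3 j4s m2s y d \<rho>. t \<le> s \<and> s < t' \<and> \<bar>e\<bar> \<le> j4 / (200 * C) \<and>
     \<bar>(t' - s) / ((s - 1) * (t' - 1)) - 3 * j4 * e\<^sup>2\<bar> \<le> C * \<bar>e\<bar> ^ 3 \<and> \<bar>j3 - 3 * j4 * e\<bar> \<le> C * e\<^sup>2 \<and>
     \<bar>j4s - j4\<bar> \<le> C * \<bar>e\<bar> \<and> \<bar>m2s - m2\<bar> \<le> C * \<bar>e\<bar> \<and>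
     edge_data C (j4 / (2000 * C)) (y / (s - 1)) j3 j4s m2s d \<rho> \<and> \<bar>y\<bar> < \<delta> \<and> (t' - s) ^ 3 < \<delta> * y\<^sup>2 \<longrightarrow>
     \<bar>\<rho> - sqrt 3 / 2 * m2 / pi * (root 3 \<bar>y\<bar> / root 3 ((t' - 1) * j4))\<bar> \<le> K * ((root 3 \<bar>y\<bar>)\<^sup>2 + sqrt (t' - s))"
proof -
  define Gmin where "Gmin = sqrt (3 * j4 * ((t - 1) * (t' - 1)))"
  have G: "0 < Gmin" unfolding Gmin_def using t j4 by auto
  define glo ghi g0 where "glo = root 3 ((t - 1) * (j4 / 2))" and "ghi = root 3 ((t' - 1) * (2 * j4))"
    and "g0 = root 3 ((t' - 1) * j4)"
  have g: "0 < glo" "0 < ghi" "0 < g0" "g0 ^ 3 = (t' - 1) * j4"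
    unfolding glo_def ghi_def g0_def using t j4 by auto
  \<comment> \<open>\<open>q \<le> \<kappa> h\<close> yields \<open>1000 |j3| \<le> j4s R\<close>,
    that is, dominance of the cubic term; the bound \<open>\<kappa> ^ 6\<close> on
    \<open>\<delta>\<close> is this condition in terms of \<open>(t' - s) ^ 3\<close> and
    \<open>y^2\<close>.\<close>
  define \<kappa> where "\<kappa> = Gmin / (8000 * ghi)"
  have \<kappa>: "0 < \<kappa>" unfolding \<kappa>_def using G g by simp
  define \<eta> where "\<eta> = j4 * glo / (2000 * C)"
  have \<eta>: "0 < \<eta>" unfolding \<eta>_def using j4 g C by simp
  define \<delta> where "\<delta> = min 1 (min (\<kappa> ^ 6) (\<eta> ^ 3))"
  have \<delta>: "0 < \<delta>" unfolding \<delta>_def using \<kappa> \<eta> by simp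
  have \<delta>_le: "\<delta> \<le> 1" "\<delta> \<le> \<kappa> ^ 6" "\<delta> \<le> \<eta> ^ 3" unfolding \<delta>_def by (auto simp: min_le_iff_disj)
  define m3 where "m3 = m2 + j4"
  have m3: "0 < m3" unfolding m3_def using m2 j4 by simp
  define B where "B = j4 * sqrt (t' - 1) + (t' - 1) * (C * (2 / Gmin))"
  have B: "0 \<le> B" unfolding B_def using t j4 C G by simp
  define K1 K2 where "K1 = 4 * C / glo\<^sup>2 + m3 * (12 * (32 * C / (glo\<^sup>2 * j4)))"
    and "K2 = m3 * (12 * (32 / Gmin)) + m3 * (B / (g0 ^ 3 * glo)) + C * (2 / Gmin) / g0"
  have K: "0 \<le> K1" "0 \<le> K2"
    unfolding K1_def K2_def
    by (intro add_nonneg_nonneg mult_nonneg_nonneg divide_nonneg_nonneg zero_le_power;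
        use C g(1-3) m3 j4 G B in simp)+
  define K where "K = K1 + K2"
  show ?thesis
  proof (rule exI[of _ \<delta>], rule conjI, rule \<delta>, rule exI[of _ K], rule conjI, use K K_def in simp, intro allI impI, elim conjE)
    fix s e j3 j4s m2s y \<rho> :: real and d :: complex
    assume s: "t \<le> s" "s < t'" and e: "\<bar>e\<bar> \<le> j4 / (200 * C)"
      and h1: "\<bar>(t' - s) / ((s - 1) * (t' - 1)) - 3 * j4 * e\<^sup>2\<bar> \<le> C * \<bar>e\<bar> ^ 3"
      and h2: "\<bar>j3 - 3 * j4 * e\<bar> \<le> C * e\<^sup>2"
      and h3: "\<bar>j4s - j4\<bar> \<le> C * \<bar>e\<bar>" and h4: "\<bar>m2s - m2\<bar> \<le> C * \<bar>e\<bar>"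
      and ed: "edge_data C (j4 / (2000 * C)) (y / (s - 1)) j3 j4s m2s d \<rho>"
      and y: "\<bar>y\<bar> < \<delta>" "(t' - s) ^ 3 < \<delta> * y\<^sup>2"
    define \<tau> T where "\<tau> = t' - s" and "T = (s - 1) * (t' - 1)"
    have \<tau>: "0 < \<tau>" "0 < T" unfolding \<tau>_def T_def using s t by auto
    define L where "L = sqrt (\<tau> / (3 * j4 * T))"
    note BS = branch_scale[OF \<tau> j4 C e h1[folded \<tau>_def T_def] h2, folded L_def]
    note L = BS(1)
    have Ce: "C * \<bar>e\<bar> \<le> j4 / 200" using mult_left_mono[OF e, of C] C by simp
    have j4s: "j4 / 2 \<le> j4s" "j4s \<le> 2 * j4" "0 < j4s" using h3 Ce j4 by (auto simp: abs_le_iff)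
    have m2s: "\<bar>m2s\<bar> \<le> m3" using h4 Ce j4 m2 unfolding m3_def by (auto simp: abs_le_iff)
    define q where "q = sqrt \<tau>"
    have q: "0 < q" "q\<^sup>2 = \<tau>" unfolding q_def using \<tau> by auto
    have s1: "0 < s - 1" "t - 1 \<le> s - 1" "s - 1 \<le> t' - 1" using s t by auto
    have Lq: "L \<le> q / Gmin"
    proof -
      have "Gmin \<le> sqrt (3 * j4 * T)" unfolding Gmin_def T_def using s1 t j4 by (auto intro!: mult_left_mono mult_right_mono)
      then have "q / sqrt (3 * j4 * T) \<le> q / Gmin" using G q by (intro frac_le) auto
      then show ?thesis unfolding L_def q_def by (simp add: real_sqrt_divide)
    qed
    define h where "h = root 3 \<bar>y\<bar>"
    have y0: "y \<noteq> 0"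
    proof
      assume "y = 0"
      then have "\<tau> ^ 3 < 0" using y(2) unfolding \<tau>_def by simp
      then show False using \<tau>(1) zero_le_power[of \<tau> 3] by simp
    qed
    have h: "0 < h" "h ^ 3 = \<bar>y\<bar>" unfolding h_def using y0 by auto
    have h1': "h \<le> 1" and h\<eta>: "h \<le> \<eta>"
    proof -
      have "h ^ 3 \<le> 1 ^ 3" using y(1) \<delta>_le unfolding h by simp
      then show "h \<le> 1" using h power_mono_iff[of h 1 3] by simp
      have "h ^ 3 \<le> \<eta> ^ 3" using y(1) \<delta>_le unfolding h by simp
      then show "h \<le> \<eta>" using \<eta> h power_mono_iff[of h \<eta> 3] by simp
    qed
    have qh: "q \<le> \<kappa> * h"
    proof -
      have "q ^ 6 = \<tau> ^ 3" unfolding q(2)[symmetric] by (simp flip: power_mult)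
      also have "\<dots> \<le> \<delta> * y\<^sup>2" using y(2) unfolding \<tau>_def by simp
      also have "\<dots> \<le> \<kappa> ^ 6 * y\<^sup>2" using \<delta>_le by (intro mult_right_mono) auto
      also have "y\<^sup>2 = h ^ 6"
      proof -
        have "y\<^sup>2 = \<bar>y\<bar>\<^sup>2" by simp
        also have "\<dots> = h ^ 6" unfolding h(2)[symmetric] by (simp flip: power_mult)
        finally show ?thesis .
      qed
      finally have "q ^ 6 \<le> (\<kappa> * h) ^ 6" by (simp add: power_mult_distrib)
      then show ?thesis using q h \<kappa> power_mono_iff[of q "\<kappa> * h" 6] by simp
    qed
    define X where "X = y / (s - 1)"
    \<comment> \<open>Normalized so that \<open>|X| = j4s (h / gs)^3\<close> exactly;
      \<open>g0\<close> is its limit as \<open>s\<close> tends to \<open>t'\<close>.\<close>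
    define gs where "gs = root 3 ((s - 1) * j4s)"
    have gs: "glo \<le> gs" "gs \<le> ghi" "0 < gs" "gs ^ 3 = (s - 1) * j4s"
    proof -
      show "glo \<le> gs" "gs \<le> ghi"
        unfolding glo_def ghi_def gs_def
        by (intro real_root_le_mono mult_mono; use s1 j4s j4 t in simp)+
      show "0 < gs" "gs ^ 3 = (s - 1) * j4s" unfolding gs_def using s1 j4s by auto
    qed
    define R where "R = h / gs"
    have R: "0 < R" unfolding R_def using h gs by simp
    have RX: "\<bar>X\<bar> = j4s * R ^ 3"
      unfolding R_def X_def power_divide h(2) gs(4) using s1 j4s by simp
    have R_hi: "R \<le> h / glo" unfolding R_def using h gs g by (intro frac_le) auto
    have ed': "0 \<le> Im d" "cmod (of_real X + of_real j3 * d\<^sup>2 + of_real j4s * d ^ 3) \<le> C * cmod d ^ 4"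
      "2 * j3 * Re d + j4s * (3 * (Re d)\<^sup>2 - (Im d)\<^sup>2) \<le> C * cmod d ^ 3"
      "\<bar>pi * \<rho> - m2s * Im d\<bar> \<le> C * (cmod d)\<^sup>2"
      using ed unfolding edge_data_def X_def by auto
    have small: "1000 * C * cmod d \<le> j4s" "1000 * C * R \<le> j4s" "1000 * \<bar>j3\<bar> \<le> j4s * R"
    proof -
      have "C * cmod d \<le> j4 / 2000" using mult_left_mono[of "cmod d" "j4 / (2000 * C)" C] ed C unfolding edge_data_def by simp
      then show "1000 * C * cmod d \<le> j4s" using j4s by simp
      have "R \<le> \<eta> / glo" using R_hi h\<eta> g by (meson divide_right_mono less_imp_le order_trans)
      then have "1000 * C * R \<le> 1000 * C * (\<eta> / glo)" using C by (intro mult_left_mono) auto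
      also have "\<dots> = j4 / 2" unfolding \<eta>_def using g C by simp
      finally show "1000 * C * R \<le> j4s" using j4s by simp
      have "1000 * \<bar>j3\<bar> \<le> 1000 * (4 * j4 * (\<kappa> * h / Gmin))"
        using BS(6) Lq qh j4 G by (intro mult_left_mono order_trans[OF BS(6)] order_trans[OF Lq] divide_right_mono) auto
      also have "\<dots> = j4 / 2 * (h / ghi)" unfolding \<kappa>_def using G g by simp
      also have "\<dots> \<le> j4s * R" unfolding R_def using j4s h gs j4 by (intro mult_mono frac_le) auto
      finally show "1000 * \<bar>j3\<bar> \<le> j4s * R" .
    qed
    note EC = edge_cuberoot[OF R RX j4s(3) less_imp_le[OF C] ed'(1,2,3) small]
    define R0 where "R0 = h / g0"
    have R0: "0 \<le> R0" "R0 \<le> 1 / g0" unfolding R0_def using h h1' g by (auto intro: divide_right_mono)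
    have s3: "0 \<le> sqrt 3 / 2" "sqrt 3 / 2 \<le> (1 :: real)" using real_sqrt_le_mono[of 3 4] by auto
    have t1: "C * (cmod d)\<^sup>2 \<le> 4 * C / glo\<^sup>2 * h\<^sup>2"
    proof -
      have "(cmod d)\<^sup>2 \<le> (2 * (h / glo))\<^sup>2" using EC(1) R_hi by (intro power_mono) auto
      then have "C * (cmod d)\<^sup>2 \<le> C * (2 * (h / glo))\<^sup>2" using C by (intro mult_left_mono) auto
      then show ?thesis by (simp add: power_mult_distrib power_divide mult_ac)
    qed
    have t2: "\<bar>m2s\<bar> * \<bar>Im d - sqrt 3 / 2 * R\<bar> \<le> m3 * (12 * (32 / Gmin)) * q + m3 * (12 * (32 * C / (glo\<^sup>2 * j4))) * h\<^sup>2"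
    proof -
      have "\<bar>j3\<bar> / j4s \<le> 4 * j4 * (q / Gmin) / (j4 / 2)"
        using BS(6) Lq j4 j4s q G by (intro frac_le order_trans[OF BS(6)] mult_left_mono) auto
      then have a: "4 * (\<bar>j3\<bar> / j4s) \<le> 32 / Gmin * q" using j4 by simp
      have "C * R\<^sup>2 / j4s \<le> C * (h / glo)\<^sup>2 / (j4 / 2)"
        using C R R_hi j4s j4 by (intro frac_le mult_left_mono power_mono) auto
      then have "16 * (C * R\<^sup>2 / j4s) \<le> 16 * (C * (h / glo)\<^sup>2 / (j4 / 2))" by (intro mult_left_mono) auto
      also have "\<dots> = 32 * C / (glo\<^sup>2 * j4) * h\<^sup>2" by (simp add: power_divide mult_ac)
      finally have "16 * (C * R\<^sup>2 / j4s) \<le> 32 * C / (glo\<^sup>2 * j4) * h\<^sup>2" .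
      then have "12 * (4 * (\<bar>j3\<bar> / j4s) + 16 * (C * R\<^sup>2 / j4s)) \<le> 12 * (32 / Gmin * q + 32 * C / (glo\<^sup>2 * j4) * h\<^sup>2)"
        using a by simp
      then have "\<bar>Im d - sqrt 3 / 2 * R\<bar> \<le> 12 * (32 / Gmin * q + 32 * C / (glo\<^sup>2 * j4) * h\<^sup>2)"
        using EC(2) by linarith
      then have "\<bar>m2s\<bar> * \<bar>Im d - sqrt 3 / 2 * R\<bar> \<le> m3 * (12 * (32 / Gmin * q + 32 * C / (glo\<^sup>2 * j4) * h\<^sup>2))"
        using m2s m3 by (intro mult_mono) auto
      then show ?thesis by (simp add: algebra_simps)
    qed
    have e_q: "\<bar>e\<bar> \<le> 2 / Gmin * q"
      using BS(2) Lq L by simp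
    have RR: "\<bar>R - R0\<bar> \<le> B / (g0 ^ 3 * glo) * q"
    proof -
      have "\<bar>g0 ^ 3 - gs ^ 3\<bar> \<le> B * q"
      proof -
        have "g0 ^ 3 - gs ^ 3 = \<tau> * j4 + (s - 1) * (j4 - j4s)" unfolding g(4) gs(4) \<tau>_def by (simp add: algebra_simps)
        then have "\<bar>g0 ^ 3 - gs ^ 3\<bar> \<le> \<bar>\<tau> * j4\<bar> + \<bar>(s - 1) * (j4 - j4s)\<bar>" by linarith
        also have "\<bar>\<tau> * j4\<bar> \<le> j4 * sqrt (t' - 1) * q"
        proof -
          have "q \<le> sqrt (t' - 1)" unfolding q_def \<tau>_def using s t by auto
          then have "q * q \<le> sqrt (t' - 1) * q" using q by (intro mult_right_mono) auto
          then show ?thesis using q j4 \<tau> unfolding q(2)[symmetric] by (simp add: abs_mult power2_eq_square mult_ac)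
        qed
        also have "\<bar>(s - 1) * (j4 - j4s)\<bar> \<le> (t' - 1) * (C * (2 / Gmin * q))"
        proof -
          have "\<bar>j4 - j4s\<bar> \<le> C * (2 / Gmin * q)"
            using h3 mult_left_mono[OF e_q, of C] C by (simp add: abs_minus_commute)
          then show ?thesis unfolding abs_mult using s1 by (intro mult_mono) auto
        qed
        finally show ?thesis unfolding B_def by (simp add: algebra_simps)
      qed
      moreover have "g0\<^sup>2 * \<bar>g0 - gs\<bar> \<le> \<bar>g0 ^ 3 - gs ^ 3\<bar>"
      proof -
        have "g0 ^ 3 - gs ^ 3 = (g0 - gs) * (g0\<^sup>2 + g0 * gs + gs\<^sup>2)" by (simp add: algebra_simps eval_nat_numeral)
        then have "\<bar>g0 ^ 3 - gs ^ 3\<bar> = \<bar>g0 - gs\<bar> * (g0\<^sup>2 + g0 * gs + gs\<^sup>2)" using g gs by (simp add: abs_mult)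
        moreover have "\<bar>g0 - gs\<bar> * g0\<^sup>2 \<le> \<bar>g0 - gs\<bar> * (g0\<^sup>2 + g0 * gs + gs\<^sup>2)" using g gs by (intro mult_left_mono) auto
        ultimately show ?thesis by (simp add: mult.commute)
      qed
      ultimately have d0: "\<bar>g0 - gs\<bar> \<le> B * q / g0\<^sup>2" using g by (simp add: pos_le_divide_eq mult.commute)
      have "R - R0 = h * (g0 - gs) / (gs * g0)" unfolding R_def R0_def using gs g by (simp add: field_simps)
      then have "\<bar>R - R0\<bar> = h * \<bar>g0 - gs\<bar> / (gs * g0)" using h gs g by (simp add: abs_mult)
      also have "\<dots> \<le> 1 * (B * q / g0\<^sup>2) / (glo * g0)"
        using d0 h h1' gs g B q by (intro frac_le mult_mono) auto
      also have "\<dots> = B / (g0 ^ 3 * glo) * q" by (simp add: power2_eq_square power3_eq_cube mult_ac)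
      finally show ?thesis .
    qed
    have t3: "\<bar>m2s\<bar> * (sqrt 3 / 2 * \<bar>R - R0\<bar>) \<le> m3 * (B / (g0 ^ 3 * glo)) * q"
    proof -
      have "sqrt 3 / 2 * \<bar>R - R0\<bar> \<le> 1 * (B / (g0 ^ 3 * glo) * q)" using s3 RR by (intro mult_mono) auto
      then have "\<bar>m2s\<bar> * (sqrt 3 / 2 * \<bar>R - R0\<bar>) \<le> m3 * (1 * (B / (g0 ^ 3 * glo) * q))"
        by (rule mult_mono[OF m2s]) (use m3 in auto)
      then show ?thesis by simp
    qed
    have t4: "\<bar>m2s - m2\<bar> * (sqrt 3 / 2 * R0) \<le> C * (2 / Gmin) / g0 * q"
    proof -
      have "\<bar>m2s - m2\<bar> \<le> C * (2 / Gmin * q)" using h4 mult_left_mono[OF e_q, of C] C by simp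
      moreover have "sqrt 3 / 2 * R0 \<le> 1 * (1 / g0)" using s3 R0 by (intro mult_mono) auto
      ultimately have "\<bar>m2s - m2\<bar> * (sqrt 3 / 2 * R0) \<le> C * (2 / Gmin * q) * (1 * (1 / g0))"
        using s3 R0 C G q by (intro mult_mono) auto
      then show ?thesis by simp
    qed
    have "A - m2 * (c * R0) = (A - m2s * I) + m2s * (I - c * R) + m2s * (c * (R - R0)) + (m2s - m2) * (c * R0)" for A I c :: real
      by (simp add: algebra_simps)
    from this[of "pi * \<rho>" "sqrt 3 / 2" "Im d"]
    have "\<bar>pi * \<rho> - m2 * (sqrt 3 / 2 * R0)\<bar> \<le> \<bar>pi * \<rho> - m2s * Im d\<bar> + \<bar>m2s * (Im d - sqrt 3 / 2 * R)\<bar> +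
        \<bar>m2s * (sqrt 3 / 2 * (R - R0))\<bar> + \<bar>(m2s - m2) * (sqrt 3 / 2 * R0)\<bar>"
      by linarith
    also have "\<bar>m2s * (Im d - sqrt 3 / 2 * R)\<bar> = \<bar>m2s\<bar> * \<bar>Im d - sqrt 3 / 2 * R\<bar>" by (rule abs_mult)
    also have "\<bar>m2s * (sqrt 3 / 2 * (R - R0))\<bar> = \<bar>m2s\<bar> * (sqrt 3 / 2 * \<bar>R - R0\<bar>)" by (simp add: abs_mult)
    also have "\<bar>(m2s - m2) * (sqrt 3 / 2 * R0)\<bar> = \<bar>m2s - m2\<bar> * (sqrt 3 / 2 * R0)" using R0 by (simp add: abs_mult)
    finally have "\<bar>pi * \<rho> - m2 * (sqrt 3 / 2 * R0)\<bar> \<le> K1 * h\<^sup>2 + K2 * q"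
      using ed'(4) t1 t2 t3 t4 unfolding K1_def K2_def distrib_right by linarith
    also have "\<dots> \<le> K * h\<^sup>2 + K * q" using K q unfolding K_def by (intro add_mono mult_right_mono) auto
    finally have fin: "\<bar>pi * \<rho> - m2 * (sqrt 3 / 2 * R0)\<bar> \<le> K * (h\<^sup>2 + q)" by (simp add: algebra_simps)
    have "pi * (\<rho> - sqrt 3 / 2 * m2 / pi * R0) = pi * \<rho> - m2 * (sqrt 3 / 2 * R0)" by (simp add: algebra_simps)
    then have "pi * \<bar>\<rho> - sqrt 3 / 2 * m2 / pi * R0\<bar> \<le> K * (h\<^sup>2 + q)"
      using fin by (metis abs_mult abs_of_pos pi_gt_zero)
    with order_trans[OF abs_le_pi_mult]
    show "\<bar>\<rho> - sqrt 3 / 2 * m2 / pi * (root 3 \<bar>y\<bar> / root 3 ((t' - 1) * j4))\<bar> \<le> K * ((root 3 \<bar>y\<bar>)\<^sup>2 + sqrt (t' - s))"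
      unfolding R0_def h_def g0_def q_def \<tau>_def by blast
  qed
qed

context free_semigroup
begin

lemma density_expand:
  assumes s: "1 < s" and x: "of_real s * \<omega> s (of_real x) \<noteq> of_real x" and r: "0 < r"
    and g: "AE u in \<mu>. r \<le> \<bar>u - w\<bar>" and d: "d = \<omega> s (of_real x) - of_real w" "cmod d \<le> r / 2"
  shows "\<exists>\<rho>. ac_density (\<nu> s) x = ereal \<rho> \<and> \<bar>pi * \<rho> - moment \<mu> 2 w * Im d\<bar> \<le> 2 / r ^ 3 * (cmod d)\<^sup>2 \<and>
    (Im d = 0 \<longrightarrow> \<rho> = 0)"
proof -
  have om: "\<omega> s (of_real x) = of_real w + d" using d(1) by simp
  let ?m = "stieltjes \<mu> (of_real w + d)"
  have "cmod (?m - (\<Sum>k<2. of_real (moment \<mu> (k + 1) w) * d ^ k)) \<le> 2 * cmod d ^ 2 / r ^ 3"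
    using mu.taylor_stieltjes[OF r g d(2), of 2] mu.prob_space by simp
  moreover have "(\<Sum>k<2. of_real (moment \<mu> (k + 1) w) * d ^ k) = of_real (moment \<mu> 1 w) + of_real (moment \<mu> 2 w) * d"
    by (simp add: eval_nat_numeral lessThan_Suc)
  ultimately have "cmod (?m - (of_real (moment \<mu> 1 w) + of_real (moment \<mu> 2 w) * d)) \<le> 2 / r ^ 3 * (cmod d)\<^sup>2" by simp
  moreover have "\<bar>Im ?m - moment \<mu> 2 w * Im d\<bar> \<le> cmod (?m - (of_real (moment \<mu> 1 w) + of_real (moment \<mu> 2 w) * d))"
    using abs_Im_le_cmod[of "?m - (of_real (moment \<mu> 1 w) + of_real (moment \<mu> 2 w) * d)"] by simp
  ultimately have b: "\<bar>pi * (Im ?m / pi) - moment \<mu> 2 w * Im d\<bar> \<le> 2 / r ^ 3 * (cmod d)\<^sup>2" by simp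
  have z: "Im ?m / pi = 0" if "Im d = 0"
  proof -
    have "of_real w + d = of_real (w + Re d)" using that by (simp add: complex_eq_iff)
    then show ?thesis using stieltjes_of_real[of \<mu> "w + Re d"] by simp
  qed
  show ?thesis using ac_density_regular[OF s x] b z unfolding om by blast
qed

text \<open>\<open>e\<close> is the displacement of the moving \<open>\<omega> s (E s)\<close> from
  its limit \<open>w'\<close>, where the third moment vanishes. All expansions are made with one gap
  radius around \<open>w'\<close>, so \<open>C\<close> does not depend on \<open>\<epsilon>\<close>
  or \<open>s\<close>.\<close>

lemma near_critical:
  assumes t: "1 < t" and fam: "edge_family \<nu> t Et t' E' E" and reg: "E' \<in> regular_points \<mu> t'"
  defines "w' \<equiv> Re (\<omega> t' (of_real E'))"
  shows "Im (\<omega> t' (of_real E')) = 0" "0 < moment M 4 w'" "0 < moment \<mu> 2 w'"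
    "\<exists>C>0. \<forall>\<epsilon>>0. \<exists>\<delta>>0. \<forall>s. t \<le> s \<and> t' - \<delta> < s \<and> s < t' \<longrightarrow> (\<exists>e j3 j4s m2s. \<bar>e\<bar> \<le> \<epsilon> \<and>
       \<bar>(t' - s) / ((s - 1) * (t' - 1)) - 3 * moment M 4 w' * e\<^sup>2\<bar> \<le> C * \<bar>e\<bar> ^ 3 \<and>
       \<bar>j3 - 3 * moment M 4 w' * e\<bar> \<le> C * e\<^sup>2 \<and> j3 \<noteq> 0 \<and>
       \<bar>j4s - moment M 4 w'\<bar> \<le> C * \<bar>e\<bar> \<and> \<bar>m2s - moment \<mu> 2 w'\<bar> \<le> C * \<bar>e\<bar> \<and>
       C1 M \<omega> s (E s) = - (s - 1) * j3 \<and>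
       (\<forall>x. \<bar>x - E s\<bar> < \<delta> \<longrightarrow> (\<exists>d \<rho>. ac_density (\<nu> s) x = ereal \<rho> \<and>
          edge_data C \<epsilon> ((x - E s) / (s - 1)) j3 j4s m2s d \<rho>)))"
proof -
  have tt': "t < t'" "1 < t'" and ext: "\<And>s. s \<in> {t..<t'} \<Longrightarrow> exterior_point (\<nu> s) (E s)"
    and int: "interior_point (\<nu> t') E'" and lim: "(E \<longlongrightarrow> E') (at_left t')"
    using fam t unfolding edge_family_def by auto
  have ed': "E' \<in> edge_set (\<nu> t')" using int unfolding interior_point_def by blast
  show Im0: "Im (\<omega> t' (of_real E')) = 0" using ed' edge_set_iff[OF tt'(2)] by blast
  note rv = regular_value[OF tt'(2) reg Im0, folded w'_def]
  obtain rM rm where rM: "0 < rM" "AE u in M. rM \<le> \<bar>u - w'\<bar>" and rm: "0 < rm" "AE u in \<mu>. rm \<le> \<bar>u - w'\<bar>"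
    using rv(3,4) unfolding gap_def by blast
  \<comment> \<open>Half of the gap at \<open>w'\<close>, so that a gap \<open>r\<close> remains at
    every point within \<open>r\<close> of \<open>w'\<close>.\<close>
  define r where "r = min rM rm / 2"
  have r: "0 < r" "2 * r \<le> rM" "2 * r \<le> rm" unfolding r_def using rM rm by auto
  have gM2: "AE u in M. 2 * r \<le> \<bar>u - w'\<bar>" using rM(2) by eventually_elim (use r in linarith)
  have gm2: "AE u in \<mu>. 2 * r \<le> \<bar>u - w'\<bar>" using rm(2) by eventually_elim (use r in linarith)
  have gM: "AE u in M. r \<le> \<bar>u - w'\<bar>" using gM2 by eventually_elim (use r in linarith)
  have gm: "AE u in \<mu>. r \<le> \<bar>u - w'\<bar>" using gm2 by eventually_elim (use r in linarith)
  note cr = edge_critical[OF tt'(2) r(1) gM ed' rv(1)]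
  have j30: "moment M 3 w' = 0" by (rule interior_moment3[OF tt'(2) r(1) gM int rv(1)])
  define j4 where "j4 = moment M 4 w'"
  show j4: "0 < moment M 4 w'" by (rule mh.moment_even_pos(2)[OF r(1) gM cr(3)])
  show m2: "0 < moment \<mu> 2 w'" by (rule mu.moment_even_pos(1)[OF r(1) gm mu_space])
  define mM where "mM = measure M (space M)"
  define B where "B = mM / r ^ 5"
  have B: "0 \<le> B" unfolding B_def mM_def using r by simp
  \<comment> \<open>136 and 12 dominate the numerical constants of the expansions for
    \<open>M\<close> and for \<open>\<mu>\<close>.\<close>
  define C where "C = 136 * B + 12 / r ^ 3"
  have C: "0 < C" unfolding C_def using B r by (intro add_nonneg_pos) auto
  have CB: "k * mM / r ^ 5 \<le> C" if "k \<le> 136" "0 \<le> k" for k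
  proof -
    have "k * mM / r ^ 5 = k * B" unfolding B_def by simp
    also have "\<dots> \<le> 136 * B" using that B by (intro mult_right_mono) auto
    also have "\<dots> \<le> C" unfolding C_def using r by simp
    finally show ?thesis .
  qed
  have Cm: "k / r ^ 3 \<le> C" if "k \<le> 12" for k
  proof -
    have "k / r ^ 3 \<le> 12 / r ^ 3" using that r by (intro divide_right_mono) auto
    then show ?thesis unfolding C_def using B by simp
  qed
  \<comment> \<open>Regularity of \<open>E'\<close> quantified; it keeps all nearby pairs
    \<open>(s, x)\<close> away from singular points.\<close>
  define \<kappa> where "\<kappa> = cmod (of_real t' * of_real w' - of_real E')"
  have \<kappa>: "0 < \<kappa>" unfolding \<kappa>_def using rv(1,2) by simp
  show "\<exists>C>0. \<forall>\<epsilon>>0. \<exists>\<delta>>0. \<forall>s. t \<le> s \<and> t' - \<delta> < s \<and> s < t' \<longrightarrow> (\<exists>e j3 j4s m2s. \<bar>e\<bar> \<le> \<epsilon> \<and>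
       \<bar>(t' - s) / ((s - 1) * (t' - 1)) - 3 * moment M 4 w' * e\<^sup>2\<bar> \<le> C * \<bar>e\<bar> ^ 3 \<and>
       \<bar>j3 - 3 * moment M 4 w' * e\<bar> \<le> C * e\<^sup>2 \<and> j3 \<noteq> 0 \<and>
       \<bar>j4s - moment M 4 w'\<bar> \<le> C * \<bar>e\<bar> \<and> \<bar>m2s - moment \<mu> 2 w'\<bar> \<le> C * \<bar>e\<bar> \<and>
       C1 M \<omega> s (E s) = - (s - 1) * j3 \<and>
       (\<forall>x. \<bar>x - E s\<bar> < \<delta> \<longrightarrow> (\<exists>d \<rho>. ac_density (\<nu> s) x = ereal \<rho> \<and>
          edge_data C \<epsilon> ((x - E s) / (s - 1)) j3 j4s m2s d \<rho>)))"
  proof (rule exI[of _ C], rule conjI[OF C], intro allI impI)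
    fix \<epsilon> :: real assume \<epsilon>: "0 < \<epsilon>"
    define a where "a = min (\<epsilon> / 2) (min (r / 4) (\<kappa> / (4 * t')))"
    have a: "0 < a" "a \<le> \<epsilon> / 2" "a \<le> r / 4" "a \<le> \<kappa> / (4 * t')"
      unfolding a_def using \<epsilon> r \<kappa> tt' by (simp, auto simp: min_le_iff_disj)
    obtain \<delta>1 where \<delta>1: "0 < \<delta>1" "\<And>s x. \<bar>s - t'\<bar> < \<delta>1 \<Longrightarrow> \<bar>x - E'\<bar> < \<delta>1 \<Longrightarrow> cmod (\<omega> s (of_real x) - \<omega> t' (of_real E')) < a"
      using omega_joint_continuous[OF tt'(2) a(1), of E'] by blast
    define b where "b = min \<delta>1 (\<kappa> / (4 * (\<bar>w'\<bar> + a + 1)))"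
    have b: "0 < b" "b \<le> \<delta>1" "b \<le> \<kappa> / (4 * (\<bar>w'\<bar> + a + 1))"
      unfolding b_def using \<delta>1 \<kappa> a by (simp, auto simp: min_le_iff_disj)
    have b': "b * (\<bar>w'\<bar> + a + 1) \<le> \<kappa> / 4"
      using b(3) a(1) by (simp add: pos_le_divide_eq) (simp add: algebra_simps)
    have "\<forall>\<^sub>F s in at_left t'. dist (E s) E' < b / 2" using tendstoD[OF lim, of "b / 2"] b(1) by simp
    then obtain c where c: "c < t'" "\<And>s. c < s \<Longrightarrow> s < t' \<Longrightarrow> dist (E s) E' < b / 2"
      unfolding eventually_at_left_field by blast
    define \<delta> where "\<delta> = min (b / 2) (t' - c)"
    have "0 < \<delta>" using b(1) c(1) unfolding \<delta>_def by simp
    moreover have "\<delta> \<le> b / 2" "\<delta> \<le> t' - c" unfolding \<delta>_def by (rule min.cobounded1, rule min.cobounded2)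
    ultimately have \<delta>: "0 < \<delta>" "\<delta> \<le> b / 2" "\<delta> \<le> t' - c" by blast+
    have om: "cmod (\<omega> s (of_real x) - of_real w') < a" if "\<bar>s - t'\<bar> < b" "\<bar>x - E'\<bar> < b" for s x
      using \<delta>1(2)[of s x] that b(2) rv(1) by simp
    show "\<exists>\<delta>>0. \<forall>s. t \<le> s \<and> t' - \<delta> < s \<and> s < t' \<longrightarrow> (\<exists>e j3 j4s m2s. \<bar>e\<bar> \<le> \<epsilon> \<and>
       \<bar>(t' - s) / ((s - 1) * (t' - 1)) - 3 * moment M 4 w' * e\<^sup>2\<bar> \<le> C * \<bar>e\<bar> ^ 3 \<and>
       \<bar>j3 - 3 * moment M 4 w' * e\<bar> \<le> C * e\<^sup>2 \<and> j3 \<noteq> 0 \<and>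
       \<bar>j4s - moment M 4 w'\<bar> \<le> C * \<bar>e\<bar> \<and> \<bar>m2s - moment \<mu> 2 w'\<bar> \<le> C * \<bar>e\<bar> \<and>
       C1 M \<omega> s (E s) = - (s - 1) * j3 \<and>
       (\<forall>x. \<bar>x - E s\<bar> < \<delta> \<longrightarrow> (\<exists>d \<rho>. ac_density (\<nu> s) x = ereal \<rho> \<and>
          edge_data C \<epsilon> ((x - E s) / (s - 1)) j3 j4s m2s d \<rho>)))"
    proof (rule exI[of _ \<delta>], rule conjI[OF \<delta>(1)], intro allI impI, elim conjE)
      fix s assume s: "t \<le> s" "t' - \<delta> < s" "s < t'"
      have s1: "1 < s" using s t by simp
      have st: "\<bar>s - t'\<bar> < b" using s \<delta>(2) b(1) by simp
      have Es: "\<bar>E s - E'\<bar> < b / 2" using c(2)[of s] s \<delta>(3) by (simp add: dist_real_def)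
      have ex: "exterior_point (\<nu> s) (E s)" using ext s by simp
      then have eds: "E s \<in> edge_set (\<nu> s)" unfolding exterior_point_def by blast
      define ws where "ws = Re (\<omega> s (of_real (E s)))"
      have wsE: "\<omega> s (of_real (E s)) = of_real ws"
        using eds edge_set_iff[OF s1] unfolding ws_def by (simp add: complex_eq_iff)
      define e where "e = ws - w'"
      have ea: "\<bar>e\<bar> < a" using om[OF st, of "E s"] Es b(1) unfolding wsE cmod_real_diff e_def by simp
      have er: "\<bar>e\<bar> \<le> r / 2" "\<bar>ws - w'\<bar> \<le> r" using ea a r unfolding e_def by auto
      have we: "w' + e = ws" unfolding e_def by simp
      have gMs: "AE u in M. r \<le> \<bar>u - ws\<bar>" by (rule mh.gap_shift[OF gM2 er(2)])
      have gms: "AE u in \<mu>. r \<le> \<bar>u - ws\<bar>" by (rule mu.gap_shift[OF gm2 er(2)])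
      note crs = edge_critical[OF s1 r(1) gMs eds wsE]
      have j3: "moment M 3 ws \<noteq> 0" by (rule exterior_moment3[OF s1 r(1) gMs ex wsE])
      \<comment> \<open>Both ends are critical: the second moment is \<open>1 / (s - 1)\<close> at
        \<open>ws\<close> and \<open>1 / (t' - 1)\<close> at \<open>w'\<close>. Since the third
        moment vanishes at \<open>w'\<close>, the difference is \<open>3 j4 e^2\<close> to leading
        order.\<close>
      have i1: "\<bar>(t' - s) / ((s - 1) * (t' - 1)) - 3 * j4 * e\<^sup>2\<bar> \<le> C * \<bar>e\<bar> ^ 3"
      proof -
        have "\<bar>sqint M (of_real w' + of_real e) - (moment M 2 w' + 2 * moment M 3 w' * e + j4 * (3 * e\<^sup>2 - 0\<^sup>2))\<bar> \<le> 11 * mM / r ^ 5 * \<bar>e\<bar> ^ 3"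
          using mh.sqint_expand[OF r(1) gM, of "of_real e"] er(1) unfolding j4_def mM_def by simp
        moreover have "sqint M (of_real w' + of_real e) = 1 / (s - 1)"
          using mh.sqpot_gap(2)[OF r(1) gMs] crs(1) unfolding we[symmetric] by simp
        moreover have "1 / (s - 1) - 1 / (t' - 1) = (t' - s) / ((s - 1) * (t' - 1))" using s1 tt' by (simp add: field_simps)
        ultimately have "\<bar>(t' - s) / ((s - 1) * (t' - 1)) - 3 * j4 * e\<^sup>2\<bar> \<le> 11 * mM / r ^ 5 * \<bar>e\<bar> ^ 3"
          unfolding cr(1) j30 by (simp add: algebra_simps)
        also have "\<dots> \<le> C * \<bar>e\<bar> ^ 3" by (intro mult_right_mono CB) auto
        finally show ?thesis .
      qed
      have i2: "\<bar>moment M 3 ws - 3 * j4 * e\<bar> \<le> C * e\<^sup>2"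
        using mh.moment_expand(2)[OF r(1) gM er(1)] mult_right_mono[OF CB[of 90], of "e\<^sup>2"] unfolding we j30 j4_def mM_def by simp
      have i3: "\<bar>moment M 4 ws - j4\<bar> \<le> C * \<bar>e\<bar>"
        using mh.moment_expand(3)[OF r(1) gM er(1)] mult_right_mono[OF CB[of 136], of "\<bar>e\<bar>"] unfolding we j4_def mM_def by simp
      have i4: "\<bar>moment \<mu> 2 ws - moment \<mu> 2 w'\<bar> \<le> C * \<bar>e\<bar>"
        using mu.moment_expand(1)[OF r(1) gm er(1)] mult_right_mono[OF Cm[of 10], of "\<bar>e\<bar>"] mu.prob_space unfolding we by simp
      have c1: "C1 M \<omega> s (E s) = - (s - 1) * moment M 3 ws"
        unfolding C1_def inv_moment_def moment_def ws_def ..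
      have dat: "\<exists>d \<rho>. ac_density (\<nu> s) x = ereal \<rho> \<and>
          edge_data C \<epsilon> ((x - E s) / (s - 1)) (moment M 3 ws) (moment M 4 ws) (moment \<mu> 2 ws) d \<rho>" if x: "\<bar>x - E s\<bar> < \<delta>" for x
      proof -
        have xE: "\<bar>x - E'\<bar> < b" using x Es \<delta>(2) by linarith
        define d where "d = \<omega> s (of_real x) - of_real ws"
        have oa: "cmod (\<omega> s (of_real x) - of_real w') < a" by (rule om[OF st xE])
        have "d = (\<omega> s (of_real x) - of_real w') - of_real e" unfolding d_def e_def by simp
        then have "cmod d \<le> cmod (\<omega> s (of_real x) - of_real w') + \<bar>e\<bar>" by (metis norm_triangle_ineq4 norm_of_real)
        then have d2: "cmod d \<le> 2 * a" using oa ea by simp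
        then have dr: "cmod d \<le> r / 2" and de: "cmod d \<le> \<epsilon>" using a by auto
        \<comment> \<open>If \<open>s \<omega> = x\<close> held nearby, continuity would make
          \<open>t' w' - E'\<close> smaller than \<open>\<kappa>\<close>.\<close>
        have ns: "of_real s * \<omega> s (of_real x) \<noteq> of_real x"
        proof
          assume eq: "of_real s * \<omega> s (of_real x) = of_real x"
          have "of_real t' * of_real w' - of_real E' = - of_real t' * (\<omega> s (of_real x) - of_real w') +
              of_real (t' - s) * \<omega> s (of_real x) + (of_real x - of_real E')"
            by (simp add: algebra_simps eq)
          then have "\<kappa> \<le> cmod (- of_real t' * (\<omega> s (of_real x) - of_real w')) + cmod (of_real (t' - s) * \<omega> s (of_real x)) + cmod (of_real x - of_real E')"
            unfolding \<kappa>_def by (simp only:) (intro order_trans[OF norm_triangle_ineq] add_mono norm_triangle_ineq order_refl)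
          also have "cmod (- of_real t' * (\<omega> s (of_real x) - of_real w')) = t' * cmod (\<omega> s (of_real x) - of_real w')"
            using tt' by (simp add: norm_mult)
          also have "\<dots> \<le> t' * (\<kappa> / (4 * t'))" using oa a(4) tt' by (intro mult_left_mono) auto
          also have "\<dots> = \<kappa> / 4" using tt' by simp
          also have "cmod (of_real (t' - s) * \<omega> s (of_real x)) \<le> b * (\<bar>w'\<bar> + a)"
          proof -
            have "cmod (\<omega> s (of_real x)) \<le> cmod (\<omega> s (of_real x) - of_real w') + cmod (of_real w' :: complex)"
              by (metis norm_triangle_ineq diff_add_cancel)
            then have "cmod (\<omega> s (of_real x)) \<le> \<bar>w'\<bar> + a" using oa by simp
            then show ?thesis unfolding norm_mult norm_of_real using st b(1) by (intro mult_mono) auto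
          qed
          also have "cmod (of_real x - of_real E') \<le> b" using xE unfolding cmod_real_diff by simp
          finally have "\<kappa> \<le> \<kappa> / 4 + b * (\<bar>w'\<bar> + a + 1)" by (simp add: algebra_simps)
          then show False using b' \<kappa> by simp
        qed
        obtain \<rho> where \<rho>: "ac_density (\<nu> s) x = ereal \<rho>" "\<bar>pi * \<rho> - moment \<mu> 2 ws * Im d\<bar> \<le> 2 / r ^ 3 * (cmod d)\<^sup>2" "Im d = 0 \<longrightarrow> \<rho> = 0"
          using density_expand[OF s1 ns r(1) gms d_def dr] by blast
        note L = local_expansion[OF s1 r(1) gMs crs(1,2) d_def dr, folded mM_def]
        have "11 * mM / r ^ 5 * cmod d ^ k \<le> C * cmod d ^ k" for k by (intro mult_right_mono CB) auto
        note C4 = this[of 4] and C3 = this[of 3]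
        have C2: "2 / r ^ 3 * (cmod d)\<^sup>2 \<le> C * (cmod d)\<^sup>2" by (intro mult_right_mono Cm) auto
        have "edge_data C \<epsilon> ((x - E s) / (s - 1)) (moment M 3 ws) (moment M 4 ws) (moment \<mu> 2 ws) d \<rho>"
          unfolding edge_data_def
        proof (intro conjI impI)
          show "cmod d \<le> \<epsilon>" by (rule de)
          show "0 \<le> Im d" by (rule L(1))
          show "cmod (of_real ((x - E s) / (s - 1)) + of_real (moment M 3 ws) * d\<^sup>2 + of_real (moment M 4 ws) * d ^ 3) \<le> C * cmod d ^ 4"
            by (rule order_trans[OF L(3) C4])
          show "2 * moment M 3 ws * Re d + moment M 4 ws * (3 * (Re d)\<^sup>2 - (Im d)\<^sup>2) \<le> C * cmod d ^ 3"
            by (rule order_trans[OF L(4) C3])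
          show "- (C * cmod d ^ 3) \<le> 2 * moment M 3 ws * Re d + moment M 4 ws * (3 * (Re d)\<^sup>2 - (Im d)\<^sup>2)" if "0 < Im d"
            using L(5)[OF that] C3 by linarith
          show "\<bar>pi * \<rho> - moment \<mu> 2 ws * Im d\<bar> \<le> C * (cmod d)\<^sup>2" by (rule order_trans[OF \<rho>(2) C2])
          show "\<rho> = 0" if "Im d = 0" using \<rho>(3) that by blast
        qed
        then show ?thesis using \<rho>(1) by blast
      qed
      have dat': "\<forall>x. \<bar>x - E s\<bar> < \<delta> \<longrightarrow> (\<exists>d \<rho>. ac_density (\<nu> s) x = ereal \<rho> \<and>
          edge_data C \<epsilon> ((x - E s) / (s - 1)) (moment M 3 ws) (moment M 4 ws) (moment \<mu> 2 ws) d \<rho>)"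
        using dat by blast
      have "\<bar>e\<bar> \<le> \<epsilon>" using ea a by simp
      then show "\<exists>e j3 j4s m2s. \<bar>e\<bar> \<le> \<epsilon> \<and>
       \<bar>(t' - s) / ((s - 1) * (t' - 1)) - 3 * moment M 4 w' * e\<^sup>2\<bar> \<le> C * \<bar>e\<bar> ^ 3 \<and>
       \<bar>j3 - 3 * moment M 4 w' * e\<bar> \<le> C * e\<^sup>2 \<and> j3 \<noteq> 0 \<and>
       \<bar>j4s - moment M 4 w'\<bar> \<le> C * \<bar>e\<bar> \<and> \<bar>m2s - moment \<mu> 2 w'\<bar> \<le> C * \<bar>e\<bar> \<and>
       C1 M \<omega> s (E s) = - (s - 1) * j3 \<and>
       (\<forall>x. \<bar>x - E s\<bar> < \<delta> \<longrightarrow> (\<exists>d \<rho>. ac_density (\<nu> s) x = ereal \<rho> \<and>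
          edge_data C \<epsilon> ((x - E s) / (s - 1)) j3 j4s m2s d \<rho>))"
        using i1 i2 j3 i3 i4 c1 dat' unfolding j4_def
        by (intro exI[of _ e] exI[of _ "moment M 3 ws"] exI[of _ "moment M 4 ws"] exI[of _ "moment \<mu> 2 ws"] conjI)
    qed
  qed
qed

end

lemma inv_moment_moment: "inv_moment k N \<omega> t E = moment N k (Re (\<omega> t (of_real E)))"
  unfolding inv_moment_def moment_def ..

text \<open>The coefficient of the theorem, with \<open>S2\<close> eliminated, equals the one
  produced by the square root law with \<open>|j3|\<close> replaced by
  \<open>3 j4 L\<close>.\<close>

lemma root4_coefficient:
  fixes s t' j4 m2 :: real
  assumes "1 < s" "s < t'" "0 < j4"
  shows "root 4 (t' - 1) / pi * (m2 / root 4 j4) / (t' / root 4 ((t' - 1) ^ 3)) * (t' / root 4 (3 * (s - 1) * (t' - 1) ^ 3)) / root 4 (t' - s) =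
    m2 / pi / sqrt ((s - 1) * (3 * j4 * sqrt ((t' - s) / (3 * j4 * ((s - 1) * (t' - 1))))))"
proof -
  define a c j h \<tau> where "a = root 4 (t' - 1)" and "c = root 4 (s - 1)" and "j = root 4 j4" and "h = root 4 3" and "\<tau> = root 4 (t' - s)"
  have p: "0 < a" "0 < c" "0 < j" "0 < h" "0 < \<tau>" unfolding a_def c_def j_def h_def \<tau>_def using assms by auto
  have q: "t' - 1 = a ^ 4" "s - 1 = c ^ 4" "j4 = j ^ 4" "3 = h ^ 4" "t' - s = \<tau> ^ 4"
    unfolding a_def c_def j_def h_def \<tau>_def using assms by auto
  have r1: "root 4 ((t' - 1) ^ 3) = a ^ 3" unfolding a_def by (rule real_root_power) simp
  have r2: "root 4 (3 * (s - 1) * (t' - 1) ^ 3) = h * c * a ^ 3"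
    unfolding h_def c_def r1[symmetric] by (simp only: real_root_mult)
  have x: "sqrt ((t' - s) / (3 * j4 * ((s - 1) * (t' - 1)))) = \<tau>\<^sup>2 / (h\<^sup>2 * j\<^sup>2 * c\<^sup>2 * a\<^sup>2)"
  proof (rule real_sqrt_unique)
    show "(\<tau>\<^sup>2 / (h\<^sup>2 * j\<^sup>2 * c\<^sup>2 * a\<^sup>2))\<^sup>2 = (t' - s) / (3 * j4 * ((s - 1) * (t' - 1)))"
      unfolding q by (simp add: power_mult_distrib power_divide mult.assoc flip: power_mult)
  qed (use p in simp)
  have z: "sqrt ((s - 1) * (3 * j4 * (\<tau>\<^sup>2 / (h\<^sup>2 * j\<^sup>2 * c\<^sup>2 * a\<^sup>2)))) = c * h * j * \<tau> / a"
  proof (rule real_sqrt_unique)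
    show "(c * h * j * \<tau> / a)\<^sup>2 = (s - 1) * (3 * j4 * (\<tau>\<^sup>2 / (h\<^sup>2 * j\<^sup>2 * c\<^sup>2 * a\<^sup>2)))"
      unfolding q using p by (simp add: field_simps eval_nat_numeral)
  qed (use p in simp)
  show ?thesis
    unfolding x z r1 r2 a_def[symmetric] j_def[symmetric] \<tau>_def[symmetric] using p assms by (simp add: field_simps)
qed

lemma root3_square: "0 < x \<Longrightarrow> (root 3 x)\<^sup>2 = x powr (2 / 3)"
  by (simp add: root_powr_inverse powr_power)

context free_semigroup
begin

lemma exterior_edge:
  assumes t: "1 < t" and reg: "Et \<in> regular_points \<mu> t" and ext: "exterior_point (\<nu> t) Et"
  defines "w \<equiv> Re (\<omega> t (of_real Et))"
  shows "Im (\<omega> t (of_real Et)) = 0"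
    "\<exists>r>0. (AE u in M. r \<le> \<bar>u - w\<bar>) \<and> (AE u in \<mu>. r \<le> \<bar>u - w\<bar>)"
    "moment M 2 w = 1 / (t - 1)" "H t (of_real w) = of_real Et" "emeasure M (space M) \<noteq> 0" "moment M 3 w \<noteq> 0"
proof -
  have ed: "Et \<in> edge_set (\<nu> t)" using ext unfolding exterior_point_def by blast
  then show Im: "Im (\<omega> t (of_real Et)) = 0" using edge_set_iff[OF t] by blast
  note rv = regular_value[OF t reg Im, folded w_def]
  obtain r1 r2 where r12: "0 < r1" "AE u in M. r1 \<le> \<bar>u - w\<bar>" "0 < r2" "AE u in \<mu>. r2 \<le> \<bar>u - w\<bar>"
    using rv(3,4) unfolding gap_def by blast
  define r where "r = min r1 r2"
  have r: "0 < r" "r \<le> r1" "r \<le> r2" unfolding r_def using r12 by auto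
  have g: "AE u in M. r \<le> \<bar>u - w\<bar>" using r12(2) by eventually_elim (use r in linarith)
  have gm: "AE u in \<mu>. r \<le> \<bar>u - w\<bar>" using r12(4) by eventually_elim (use r in linarith)
  show "\<exists>r>0. (AE u in M. r \<le> \<bar>u - w\<bar>) \<and> (AE u in \<mu>. r \<le> \<bar>u - w\<bar>)" using r(1) g gm by blast
  show "moment M 2 w = 1 / (t - 1)" "H t (of_real w) = of_real Et" "emeasure M (space M) \<noteq> 0"
    by (rule edge_critical[OF t r(1) g ed rv(1)])+
  show "moment M 3 w \<noteq> 0" by (rule exterior_moment3[OF t r(1) g ext rv(1)])
qed

text \<open>The square root law for \<open>Im \<omega>\<close> is transferred to the density by
  linearizing \<open>stieltjes \<mu>\<close> at \<open>w\<close>; \<open>|d|^2\<close> is already of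
  order \<open>|x - Et|\<close>.\<close>

lemma exterior_square_root:
  assumes t: "1 < t" and reg: "Et \<in> regular_points \<mu> t" and ext: "exterior_point (\<nu> t) Et"
  defines "w \<equiv> Re (\<omega> t (of_real Et))"
  shows "0 < moment \<mu> 2 w"
    "\<exists>\<delta>>0. \<exists>K. \<forall>x. \<bar>x - Et\<bar> < \<delta> \<and> 0 \<le> sgn (moment M 3 w) * (x - Et) \<longrightarrow>
      (\<exists>\<rho>. ac_density (\<nu> t) x = ereal \<rho> \<and>
        \<bar>\<rho> - 1 / pi * (moment \<mu> 2 w / sqrt ((t - 1) * \<bar>moment M 3 w\<bar>)) * sqrt \<bar>x - Et\<bar>\<bar> \<le> K * \<bar>x - Et\<bar>)"
proof -
  note EE = exterior_edge[OF t reg ext, folded w_def]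
  note rv = regular_value[OF t reg EE(1), folded w_def]
  obtain r where r: "0 < r" and g: "AE u in M. r \<le> \<bar>u - w\<bar>" and gm: "AE u in \<mu>. r \<le> \<bar>u - w\<bar>" using EE(2) by blast
  show m2: "0 < moment \<mu> 2 w" by (rule mu.moment_even_pos(1)[OF r gm mu_space])
  define m j \<sigma> where "m = moment \<mu> 2 w" and "j = (t - 1) * \<bar>moment M 3 w\<bar>" and "\<sigma> = sgn (moment M 3 w)"
  have \<sigma>: "\<bar>\<sigma>\<bar> = 1" unfolding \<sigma>_def using EE(6) by (simp add: sgn_if)
  obtain \<delta>1 K where \<delta>1: "0 < \<delta>1" and K: "0 \<le> K" and SE: "\<And>x. \<bar>x - Et\<bar> < \<delta>1 \<Longrightarrow> cmod (\<omega> t (of_real x) - of_real w) \<le> r / 2 \<and>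
      (cmod (\<omega> t (of_real x) - of_real w))\<^sup>2 \<le> K * \<bar>x - Et\<bar> \<and>
      (0 \<le> \<sigma> * (x - Et) \<longrightarrow> \<bar>Im (\<omega> t (of_real x)) - sqrt (\<sigma> * (x - Et) / j)\<bar> \<le> K * \<bar>x - Et\<bar>)"
    using simple_edge(2)[OF t r g EE(3,4,6), folded \<sigma>_def j_def] by blast
  obtain \<delta>2 where \<delta>2: "0 < \<delta>2" "\<And>z. 0 \<le> Im z \<Longrightarrow> cmod (z - of_real Et) \<le> \<delta>2 \<Longrightarrow> z \<noteq> of_real t * \<omega> t z"
    using bdry_nbhd[OF t rv(2)] by blast
  have "\<exists>\<rho>. ac_density (\<nu> t) x = ereal \<rho> \<and> \<bar>\<rho> - 1 / pi * (m / sqrt j) * sqrt \<bar>x - Et\<bar>\<bar> \<le> (2 / r ^ 3 * K + m * K) * \<bar>x - Et\<bar>"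
    if x: "\<bar>x - Et\<bar> < min \<delta>1 \<delta>2" "0 \<le> \<sigma> * (x - Et)" for x
  proof -
    define d where "d = \<omega> t (of_real x) - of_real w"
    have y: "\<sigma> * (x - Et) = \<bar>x - Et\<bar>" using x(2) \<sigma> by (metis abs_mult abs_of_nonneg mult_1)
    have S: "cmod d \<le> r / 2" "(cmod d)\<^sup>2 \<le> K * \<bar>x - Et\<bar>" "\<bar>Im d - sqrt \<bar>x - Et\<bar> / sqrt j\<bar> \<le> K * \<bar>x - Et\<bar>"
      using SE[of x] x unfolding y d_def by (simp_all add: real_sqrt_divide)
    have ns: "of_real t * \<omega> t (of_real x) \<noteq> of_real x"
      using \<delta>2(2)[of "of_real x"] x(1) unfolding cmod_real_diff by auto
    obtain \<rho> where \<rho>: "ac_density (\<nu> t) x = ereal \<rho>" "\<bar>pi * \<rho> - m * Im d\<bar> \<le> 2 / r ^ 3 * (cmod d)\<^sup>2"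
      using density_expand[OF t ns r gm d_def S(1)] unfolding m_def by blast
    have "\<bar>m * Im d - m * (sqrt \<bar>x - Et\<bar> / sqrt j)\<bar> = m * \<bar>Im d - sqrt \<bar>x - Et\<bar> / sqrt j\<bar>"
      using m2 unfolding m_def by (simp only: right_diff_distrib[symmetric] abs_mult abs_of_pos)
    also have "\<dots> \<le> m * (K * \<bar>x - Et\<bar>)" using S(3) m2 unfolding m_def by (intro mult_left_mono) auto
    finally have 1: "\<bar>m * Im d - m * (sqrt \<bar>x - Et\<bar> / sqrt j)\<bar> \<le> m * (K * \<bar>x - Et\<bar>)" .
    have 2: "2 / r ^ 3 * (cmod d)\<^sup>2 \<le> 2 / r ^ 3 * (K * \<bar>x - Et\<bar>)" using S(2) r by (intro mult_left_mono) auto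
    let ?q = "\<rho> - 1 / pi * (m / sqrt j) * sqrt \<bar>x - Et\<bar>"
    have "pi * ?q = pi * \<rho> - m * (sqrt \<bar>x - Et\<bar> / sqrt j)" by (simp add: field_simps)
    moreover have "\<bar>pi * \<rho> - m * (sqrt \<bar>x - Et\<bar> / sqrt j)\<bar> \<le> 2 / r ^ 3 * (K * \<bar>x - Et\<bar>) + m * (K * \<bar>x - Et\<bar>)"
      using abs_triangle_ineq[of "pi * \<rho> - m * Im d" "m * Im d - m * (sqrt \<bar>x - Et\<bar> / sqrt j)"]
      by (intro order_trans[OF _ add_mono[OF order_trans[OF \<rho>(2) 2] 1]]) simp
    ultimately have "\<bar>pi * ?q\<bar> \<le> 2 / r ^ 3 * (K * \<bar>x - Et\<bar>) + m * (K * \<bar>x - Et\<bar>)" by (simp only:)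
    then have "pi * \<bar>?q\<bar> \<le> 2 / r ^ 3 * (K * \<bar>x - Et\<bar>) + m * (K * \<bar>x - Et\<bar>)"
      by (simp only: abs_mult abs_of_pos[OF pi_gt_zero])
    also have "\<dots> = (2 / r ^ 3 * K + m * K) * \<bar>x - Et\<bar>" by (simp add: algebra_simps)
    finally have "pi * \<bar>?q\<bar> \<le> (2 / r ^ 3 * K + m * K) * \<bar>x - Et\<bar>" .
    then have "\<bar>?q\<bar> \<le> (2 / r ^ 3 * K + m * K) * \<bar>x - Et\<bar>" using abs_le_pi_mult[of ?q] by linarith
    then show ?thesis using \<rho>(1) by blast
  qed
  then show "\<exists>\<delta>>0. \<exists>K. \<forall>x. \<bar>x - Et\<bar> < \<delta> \<and> 0 \<le> sgn (moment M 3 w) * (x - Et) \<longrightarrow>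
      (\<exists>\<rho>. ac_density (\<nu> t) x = ereal \<rho> \<and>
        \<bar>\<rho> - 1 / pi * (moment \<mu> 2 w / sqrt ((t - 1) * \<bar>moment M 3 w\<bar>)) * sqrt \<bar>x - Et\<bar>\<bar> \<le> K * \<bar>x - Et\<bar>)"
    unfolding m_def j_def \<sigma>_def
    by (intro exI[of _ "min \<delta>1 \<delta>2"] conjI exI[of _ "2 / r ^ 3 * K + moment \<mu> 2 w * K"]) (use \<delta>1 \<delta>2(1) in auto)
qed

lemma square_root_edge:
  assumes t: "1 < t" and reg: "Et \<in> regular_points \<mu> t" and ext: "exterior_point (\<nu> t) Et"
  shows "\<exists>S1 > 0. S1 * (t / sqrt ((t - 1) ^ 3)) =
           1 / pi * (inv_moment 2 \<mu> \<omega> t Et / sqrt ((t - 1) * \<bar>inv_moment 3 M \<omega> t Et\<bar>)) \<and>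
         (\<exists>K. \<exists>\<delta> > 0.
            C1 M \<omega> t Et < 0 \<and> right_edge (\<nu> t) Et (S1 * (t / sqrt ((t - 1) ^ 3))) (\<lambda>r. K * r) (ball Et \<delta>) \<or>
            C1 M \<omega> t Et > 0 \<and> left_edge (\<nu> t) Et (S1 * (t / sqrt ((t - 1) ^ 3))) (\<lambda>r. K * r) (ball Et \<delta>))"
proof -
  define w where "w = Re (\<omega> t (of_real Et))"
  note ES = exterior_square_root[OF t reg ext, folded w_def]
  have j3: "moment M 3 w \<noteq> 0" using exterior_edge(6)[OF t reg ext] unfolding w_def .
  define c where "c = 1 / pi * (moment \<mu> 2 w / sqrt ((t - 1) * \<bar>moment M 3 w\<bar>))"
  have c: "0 < c" unfolding c_def using ES(1) j3 t by simp
  define q where "q = t / sqrt ((t - 1) ^ 3)"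
  have q: "0 < q" unfolding q_def using t by simp
  obtain \<delta> K where \<delta>: "0 < \<delta>" and K: "\<And>x. \<bar>x - Et\<bar> < \<delta> \<Longrightarrow> 0 \<le> sgn (moment M 3 w) * (x - Et) \<Longrightarrow>
      \<exists>\<rho>. ac_density (\<nu> t) x = ereal \<rho> \<and> \<bar>\<rho> - c * sqrt \<bar>x - Et\<bar>\<bar> \<le> K * \<bar>x - Et\<bar>"
    using ES(2) unfolding c_def by blast
  have C1: "C1 M \<omega> t Et = - (t - 1) * moment M 3 w" unfolding C1_def inv_moment_moment w_def ..
  have "C1 M \<omega> t Et < 0 \<and> right_edge (\<nu> t) Et c (\<lambda>r. K * r) (ball Et \<delta>) \<or>
        C1 M \<omega> t Et > 0 \<and> left_edge (\<nu> t) Et c (\<lambda>r. K * r) (ball Et \<delta>)"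
  proof (cases "0 < moment M 3 w")
    case True
    have "right_edge (\<nu> t) Et c (\<lambda>r. K * r) (ball Et \<delta>)"
      unfolding right_edge_def
    proof (intro ballI impI)
      fix x assume "x \<in> ball Et \<delta>" "Et \<le> x"
      then show "\<bar>ac_density (\<nu> t) x - ereal (c * sqrt (x - Et))\<bar> \<le> ereal (K * (x - Et))"
        using K[of x] True by (auto simp: dist_real_def)
    qed
    then show ?thesis using mult_pos_pos[of "t - 1" "moment M 3 w"] True t unfolding C1 by (simp only: minus_mult_left[symmetric] diff_gt_0_iff_gt neg_less_0_iff_less simp_thms)
  next
    case False
    then have neg: "moment M 3 w < 0" using j3 by simp
    have "left_edge (\<nu> t) Et c (\<lambda>r. K * r) (ball Et \<delta>)"
      unfolding left_edge_def
    proof (intro ballI impI)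
      fix x assume "x \<in> ball Et \<delta>" "x \<le> Et"
      then show "\<bar>ac_density (\<nu> t) x - ereal (c * sqrt (Et - x))\<bar> \<le> ereal (K * (Et - x))"
        using K[of x] neg by (auto simp: dist_real_def abs_minus_commute)
    qed
    then show ?thesis using mult_pos_neg[of "t - 1" "moment M 3 w"] neg t unfolding C1 by (simp only: minus_mult_left[symmetric] diff_gt_0_iff_gt neg_0_less_iff_less simp_thms)
  qed
  then show ?thesis
    unfolding inv_moment_moment w_def[symmetric] q_def[symmetric] c_def[symmetric]
    using c q \<delta> by (intro exI[of _ "c / q"]) auto
qed

lemma merging_edge_square_root:
  assumes t: "1 < t" and fam: "edge_family \<nu> t Et t' E' E" and reg: "E' \<in> regular_points \<mu> t'"
  shows "\<exists>S2 > 0. S2 * (t' / root 4 ((t' - 1) ^ 3)) =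
      root 4 (t' - 1) / pi * (inv_moment 2 \<mu> \<omega> t' E' / root 4 (inv_moment 4 M \<omega> t' E')) \<and>
    (\<exists>K. \<exists>\<delta> > 0. \<forall>s. t \<le> s \<and> t' - \<delta> < s \<and> s < t' \<longrightarrow>
       (let A = S2 * (t' / root 4 (3 * (s - 1) * (t' - 1) ^ 3)) / root 4 (t' - s);
            err = (\<lambda>r. r / sqrt (t' - s) + sqrt r * root 4 (t' - s));
            err' = (\<lambda>r. err r + sqrt (r ^ 3) / root 4 ((t' - s) ^ 7));
            X = {x. \<bar>x - E s\<bar> ^ 2 < \<delta> * (t' - s) ^ 3}
        in \<exists>U. open U \<and> E s \<in> U \<and>
          (C1 M \<omega> s (E s) < 0 \<and>
             right_edge (\<nu> s) (E s) A (\<lambda>r. K * err r) (U \<inter> X) \<and>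
             right_edge (\<nu> s) (E s) A (\<lambda>r. K * err' r) X \<and>
             (\<forall>x \<in> X. x < E s \<longrightarrow> ac_density (\<nu> s) x = 0) \<or>
           C1 M \<omega> s (E s) > 0 \<and>
             left_edge (\<nu> s) (E s) A (\<lambda>r. K * err r) (U \<inter> X) \<and>
             left_edge (\<nu> s) (E s) A (\<lambda>r. K * err' r) X \<and>
             (\<forall>x \<in> X. E s < x \<longrightarrow> ac_density (\<nu> s) x = 0))))"
proof -
  have tt': "t < t'" "1 < t'" using fam t unfolding edge_family_def by auto
  define w' where "w' = Re (\<omega> t' (of_real E'))"
  note NC = near_critical[OF t fam reg, folded w'_def]
  define j4 m2 where "j4 = moment M 4 w'" and "m2 = moment \<mu> 2 w'"
  have j4: "0 < j4" and m2: "0 < m2" using NC(2,3) unfolding j4_def m2_def .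
  obtain C where C: "0 < C" and N: "\<And>\<epsilon>. 0 < \<epsilon> \<Longrightarrow> \<exists>\<delta>>0. \<forall>s. t \<le> s \<and> t' - \<delta> < s \<and> s < t' \<longrightarrow> (\<exists>e j3 j4s m2s. \<bar>e\<bar> \<le> \<epsilon> \<and>
       \<bar>(t' - s) / ((s - 1) * (t' - 1)) - 3 * j4 * e\<^sup>2\<bar> \<le> C * \<bar>e\<bar> ^ 3 \<and>
       \<bar>j3 - 3 * j4 * e\<bar> \<le> C * e\<^sup>2 \<and> j3 \<noteq> 0 \<and>
       \<bar>j4s - j4\<bar> \<le> C * \<bar>e\<bar> \<and> \<bar>m2s - m2\<bar> \<le> C * \<bar>e\<bar> \<and>
       C1 M \<omega> s (E s) = - (s - 1) * j3 \<and>
       (\<forall>x. \<bar>x - E s\<bar> < \<delta> \<longrightarrow> (\<exists>d \<rho>. ac_density (\<nu> s) x = ereal \<rho> \<and>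
          edge_data C \<epsilon> ((x - E s) / (s - 1)) j3 j4s m2s d \<rho>)))"
    using NC(4) unfolding j4_def[symmetric] m2_def[symmetric] by blast
  have \<epsilon>: "0 < j4 / (200 * C)" using j4 C by simp
  obtain \<delta>1 where \<delta>1: "0 < \<delta>1" and N1: "\<And>s. t \<le> s \<Longrightarrow> t' - \<delta>1 < s \<Longrightarrow> s < t' \<Longrightarrow> (\<exists>e j3 j4s m2s. \<bar>e\<bar> \<le> j4 / (200 * C) \<and>
       \<bar>(t' - s) / ((s - 1) * (t' - 1)) - 3 * j4 * e\<^sup>2\<bar> \<le> C * \<bar>e\<bar> ^ 3 \<and>
       \<bar>j3 - 3 * j4 * e\<bar> \<le> C * e\<^sup>2 \<and> j3 \<noteq> 0 \<and>
       \<bar>j4s - j4\<bar> \<le> C * \<bar>e\<bar> \<and> \<bar>m2s - m2\<bar> \<le> C * \<bar>e\<bar> \<and>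
       C1 M \<omega> s (E s) = - (s - 1) * j3 \<and>
       (\<forall>x. \<bar>x - E s\<bar> < \<delta>1 \<longrightarrow> (\<exists>d \<rho>. ac_density (\<nu> s) x = ereal \<rho> \<and>
          edge_data C (j4 / (200 * C)) ((x - E s) / (s - 1)) j3 j4s m2s d \<rho>)))"
    using N[OF \<epsilon>] by blast
  define err err' where "err s r = r / sqrt (t' - s) + sqrt r * root 4 (t' - s)"
    and "err' s r = err s r + sqrt (r ^ 3) / root 4 ((t' - s) ^ 7)" for s r :: real
  have err': "(sqrt r)\<^sup>2 / (root 4 (t' - s))\<^sup>2 + sqrt r * root 4 (t' - s) + sqrt r ^ 3 / root 4 (t' - s) ^ 7 = err' s r"
    if "0 \<le> r" "s < t'" for s r
  proof -
    have "sqrt (t' - s) = (root 4 (t' - s))\<^sup>2"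
      using that by (intro real_sqrt_unique) (auto simp flip: power_mult)
    then show ?thesis unfolding err'_def err_def using that by (simp add: real_sqrt_power real_root_power)
  qed
  \<comment> \<open>With \<open>p = sqrt r\<close> and \<open>q = root 4 (t' - s)\<close>, the
    hypothesis reads \<open>p < q^5\<close>, and then \<open>p^3 / q^7 \<le> p^2 / q^2\<close>: the
    additional term is absorbed.\<close>
  have err2: "err' s r \<le> 2 * err s r" if r: "0 \<le> r" "r\<^sup>2 < (t' - s) ^ 5" and s: "s < t'" for s r
  proof -
    define p q where "p = sqrt r" and "q = root 4 (t' - s)"
    have p: "0 \<le> p" "r = p\<^sup>2" and q: "0 < q" "t' - s = q ^ 4" unfolding p_def q_def using r s by auto
    have "p ^ 4 < (q ^ 5) ^ 4" using r(2) unfolding p(2) q(2) by (simp flip: power_mult)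
    then have pq: "p < q ^ 5" by (rule power_less_imp_less_base) (use q in simp)
    have "p ^ 3 / q ^ 7 \<le> (p\<^sup>2 * q ^ 5) / q ^ 7"
      using mult_left_mono[of p "q ^ 5" "p\<^sup>2"] pq q by (intro divide_right_mono) (auto simp: eval_nat_numeral)
    also have "\<dots> = p\<^sup>2 / q\<^sup>2" using q by (simp add: divide_simps flip: power_add)
    finally have 1: "p ^ 3 / q ^ 7 \<le> p\<^sup>2 / q\<^sup>2" .
    have sq: "sqrt (t' - s) = q\<^sup>2" unfolding q(2) using q by (intro real_sqrt_unique) (auto simp flip: power_mult)
    have "0 \<le> p * q" using p q by simp
    with 1 show ?thesis
      unfolding err'[OF r(1) s, symmetric] err_def sq p_def[symmetric] q_def[symmetric] p(2)[symmetric] by simp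
  qed
  obtain \<delta>2 K where \<delta>2: "0 < \<delta>2" and K: "0 \<le> K" and SR: "\<And>s e j3 j4s m2s y d \<rho>. t \<le> s \<and> s < t' \<and> \<bar>e\<bar> \<le> j4 / (200 * C) \<and>
     \<bar>(t' - s) / ((s - 1) * (t' - 1)) - 3 * j4 * e\<^sup>2\<bar> \<le> C * \<bar>e\<bar> ^ 3 \<and> \<bar>j3 - 3 * j4 * e\<bar> \<le> C * e\<^sup>2 \<and> j3 \<noteq> 0 \<and>
     \<bar>j4s - j4\<bar> \<le> C * \<bar>e\<bar> \<and> \<bar>m2s - m2\<bar> \<le> C * \<bar>e\<bar> \<and>
     edge_data C (j4 / (200 * C)) (y / (s - 1)) j3 j4s m2s d \<rho> \<and> y\<^sup>2 < \<delta>2 * (t' - s) ^ 3 \<Longrightarrow>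
     (sgn j3 * y < 0 \<longrightarrow> \<rho> = 0) \<and>
     (0 \<le> sgn j3 * y \<longrightarrow>
       \<bar>\<rho> - m2 / pi * (sqrt \<bar>y\<bar> / sqrt ((s - 1) * (3 * j4 * sqrt ((t' - s) / (3 * j4 * ((s - 1) * (t' - 1)))))))\<bar> \<le>
       K * ((sqrt \<bar>y\<bar>)\<^sup>2 / (root 4 (t' - s))\<^sup>2 + sqrt \<bar>y\<bar> * root 4 (t' - s) + sqrt \<bar>y\<bar> ^ 3 / root 4 (t' - s) ^ 7))"
    using square_root_regime[OF t tt'(1) j4 m2 C] by (elim exE conjE) (rule that, assumption+, blast)
  define S2 where "S2 = root 4 (t' - 1) / pi * (m2 / root 4 j4) / (t' / root 4 ((t' - 1) ^ 3))"
  have S2: "0 < S2" unfolding S2_def using tt' j4 m2 by simp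
  have S2eq: "S2 * (t' / root 4 ((t' - 1) ^ 3)) = root 4 (t' - 1) / pi * (m2 / root 4 j4)" unfolding S2_def using tt' by simp
  define A where "A s = S2 * (t' / root 4 (3 * (s - 1) * (t' - 1) ^ 3)) / root 4 (t' - s)" for s
  have A: "m2 / pi * (z / sqrt ((s - 1) * (3 * j4 * sqrt ((t' - s) / (3 * j4 * ((s - 1) * (t' - 1))))))) = A s * z"
    if "1 < s" "s < t'" for s z
    unfolding A_def S2_def root4_coefficient[OF that j4] by simp
  \<comment> \<open>The cap 1 ensures \<open>(t' - s) ^ 3 \<le> t' - s < \<delta>\<close>, so that
    \<open>X s\<close> lies within distance \<open>\<delta>\<close> of \<open>E s\<close>, where the
    local data are available.\<close>
  define \<delta> where "\<delta> = min \<delta>2 (min \<delta>1 1)"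
  have \<delta>: "0 < \<delta>" "\<delta> \<le> \<delta>2" "\<delta> \<le> \<delta>1" "\<delta> \<le> 1" unfolding \<delta>_def using \<delta>1 \<delta>2 by auto
  define X where "X s = {x. \<bar>x - E s\<bar> ^ 2 < \<delta> * (t' - s) ^ 3}" for s
  have main: "\<exists>U. open U \<and> E s \<in> U \<and>
          (C1 M \<omega> s (E s) < 0 \<and>
             right_edge (\<nu> s) (E s) (A s) (\<lambda>r. 2 * K * err s r) (U \<inter> X s) \<and>
             right_edge (\<nu> s) (E s) (A s) (\<lambda>r. 2 * K * err' s r) (X s) \<and>
             (\<forall>x \<in> X s. x < E s \<longrightarrow> ac_density (\<nu> s) x = 0) \<or>
           C1 M \<omega> s (E s) > 0 \<and>
             left_edge (\<nu> s) (E s) (A s) (\<lambda>r. 2 * K * err s r) (U \<inter> X s) \<and>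
             left_edge (\<nu> s) (E s) (A s) (\<lambda>r. 2 * K * err' s r) (X s) \<and>
             (\<forall>x \<in> X s. E s < x \<longrightarrow> ac_density (\<nu> s) x = 0))"
    if s: "t \<le> s" "t' - \<delta> < s" "s < t'" for s
  proof -
    have s1: "1 < s" using s t by simp
    have s\<delta>: "t' - \<delta>1 < s" using s(2) \<delta> by simp
    obtain e j3 j4s m2s where D: "\<bar>e\<bar> \<le> j4 / (200 * C)" "\<bar>(t' - s) / ((s - 1) * (t' - 1)) - 3 * j4 * e\<^sup>2\<bar> \<le> C * \<bar>e\<bar> ^ 3"
       "\<bar>j3 - 3 * j4 * e\<bar> \<le> C * e\<^sup>2" "j3 \<noteq> 0" "\<bar>j4s - j4\<bar> \<le> C * \<bar>e\<bar>" "\<bar>m2s - m2\<bar> \<le> C * \<bar>e\<bar>"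
       "C1 M \<omega> s (E s) = - (s - 1) * j3"
       "\<And>x. \<bar>x - E s\<bar> < \<delta>1 \<Longrightarrow> (\<exists>d \<rho>. ac_density (\<nu> s) x = ereal \<rho> \<and>
          edge_data C (j4 / (200 * C)) ((x - E s) / (s - 1)) j3 j4s m2s d \<rho>)"
      using N1[OF s(1) s\<delta> s(3)] by blast
    have D': "\<exists>\<rho>. ac_density (\<nu> s) x = ereal \<rho> \<and> (sgn j3 * (x - E s) < 0 \<longrightarrow> \<rho> = 0) \<and>
        (0 \<le> sgn j3 * (x - E s) \<longrightarrow> \<bar>\<rho> - A s * sqrt \<bar>x - E s\<bar>\<bar> \<le> K * err' s \<bar>x - E s\<bar>)" if x: "x \<in> X s" for x
    proof -
      have x2: "\<bar>x - E s\<bar>\<^sup>2 < \<delta> * (t' - s) ^ 3" using x unfolding X_def by simp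
      have "(t' - s) ^ 3 \<le> (t' - s) ^ 1" using s \<delta>(4) by (intro power_decreasing) auto
      then have "\<delta> * (t' - s) ^ 3 \<le> \<delta> * \<delta>" using s \<delta>(1) by (intro mult_left_mono) auto
      then have "\<bar>x - E s\<bar>\<^sup>2 < \<delta>\<^sup>2" using x2 by (simp add: power2_eq_square)
      then have "\<bar>x - E s\<bar> < \<delta>" by (rule power_less_imp_less_base) (use \<delta> in simp)
      then have "\<bar>x - E s\<bar> < \<delta>1" using \<delta>(3) by simp
      then obtain d \<rho> where \<rho>: "ac_density (\<nu> s) x = ereal \<rho>" "edge_data C (j4 / (200 * C)) ((x - E s) / (s - 1)) j3 j4s m2s d \<rho>"
        using D(8) by blast
      have "\<delta> * (t' - s) ^ 3 \<le> \<delta>2 * (t' - s) ^ 3" using \<delta>(2) s by (intro mult_right_mono) auto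
      then have "(x - E s)\<^sup>2 < \<delta>2 * (t' - s) ^ 3" using x2 by simp
      note y2 = this
      have "(sgn j3 * (x - E s) < 0 \<longrightarrow> \<rho> = 0) \<and>
        (0 \<le> sgn j3 * (x - E s) \<longrightarrow> \<bar>\<rho> - A s * sqrt \<bar>x - E s\<bar>\<bar> \<le> K * err' s \<bar>x - E s\<bar>)"
        by (rule SR[of s e j3 j4s m2s "x - E s" d \<rho>, unfolded A[OF s1 s(3)] err'[OF abs_ge_zero s(3)]])
          (intro conjI s D(1-6) \<rho>(2) y2)
      then show ?thesis using \<rho>(1) by blast
    qed
    have e0: "0 \<le> err' s r" if "0 \<le> r" for r
      unfolding err'_def err_def using that s by simp
    have le2: "K * err' s r \<le> 2 * K * err' s r" if "0 \<le> r" for r using K e0[OF that] by simp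
    \<comment> \<open>The neighbourhood, shrinking with \<open>s\<close>, on which the additional
      error term is dominated.\<close>
    define U where "U = {x. \<bar>x - E s\<bar>\<^sup>2 < (t' - s) ^ 5}"
    have U: "open U" unfolding U_def by (intro open_Collect_less continuous_intros)
    have EU: "E s \<in> U" unfolding U_def using s by simp
    have leU: "K * err' s \<bar>x - E s\<bar> \<le> 2 * K * err s \<bar>x - E s\<bar>" if "x \<in> U" for x
      using mult_left_mono[OF err2[OF abs_ge_zero _ s(3), of "x - E s"] K] that unfolding U_def by simp
    show ?thesis
    proof (cases "0 < j3")
      case True
      have R: "\<exists>\<rho>. ac_density (\<nu> s) x = ereal \<rho> \<and> (x < E s \<longrightarrow> \<rho> = 0) \<and>
        (E s \<le> x \<longrightarrow> \<bar>\<rho> - A s * sqrt (x - E s)\<bar> \<le> K * err' s (x - E s))" if "x \<in> X s" for x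
        using D'[OF that] True by auto
      have "right_edge (\<nu> s) (E s) (A s) (\<lambda>r. 2 * K * err' s r) (X s)"
        unfolding right_edge_def
      proof (intro ballI impI)
        fix x assume x: "x \<in> X s" "E s \<le> x"
        show "\<bar>ac_density (\<nu> s) x - ereal (A s * sqrt (x - E s))\<bar> \<le> ereal (2 * K * err' s (x - E s))"
          using R[OF x(1)] x(2) le2[of "x - E s"] by auto
      qed
      moreover have "right_edge (\<nu> s) (E s) (A s) (\<lambda>r. 2 * K * err s r) (U \<inter> X s)"
        unfolding right_edge_def
      proof (intro ballI impI)
        fix x assume x: "x \<in> U \<inter> X s" "E s \<le> x"
        show "\<bar>ac_density (\<nu> s) x - ereal (A s * sqrt (x - E s))\<bar> \<le> ereal (2 * K * err s (x - E s))"
          using R[of x] x leU[of x] by auto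
      qed
      moreover have "\<forall>x \<in> X s. x < E s \<longrightarrow> ac_density (\<nu> s) x = 0" using R by fastforce
      moreover have "C1 M \<omega> s (E s) < 0"
        using mult_pos_pos[of "s - 1" j3] True s1 unfolding D(7)
        by (simp only: minus_mult_left[symmetric] diff_gt_0_iff_gt neg_less_0_iff_less simp_thms)
      ultimately show ?thesis using U EU by blast
    next
      case False
      then have neg: "j3 < 0" using D(4) by simp
      have R: "\<exists>\<rho>. ac_density (\<nu> s) x = ereal \<rho> \<and> (E s < x \<longrightarrow> \<rho> = 0) \<and>
        (x \<le> E s \<longrightarrow> \<bar>\<rho> - A s * sqrt (E s - x)\<bar> \<le> K * err' s (E s - x))" if "x \<in> X s" for x
        using D'[OF that] neg by (auto simp: abs_minus_commute)
      have "left_edge (\<nu> s) (E s) (A s) (\<lambda>r. 2 * K * err' s r) (X s)"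
        unfolding left_edge_def
      proof (intro ballI impI)
        fix x assume x: "x \<in> X s" "x \<le> E s"
        show "\<bar>ac_density (\<nu> s) x - ereal (A s * sqrt (E s - x))\<bar> \<le> ereal (2 * K * err' s (E s - x))"
          using R[OF x(1)] x(2) le2[of "E s - x"] by auto
      qed
      moreover have "left_edge (\<nu> s) (E s) (A s) (\<lambda>r. 2 * K * err s r) (U \<inter> X s)"
        unfolding left_edge_def
      proof (intro ballI impI)
        fix x assume x: "x \<in> U \<inter> X s" "x \<le> E s"
        show "\<bar>ac_density (\<nu> s) x - ereal (A s * sqrt (E s - x))\<bar> \<le> ereal (2 * K * err s (E s - x))"
          using R[of x] x leU[of x] by auto
      qed
      moreover have "\<forall>x \<in> X s. E s < x \<longrightarrow> ac_density (\<nu> s) x = 0" using R by fastforce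
      moreover have "0 < C1 M \<omega> s (E s)"
        using mult_pos_neg[of "s - 1" j3] neg s1 unfolding D(7)
        by (simp only: minus_mult_left[symmetric] diff_gt_0_iff_gt neg_0_less_iff_less simp_thms)
      ultimately show ?thesis using U EU by blast
    qed
  qed
  show ?thesis
    unfolding inv_moment_moment w'_def[symmetric] m2_def[symmetric] j4_def[symmetric] Let_def
    by (intro exI[of _ S2] conjI[OF S2] conjI[OF S2eq] exI[of _ "2 * K"] exI[of _ \<delta>] conjI[OF \<delta>(1)] allI impI, elim conjE)
      (rule main[unfolded A_def X_def err'_def err_def])
qed

lemma merging_edge_cube_root:
  assumes t: "1 < t" and fam: "edge_family \<nu> t Et t' E' E" and reg: "E' \<in> regular_points \<mu> t'"
  shows "\<exists>S3 > 0. S3 * (t' / root 3 ((t' - 1) ^ 4)) =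
      sqrt 3 / (2 * pi) * (inv_moment 2 \<mu> \<omega> t' E' / root 3 ((t' - 1) * inv_moment 4 M \<omega> t' E')) \<and>
    (\<exists>K. \<exists>\<delta> > 0. \<forall>s x. t \<le> s \<and> t' - \<delta> < s \<and> s < t' \<and>
       \<bar>x - E s\<bar> < \<delta> \<and> (t' - s) ^ 3 < \<delta> * \<bar>x - E s\<bar> ^ 2 \<longrightarrow>
       \<bar>ac_density (\<nu> s) x - ereal (S3 * (t' / root 3 ((t' - 1) ^ 4)) * root 3 \<bar>x - E s\<bar>)\<bar>
         \<le> ereal (K * (\<bar>x - E s\<bar> powr (2 / 3) + sqrt (t' - s))))"
proof -
  have tt': "t < t'" "1 < t'" using fam t unfolding edge_family_def by auto
  define w' where "w' = Re (\<omega> t' (of_real E'))"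
  note NC = near_critical[OF t fam reg, folded w'_def]
  define j4 m2 where "j4 = moment M 4 w'" and "m2 = moment \<mu> 2 w'"
  have j4: "0 < j4" and m2: "0 < m2" using NC(2,3) unfolding j4_def m2_def .
  obtain C where C: "0 < C" and N: "\<And>\<epsilon>. 0 < \<epsilon> \<Longrightarrow> \<exists>\<delta>>0. \<forall>s. t \<le> s \<and> t' - \<delta> < s \<and> s < t' \<longrightarrow> (\<exists>e j3 j4s m2s. \<bar>e\<bar> \<le> \<epsilon> \<and>
       \<bar>(t' - s) / ((s - 1) * (t' - 1)) - 3 * j4 * e\<^sup>2\<bar> \<le> C * \<bar>e\<bar> ^ 3 \<and>
       \<bar>j3 - 3 * j4 * e\<bar> \<le> C * e\<^sup>2 \<and> j3 \<noteq> 0 \<and>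
       \<bar>j4s - j4\<bar> \<le> C * \<bar>e\<bar> \<and> \<bar>m2s - m2\<bar> \<le> C * \<bar>e\<bar> \<and>
       C1 M \<omega> s (E s) = - (s - 1) * j3 \<and>
       (\<forall>x. \<bar>x - E s\<bar> < \<delta> \<longrightarrow> (\<exists>d \<rho>. ac_density (\<nu> s) x = ereal \<rho> \<and>
          edge_data C \<epsilon> ((x - E s) / (s - 1)) j3 j4s m2s d \<rho>)))"
    using NC(4) unfolding j4_def[symmetric] m2_def[symmetric] by blast
  \<comment> \<open>Ten times smaller than in the square root regime, because the selection of the
    cube root needs \<open>1000 C |d| \<le> j4s\<close>.\<close>
  have \<epsilon>: "0 < j4 / (2000 * C)" using j4 C by simp
  obtain \<delta>1 where \<delta>1: "0 < \<delta>1" and N1: "\<And>s. t \<le> s \<Longrightarrow> t' - \<delta>1 < s \<Longrightarrow> s < t' \<Longrightarrow> (\<exists>e j3 j4s m2s. \<bar>e\<bar> \<le> j4 / (2000 * C) \<and>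
       \<bar>(t' - s) / ((s - 1) * (t' - 1)) - 3 * j4 * e\<^sup>2\<bar> \<le> C * \<bar>e\<bar> ^ 3 \<and>
       \<bar>j3 - 3 * j4 * e\<bar> \<le> C * e\<^sup>2 \<and> j3 \<noteq> 0 \<and>
       \<bar>j4s - j4\<bar> \<le> C * \<bar>e\<bar> \<and> \<bar>m2s - m2\<bar> \<le> C * \<bar>e\<bar> \<and>
       C1 M \<omega> s (E s) = - (s - 1) * j3 \<and>
       (\<forall>x. \<bar>x - E s\<bar> < \<delta>1 \<longrightarrow> (\<exists>d \<rho>. ac_density (\<nu> s) x = ereal \<rho> \<and>
          edge_data C (j4 / (2000 * C)) ((x - E s) / (s - 1)) j3 j4s m2s d \<rho>)))"
    using N[OF \<epsilon>] by blast
  have le: "j4 / (2000 * C) \<le> j4 / (200 * C)" using j4 C by (intro divide_left_mono) auto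
  obtain \<delta>2 K where \<delta>2: "0 < \<delta>2" and CR: "\<And>s e j3 j4s m2s y d \<rho>. t \<le> s \<and> s < t' \<and> \<bar>e\<bar> \<le> j4 / (200 * C) \<and>
     \<bar>(t' - s) / ((s - 1) * (t' - 1)) - 3 * j4 * e\<^sup>2\<bar> \<le> C * \<bar>e\<bar> ^ 3 \<and> \<bar>j3 - 3 * j4 * e\<bar> \<le> C * e\<^sup>2 \<and>
     \<bar>j4s - j4\<bar> \<le> C * \<bar>e\<bar> \<and> \<bar>m2s - m2\<bar> \<le> C * \<bar>e\<bar> \<and>
     edge_data C (j4 / (2000 * C)) (y / (s - 1)) j3 j4s m2s d \<rho> \<and> \<bar>y\<bar> < \<delta>2 \<and> (t' - s) ^ 3 < \<delta>2 * y\<^sup>2 \<Longrightarrow>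
     \<bar>\<rho> - sqrt 3 / 2 * m2 / pi * (root 3 \<bar>y\<bar> / root 3 ((t' - 1) * j4))\<bar> \<le> K * ((root 3 \<bar>y\<bar>)\<^sup>2 + sqrt (t' - s))"
    using cube_root_regime[OF t tt'(1) j4 m2 C] by (elim exE conjE) (rule that, assumption, blast)
  define c q where "c = sqrt 3 / (2 * pi) * (m2 / root 3 ((t' - 1) * j4))" and "q = t' / root 3 ((t' - 1) ^ 4)"
  have c: "0 < c" unfolding c_def using m2 j4 tt' by simp
  have q: "0 < q" unfolding q_def using tt' by simp
  define \<delta> where "\<delta> = min \<delta>1 \<delta>2"
  have \<delta>: "0 < \<delta>" "\<delta> \<le> \<delta>1" "\<delta> \<le> \<delta>2" unfolding \<delta>_def using \<delta>1 \<delta>2 by auto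
  have main: "\<bar>ac_density (\<nu> s) x - ereal (c * root 3 \<bar>x - E s\<bar>)\<bar> \<le> ereal (K * (\<bar>x - E s\<bar> powr (2 / 3) + sqrt (t' - s)))"
    if s: "t \<le> s" "t' - \<delta> < s" "s < t'" and x: "\<bar>x - E s\<bar> < \<delta>" "(t' - s) ^ 3 < \<delta> * \<bar>x - E s\<bar> ^ 2" for s x
  proof -
    have s\<delta>: "t' - \<delta>1 < s" using s(2) \<delta> by simp
    obtain e j3 j4s m2s where D: "\<bar>e\<bar> \<le> j4 / (2000 * C)" "\<bar>(t' - s) / ((s - 1) * (t' - 1)) - 3 * j4 * e\<^sup>2\<bar> \<le> C * \<bar>e\<bar> ^ 3"
       "\<bar>j3 - 3 * j4 * e\<bar> \<le> C * e\<^sup>2" "\<bar>j4s - j4\<bar> \<le> C * \<bar>e\<bar>" "\<bar>m2s - m2\<bar> \<le> C * \<bar>e\<bar>"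
       "\<And>x. \<bar>x - E s\<bar> < \<delta>1 \<Longrightarrow> (\<exists>d \<rho>. ac_density (\<nu> s) x = ereal \<rho> \<and>
          edge_data C (j4 / (2000 * C)) ((x - E s) / (s - 1)) j3 j4s m2s d \<rho>)"
      using N1[OF s(1) s\<delta> s(3)] by blast
    obtain d \<rho> where \<rho>: "ac_density (\<nu> s) x = ereal \<rho>" "edge_data C (j4 / (2000 * C)) ((x - E s) / (s - 1)) j3 j4s m2s d \<rho>"
      using D(6)[of x] x(1) \<delta>(2) by auto
    have "\<delta> * \<bar>x - E s\<bar>\<^sup>2 \<le> \<delta>2 * \<bar>x - E s\<bar>\<^sup>2" using \<delta>(3) by (intro mult_right_mono) auto
    then have x2: "(t' - s) ^ 3 < \<delta>2 * (x - E s)\<^sup>2" using x(2) by simp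
    have "0 < \<bar>x - E s\<bar>"
    proof (rule ccontr)
      assume "\<not> ?thesis"
      then show False using x2 s by simp
    qed
    from root3_square[OF this] have p: "(root 3 \<bar>x - E s\<bar>)\<^sup>2 = \<bar>x - E s\<bar> powr (2 / 3)" .
    have "\<bar>\<rho> - sqrt 3 / 2 * m2 / pi * (root 3 \<bar>x - E s\<bar> / root 3 ((t' - 1) * j4))\<bar> \<le> K * ((root 3 \<bar>x - E s\<bar>)\<^sup>2 + sqrt (t' - s))"
      by (rule CR[of s e j3 j4s m2s _ d]) (intro conjI s D(2-5) order_trans[OF D(1) le] \<rho>(2) x2 order.strict_trans2[OF x(1) \<delta>(3)])
    also have "sqrt 3 / 2 * m2 / pi * (root 3 \<bar>x - E s\<bar> / root 3 ((t' - 1) * j4)) = c * root 3 \<bar>x - E s\<bar>"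
      unfolding c_def by simp
    finally show ?thesis unfolding \<rho>(1) p by simp
  qed
  then show ?thesis
    unfolding inv_moment_moment w'_def[symmetric] m2_def[symmetric] j4_def[symmetric] c_def[symmetric] q_def[symmetric]
    using c q \<delta>(1) by (intro exI[of _ "c / q"] conjI exI[of _ K] exI[of _ \<delta>]) auto
qed

end

text \<open>The regime of (1) is encoded by \<open>X\<close> and that of (2) by the reversed
  inequality, each with one \<open>\<delta>\<close> and one \<open>K\<close> for all times near
  \<open>t'\<close>, which expresses uniformity. In (1) the error \<open>err\<close> holds on a
  neighbourhood \<open>U\<close> of the edge that may depend on \<open>s\<close>; on all of
  \<open>X\<close> the bound is \<open>err'\<close>, whose additional term is the cubic correction
  to the square root.\<close>

theorem theorem2p3:
  fixes nac npp :: nat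
    and \<mu> \<mu>h :: "real measure"
    and \<omega> :: "real \<Rightarrow> complex \<Rightarrow> complex"
    and \<nu> :: "real \<Rightarrow> real measure"
    and t Et :: real
  assumes "assumption_A nac npp \<mu>"
    and "nevanlinna_measure \<mu> \<mu>h"
    and "subordination \<mu> \<omega>"
    and "free_conv_semigroup \<mu> \<omega> \<nu>"
    and "1 < t"
    and "Et \<in> regular_points \<mu> t"
    and "exterior_point (\<nu> t) Et"
  shows
    "(Im (\<omega> t (of_real Et)) = 0 \<and>
      (\<exists>S1 > 0.
         S1 * (t / sqrt ((t - 1) ^ 3)) =
           1 / pi * (inv_moment 2 \<mu> \<omega> t Et / sqrt ((t - 1) * \<bar>inv_moment 3 \<mu>h \<omega> t Et\<bar>)) \<and>
         (\<exists>K. \<exists>\<delta> > 0.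
            C1 \<mu>h \<omega> t Et < 0 \<and>
              right_edge (\<nu> t) Et (S1 * (t / sqrt ((t - 1) ^ 3))) (\<lambda>r. K * r) (ball Et \<delta>) \<or>
            C1 \<mu>h \<omega> t Et > 0 \<and>
              left_edge (\<nu> t) Et (S1 * (t / sqrt ((t - 1) ^ 3))) (\<lambda>r. K * r) (ball Et \<delta>)))) \<and>
     ((\<exists>x \<in> msupp (ac_part (\<nu> t)). x < Et) \<and> (\<exists>x \<in> msupp (ac_part (\<nu> t)). Et < x) \<longrightarrow>
      (\<exists>t' E' E. edge_family \<nu> t Et t' E' E) \<and>
      (\<forall>t' E' E. edge_family \<nu> t Et t' E' E \<and> E' \<in> regular_points \<mu> t' \<longrightarrow>
         Im (\<omega> t' (of_real E')) = 0 \<and>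
         (\<exists>S2 > 0.
            S2 * (t' / root 4 ((t' - 1) ^ 3)) =
              root 4 (t' - 1) / pi * (inv_moment 2 \<mu> \<omega> t' E' / root 4 (inv_moment 4 \<mu>h \<omega> t' E')) \<and>
            (\<exists>K. \<exists>\<delta> > 0. \<forall>s. t \<le> s \<and> t' - \<delta> < s \<and> s < t' \<longrightarrow>
               (let A = S2 * (t' / root 4 (3 * (s - 1) * (t' - 1) ^ 3)) / root 4 (t' - s);
                    err = (\<lambda>r. r / sqrt (t' - s) + sqrt r * root 4 (t' - s));
                    err' = (\<lambda>r. err r + sqrt (r ^ 3) / root 4 ((t' - s) ^ 7));
                    X = {x. \<bar>x - E s\<bar> ^ 2 < \<delta> * (t' - s) ^ 3}
                in \<exists>U. open U \<and> E s \<in> U \<and>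
                  (C1 \<mu>h \<omega> s (E s) < 0 \<and>
                     right_edge (\<nu> s) (E s) A (\<lambda>r. K * err r) (U \<inter> X) \<and>
                     right_edge (\<nu> s) (E s) A (\<lambda>r. K * err' r) X \<and>
                     (\<forall>x \<in> X. x < E s \<longrightarrow> ac_density (\<nu> s) x = 0) \<or>
                   C1 \<mu>h \<omega> s (E s) > 0 \<and>
                     left_edge (\<nu> s) (E s) A (\<lambda>r. K * err r) (U \<inter> X) \<and>
                     left_edge (\<nu> s) (E s) A (\<lambda>r. K * err' r) X \<and>
                     (\<forall>x \<in> X. E s < x \<longrightarrow> ac_density (\<nu> s) x = 0))))) \<and>
         (\<exists>S3 > 0.
            S3 * (t' / root 3 ((t' - 1) ^ 4)) =
              sqrt 3 / (2 * pi) *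
                (inv_moment 2 \<mu> \<omega> t' E' / root 3 ((t' - 1) * inv_moment 4 \<mu>h \<omega> t' E')) \<and>
            (\<exists>K. \<exists>\<delta> > 0. \<forall>s x. t \<le> s \<and> t' - \<delta> < s \<and> s < t' \<and>
               \<bar>x - E s\<bar> < \<delta> \<and> (t' - s) ^ 3 < \<delta> * \<bar>x - E s\<bar> ^ 2 \<longrightarrow>
               \<bar>ac_density (\<nu> s) x - ereal (S3 * (t' / root 3 ((t' - 1) ^ 4)) * root 3 \<bar>x - E s\<bar>)\<bar>
                 \<le> ereal (K * (\<bar>x - E s\<bar> powr (2 / 3) + sqrt (t' - s)))))))"
proof -
  interpret free_semigroup nac npp \<mu> \<mu>h \<omega> \<nu>
    using assms(1-4) by unfold_locales
  show ?thesis
  proof (intro conjI impI allI)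
    show "Im (\<omega> t (of_real Et)) = 0" by (rule exterior_edge(1)[OF assms(5-7)])
  next
    assume "(\<exists>x \<in> msupp (ac_part (\<nu> t)). x < Et) \<and> (\<exists>x \<in> msupp (ac_part (\<nu> t)). Et < x)"
    note lr = conjunct1[OF this] conjunct2[OF this]
    note EE = exterior_edge[OF assms(5-7)]
    obtain r where r: "0 < r" "AE u in \<mu>h. r \<le> \<bar>u - Re (\<omega> t (of_real Et))\<bar>" using EE(2) by blast
    show "\<exists>t' E' E. edge_family \<nu> t Et t' E' E"
      by (rule edge_family_exists[OF assms(5) r EE(3,4,6,5) lr])
  next
    fix t' E' E assume *: "edge_family \<nu> t Et t' E' E \<and> E' \<in> regular_points \<mu> t'"
    show "Im (\<omega> t' (of_real E')) = 0"
      by (rule near_critical(1)[OF assms(5) conjunct1[OF *] conjunct2[OF *]])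
  qed (rule square_root_edge[OF assms(5-7)], (elim conjE, erule (1) merging_edge_square_root[OF assms(5)]),
      (elim conjE, erule (1) merging_edge_cube_root[OF assms(5)]))
qed

end
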